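(* Let $k$ be a field, $X$ transcendental over $k$, and let $K = k(X)(\sqrt[p]{aX^p+bX+c})$, where $p$ is a prime number with $p\neq \operatorname{char} k$, $a,b,c\in k$ and $a\neq 0$. Assume that $k$ contains a primitive $p$-th root of unity, and let $v$ be a valuation of $k$ with $p\neq \operatorname{char} kv$. Assume that \[ \frac{1}{p-1}\,v\!\left(\frac ba\right)\le\frac1p\, v\!\left(\frac ca\right), \] that $k$ is separable-algebraically closed, that $\operatorname{char} k=\operatorname{char} kv$, and that $\operatorname{char} k$ does not divide $p-1$. Then there exist at most two distinct residue transcendental extensions of $v$ to $K$ such that the residue field extension $Kv|kv$ is non-ruled. Moreover, if there are two such extensions, then one of them is necessarily the Gauss extension with $vX=\frac{1}{p-1}v\left(\frac ba\right)$.
   Context: Valuations are Krull valuations, written additively, with $v0=\infty$; valuations are considered up to equivalence. $vk$ denotes the value group and $kv$ the residue field of $(k,v)$. Multiples $\frac1n vx$ are taken in the divisible hull of $vk$. "Separable-algebraically closed" means having no proper separable algebraic extension. A finitely generated field extension $K|k$ of transcendence degree one is called ruled if $K$ is purely transcendental over a finite extension of $k$. For such $K|k$ and a valuation $v$ on $K$, $(K|k,v)$ is residue transcendental if $\operatorname{trdeg}[Kv:kv]=1$; then one also says that $v$ on $K$ is a residue transcendental extension of $v|_k$. For $\gamma$ in the divisible hull of $vk$, the Gauss extension of $v$ to $k(X)$ with $vX=\gamma$ is given by $v\left(\sum_i c_iX^i\right)=\min_i\{vc_i+i\gamma\}$ for $\sum_i c_iX^i\in k[X]$. A Gauss extension of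 $v$ to $K$ is an extension of $v$ to $K$ whose restriction to $k(X)$ is of this form. *)

theory Defs
  imports "HOL-Algebra.Algebra"
begin

section \<open>Divisible hull of an ordered abelian group\<close>

primrec ntimes :: "nat \<Rightarrow> 'g::ab_group_add \<Rightarrow> 'g" where
  "ntimes 0 x = 0"
| "ntimes (Suc n) x = x + ntimes n x"

lemma ntimes_zero [simp]: "ntimes n 0 = 0"
  by (induction n) auto

lemma ntimes_1 [simp]: "ntimes (Suc 0) x = x"
  by simp

lemma ntimes_add: "ntimes n (x + y) = ntimes n x + ntimes n y"
  by (induction n) (auto simp: algebra_simps)

lemma ntimes_minus: "ntimes n (- x) = - ntimes n x"
  by (induction n) auto

lemma ntimes_add_left: "ntimes (m + n) x = ntimes m x + ntimes n x"
  by (induction m) (auto simp: algebra_simps)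

lemma ntimes_mult: "ntimes (m * n) x = ntimes m (ntimes n x)"
  by (induction m) (auto simp: ntimes_add_left)

lemma ntimes_commute: "ntimes m (ntimes n x) = ntimes n (ntimes m x)"
  by (metis ntimes_mult mult.commute)

lemma ntimes_less:
  fixes x y :: "'g::linordered_ab_group_add"
  assumes "0 < n" "x < y" shows "ntimes n x < ntimes n y"
  using assms(1)
proof (induction n)
  case (Suc n)
  show ?case
    using Suc assms(2) by (cases "n = 0") (auto intro: add_strict_mono)
qed simp

lemma ntimes_le_iff:
  fixes x y :: "'g::linordered_ab_group_add"
  assumes "0 < n" shows "ntimes n x \<le> ntimes n y \<longleftrightarrow> x \<le> y"
  using ntimes_less[OF assms, of x y] ntimes_less[OF assms, of y x]
  by (metis linorder_not_less order_le_less)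

lemma ntimes_eq_iff:
  fixes x y :: "'g::linordered_ab_group_add"
  assumes "0 < n" shows "ntimes n x = ntimes n y \<longleftrightarrow> x = y"
  using ntimes_le_iff[OF assms] by (metis order_antisym order_refl)

text \<open>A pair \<open>(x, m)\<close> stands for the fraction \<open>x / m\<close>.\<close>

definition frac_rel :: "'g::linordered_ab_group_add \<times> nat \<Rightarrow> 'g \<times> nat \<Rightarrow> bool" where
  "frac_rel r s \<longleftrightarrow> 0 < snd r \<and> 0 < snd s \<and> ntimes (snd s) (fst r) = ntimes (snd r) (fst s)"

lemma frac_rel_trans:
  assumes "frac_rel (x, l) (y, m)" "frac_rel (y, m) (z, n)"
  shows "frac_rel (x, l) (z, n)"
proof -
  from assms have pos: "0 < l" "0 < m" "0 < n"
    and 1: "ntimes m x = ntimes l y" and 2: "ntimes n y = ntimes m z"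
    by (auto simp: frac_rel_def)
  have "ntimes m (ntimes n x) = ntimes m (ntimes l z)"
    by (metis 1 2 ntimes_commute)
  then show ?thesis
    using pos ntimes_eq_iff[OF pos(2), of "ntimes n x" "ntimes l z"] by (simp add: frac_rel_def)
qed

quotient_type (overloaded) 'g divhull = "'g::linordered_ab_group_add \<times> nat" / partial: frac_rel
proof (rule part_equivpI)
  show "\<exists>x. frac_rel x x"
    by (rule exI[of _ "(0, 1)"]) (simp add: frac_rel_def)
  show "symp frac_rel"
    by (rule sympI) (auto simp: frac_rel_def)
  show "transp frac_rel"
    by (rule transpI) (metis frac_rel_trans surj_pair)
qed

text \<open>The element \<open>x / n\<close> of the divisible hull; as usual \<open>x / 0 = 0\<close>.\<close>

lift_definition divby :: "'g::linordered_ab_group_add \<Rightarrow> nat \<Rightarrow> 'g divhull" is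
  "\<lambda>x n. if n = 0 then (0, 1) else (x, n)"
  by (simp add: frac_rel_def)

instantiation divhull :: (linordered_ab_group_add) linordered_ab_group_add
begin

lift_definition zero_divhull :: "'a divhull" is "(0, 1)"
  by (simp add: frac_rel_def)

lift_definition plus_divhull :: "'a divhull \<Rightarrow> 'a divhull \<Rightarrow> 'a divhull" is
  "\<lambda>r s. (ntimes (snd s) (fst r) + ntimes (snd r) (fst s), snd r * snd s)"
proof -
  fix r r' s s' :: "'a \<times> nat"
  assume "frac_rel r r'" "frac_rel s s'"
  then have 1: "ntimes (snd r') (fst r) = ntimes (snd r) (fst r')"
    "ntimes (snd s') (fst s) = ntimes (snd s) (fst s')"
    and pos: "0 < snd r" "0 < snd r'" "0 < snd s" "0 < snd s'"
    by (auto simp: frac_rel_def)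
  have "ntimes (snd r' * snd s') (ntimes (snd s) (fst r)) =
        ntimes (snd r * snd s) (ntimes (snd s') (fst r'))"
    by (metis 1(1) ntimes_mult ntimes_commute)
  moreover have "ntimes (snd r' * snd s') (ntimes (snd r) (fst s)) =
        ntimes (snd r * snd s) (ntimes (snd r') (fst s'))"
    by (metis 1(2) ntimes_mult ntimes_commute)
  ultimately show "frac_rel (ntimes (snd s) (fst r) + ntimes (snd r) (fst s), snd r * snd s)
      (ntimes (snd s') (fst r') + ntimes (snd r') (fst s'), snd r' * snd s')"
    using pos by (simp add: frac_rel_def ntimes_add)
qed

lift_definition uminus_divhull :: "'a divhull \<Rightarrow> 'a divhull" is "\<lambda>r. (- fst r, snd r)"
  by (simp add: frac_rel_def ntimes_minus)

definition minus_divhull :: "'a divhull \<Rightarrow> 'a divhull \<Rightarrow> 'a divhull" where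
  "minus_divhull x y = x + - y"

lift_definition less_eq_divhull :: "'a divhull \<Rightarrow> 'a divhull \<Rightarrow> bool" is
  "\<lambda>r s. ntimes (snd s) (fst r) \<le> ntimes (snd r) (fst s)"
proof -
  fix r r' s s' :: "'a \<times> nat"
  assume "frac_rel r r'" "frac_rel s s'"
  then have 1: "ntimes (snd r') (fst r) = ntimes (snd r) (fst r')"
    "ntimes (snd s') (fst s) = ntimes (snd s) (fst s')"
    and pos: "0 < snd r" "0 < snd r'" "0 < snd s" "0 < snd s'"
    by (auto simp: frac_rel_def)
  have "ntimes (snd r' * snd s') (ntimes (snd s) (fst r)) =
        ntimes (snd r * snd s) (ntimes (snd s') (fst r'))"
    by (metis 1(1) ntimes_mult ntimes_commute)
  moreover have "ntimes (snd r' * snd s') (ntimes (snd r) (fst s)) =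
        ntimes (snd r * snd s) (ntimes (snd r') (fst s'))"
    by (metis 1(2) ntimes_mult ntimes_commute)
  ultimately show "ntimes (snd s) (fst r) \<le> ntimes (snd r) (fst s) \<longleftrightarrow>
      ntimes (snd s') (fst r') \<le> ntimes (snd r') (fst s')"
    using pos ntimes_le_iff[of "snd r' * snd s'"] ntimes_le_iff[of "snd r * snd s"]
    by (metis nat_0_less_mult_iff)
qed

definition less_divhull :: "'a divhull \<Rightarrow> 'a divhull \<Rightarrow> bool" where
  "less_divhull x y \<longleftrightarrow> x \<le> y \<and> \<not> y \<le> x"

instance
proof
  fix x y z :: "'a divhull"
  show "x + y + z = x + (y + z)"
  proof (transfer, clarsimp simp: frac_rel_def ntimes_add mult.assoc)
    fix a b c :: 'a and l m n :: nat
    show "ntimes (l * (m * n)) (ntimes n (ntimes m a)) +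
      ntimes (l * (m * n)) (ntimes n (ntimes l b)) +
      ntimes (l * (m * n)) (ntimes (l * m) c) =
      ntimes (l * (m * n)) (ntimes (m * n) a) +
      (ntimes (l * (m * n)) (ntimes l (ntimes n b)) +
       ntimes (l * (m * n)) (ntimes l (ntimes m c)))"
      by (simp add: ntimes_mult[symmetric] ac_simps)
  qed
  show "x + y = y + x"
    by transfer (auto simp: frac_rel_def ac_simps)
  show "0 + x = x"
    by transfer (auto simp: frac_rel_def)
  show "- x + x = 0"
    by transfer (auto simp: frac_rel_def ntimes_minus)
  show "x - y = x + - y"
    by (simp add: minus_divhull_def)
  show "x < y \<longleftrightarrow> x \<le> y \<and> \<not> y \<le> x"
    by (simp add: less_divhull_def)
  show "x \<le> x"
    by transfer auto
  show "x \<le> y \<or> y \<le> x"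
    by transfer auto
  show "x = y" if "x \<le> y" "y \<le> x"
    using that by transfer (auto simp: frac_rel_def)
  show "x \<le> z" if "x \<le> y" "y \<le> z"
    using that
  proof (transfer, clarsimp simp: frac_rel_def)
    fix a b c :: 'a and l m n :: nat
    assume pos: "0 < l" "0 < m" "0 < n"
      and 1: "ntimes m a \<le> ntimes l b" and 2: "ntimes n b \<le> ntimes m c"
    have "ntimes m (ntimes n a) = ntimes n (ntimes m a)" by (rule ntimes_commute)
    also have "\<dots> \<le> ntimes n (ntimes l b)" using 1 pos by (simp add: ntimes_le_iff)
    also have "\<dots> = ntimes l (ntimes n b)" by (rule ntimes_commute)
    also have "\<dots> \<le> ntimes l (ntimes m c)" using 2 pos by (simp add: ntimes_le_iff)
    also have "\<dots> = ntimes m (ntimes l c)" by (rule ntimes_commute)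
    finally show "ntimes n a \<le> ntimes l c" using pos by (simp add: ntimes_le_iff)
  qed
  show "z + x \<le> z + y" if "x \<le> y"
    using that
  proof (transfer, clarsimp simp: frac_rel_def ntimes_add)
    fix a b c :: 'a and l m n :: nat
    assume pos: "0 < l" "0 < m" "0 < n" and 1: "ntimes m a \<le> ntimes l b"
    have "ntimes (n * n) (ntimes m a) \<le> ntimes (n * n) (ntimes l b)"
      using 1 pos by (simp add: ntimes_le_iff)
    then have 2: "ntimes (n * m) (ntimes n a) \<le> ntimes (n * l) (ntimes n b)"
      by (simp add: ntimes_mult[symmetric] ac_simps)
    have 3: "ntimes (n * m) (ntimes l c) = ntimes (n * l) (ntimes m c)"
      by (simp add: ntimes_mult[symmetric] ac_simps)
    show "ntimes (n * m) (ntimes l c) + ntimes (n * m) (ntimes n a)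
        \<le> ntimes (n * l) (ntimes m c) + ntimes (n * l) (ntimes n b)"
      using 2 3 by simp
  qed
qed

end

lemma ntimes_divby: "0 < n \<Longrightarrow> ntimes n (divby x n) = divby x 1"
proof -
  assume n: "0 < n"
  have "ntimes i (divby x n) = divby (ntimes i x) n" for i
  proof (induction i)
    case 0
    show ?case using n by simp (transfer, auto simp: frac_rel_def)
  next
    case (Suc i)
    then show ?case using n
      by simp (transfer, auto simp: frac_rel_def ntimes_add ntimes_mult)
  qed
  moreover have "divby (ntimes n x) n = divby x 1"
    using n by transfer (auto simp: frac_rel_def)
  ultimately show ?thesis by simp
qed

lemma divby_1_le_iff: "divby x 1 \<le> divby y 1 \<longleftrightarrow> x \<le> y"
  by transfer simp

lemma divby_1_add: "divby (x + y) 1 = divby x 1 + divby y 1"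
  by transfer (simp add: frac_rel_def)


section \<open>Value groups with infinity\<close>

datatype 'g vinf = Val 'g | Infty

instantiation vinf :: (linordered_ab_group_add) "{linorder, ordered_comm_monoid_add}"
begin

definition zero_vinf :: "'a vinf" where
  "zero_vinf = Val 0"

fun plus_vinf :: "'a vinf \<Rightarrow> 'a vinf \<Rightarrow> 'a vinf" where
  "Val x + Val y = Val (x + y)"
| "_ + _ = Infty"

fun less_eq_vinf :: "'a vinf \<Rightarrow> 'a vinf \<Rightarrow> bool" where
  "_ \<le> Infty \<longleftrightarrow> True"
| "Val x \<le> Val y \<longleftrightarrow> x \<le> y"
| "Infty \<le> Val y \<longleftrightarrow> False"

definition less_vinf :: "'a vinf \<Rightarrow> 'a vinf \<Rightarrow> bool" where
  "less_vinf x y \<longleftrightarrow> x \<le> y \<and> \<not> y \<le> x"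

instance
proof
  fix x y z :: "'a vinf"
  show "x + y + z = x + (y + z)" by (cases x; cases y; cases z) (auto simp: ac_simps)
  show "x + y = y + x" by (cases x; cases y) (auto simp: ac_simps)
  show "0 + x = x" by (cases x) (auto simp: zero_vinf_def)
  show "x < y \<longleftrightarrow> x \<le> y \<and> \<not> y \<le> x" by (simp add: less_vinf_def)
  show "x \<le> x" by (cases x) auto
  show "x \<le> y \<or> y \<le> x" by (cases x; cases y) auto
  show "x = y" if "x \<le> y" "y \<le> x" using that by (cases x; cases y) auto
  show "x \<le> z" if "x \<le> y" "y \<le> z" using that by (cases x; cases y; cases z) auto
  show "z + x \<le> z + y" if "x \<le> y" using that by (cases x; cases y; cases z) auto
qed

end

text \<open>The multiple \<open>(1/n) \<alpha>\<close>, taken in the divisible hull, with \<open>(1/n) \<infinity> = \<infinity>\<close>.\<close>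

definition vdivby :: "'g::linordered_ab_group_add vinf \<Rightarrow> nat \<Rightarrow> 'g divhull vinf" where
  "vdivby \<alpha> n = map_vinf (\<lambda>x. divby x n) \<alpha>"


section \<open>Krull valuations\<close>

text \<open>
  The value group is the subgroup of \<open>'g\<close> formed by the finite values; it need not be all of \<open>'g\<close>.
  Its divisible hull is then a subgroup of \<open>'g divhull\<close>, with the induced order.
\<close>

definition valuation ::
    "('a, 'm) ring_scheme \<Rightarrow> ('a \<Rightarrow> 'g::linordered_ab_group_add vinf) \<Rightarrow> bool" where
  "valuation R v \<longleftrightarrow>
     (\<forall>x\<in>carrier R. v x = Infty \<longleftrightarrow> x = \<zero>\<^bsub>R\<^esub>) \<and>
     (\<forall>x\<in>carrier R. \<forall>y\<in>carrier R. v (x \<otimes>\<^bsub>R\<^esub> y) = v x + v y) \<and>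
     (\<forall>x\<in>carrier R. \<forall>y\<in>carrier R. min (v x) (v y) \<le> v (x \<oplus>\<^bsub>R\<^esub> y))"

definition val_ring ::
    "('a, 'm) ring_scheme \<Rightarrow> ('a \<Rightarrow> 'g::linordered_ab_group_add vinf) \<Rightarrow> 'a set" where
  "val_ring R v = {x \<in> carrier R. 0 \<le> v x}"

definition val_ideal ::
    "('a, 'm) ring_scheme \<Rightarrow> ('a \<Rightarrow> 'g::linordered_ab_group_add vinf) \<Rightarrow> 'a set" where
  "val_ideal R v = {x \<in> carrier R. 0 < v x}"

definition residue_field ::
    "('a, 'm) ring_scheme \<Rightarrow> ('a \<Rightarrow> 'g::linordered_ab_group_add vinf) \<Rightarrow> 'a set ring" where
  "residue_field R v = (R\<lparr>carrier := val_ring R v\<rparr>) Quot (val_ideal R v)"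

text \<open>
  For a subfield \<open>k\<close> of \<open>R\<close>, the residue field of \<open>(k, v)\<close> is regarded as a subfield of the
  residue field of \<open>(R, v)\<close>, via the canonical embedding.
\<close>

definition residue_subfield ::
    "('a, 'm) ring_scheme \<Rightarrow> 'a set \<Rightarrow> ('a \<Rightarrow> 'g::linordered_ab_group_add vinf) \<Rightarrow> 'a set set"
  where
  "residue_subfield R k v = (\<lambda>x. val_ideal R v +>\<^bsub>R\<^esub> x) ` (val_ring R v \<inter> k)"

text \<open>Equivalence of valuations, whose value groups may live in different types.\<close>

definition equiv_valuations ::
    "('a, 'm) ring_scheme \<Rightarrow> ('a \<Rightarrow> 'g::linordered_ab_group_add vinf) \<Rightarrow>
     ('a \<Rightarrow> 'h::linordered_ab_group_add vinf) \<Rightarrow> bool" where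
  "equiv_valuations R v w \<longleftrightarrow> val_ring R v = val_ring R w"

definition extends_valuation ::
    "('a, 'm) ring_scheme \<Rightarrow> 'a set \<Rightarrow> ('a \<Rightarrow> 'g::linordered_ab_group_add vinf) \<Rightarrow>
     ('a \<Rightarrow> 'h::linordered_ab_group_add vinf) \<Rightarrow> bool" where
  "extends_valuation R k v w \<longleftrightarrow>
     valuation R w \<and> equiv_valuations (R\<lparr>carrier := k\<rparr>) v w"

text \<open>
  The Gauss valuation \<open>u\<close> of \<open>k(x)\<close> takes its values in the divisible hull of the value group
  of \<open>v\<close>; the restriction of \<open>w\<close> to \<open>k(x)\<close> has to agree with it up to equivalence.
\<close>

definition gauss_extension ::
    "('a, 'm) ring_scheme \<Rightarrow> 'a set \<Rightarrow> ('a \<Rightarrow> 'g::linordered_ab_group_add vinf) \<Rightarrow> 'a \<Rightarrow>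
     'g divhull \<Rightarrow> ('a \<Rightarrow> 'h::linordered_ab_group_add vinf) \<Rightarrow> bool" where
  "gauss_extension R k v x \<gamma> w \<longleftrightarrow>
     extends_valuation R k v w \<and>
     (\<exists>u :: 'a \<Rightarrow> 'g divhull vinf.
        valuation (R\<lparr>carrier := generate_field R (insert x k)\<rparr>) u \<and>
        (\<forall>f\<in>carrier (univ_poly R k).
           u (ring.eval R f x) =
             (MIN i\<in>{..Polynomials.degree f}. vdivby (v (ring.coeff R f i)) 1 + Val (ntimes i \<gamma>))) \<and>
        equiv_valuations (R\<lparr>carrier := generate_field R (insert x k)\<rparr>) u w)"


section \<open>Field theory\<close>

text \<open>The additive order of 1, which by convention is 0 if no positive multiple of 1 vanishes.\<close>

definition ring_char :: "('a, 'm) ring_scheme \<Rightarrow> nat" where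
  "ring_char R = group.ord (add_monoid R) \<one>\<^bsub>R\<^esub>"

definition primitive_root :: "('a, 'm) ring_scheme \<Rightarrow> nat \<Rightarrow> 'a \<Rightarrow> bool" where
  "primitive_root R n z \<longleftrightarrow>
     z \<in> carrier R \<and> z [^]\<^bsub>R\<^esub> n = \<one>\<^bsub>R\<^esub> \<and> (\<forall>m. 0 < m \<and> m < n \<longrightarrow> z [^]\<^bsub>R\<^esub> m \<noteq> \<one>\<^bsub>R\<^esub>)"

text \<open>
  An algebraic element is separable if it is a simple root of its minimal polynomial
  (all roots of an irreducible polynomial in an algebraic closure have the same multiplicity).
\<close>

definition separable_element :: "('a, 'm) ring_scheme \<Rightarrow> 'a set \<Rightarrow> 'a \<Rightarrow> bool" where
  "separable_element L F x \<longleftrightarrow>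
     \<not> ring.transcendental L F x \<and> ring.alg_mult L (ring.Irr L F x) x = 1"

text \<open>
  No proper separable algebraic extension. An algebraic extension of a field has at most as many
  elements as there are polynomials over it, so every algebraic extension of \<open>F\<close> has an isomorphic
  copy whose carrier is a set of elements of type \<open>'a list set\<close> (for instance an iterated
  quotient of polynomial rings), and it suffices to quantify over these.
\<close>

definition sep_alg_closed :: "('a, 'm) ring_scheme \<Rightarrow> bool" where
  "sep_alg_closed F \<longleftrightarrow>
     (\<forall>(L :: 'a list set ring) h.
        field L \<and> h \<in> ring_hom F L \<and>
        (\<forall>x\<in>carrier L. separable_element L (h ` carrier F) x)
        \<longrightarrow> h ` carrier F = carrier L)"

text \<open>Transcendence degree one: there is a transcendence basis with exactly one element.\<close>

definition trdeg_one :: "('a, 'm) ring_scheme \<Rightarrow> 'a set \<Rightarrow> bool" where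
  "trdeg_one L F \<longleftrightarrow>
     (\<exists>t\<in>carrier L. ring.transcendental L F t \<and>
        (\<forall>x\<in>carrier L. \<not> ring.transcendental L (generate_field L (insert t F)) x))"

text \<open>
  An extension as in this definition is automatically finitely generated of transcendence degree
  one.
\<close>

definition ruled :: "('a, 'm) ring_scheme \<Rightarrow> 'a set \<Rightarrow> bool" where
  "ruled L F \<longleftrightarrow>
     (\<exists>E t. subfield E L \<and> F \<subseteq> E \<and> ring.finite_dimension L F E \<and>
        t \<in> carrier L \<and> ring.transcendental L E t \<and>
        generate_field L (insert t E) = carrier L)"

definition residue_transcendental_extension ::
    "('a, 'm) ring_scheme \<Rightarrow> 'a set \<Rightarrow> ('a \<Rightarrow> 'g::linordered_ab_group_add vinf) \<Rightarrow>
     ('a \<Rightarrow> 'h::linordered_ab_group_add vinf) \<Rightarrow> bool" where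
  "residue_transcendental_extension K k v w \<longleftrightarrow>
     extends_valuation K k v w \<and> trdeg_one (residue_field K w) (residue_subfield K k w)"

definition nonruled_rt_extension ::
    "('a, 'm) ring_scheme \<Rightarrow> 'a set \<Rightarrow> ('a \<Rightarrow> 'g::linordered_ab_group_add vinf) \<Rightarrow>
     ('a \<Rightarrow> 'h::linordered_ab_group_add vinf) \<Rightarrow> bool" where
  "nonruled_rt_extension K k v w \<longleftrightarrow>
     residue_transcendental_extension K k v w \<and>
     \<not> ruled (residue_field K w) (residue_subfield K k w)"

end

theory Submission
  imports Defs
begin

text \<open>
  A valuation \<open>w\<close> of \<open>K\<close> is studied through its valuation ring \<open>V\<close>, the maximal ideal \<open>M\<close> and the residue
  field \<open>RF\<close>; equivalence of valuations is equality of valuation rings.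

  \<^emph>\<open>Normal form.\<close> The ground field contains \<open>\<beta>\<close> with \<open>\<beta> ^ (p - 1) = b / a\<close> and \<open>\<alpha>\<close> with \<open>\<alpha> ^ p = a\<close>. The substitution
  \<open>x = \<beta> x'\<close>, \<open>y = \<alpha> \<beta> y'\<close> turns the equation into \<open>y' ^ p = f(x')\<close> with \<open>f(X) = X ^ p + X + c'\<close>, and the inequality
  between the values of \<open>b / a\<close> and \<open>c / a\<close> says precisely that \<open>c'\<close> is integral (\<open>normal_form\<close>). Two degenerate
  cases drop out: for \<open>b = 0\<close> also \<open>c = 0\<close>, so that \<open>y / x\<close> lies in \<open>k\<close> and every residue field in question is rational; and if \<open>v\<close> is trivial, then so is \<open>w\<close>.

  \<^emph>\<open>Residue transcendental valuations.\<close> If \<open>v\<close> is not trivial, then \<open>kv\<close> has no proper algebraic extension inside the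
  residue field of \<open>K\<close>, all values are values of elements of \<open>k\<close>, and some \<open>t = (x - d) / e\<close> with \<open>d, e\<close> in \<open>k\<close> has
  transcendental residue (\<open>exists_center\<close>). By the Gauss lemma \<open>t\<close> determines \<open>w\<close> on \<open>k(x)\<close>, whose residue field is
  \<open>kv(t)\<close>. Dividing \<open>y\<close> by a suitable element of \<open>k(x)\<close> gives a unit \<open>s\<close>, and the residue field of \<open>K\<close> is
  generated over that of \<open>k(x)\<close> by the residue of \<open>s\<close> (\<open>carrier_RF_generated\<close>). So it is ruled as soon as the
  residues of \<open>t\<close> and \<open>s\<close> are rational functions of a single element.

  \<^emph>\<open>At most two types.\<close> Suppose that \<open>x\<close> itself is not residually transcendental. Then \<open>x\<close> is integral and congruent to an
  element of \<open>k\<close>, unless the residue field is ruled, and \<open>e\<close> lies in \<open>M\<close>. In the expansion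
  \<open>f(d + e t) = f(d) + f'(d) e t + (f''(d) / 2) e ^ 2 t ^ 2 + \<dots>\<close> the terms of least value give an
  equation for the residue of \<open>s ^ p\<close>. If the quadratic term is not among them, the right-hand side is linear in \<open>t\<close>,
  and the residue field is rational. If it is, then \<open>f'(d)\<close> lies in \<open>M\<close>, and \<open>d\<close> and \<open>f''(d) / 2\<close> are units because \<open>p\<close> and
  \<open>p - 1\<close> are; completing the square leaves \<open>s ^ p = A + D t ^ 2\<close> in the residue field, and for \<open>A = 0\<close> this
  curve is rational. Hence for a non-ruled valuation either \<open>x\<close> itself is residually transcendental, which is
  the Gauss extension of the theorem, or the valuation is centred at an approximate double root of \<open>f\<close> (\<open>dichotomy\<close>).

  \<^emph>\<open>Uniqueness.\<close> Modulo \<open>M\<close> a double root of \<open>f\<close> satisfies \<open>(p - 1) d + p c = p f(d) - d f'(d) = 0\<close>, so its residue is unique; the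
  value of \<open>f(d)\<close> then determines the radius \<open>e\<close> (\<open>double_root_comparison\<close>). Thus each type determines \<open>w\<close>
  on \<open>k(x)\<close>. The residual Kummer equation is irreducible when the residue field is not ruled, so that
  \<open>V\<close> consists of the polynomials in \<open>s\<close> with integral coefficients in \<open>k(x)\<close> (\<open>val_ring_eq\<close>) and \<open>w\<close> is determined on \<open>K\<close>.
  There is at most one valuation of each type, and of two distinct ones exactly one is the Gauss extension.
\<close>

section \<open>Finite sums and polynomial values\<close>

primrec sumn :: "('a, 'm) ring_scheme \<Rightarrow> (nat \<Rightarrow> 'a) \<Rightarrow> nat \<Rightarrow> 'a" where
  "sumn R f 0 = \<zero>\<^bsub>R\<^esub>"
| "sumn R f (Suc n) = sumn R f n \<oplus>\<^bsub>R\<^esub> f n"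

text \<open>
  Polynomials are handled through a coefficient function and a bound for the degree; no
  leading coefficient has to be tracked, and one function can be evaluated in a field and in its
  residue field.
\<close>

definition pev :: "('a, 'm) ring_scheme \<Rightarrow> (nat \<Rightarrow> 'a) \<Rightarrow> nat \<Rightarrow> 'a \<Rightarrow> 'a" where
  "pev R c n z = sumn R (\<lambda>i. c i \<otimes>\<^bsub>R\<^esub> z [^]\<^bsub>R\<^esub> i) n"

lemma sumn_cong:
  assumes "\<And>i. i < n \<Longrightarrow> f i = g i" shows "sumn R f n = sumn R g n"
  using assms by (induction n) auto

lemma pev_cong:
  assumes "\<And>i. i < n \<Longrightarrow> c i = d i" shows "pev R c n z = pev R d n z"
  unfolding pev_def using assms by (intro sumn_cong) auto

lemma pev_0 [simp]: "pev R c 0 z = \<zero>\<^bsub>R\<^esub>"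
  by (simp add: pev_def)

lemma pev_Suc [simp]: "pev R c (Suc n) z = pev R c n z \<oplus>\<^bsub>R\<^esub> c n \<otimes>\<^bsub>R\<^esub> z [^]\<^bsub>R\<^esub> n"
  by (simp add: pev_def)

lemma sumn_in_subgroup:
  assumes "\<zero>\<^bsub>R\<^esub> \<in> S" "\<And>x y. x \<in> S \<Longrightarrow> y \<in> S \<Longrightarrow> x \<oplus>\<^bsub>R\<^esub> y \<in> S" "\<And>i. i < n \<Longrightarrow> f i \<in> S"
  shows "sumn R f n \<in> S"
  using assms(3) by (induction n) (auto intro: assms)

context ring
begin

lemma sumn_closed [intro, simp]:
  assumes "\<And>i. i < n \<Longrightarrow> f i \<in> carrier R" shows "sumn R f n \<in> carrier R"
  using assms by (induction n) auto

lemma pev_closed [intro, simp]: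
  assumes "\<And>i. i < n \<Longrightarrow> c i \<in> carrier R" "z \<in> carrier R" shows "pev R c n z \<in> carrier R"
  unfolding pev_def using assms by (intro sumn_closed) auto

lemma sumn_zero:
  assumes "\<And>i. i < n \<Longrightarrow> f i = \<zero>" shows "sumn R f n = \<zero>"
  using assms by (induction n) auto

lemma sumn_add:
  assumes "\<And>i. i < n \<Longrightarrow> f i \<in> carrier R" "\<And>i. i < n \<Longrightarrow> g i \<in> carrier R"
  shows "sumn R (\<lambda>i. f i \<oplus> g i) n = sumn R f n \<oplus> sumn R g n"
  using assms by (induction n) (auto simp: a_ac)

lemma sumn_ldistr:
  assumes "\<And>i. i < n \<Longrightarrow> f i \<in> carrier R" "a \<in> carrier R"
  shows "a \<otimes> sumn R f n = sumn R (\<lambda>i. a \<otimes> f i) n"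
  using assms by (induction n) (auto simp: r_distr)

lemma sumn_rdistr:
  assumes "\<And>i. i < n \<Longrightarrow> f i \<in> carrier R" "a \<in> carrier R"
  shows "sumn R f n \<otimes> a = sumn R (\<lambda>i. f i \<otimes> a) n"
  using assms by (induction n) (auto simp: l_distr)

lemma sumn_swap:
  assumes "\<And>i j. i < m \<Longrightarrow> j < n \<Longrightarrow> f i j \<in> carrier R"
  shows "sumn R (\<lambda>i. sumn R (\<lambda>j. f i j) n) m = sumn R (\<lambda>j. sumn R (\<lambda>i. f i j) m) n"
  using assms
proof (induction m)
  case 0
  then show ?case by (simp add: sumn_zero)
next
  case (Suc m)
  then show ?case by (simp add: sumn_add[symmetric])
qed

lemma sumn_single:
  assumes "j < n" "f j \<in> carrier R" "\<And>i. i < n \<Longrightarrow> i \<noteq> j \<Longrightarrow> f i = \<zero>"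
  shows "sumn R f n = f j"
  using assms
proof (induction n)
  case (Suc n)
  show ?case
  proof (cases "j = n")
    case True
    then have "sumn R f n = \<zero>" using Suc.prems by (intro sumn_zero) auto
    then show ?thesis using Suc.prems True by simp
  next
    case False
    then show ?thesis using Suc by auto
  qed
qed simp

lemma sumn_Suc_shift:
  assumes "\<And>i. i \<le> n \<Longrightarrow> f i \<in> carrier R"
  shows "sumn R f (Suc n) = f 0 \<oplus> sumn R (\<lambda>i. f (Suc i)) n"
  using assms by (induction n) (auto simp: a_assoc)

lemma pev_add:
  assumes "\<And>i. i < n \<Longrightarrow> c i \<in> carrier R" "\<And>i. i < n \<Longrightarrow> d i \<in> carrier R" "z \<in> carrier R"
  shows "pev R (\<lambda>i. c i \<oplus> d i) n z = pev R c n z \<oplus> pev R d n z"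
  using assms by (induction n) (auto simp: l_distr a_ac)

lemma pev_smult:
  assumes "\<And>i. i < n \<Longrightarrow> c i \<in> carrier R" "a \<in> carrier R" "z \<in> carrier R"
  shows "pev R (\<lambda>i. a \<otimes> c i) n z = a \<otimes> pev R c n z"
  using assms by (induction n) (auto simp: r_distr m_assoc)

lemma pev_pad:
  assumes "\<And>i. i < n \<Longrightarrow> c i \<in> carrier R" "z \<in> carrier R" "n \<le> m"
  shows "pev R (\<lambda>i. if i < n then c i else \<zero>) m z = pev R c n z"
  using assms(3)
proof (induction rule: dec_induct)
  case base
  show ?case by (rule pev_cong) auto
next
  case (step m)
  then show ?case using assms by (auto)
qed

lemma eval_eq_pev:
  assumes "set p \<subseteq> carrier R" "z \<in> carrier R"
  shows "eval p z = pev R (coeff p) (length p) z"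
  using assms(1)
proof (induction p)
  case (Cons a p)
  have "pev R (coeff (a # p)) (length p) z = pev R (coeff p) (length p) z"
    by (rule pev_cong) auto
  then show ?case using Cons assms(2)
    by (auto simp: eval_in_carrier intro!: a_comm)
qed simp

text \<open>
  The passage to list polynomials normalises the coefficient list; coefficients and values survive.
\<close>

lemma pev_as_eval:
  assumes "subring A R" "\<And>i. i < n \<Longrightarrow> c i \<in> A"
  shows "\<exists>p\<in>carrier (A[X]). length p \<le> n \<and>
    (\<forall>i. coeff p i = (if i < n then c i else \<zero>)) \<and> (\<forall>z\<in>carrier R. eval p z = pev R c n z)"
proof -
  define q where "q = map c (rev [0..<n])"
  have co: "coeff (map c (rev [0..<n])) i = (if i < n then c i else \<zero>)" for i n
    by (induction n) auto
  have q: "set q \<subseteq> A" using assms(2) by (auto simp: q_def)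
  then have qc: "set q \<subseteq> carrier R" using subringE(1)[OF assms(1)] by blast
  show ?thesis
  proof (intro bexI[of _ "normalize q"] conjI allI ballI)
    show "normalize q \<in> carrier (A[X])"
      using normalize_gives_polynomial[OF q] by (simp add: univ_poly_def)
    show "length (normalize q) \<le> n"
      using normalize_length_le[of q] by (simp add: q_def)
    show "coeff (normalize q) i = (if i < n then c i else \<zero>)" for i
      using normalize_coeff[of q] co[of n i] by (simp add: q_def)
    show "eval (normalize q) z = pev R c n z" if z: "z \<in> carrier R" for z
    proof -
      have "eval (normalize q) z = pev R (coeff q) n z"
        using eval_normalize[OF qc z] eval_eq_pev[OF qc z] by (simp add: q_def)
      also have "\<dots> = pev R c n z"
        by (rule pev_cong) (simp add: q_def co)
      finally show ?thesis .
    qed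
  qed
qed

end

text \<open>
  Algebraicity as a nontrivial relation, without the normal form of a polynomial.
\<close>

lemma (in domain) algebraic_iff_pev:
  assumes "subring A R" "z \<in> carrier R"
  shows "\<not> transcendental A z \<longleftrightarrow>
    (\<exists>c n. (\<forall>i<n. c i \<in> A) \<and> (\<exists>i<n. c i \<noteq> \<zero>) \<and> pev R c n z = \<zero>)"
proof
  assume "\<not> transcendental A z"
  then obtain p where p: "p \<in> carrier (A[X])" "p \<noteq> []" "eval p z = \<zero>"
    using algebraicE[OF assms] by (auto simp: over_def)
  have pp: "polynomial A p" using p(1) by (simp add: univ_poly_carrier)
  have sA: "set p \<subseteq> A" using polynomial_incl[OF pp] .
  then have sc: "set p \<subseteq> carrier R" using subringE(1)[OF assms(1)] by blast
  have "coeff p i \<in> A" if "i < length p" for i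
    using coeff_img_restrict[of p] sA that by blast
  moreover have "coeff p (degree p) \<noteq> \<zero>"
    using p(2) pp lead_coeff_simp[OF p(2)] by (simp add: polynomial_def)
  moreover have "degree p < length p" using p(2) by (cases p) auto
  ultimately show "\<exists>c n. (\<forall>i<n. c i \<in> A) \<and> (\<exists>i<n. c i \<noteq> \<zero>) \<and> pev R c n z = \<zero>"
    using eval_eq_pev[OF sc assms(2)] p(3) by metis
next
  assume "\<exists>c n. (\<forall>i<n. c i \<in> A) \<and> (\<exists>i<n. c i \<noteq> \<zero>) \<and> pev R c n z = \<zero>"
  then obtain c n j where c: "\<And>i. i < n \<Longrightarrow> c i \<in> A" "j < n" "c j \<noteq> \<zero>" "pev R c n z = \<zero>"
    by blast
  have "\<exists>p\<in>carrier (A[X]). length p \<le> n \<and>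
    (\<forall>i. coeff p i = (if i < n then c i else \<zero>)) \<and> (\<forall>z\<in>carrier R. eval p z = pev R c n z)"
    using assms(1) c(1) by (rule pev_as_eval)
  then obtain p where p: "p \<in> carrier (A[X])" "\<And>i. coeff p i = (if i < n then c i else \<zero>)"
    "eval p z = pev R c n z" using assms(2) by blast
  have "p \<noteq> []" using p(2)[of j] c by auto
  then show "\<not> transcendental A z"
    using algebraicI[OF p(1)] p(3) c(4) by (simp add: over_def)
qed

section \<open>Kummer extensions of prime degree\<close>

locale kummer = field L for L (structure) +
  fixes F :: "'a set" and s \<zeta> :: 'a and p :: nat
  assumes subF: "subfield F L" and s: "s \<in> carrier L" and p: "Factorial_Ring.prime p"
    and sp: "s [^] p \<in> F" and z: "\<zeta> \<in> F" and zp: "\<zeta> [^] p = \<one>" and z1: "\<zeta> \<noteq> \<one>"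
    and p0: "[p] \<cdot> \<one> \<noteq> \<zero>"

lemma (in domain) geometric_zero:
  assumes "w \<in> carrier R" "w [^] n = \<one>" "w \<noteq> \<one>"
  shows "sumn R (\<lambda>j. w [^] j) n = \<zero>"
proof -
  have "(w \<ominus> \<one>) \<otimes> sumn R (\<lambda>j. w [^] j) n = w [^] n \<ominus> \<one>" for n
  proof (induction n)
    case 0
    then show ?case using assms(1) by (simp add: minus_eq r_neg)
  next
    case (Suc n)
    have c: "sumn R (\<lambda>j. w [^] j) n \<in> carrier R" "w [^] n \<in> carrier R" using assms(1) by auto
    have *: "(u \<ominus> \<one>) \<oplus> (w \<ominus> \<one>) \<otimes> u = u \<otimes> w \<ominus> \<one>" if "u \<in> carrier R" for u
      using that assms(1) by algebra
    show ?case using *[of "w [^] n"] Suc c assms(1) by (simp add: r_distr)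
  qed
  from this[of n] have "(w \<ominus> \<one>) \<otimes> sumn R (\<lambda>j. w [^] j) n = \<zero>"
    using assms by (simp add: minus_eq r_neg)
  moreover have "w \<ominus> \<one> \<noteq> \<zero>" using assms r_right_minus_eq by auto
  moreover have "sumn R (\<lambda>j. w [^] j) n \<in> carrier R" using assms(1) by auto
  ultimately show ?thesis using assms(1) integral by blast
qed

lemma (in domain) pow_nonzero: "a \<in> carrier R \<Longrightarrow> a \<noteq> \<zero> \<Longrightarrow> a [^] (n::nat) \<noteq> \<zero>"
  by (induction n) (auto simp: integral_iff)

lemma dvd_less_double:
  fixes p n :: nat assumes "p dvd n" "0 < n" "n < 2 * p" shows "n = p"
proof -
  obtain m where m: "n = p * m" using assms(1) by auto
  then have "m \<noteq> 0" "m < 2" using assms by (auto simp: mult.commute)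
  then have "m = 1" by simp
  then show ?thesis using m by simp
qed

lemma (in ring) sumn_const: "a \<in> carrier R \<Longrightarrow> sumn R (\<lambda>_. a) n = [n] \<cdot> a"
  by (induction n) (auto simp: a_comm)

lemma (in monoid) pow_coprime_eq_one:
  assumes "w \<in> carrier G" "w [^] (m::nat) = \<one>" "w [^] (n::nat) = \<one>" "coprime m n"
  shows "w = \<one>"
proof (cases "m = 0")
  case True
  then show ?thesis using assms by auto
next
  case False
  then obtain a b where ab: "m * a = n * b + gcd m n" using bezout_nat by blast
  then have "m * a = n * b + 1" using assms(4) by simp
  then have "w [^] (m * a) = w [^] (n * b) \<otimes> w"
    using assms(1) by (metis nat_pow_mult nat_pow_eone)
  moreover have "w [^] (m * a) = \<one>" "w [^] (n * b) = \<one>"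
    using assms by (simp_all add: nat_pow_pow[symmetric])
  ultimately show ?thesis using assms(1) by simp
qed

context kummer
begin

lemma F_closed: "a \<in> F \<Longrightarrow> a \<in> carrier L"
  using subfieldE(3)[OF subF] by blast

lemma zc [simp]: "\<zeta> \<in> carrier L" using z F_closed by simp

lemmas F_sub = subringE[OF subfieldE(1)[OF subF]]

lemma F_pow: "a \<in> F \<Longrightarrow> a [^] (n::nat) \<in> F"
  by (induction n) (auto intro: F_sub)

lemma F_inv: "a \<in> F \<Longrightarrow> a \<noteq> \<zero> \<Longrightarrow> inv a \<in> F"
  using subfield_m_inv(1)[OF subF, of a] by simp

lemma p_pos: "0 < p" "1 < p" using p prime_gt_1_nat prime_gt_0_nat by auto

lemma zpow_eq_one_iff: "\<zeta> [^] (m::nat) = \<one> \<longleftrightarrow> p dvd m"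
proof
  assume m: "\<zeta> [^] m = \<one>"
  show "p dvd m"
  proof (rule ccontr)
    assume "\<not> p dvd m"
    then have "coprime p m" using p by (simp add: prime_imp_coprime)
    then show False using pow_coprime_eq_one[OF zc zp m] z1 by simp
  qed
next
  assume "p dvd m"
  then show "\<zeta> [^] m = \<one>" using zp by (auto simp: nat_pow_pow[symmetric])
qed

text \<open>
  If \<open>s\<close> has degree \<open>p\<close> over \<open>F\<close>, the sequence \<open>P j = c(\<zeta> ^ j s)\<close> consists of the conjugates of the element \<open>P 0\<close> of \<open>F(s)\<close>. The
  set of all these sequences is a ring, stable under shifts. It replaces the Galois group and still makes sense
  when \<open>s\<close> lies in \<open>F\<close>, which is the case where the residue field extension degenerates.
\<close>

definition conjs :: "(nat \<Rightarrow> 'a) set" where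
  "conjs = {P. \<exists>c. (\<forall>i<p. c i \<in> F) \<and> P = (\<lambda>j. pev L c p (\<zeta> [^] j \<otimes> s))}"

lemma S_closed [simp]: "\<zeta> [^] (j::nat) \<otimes> s \<in> carrier L" using s by simp

lemma S_pow: "(\<zeta> [^] (j::nat) \<otimes> s) [^] p = s [^] p"
proof -
  have "(\<zeta> [^] j) [^] p = (\<zeta> [^] p) [^] j"
    by (simp add: nat_pow_pow mult.commute)
  then show ?thesis using s zp by (simp add: nat_pow_distrib)
qed

lemma conjs_closed: "P \<in> conjs \<Longrightarrow> P j \<in> carrier L"
  by (auto simp: conjs_def F_closed)

lemma conjs_add: "P \<in> conjs \<Longrightarrow> Q \<in> conjs \<Longrightarrow> (\<lambda>j. P j \<oplus> Q j) \<in> conjs"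
proof -
  assume "P \<in> conjs" "Q \<in> conjs"
  then obtain c d where "\<forall>i<p. c i \<in> F" "P = (\<lambda>j. pev L c p (\<zeta> [^] j \<otimes> s))"
    "\<forall>i<p. d i \<in> F" "Q = (\<lambda>j. pev L d p (\<zeta> [^] j \<otimes> s))" by (auto simp: conjs_def)
  then show ?thesis unfolding conjs_def
    by (auto intro!: exI[of _ "\<lambda>i. c i \<oplus> d i"] simp: pev_add F_closed F_sub(7))
qed

lemma conjs_smult:
  assumes "P \<in> conjs" "g \<in> F" shows "(\<lambda>j. g \<otimes> P j) \<in> conjs"
proof -
  obtain c where "\<forall>i<p. c i \<in> F" "P = (\<lambda>j. pev L c p (\<zeta> [^] j \<otimes> s))"
    using assms by (auto simp: conjs_def)
  then show ?thesis unfolding conjs_def using assms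
    by (auto intro!: exI[of _ "\<lambda>i. g \<otimes> c i"] simp: pev_smult F_closed F_sub(6))
qed

lemma conjs_const: assumes "g \<in> F" shows "(\<lambda>j. g) \<in> conjs"
proof -
  have "pev L (\<lambda>i. if i = 0 then g else \<zero>) p (\<zeta> [^] j \<otimes> s) = g" for j :: nat
    unfolding pev_def using p_pos assms
    by (subst sumn_single[of 0]) (auto simp: F_closed)
  then show ?thesis unfolding conjs_def using assms
    by (auto intro!: exI[of _ "\<lambda>i. if i = 0 then g else \<zero>"] simp: F_sub)
qed

text \<open>
  Multiplication by \<open>s\<close> shifts the coefficients cyclically, since \<open>s ^ p\<close> lies in \<open>F\<close> and is common to all conjugates.
\<close>

lemma conjs_S: assumes "P \<in> conjs" shows "(\<lambda>j. (\<zeta> [^] j \<otimes> s) \<otimes> P j) \<in> conjs"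
proof -
  obtain c where c: "\<And>i. i < p \<Longrightarrow> c i \<in> F" and P: "P = (\<lambda>j. pev L c p (\<zeta> [^] j \<otimes> s))"
    using assms by (auto simp: conjs_def)
  obtain q where q: "p = Suc q" using p_pos by (cases p) auto
  define d where "d i = (case i of 0 \<Rightarrow> c q \<otimes> s [^] p | Suc m \<Rightarrow> c m)" for i
  have d: "\<forall>i<p. d i \<in> F" using c q sp by (auto simp: d_def F_sub split: nat.splits)
  have "(\<zeta> [^] j \<otimes> s) \<otimes> P j = pev L d p (\<zeta> [^] j \<otimes> s)" for j :: nat
  proof -
    define w where "w = \<zeta> [^] j \<otimes> s"
    have w: "w \<in> carrier L" "w [^] p = s [^] p" using S_pow by (auto simp: w_def)
    have "pev L d p w = d 0 \<oplus> sumn L (\<lambda>i. d (Suc i) \<otimes> w [^] Suc i) q"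
      unfolding pev_def q using d w F_closed q by (subst sumn_Suc_shift) auto
    also have "sumn L (\<lambda>i. d (Suc i) \<otimes> w [^] Suc i) q = w \<otimes> pev L c q w"
      unfolding pev_def using c w q F_closed
      by (subst sumn_ldistr) (auto simp: d_def m_ac intro!: sumn_cong)
    also have "d 0 = w \<otimes> (c q \<otimes> w [^] q)"
      unfolding d_def w(2)[symmetric] using c[of q] w(1) q F_closed by (simp add: m_ac)
    also have "\<dots> \<oplus> w \<otimes> pev L c q w = w \<otimes> pev L c p w"
      using c w(1) q F_closed by (simp add: r_distr a_comm)
    finally show ?thesis by (simp add: P w_def)
  qed
  then show ?thesis unfolding conjs_def using d by auto
qed

lemma conjs_pev_mult:
  assumes "P \<in> conjs" "\<And>i. i < n \<Longrightarrow> c i \<in> F"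
  shows "(\<lambda>j. pev L c n (\<zeta> [^] j \<otimes> s) \<otimes> P j) \<in> conjs"
  using assms(2)
proof (induction n)
  case 0
  then show ?case using conjs_const[of "\<zero>"] conjs_closed[OF assms(1)] by (simp add: F_sub)
next
  case (Suc n)
  have "(\<lambda>j. (\<zeta> [^] j \<otimes> s) [^] m \<otimes> P j) \<in> conjs" for m :: nat
  proof (induction m)
    case 0
    then show ?case using assms(1) conjs_closed[OF assms(1)] by simp
  next
    case (Suc m)
    show ?case using conjs_S[OF Suc] conjs_closed[OF assms(1)] by (simp add: m_ac)
  qed
  from conjs_smult[OF this[of n], of "c n"] have 1:
    "(\<lambda>j. c n \<otimes> ((\<zeta> [^] j \<otimes> s) [^] n \<otimes> P j)) \<in> conjs" using Suc by simp
  have "(\<lambda>j. pev L c n (\<zeta> [^] j \<otimes> s) \<otimes> P j) \<in> conjs" using Suc by simp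
  from conjs_add[OF this 1] show ?case
    using Suc.prems conjs_closed[OF assms(1)] by (simp add: l_distr F_closed m_assoc)
qed

lemma conjs_mult: "P \<in> conjs \<Longrightarrow> Q \<in> conjs \<Longrightarrow> (\<lambda>j. P j \<otimes> Q j) \<in> conjs"
  using conjs_pev_mult[of Q p] by (auto simp: conjs_def[of ] )

lemma conjs_shift: assumes "P \<in> conjs" shows "(\<lambda>j. P (j + l)) \<in> conjs"
proof -
  obtain c where c: "\<And>i. i < p \<Longrightarrow> c i \<in> F" and P: "P = (\<lambda>j. pev L c p (\<zeta> [^] j \<otimes> s))"
    using assms by (auto simp: conjs_def)
  have "pev L c p (\<zeta> [^] (j + l) \<otimes> s) = pev L (\<lambda>i. (\<zeta> [^] l) [^] i \<otimes> c i) p (\<zeta> [^] j \<otimes> s)" for j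
    unfolding pev_def
  proof (rule sumn_cong)
    fix i assume i: "i < p"
    have "\<zeta> [^] (j + l) \<otimes> s = \<zeta> [^] l \<otimes> (\<zeta> [^] j \<otimes> s)"
      using s by (simp add: nat_pow_mult[symmetric] m_ac)
    then show "c i \<otimes> (\<zeta> [^] (j + l) \<otimes> s) [^] i =
      (\<zeta> [^] l) [^] i \<otimes> c i \<otimes> (\<zeta> [^] j \<otimes> s) [^] i"
      using c[OF i] F_closed by (simp add: nat_pow_distrib m_ac)
  qed
  then show ?thesis unfolding conjs_def P using c z
    by (auto intro!: exI[of _ "\<lambda>i. (\<zeta> [^] l) [^] i \<otimes> c i"] simp: F_sub F_pow)
qed

lemma conjs_periodic: assumes "P \<in> conjs" shows "P (j + p * m) = P j"
proof -
  have "\<zeta> [^] (j + p * m) = \<zeta> [^] j"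
    using zpow_eq_one_iff[of "p * m"] by (simp add: nat_pow_mult[symmetric])
  then show ?thesis using assms by (auto simp: conjs_def)
qed

lemma conjs_mod: assumes "P \<in> conjs" shows "P (j mod p) = P j"
  using conjs_periodic[OF assms, of "j mod p" "j div p"] by simp

text \<open>
  Inversion of the finite Fourier transform: the coefficients are recovered from the conjugates. The factor \<open>p\<close> on the left is a unit
  in the applications, and then integrality of all conjugates implies integrality of the coefficients.
\<close>

lemma fourier:
  assumes c: "\<And>i. i < p \<Longrightarrow> c i \<in> F" and l: "l < p"
  shows "[p] \<cdot> (c l \<otimes> s [^] l) =
    sumn L (\<lambda>j. \<zeta> [^] ((p - l) * j) \<otimes> pev L c p (\<zeta> [^] j \<otimes> s)) p"
proof -
  have cc: "\<And>i. i < p \<Longrightarrow> c i \<in> carrier L" using c F_closed by blast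
  have t: "\<zeta> [^] ((p - l) * j) \<otimes> (c i \<otimes> (\<zeta> [^] j \<otimes> s) [^] i) =
     (c i \<otimes> s [^] i) \<otimes> (\<zeta> [^] (p - l + i)) [^] j" if "i < p" for i j :: nat
  proof -
    have "(\<zeta> [^] (p - l + i)) [^] j = \<zeta> [^] ((p - l) * j) \<otimes> (\<zeta> [^] j) [^] i"
      by (simp add: nat_pow_pow nat_pow_mult algebra_simps)
    then show ?thesis using cc[OF that] s by (simp add: nat_pow_distrib m_ac)
  qed
  have "sumn L (\<lambda>j. \<zeta> [^] ((p - l) * j) \<otimes> pev L c p (\<zeta> [^] j \<otimes> s)) p =
    sumn L (\<lambda>j. sumn L (\<lambda>i. (c i \<otimes> s [^] i) \<otimes> (\<zeta> [^] (p - l + i)) [^] j) p) p"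
  proof (rule sumn_cong)
    fix j
    show "\<zeta> [^] ((p - l) * j) \<otimes> pev L c p (\<zeta> [^] j \<otimes> s) =
      sumn L (\<lambda>i. (c i \<otimes> s [^] i) \<otimes> (\<zeta> [^] (p - l + i)) [^] j) p"
      unfolding pev_def using cc by (subst sumn_ldistr) (auto simp: t intro!: sumn_cong)
  qed
  also have "\<dots> = sumn L (\<lambda>i. sumn L (\<lambda>j. (c i \<otimes> s [^] i) \<otimes> (\<zeta> [^] (p - l + i)) [^] j) p) p"
    using cc s by (intro sumn_swap) auto
  also have "\<dots> = sumn L (\<lambda>i. (c i \<otimes> s [^] i) \<otimes> sumn L (\<lambda>j. (\<zeta> [^] (p - l + i)) [^] j) p) p"
    using cc s by (intro sumn_cong) (simp add: sumn_ldistr)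
  also have "\<dots> = (c l \<otimes> s [^] l) \<otimes> sumn L (\<lambda>j. (\<zeta> [^] (p - l + l)) [^] j) p"
  proof (rule sumn_single[OF l])
    fix i assume i: "i < p" "i \<noteq> l"
    have "\<not> p dvd (p - l + i)"
    proof
      assume "p dvd (p - l + i)"
      then have "p - l + i = p" using i l by (intro dvd_less_double) auto
      then show False using i l by auto
    qed
    moreover have "(\<zeta> [^] (p - l + i)) [^] p = \<one>"
      using zpow_eq_one_iff[of "(p - l + i) * p"] by (simp add: nat_pow_pow)
    ultimately have "sumn L (\<lambda>j. (\<zeta> [^] (p - l + i)) [^] j) p = \<zero>"
      using zpow_eq_one_iff by (intro geometric_zero) auto
    then show "c i \<otimes> s [^] i \<otimes> sumn L (\<lambda>j. (\<zeta> [^] (p - l + i)) [^] j) p = \<zero>"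
      using cc i s by simp
  qed (use cc l s in auto)
  also have "sumn L (\<lambda>j. (\<zeta> [^] (p - l + l)) [^] j) p = [p] \<cdot> \<one>"
    using l zp by (simp add: sumn_const)
  finally show ?thesis using cc[OF l] s add_pow_rdistr[of "c l \<otimes> s [^] l" \<one> p] by simp
qed

text \<open>
  If no conjugate of \<open>s\<close> were 1, then \<open>1 + X + \<dots> + X ^ (p - 1)\<close> would vanish at all conjugates, against Fourier inversion.
\<close>

lemma root_of_unity:
  assumes "s [^] p = \<one>" obtains m :: nat where "s = \<zeta> [^] m"
proof -
  have "\<exists>j. \<zeta> [^] (j::nat) \<otimes> s = \<one>"
  proof (rule ccontr)
    assume n: "\<nexists>j. \<zeta> [^] (j::nat) \<otimes> s = \<one>"
    have "pev L (\<lambda>_. \<one>) p (\<zeta> [^] j \<otimes> s) = \<zero>" for j :: nat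
    proof -
      have "pev L (\<lambda>_. \<one>) p (\<zeta> [^] j \<otimes> s) = sumn L (\<lambda>i. (\<zeta> [^] j \<otimes> s) [^] i) p"
        unfolding pev_def by (intro sumn_cong) simp
      also have "\<dots> = \<zero>" using n S_pow assms by (intro geometric_zero) auto
      finally show ?thesis .
    qed
    then have "[p] \<cdot> (\<one> \<otimes> s [^] (0::nat)) = \<zero>"
      using p_pos by (subst fourier) (auto simp: F_sub intro!: sumn_zero)
    then show False using p0 by simp
  qed
  then obtain j :: nat where j: "\<zeta> [^] j \<otimes> s = \<one>" by blast
  have "\<zeta> [^] ((p - 1) * j) \<otimes> \<zeta> [^] j = \<one>"
  proof -
    have "(p - 1) * j + j = p * j" using p_pos by (cases p) auto
    then show ?thesis using zpow_eq_one_iff[of "p * j"] by (simp add: nat_pow_mult)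
  qed
  then have "s = \<zeta> [^] ((p - 1) * j) \<otimes> (\<zeta> [^] j \<otimes> s)"
    using s by (simp add: m_assoc[symmetric])
  then show ?thesis using j that by simp
qed

text \<open>
  The product of all conjugates is the norm. It is constant along the sequence, hence an element of \<open>F\<close>, and the inverse of a
  conjugate is the product of the others divided by the norm.
\<close>

lemma conjs_inverse:
  assumes P: "P \<in> conjs" and nz: "\<And>j. j < p \<Longrightarrow> P j \<noteq> \<zero>"
  shows "(\<lambda>j. inv (P j)) \<in> conjs"
proof -
  have nz: "P j \<noteq> \<zero>" for j
    using nz[of "j mod p"] conjs_mod[OF P, of j] p_pos by simp
  \<comment> \<open>\<open>W m j\<close> is the product of the \<open>m\<close> conjugates \<open>P j, \<dots>, P (j + m - 1)\<close>; the norm is \<open>W p\<close>.\<close>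
  define W where "W = rec_nat (\<lambda>_. \<one>) (\<lambda>m f j. f j \<otimes> P (j + m))"
  have W0: "W 0 j = \<one>" and WS: "W (Suc m) j = W m j \<otimes> P (j + m)" for m j
    by (auto simp: W_def)
  have Wc: "W m \<in> conjs" for m
    by (induction m) (auto simp: W0[abs_def] WS[abs_def] F_sub conjs_const conjs_mult conjs_shift P)
  have Wnz: "W m j \<noteq> \<zero>" for m j
    by (induction m) (auto simp: W0 WS integral_iff nz conjs_closed Wc P)
  have front: "P j \<otimes> W m (Suc j) = W (Suc m) j" for m j
    by (induction m) (auto simp: W0 WS conjs_closed Wc P m_assoc[symmetric])
  obtain q where q: "p = Suc q" using p_pos by (cases p) auto
  \<comment> \<open>Shifting a full product drops its first factor and appends the same one, by periodicity.\<close>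
  have "W p (Suc j) = W p j" for j
  proof -
    have "W p (Suc j) = W q (Suc j) \<otimes> P (j + p * 1)" by (simp add: q WS)
    also have "\<dots> = P j \<otimes> W q (Suc j)"
      unfolding conjs_periodic[OF P] by (simp add: m_comm conjs_closed Wc P)
    finally show ?thesis using front[of j q] by (simp add: q)
  qed
  then have const: "W p j = W p 0" for j by (induction j) auto
  obtain c where c: "\<And>i. i < p \<Longrightarrow> c i \<in> F" "W p = (\<lambda>j. pev L c p (\<zeta> [^] j \<otimes> s))"
    using Wc[of p] by (auto simp: conjs_def)
  have "[p] \<cdot> c 0 = sumn L (\<lambda>j. W p 0) p"
  proof -
    have "[p] \<cdot> (c 0 \<otimes> s [^] (0::nat)) =
      sumn L (\<lambda>j. \<zeta> [^] ((p - 0) * j) \<otimes> pev L c p (\<zeta> [^] j \<otimes> s)) p"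
      using c p_pos by (intro fourier) auto
    also have "\<dots> = sumn L (\<lambda>j. W p 0) p"
    proof (rule sumn_cong)
      fix j show "\<zeta> [^] ((p - 0) * j) \<otimes> pev L c p (\<zeta> [^] j \<otimes> s) = W p 0"
        using const[of j] c(2) zpow_eq_one_iff[of "p * j"] conjs_closed[OF Wc, of p 0] by auto
    qed
    finally show ?thesis using c(1)[of 0] p_pos F_closed by simp
  qed
  then have "([p] \<cdot> \<one>) \<otimes> c 0 = ([p] \<cdot> \<one>) \<otimes> W p 0"
    using c(1)[of 0] p_pos F_closed conjs_closed[OF Wc, of p 0]
    by (simp add: sumn_const add_pow_ldistr)
  then have "W p 0 = c 0"
    using p0 c(1)[of 0] p_pos F_closed conjs_closed[OF Wc, of p 0] m_lcancel[of "[p] \<cdot> \<one>"] by simp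
  then have n: "W p 0 \<in> F" "W p 0 \<noteq> \<zero>" using c(1)[of 0] p_pos Wnz by auto
  have "inv (P j) = inv (W p 0) \<otimes> W q (j + 1)" for j
  proof -
    have "P j \<otimes> W q (j + 1) = W p 0" using front[of j q] const[of j] q by simp
    moreover have cl: "P j \<in> carrier L" "W q (j + 1) \<in> carrier L" "W p 0 \<in> carrier L"
      by (auto simp: conjs_closed P Wc)
    moreover have iW: "inv (W p 0) \<in> carrier L" using F_inv[OF n] F_closed by simp
    ultimately have "P j \<otimes> (inv (W p 0) \<otimes> W q (j + 1)) = inv (W p 0) \<otimes> W p 0"
      by (metis m_comm m_assoc m_closed)
    then have "P j \<otimes> (inv (W p 0) \<otimes> W q (j + 1)) = \<one>"
      using n F_closed field_Units by simp
    then show ?thesis using comm_inv_char cl iW by simp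
  qed
  then have "(\<lambda>j. inv (P j)) = (\<lambda>j. inv (W p 0) \<otimes> W q (j + 1))" by (intro ext)
  then show ?thesis using conjs_smult[OF conjs_shift[OF Wc, of q 1] F_inv[OF n]] by metis
qed

text \<open>
  \<open>X ^ p - s ^ p\<close> is irreducible over \<open>F\<close> or has a root there. The proof uses supports instead of minimal polynomials. A relation
  of degree less than \<open>p\<close> gives a sequence in \<open>conjs\<close> that vanishes at 0 but not identically. One with minimal support has just one
  nonzero entry: the product with a shifted copy has smaller support, unless the support is invariant under a shift coprime to \<open>p\<close> and
  therefore everything. For a sequence supported at one point Fourier inversion shows that all terms \<open>d l s ^ l\<close> agree, so \<open>d 0 = d 1 s\<close>.
\<close>

lemma kummer_dichotomy:
  assumes c: "\<And>i. i < p \<Longrightarrow> c i \<in> F" and nz: "\<exists>i<p. c i \<noteq> \<zero>" and rel: "pev L c p s = \<zero>"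
  shows "s \<in> F"
proof (cases "s = \<zero>")
  case True
  then show ?thesis using F_sub(2) by simp
next
  case s0: False
  define supp where "supp P = {j. j < p \<and> P j \<noteq> \<zero>}" for P :: "nat \<Rightarrow> 'a"
  define good where "good P \<longleftrightarrow> P \<in> conjs \<and> supp P \<noteq> {} \<and> supp P \<noteq> {..<p}" for P
  define P0 where "P0 = (\<lambda>j. pev L c p (\<zeta> [^] (j::nat) \<otimes> s))"
  have "good P0"
  proof -
    have "P0 \<in> conjs" unfolding conjs_def P0_def mem_Collect_eq using c by (intro exI[of _ c]) simp
    moreover have "P0 0 = \<zero>" using rel s by (simp add: P0_def)
    moreover have "supp P0 \<noteq> {}"
    proof
      assume e: "supp P0 = {}"
      obtain l where l: "l < p" "c l \<noteq> \<zero>" using nz by blast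
      have "[p] \<cdot> (c l \<otimes> s [^] l) = \<zero>"
      proof -
        have "P0 j = \<zero>" if "j < p" for j using e that by (auto simp: supp_def)
        then have "sumn L (\<lambda>j. \<zeta> [^] ((p - l) * j) \<otimes> pev L c p (\<zeta> [^] j \<otimes> s)) p = \<zero>"
          by (intro sumn_zero) (simp add: P0_def)
        then show ?thesis using fourier[of c l] c l(1) by simp
      qed
      then have "([p] \<cdot> \<one>) \<otimes> (c l \<otimes> s [^] l) = \<zero>"
        using c[OF l(1)] s F_closed by (simp add: add_pow_ldistr)
      then show False using p0 l c[OF l(1)] s pow_nonzero[OF s s0, of l] F_closed by (auto simp: integral_iff)
    qed
    moreover have "0 \<notin> supp P0" if "P0 0 = \<zero>" using that by (simp add: supp_def)
    ultimately show ?thesis unfolding good_def using p_pos(1) by blast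
  qed
  from ex_has_least_nat[of good, OF this, of "\<lambda>P. card (supp P)"]
  obtain P where P: "good P" and min: "\<And>Q. good Q \<Longrightarrow> card (supp P) \<le> card (supp Q)"
    by auto
  have Pc: "P \<in> conjs" using P unfolding good_def by blast
  have "supp P \<noteq> {}" using P unfolding good_def by blast
  then obtain a where a: "a < p" "P a \<noteq> \<zero>" by (auto simp: supp_def)
  have uniq: "b = a" if b: "b < p" "P b \<noteq> \<zero>" for b
  proof (rule ccontr)
    assume ab: "b \<noteq> a"
    \<comment> \<open>\<open>r\<close> is \<open>a - b\<close> modulo \<open>p\<close>.\<close>
    define r where "r = a + p - b"
    have r: "coprime r p"
    proof -
      have "\<not> p dvd r"
      proof
        assume "p dvd r"
        then have "r = p" by (rule dvd_less_double) (use a b in \<open>auto simp: r_def\<close>)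
        then show False using ab a b by (auto simp: r_def)
      qed
      then have "coprime p r" using p by (intro prime_imp_coprime)
      then show ?thesis by (simp add: coprime_commute)
    qed
    define Q where "Q = (\<lambda>j. P j \<otimes> P (j + r))"
    have Qc: "Q \<in> conjs" unfolding Q_def by (intro conjs_mult conjs_shift Pc)
    have sub: "supp Q \<subseteq> supp P" by (auto simp: supp_def Q_def conjs_closed[OF Pc])
    have "P (b + r) = P a" using conjs_periodic[OF Pc, of a 1] b by (simp add: r_def)
    then have "b \<in> supp Q" using a b by (simp add: supp_def Q_def integral_iff conjs_closed[OF Pc])
    moreover have "supp P \<subseteq> {..<p}" by (auto simp: supp_def)
    moreover have "supp P \<noteq> {..<p}" using P unfolding good_def by blast
    ultimately have gQ: "good Q" using Qc sub unfolding good_def by blast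
    have "finite (supp P)" by (simp add: supp_def)
    then have "supp Q = supp P" using min[OF gQ] sub by (intro card_seteq)
    have step: "P (j + r) \<noteq> \<zero>" if "P j \<noteq> \<zero>" for j
    proof -
      have "j mod p \<in> supp Q"
        using \<open>supp Q = supp P\<close> that conjs_mod[OF Pc, of j] p_pos by (simp add: supp_def)
      then have "P (j mod p + r) \<noteq> \<zero>" by (auto simp: supp_def Q_def conjs_closed[OF Pc])
      then show ?thesis using conjs_mod[OF Pc, of "j mod p + r"] conjs_mod[OF Pc, of "j + r"]
        by (simp add: mod_add_left_eq)
    qed
    have it: "P (a + r * m) \<noteq> \<zero>" for m
    proof (induction m)
      case 0
      then show ?case using a by simp
    next
      case (Suc m)
      have "a + r * Suc m = a + r * m + r" by simp
      then show ?case using step[OF Suc] by metis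
    qed
    have "P i \<noteq> \<zero>" if "i < p" for i
    proof -
      obtain x y where "r * x = p * y + 1"
        using bezout_nat[of r p] r a b by (auto simp: r_def)
      then have "r * (x * n) = n + p * (y * n)" for n
        by (metis mult.assoc distrib_right mult_1 add.commute)
      then have "(a + r * (x * (i + p - a))) mod p = (a + (i + p - a)) mod p"
        by (metis add.assoc mod_mult_self2)
      also have "\<dots> = i mod p" using a that by simp
      finally show ?thesis
        using it[of "x * (i + p - a)"] conjs_mod[OF Pc, of "a + r * (x * (i + p - a))"]
          conjs_mod[OF Pc, of i] by simp
    qed
    then have "supp P = {..<p}" by (auto simp: supp_def)
    then show False using P unfolding good_def by blast
  qed
  define Q where "Q = (\<lambda>j. P (j + a))"
  have Qc: "Q \<in> conjs" unfolding Q_def by (intro conjs_shift Pc)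
  obtain d where d: "\<And>i. i < p \<Longrightarrow> d i \<in> F" "Q = (\<lambda>j. pev L d p (\<zeta> [^] j \<otimes> s))"
    using Qc by (auto simp: conjs_def)
  have Q0: "Q 0 \<noteq> \<zero>" using a by (simp add: Q_def)
  have Qz: "Q j = \<zero>" if "0 < j" "j < p" for j
  proof (rule ccontr)
    assume "Q j \<noteq> \<zero>"
    then have "P ((j + a) mod p) \<noteq> \<zero>" using conjs_mod[OF Pc] by (simp add: Q_def)
    then have "(j + a) mod p = a" using uniq p_pos by simp
    then show False using that a by (cases "j + a < p") (auto simp: le_mod_geq)
  qed
  have co: "([p] \<cdot> \<one>) \<otimes> (d l \<otimes> s [^] l) = Q 0" if l: "l < p" for l
  proof -
    have "[p] \<cdot> (d l \<otimes> s [^] l) = sumn L (\<lambda>j. \<zeta> [^] ((p - l) * j) \<otimes> Q j) p"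
      using fourier[of d l] d l by simp
    also have "\<dots> = \<zeta> [^] ((p - l) * 0) \<otimes> Q 0"
      using p_pos by (intro sumn_single[of 0]) (auto simp: Qz conjs_closed[OF Qc])
    finally show ?thesis using d(1)[OF l] F_closed s conjs_closed[OF Qc, of 0]
      by (simp add: add_pow_ldistr)
  qed
  have dc: "d 0 \<in> F" "d 1 \<in> F" using d p_pos by auto
  have e: "d 0 = d 1 \<otimes> s"
  proof -
    have "([p] \<cdot> \<one>) \<otimes> d 0 = ([p] \<cdot> \<one>) \<otimes> (d 1 \<otimes> s)"
      using co[of 0] co[of 1] p_pos dc F_closed s by simp
    then show ?thesis using dc F_closed s p0 m_lcancel[of "[p] \<cdot> \<one>" "d 0" "d 1 \<otimes> s"] by simp
  qed
  have "d 0 \<noteq> \<zero>" using co[of 0] p_pos Q0 by auto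
  then have d1: "d 1 \<noteq> \<zero>" using e s by auto
  have "s = inv (d 1) \<otimes> d 0"
    using e d1 dc F_closed s by (simp add: m_assoc[symmetric] field_Units)
  then show ?thesis using dc d1 F_inv F_sub(6) by simp
qed

end

section \<open>Multiples of one, Frobenius powers, linear factors\<close>

abbreviation nat_el :: "('a, 'm) ring_scheme \<Rightarrow> nat \<Rightarrow> 'a" where
  "nat_el R n \<equiv> [n] \<cdot>\<^bsub>R\<^esub> \<one>\<^bsub>R\<^esub>"

context ring
begin

lemma nat_el_closed [simp]: "nat_el R n \<in> carrier R"
  by simp

lemma nat_el_Suc: "nat_el R (Suc n) = nat_el R n \<oplus> \<one>"
  by simp

lemma nat_el_add: "nat_el R (m + n) = nat_el R m \<oplus> nat_el R n"
  by (simp add: add.nat_pow_mult)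

lemma add_pow_eq_nat_el: "a \<in> carrier R \<Longrightarrow> [n] \<cdot> a = nat_el R n \<otimes> a"
  by (simp add: add_pow_ldistr)

lemma nat_el_mult: "nat_el R (m * n) = nat_el R m \<otimes> nat_el R n"
proof -
  have "nat_el R (m * n) = [m] \<cdot> nat_el R n"
    by (simp add: add.nat_pow_pow mult.commute)
  then show ?thesis by (simp add: add_pow_eq_nat_el[of "nat_el R n"])
qed

lemma nat_el_dvd: "q dvd n \<Longrightarrow> nat_el R q = \<zero> \<Longrightarrow> nat_el R n = \<zero>"
  by (auto simp: nat_el_mult)

lemma nat_el_coprime:
  assumes "coprime m n" "nat_el R m = \<zero>" "nat_el R n = \<zero>" shows "\<one> = \<zero>"
proof (cases "m = 0")
  case True
  then have "n = 1" using assms(1) by simp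
  then show ?thesis using assms by simp
next
  case False
  then obtain a b where "m * a = n * b + gcd m n" using bezout_nat by blast
  then have "nat_el R (m * a) = nat_el R (n * b + 1)" using assms(1) by simp
  then have "nat_el R m \<otimes> nat_el R a = nat_el R n \<otimes> nat_el R b \<oplus> \<one>"
    unfolding nat_el_mult nat_el_add by simp
  then show ?thesis using assms by simp
qed

lemma sumn_append:
  assumes "\<And>i. i < n + m \<Longrightarrow> f i \<in> carrier R"
  shows "sumn R f (n + m) = sumn R f n \<oplus> sumn R (\<lambda>i. f (n + i)) m"
  using assms by (induction m) (auto simp: a_assoc)

text \<open>
  For polynomials in \<open>X ^ q\<close>, which arise in characteristic \<open>q\<close> from a vanishing derivative.
\<close>

lemma sumn_multiples:
  assumes "0 < q" "\<And>i. f i \<in> carrier R" "\<And>i. \<not> q dvd i \<Longrightarrow> f i = \<zero>"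
  shows "sumn R f (q * k + 1) = sumn R (\<lambda>j. f (q * j)) (k + 1)"
proof (induction k)
  case 0
  then show ?case by simp
next
  case (Suc k)
  obtain r where r: "q = Suc r" using assms(1) by (cases q) auto
  have "sumn R (\<lambda>i. f (q * k + 1 + i)) q = sumn R (\<lambda>i. f (q * k + 1 + i)) r \<oplus> f (q * k + q)"
    using r by simp
  also have "sumn R (\<lambda>i. f (q * k + 1 + i)) r = \<zero>"
  proof (rule sumn_zero)
    fix i assume "i < r"
    have "\<not> q dvd (1 + i)" using r \<open>i < r\<close> by (auto dest: dvd_imp_le)
    then have "\<not> q dvd (q * k + 1 + i)" by (metis add.assoc dvd_add_right_iff dvd_triv_left)
    then show "f (q * k + 1 + i) = \<zero>" by (rule assms(3))
  qed
  finally have "sumn R (\<lambda>i. f (q * k + 1 + i)) q = f (q * Suc k)"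
    using assms(2) by (simp add: add.commute)
  moreover have "q * Suc k + 1 = (q * k + 1) + q" by simp
  ultimately have "sumn R f (q * Suc k + 1) = sumn R f (q * k + 1) \<oplus> f (q * Suc k)"
    using sumn_append[of "q * k + 1" q f] assms(2) by presburger
  then show ?case unfolding Suc.IH by simp
qed

end

lemma (in cring) binomial:
  assumes x: "x \<in> carrier R" and y: "y \<in> carrier R"
  shows "(x \<oplus> y) [^] n = sumn R (\<lambda>k. nat_el R (n choose k) \<otimes> (x [^] k \<otimes> y [^] (n - k))) (Suc n)"
proof (induction n)
  case 0
  then show ?case by simp
next
  case (Suc n)
  define f where "f m k = nat_el R (m choose k) \<otimes> (x [^] k \<otimes> y [^] (m - k))" for m k
  have fc [simp]: "f m k \<in> carrier R" for m k using x y by (simp add: f_def)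
  have f0: "f (Suc n) 0 = y \<otimes> f n 0" using y by (simp add: f_def m_comm)
  have fS: "f (Suc n) (Suc k) = x \<otimes> f n k \<oplus> (if k < n then y \<otimes> f n (Suc k) else \<zero>)"
    if "k \<le> n" for k
  proof -
    have "f (Suc n) (Suc k) = x \<otimes> f n k \<oplus> nat_el R (n choose Suc k) \<otimes> (x [^] Suc k \<otimes> y [^] (n - k))"
    proof -
      have "(C \<oplus> D) \<otimes> (x \<otimes> u \<otimes> w) = x \<otimes> (C \<otimes> (u \<otimes> w)) \<oplus> D \<otimes> (x \<otimes> u \<otimes> w)"
        if "C \<in> carrier R" "D \<in> carrier R" "u \<in> carrier R" "w \<in> carrier R" for C D u w
        using that x by algebra
      from this[of "nat_el R (n choose k)" "nat_el R (n choose Suc k)" "x [^] k" "y [^] (n - k)"]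
      show ?thesis using x y unfolding f_def by (simp add: nat_el_add m_comm[of _ x])
    qed
    moreover have "nat_el R (n choose Suc k) \<otimes> (x [^] Suc k \<otimes> y [^] (n - k)) = y \<otimes> f n (Suc k)"
      if "k < n"
    proof -
      have "n - k = Suc (n - Suc k)" using that by simp
      then show ?thesis using x y unfolding f_def by (simp add: m_ac)
    qed
    ultimately show ?thesis using that x y by (auto simp: binomial_eq_0)
  qed
  have "sumn R (f (Suc n)) (Suc (Suc n)) = f (Suc n) 0 \<oplus> sumn R (\<lambda>k. f (Suc n) (Suc k)) (Suc n)"
    by (intro sumn_Suc_shift) simp
  also have "sumn R (\<lambda>k. f (Suc n) (Suc k)) (Suc n) =
    sumn R (\<lambda>k. x \<otimes> f n k \<oplus> (if k < n then y \<otimes> f n (Suc k) else \<zero>)) (Suc n)"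
    by (intro sumn_cong fS) simp
  also have "\<dots> = sumn R (\<lambda>k. x \<otimes> f n k) (Suc n) \<oplus>
      sumn R (\<lambda>k. if k < n then y \<otimes> f n (Suc k) else \<zero>) (Suc n)"
    using x y by (intro sumn_add) auto
  also have "sumn R (\<lambda>k. if k < n then y \<otimes> f n (Suc k) else \<zero>) (Suc n) = sumn R (\<lambda>k. y \<otimes> f n (Suc k)) n"
    using y by (simp cong: sumn_cong)
  also have "sumn R (\<lambda>k. x \<otimes> f n k) (Suc n) = x \<otimes> sumn R (f n) (Suc n)"
    using x by (intro sumn_ldistr[symmetric]) auto
  finally have "sumn R (f (Suc n)) (Suc (Suc n)) =
    y \<otimes> f n 0 \<oplus> (x \<otimes> sumn R (f n) (Suc n) \<oplus> sumn R (\<lambda>k. y \<otimes> f n (Suc k)) n)"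
    by (simp only: f0)
  also have "\<dots> = x \<otimes> sumn R (f n) (Suc n) \<oplus> (y \<otimes> f n 0 \<oplus> sumn R (\<lambda>k. y \<otimes> f n (Suc k)) n)"
    using x y sumn_closed[of n "\<lambda>k. y \<otimes> f n (Suc k)"] sumn_closed[of "Suc n" "f n"]
    by (simp add: a_lcomm del: sumn.simps)
  also have "y \<otimes> f n 0 \<oplus> sumn R (\<lambda>k. y \<otimes> f n (Suc k)) n = sumn R (\<lambda>k. y \<otimes> f n k) (Suc n)"
    using y by (intro sumn_Suc_shift[symmetric]) simp
  also have "\<dots> = y \<otimes> sumn R (f n) (Suc n)"
    using y by (intro sumn_ldistr[symmetric]) auto
  also have "x \<otimes> sumn R (f n) (Suc n) \<oplus> y \<otimes> sumn R (f n) (Suc n) = (x \<oplus> y) \<otimes> sumn R (f n) (Suc n)"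
    using x y sumn_closed[of "Suc n" "f n"] by (simp add: l_distr del: sumn.simps)
  also have "\<dots> = (x \<oplus> y) [^] Suc n"
  proof -
    have "(x \<oplus> y) [^] n = sumn R (f n) (Suc n)" using Suc.IH unfolding f_def[abs_def] .
    then show ?thesis using x y by (simp add: m_comm del: sumn.simps)
  qed
  finally show ?case unfolding f_def[abs_def] by (rule sym)
qed

lemma (in cring) frobenius:
  assumes q: "Factorial_Ring.prime q" "nat_el R q = \<zero>" and x: "x \<in> carrier R" and y: "y \<in> carrier R"
  shows "(x \<oplus> y) [^] (q ^ m) = x [^] (q ^ m) \<oplus> y [^] (q ^ m)"
proof -
  have one: "(u \<oplus> v) [^] q = u [^] q \<oplus> v [^] q" if u: "u \<in> carrier R" and v: "v \<in> carrier R" for u v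
  proof -
    obtain r where r: "q = Suc r" using q(1) prime_gt_0_nat[of q] by (cases q) auto
    let ?f = "\<lambda>k. nat_el R (q choose k) \<otimes> (u [^] k \<otimes> v [^] (q - k))"
    have z: "?f (Suc k) = \<zero>" if "k < r" for k
    proof -
      have "q dvd (q choose Suc k)" using q(1) that r by (intro dvd_choose_prime) auto
      then show ?thesis using nat_el_dvd q(2) u v by simp
    qed
    have "(u \<oplus> v) [^] q = sumn R ?f (Suc (Suc r))" using binomial[OF u v, of q] r by simp
    also have "\<dots> = ?f 0 \<oplus> sumn R (\<lambda>k. ?f (Suc k)) (Suc r)"
      using u v by (intro sumn_Suc_shift) simp
    also have "sumn R (\<lambda>k. ?f (Suc k)) (Suc r) = \<zero> \<oplus> ?f (Suc r)"
      using z by (simp add: sumn_zero)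
    finally show ?thesis using u v r by (simp add: a_comm)
  qed
  show ?thesis
  proof (induction m)
    case 0
    then show ?case using x y by simp
  next
    case (Suc m)
    have "(x \<oplus> y) [^] (q ^ Suc m) = ((x \<oplus> y) [^] (q ^ m)) [^] q"
      using x y by (simp add: nat_pow_pow mult.commute)
    also have "\<dots> = (x [^] (q ^ m)) [^] q \<oplus> (y [^] (q ^ m)) [^] q"
      unfolding Suc using x y by (intro one) auto
    also have "\<dots> = x [^] (q ^ Suc m) \<oplus> y [^] (q ^ Suc m)"
      using x y by (simp add: nat_pow_pow mult.commute)
    finally show ?case .
  qed
qed

lemma (in cring) frobenius_sumn:
  assumes q: "Factorial_Ring.prime q" "nat_el R q = \<zero>" and f: "\<And>i. i < n \<Longrightarrow> f i \<in> carrier R"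
  shows "sumn R f n [^] (q ^ m) = sumn R (\<lambda>i. f i [^] (q ^ m)) n"
  using f
proof (induction n)
  case 0
  have "q ^ m \<noteq> 0" using q(1) by auto
  then show ?case by (simp add: nat_pow_zero)
next
  case (Suc n)
  then show ?case by (simp add: frobenius[OF q])
qed

text \<open>
  Synthetic division by \<open>X - r\<close>. The leading coefficient is recorded because it keeps the quotient nonzero modulo \<open>M\<close>.
\<close>

lemma (in cring) pev_factor:
  assumes A: "subring A R" and r: "r \<in> A" and c: "\<And>i. i \<le> n \<Longrightarrow> c i \<in> A"
  shows "\<exists>g. (\<forall>i<n. g i \<in> A) \<and> (0 < n \<longrightarrow> g (n - 1) = c n) \<and>
    (\<forall>z\<in>carrier R. pev R c (Suc n) z = (z \<ominus> r) \<otimes> pev R g n z \<oplus> pev R c (Suc n) r)"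
proof -
  note A' = subringE[OF A]
  have rc: "r \<in> carrier R" using r A'(1) by blast
  show ?thesis
    using c
  proof (induction n arbitrary: c)
    case 0
    have "c 0 \<in> carrier R" using 0 A'(1) by auto
    then show ?case using rc by auto
  next
    case (Suc n)
    have cc: "c i \<in> carrier R" if "i \<le> Suc n" for i using Suc.prems[OF that] A'(1) by blast
    define d where "d = c(n := c n \<oplus> r \<otimes> c (Suc n))"
    have "\<exists>g. (\<forall>i<n. g i \<in> A) \<and> (0 < n \<longrightarrow> g (n - 1) = d n) \<and>
      (\<forall>z\<in>carrier R. pev R d (Suc n) z = (z \<ominus> r) \<otimes> pev R g n z \<oplus> pev R d (Suc n) r)"
      using Suc.prems r by (intro Suc.IH) (auto simp: d_def intro!: A'(6,7))
    then obtain g where g: "\<And>i. i < n \<Longrightarrow> g i \<in> A"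
      "\<And>z. z \<in> carrier R \<Longrightarrow> pev R d (Suc n) z = (z \<ominus> r) \<otimes> pev R g n z \<oplus> pev R d (Suc n) r"
      by blast
    have gc: "g i \<in> carrier R" if "i < n" for i using g(1)[OF that] A'(1) by blast
    have d: "pev R c (Suc (Suc n)) z = pev R d (Suc n) z \<oplus> (z \<ominus> r) \<otimes> (c (Suc n) \<otimes> z [^] n)"
      if z: "z \<in> carrier R" for z
    proof -
      have "pev R d n z = pev R c n z" by (rule pev_cong) (simp add: d_def)
      moreover have "S \<oplus> cn \<otimes> w \<oplus> cs \<otimes> (w \<otimes> z) =
         S \<oplus> (cn \<oplus> r \<otimes> cs) \<otimes> w \<oplus> (z \<ominus> r) \<otimes> (cs \<otimes> w)"
        if "S \<in> carrier R" "cn \<in> carrier R" "w \<in> carrier R" "cs \<in> carrier R" for S cn w cs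
        using that z rc by algebra
      ultimately show ?thesis using cc z by (simp add: d_def)
    qed
    define h where "h = g(n := c (Suc n))"
    have hp: "pev R h (Suc n) z = pev R g n z \<oplus> c (Suc n) \<otimes> z [^] n" for z
    proof -
      have "pev R h n z = pev R g n z" by (rule pev_cong) (simp add: h_def)
      then show ?thesis by (simp add: h_def)
    qed
    have "pev R c (Suc (Suc n)) z = (z \<ominus> r) \<otimes> pev R h (Suc n) z \<oplus> pev R c (Suc (Suc n)) r"
      if z: "z \<in> carrier R" for z
    proof -
      have 1: "pev R c (Suc (Suc n)) r = pev R d (Suc n) r"
        using d[OF rc] rc cc A'(1) by (simp add: minus_eq r_neg d_def)
      have *: "(z \<ominus> r) \<otimes> G \<oplus> D \<oplus> (z \<ominus> r) \<otimes> C = (z \<ominus> r) \<otimes> (G \<oplus> C) \<oplus> D"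
        if "G \<in> carrier R" "D \<in> carrier R" "C \<in> carrier R" for G C D
        using that z rc by algebra
      have dc: "pev R d (Suc n) r \<in> carrier R"
        using cc rc by (intro pev_closed) (auto simp: d_def less_Suc_eq)
      show ?thesis unfolding 1 d[OF z] g(2)[OF z] hp
        using z gc cc dc by (intro *) auto
    qed
    moreover have "\<forall>i<Suc n. h i \<in> A" using g(1) Suc.prems[of "Suc n"] by (auto simp: h_def less_Suc_eq)
    moreover have "h (Suc n - 1) = c (Suc n)" by (simp add: h_def)
    ultimately show ?case by blast
  qed
qed

section \<open>Simple separable extensions\<close>

definition deriv_zero :: "('a, 'm) ring_scheme \<Rightarrow> 'a list \<Rightarrow> bool" where
  "deriv_zero R f \<longleftrightarrow> (\<forall>i. nat_el R i \<otimes>\<^bsub>R\<^esub> ring.coeff R f i = \<zero>\<^bsub>R\<^esub>)"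

text \<open>
  A telescoping form of \<open>f'(c) = g(c)\<close> for \<open>f = (X - c) g\<close>; once \<open>N\<close> exceeds the degree of \<open>g\<close> the correction term disappears.
\<close>

lemma (in domain) deriv_partial_sum:
  assumes c: "c \<in> carrier R" and g: "g \<in> carrier (poly_ring R)"
    and f: "f = poly_mult [\<one>, \<ominus> c] g"
  shows "pev R (\<lambda>i. nat_el R (Suc i) \<otimes> coeff f (Suc i)) N c = \<ominus> (nat_el R N \<otimes> coeff g N \<otimes> c [^] N) \<oplus>
    pev R (coeff g) N c"
proof -
  have gs: "set g \<subseteq> carrier R"
    using g polynomial_incl by (auto simp: univ_poly_carrier[symmetric])
  have gc [simp]: "coeff g i \<in> carrier R" for i using gs by simp
  have co: "coeff f (Suc n) = coeff g n \<ominus> c \<otimes> coeff g (Suc n)" for n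
  proof -
    let ?l = "[\<one>, \<ominus> c]"
    have ls: "set ?l \<subseteq> carrier R" using c by simp
    have lk: "coeff ?l k = (if k = 1 then \<one> else if k = 0 then \<ominus> c else \<zero>)" for k by auto
    have lc: "coeff ?l k \<in> carrier R" for k using c by (simp only: lk) auto
    have "coeff f (Suc n) = (\<Oplus>k\<in>{..Suc n}. coeff ?l k \<otimes> coeff g (Suc n - k))"
      unfolding f poly_mult_coeff[OF ls gs] ..
    also have "\<dots> = (\<Oplus>k\<in>{..n}. coeff ?l (Suc k) \<otimes> coeff g (Suc n - Suc k)) \<oplus> coeff ?l 0 \<otimes> coeff g (Suc n)"
      using lc by (subst add.finprod_Suc2) auto
    also have "(\<Oplus>k\<in>{..n}. coeff ?l (Suc k) \<otimes> coeff g (Suc n - Suc k)) =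
      (\<Oplus>k\<in>{..n}. if 0 = k then coeff g n else \<zero>)"
    proof (rule add.finprod_cong')
      show "coeff ?l (Suc k) \<otimes> coeff g (Suc n - Suc k) = (if 0 = k then coeff g n else \<zero>)"
        if "k \<in> {..n}" for k
        unfolding lk by simp
    qed auto
    also have "\<dots> = coeff g n"
      using add.finprod_singleton[of 0 "{..n}" "\<lambda>_. coeff g n"] by simp
    finally have "coeff f (Suc n) = coeff g n \<oplus> coeff ?l 0 \<otimes> coeff g (Suc n)" .
    then show ?thesis unfolding lk using c by (simp add: minus_eq l_minus)
  qed
  show ?thesis
  proof (induction N)
    case 0
    then show ?case using c by simp
  next
    case (Suc N)
    have *: "(\<ominus> (k \<otimes> a \<otimes> w) \<oplus> G) \<oplus> (k \<oplus> \<one>) \<otimes> (a \<ominus> c \<otimes> b) \<otimes> w =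
       \<ominus> ((k \<oplus> \<one>) \<otimes> b \<otimes> (w \<otimes> c)) \<oplus> (G \<oplus> a \<otimes> w)"
      if "k \<in> carrier R" "a \<in> carrier R" "w \<in> carrier R" "G \<in> carrier R" "b \<in> carrier R"
      for k a w G b using that c by algebra
    show ?case unfolding pev_Suc Suc.IH unfolding co nat_el_Suc nat_pow_Suc
      using c by (intro *) auto
  qed
qed

locale field_ext = field L for L (structure) + fixes E assumes subE: "subfield E L"
begin

lemmas E_sub = subringE[OF subfieldE(1)[OF subE]]
lemma E_closed: "a \<in> E \<Longrightarrow> a \<in> carrier L" using E_sub(1) by blast
lemma E_subring: "subring E L" using subfieldE(1)[OF subE] .
lemma E_pow: "a \<in> E \<Longrightarrow> a [^] (n::nat) \<in> E" by (induction n) (auto intro: E_sub)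

definition deg :: "'a \<Rightarrow> nat" where "deg c = degree (Irr E c)"

lemma Irr_coeffs:
  assumes c: "c \<in> carrier L" "\<not> transcendental E c"
  shows "coeff (Irr E c) i \<in> E" "coeff (Irr E c) (deg c) = \<one>"
    "pev L (coeff (Irr E c)) (Suc (deg c)) c = \<zero>" "deg c < i \<Longrightarrow> coeff (Irr E c) i = \<zero>"
    "0 < deg c" "length (Irr E c) = Suc (deg c)" "set (Irr E c) \<subseteq> E"
proof -
  have alg: "(algebraic over E) c" using c(2) by (simp add: over_def)
  note I = IrrE[OF subE c(1) alg]
  have pp: "polynomial E (Irr E c)" using I(1) by (simp add: univ_poly_carrier)
  have ne: "Irr E c \<noteq> []" using I(4) I(3) pirreducibleE(1)[OF E_subring I(1,2)] by simp
  then show len: "length (Irr E c) = Suc (deg c)" by (cases "Irr E c") (auto simp: deg_def)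
  show set: "set (Irr E c) \<subseteq> E" using polynomial_incl[OF pp] .
  show "coeff (Irr E c) i \<in> E"
  proof (cases "i < length (Irr E c)")
    case True
    then show ?thesis using coeff_img_restrict[of "Irr E c"] set by blast
  next
    case False
    then show ?thesis using coeff_length[of "Irr E c" i] E_sub(2) by simp
  qed
  show lc: "coeff (Irr E c) (deg c) = \<one>" using lead_coeff_simp[OF ne] I(3) by (simp add: deg_def)
  have setc: "set (Irr E c) \<subseteq> carrier L" using set E_closed by blast
  show ev: "pev L (coeff (Irr E c)) (Suc (deg c)) c = \<zero>"
    using eval_eq_pev[OF setc c(1)] I(4) len by simp
  show "deg c < i \<Longrightarrow> coeff (Irr E c) i = \<zero>" using coeff_degree[of "Irr E c" i] by (simp add: deg_def)
  show "0 < deg c"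
  proof (rule ccontr)
    assume "\<not> 0 < deg c"
    then have "coeff (Irr E c) 0 = \<zero>" "coeff (Irr E c) 0 = \<one>"
      using ev lc set setc by (simp_all add: coeff_in_carrier)
    then show False by simp
  qed
qed

lemma deg_minimal:
  assumes c: "c \<in> carrier L" "\<not> transcendental E c"
    and d: "\<And>i. i < n \<Longrightarrow> d i \<in> E" "n \<le> deg c" "pev L d n c = \<zero>" and i: "i < n"
  shows "d i = \<zero>"
proof -
  have "\<exists>q\<in>carrier (E[X]). length q \<le> n \<and>
    (\<forall>i. coeff q i = (if i < n then d i else \<zero>)) \<and> (\<forall>z\<in>carrier L. eval q z = pev L d n z)"
    using E_subring d(1) by (rule pev_as_eval)
  then obtain q where q: "q \<in> carrier (E[X])" "length q \<le> n"
    "\<And>i. coeff q i = (if i < n then d i else \<zero>)"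
    and ev: "\<And>z. z \<in> carrier L \<Longrightarrow> eval q z = pev L d n z"
    by blast
  have alg: "(algebraic over E) c" using c(2) by (simp add: over_def)
  note I = IrrE[OF subE c(1) alg]
  have "q = []"
  proof (rule ccontr)
    assume "q \<noteq> []"
    moreover have "Irr E c pdivides q"
      using Irr_minimal[OF subE c(1) alg q(1)] ev[OF c(1)] d(3) by simp
    ultimately have "degree (Irr E c) \<le> degree q"
      using pdivides_imp_degree_le[OF E_subring I(1) q(1)] by simp
    moreover have "degree q < n" using q(2) \<open>q \<noteq> []\<close> by (cases q) auto
    ultimately show False using d(2) by (simp add: deg_def)
  qed
  then show ?thesis using q(3)[of i] i by simp
qed

lemma deg_le_if_relation:
  assumes "c \<in> carrier L" "\<not> transcendental E c"
    and "\<And>i. i \<le> n \<Longrightarrow> d i \<in> E" "pev L d (Suc n) c = \<zero>" "i \<le> n" "d i \<noteq> \<zero>"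
  shows "deg c \<le> n"
proof (rule ccontr)
  assume "\<not> deg c \<le> n"
  then have "Suc n \<le> deg c" by simp
  then have "d i = \<zero>"
    using deg_minimal[OF assms(1,2), of "Suc n" d i] assms(3-5) by (simp del: pev_Suc add: less_Suc_eq_le)
  then show False using assms(6) by simp
qed

lemma deg_one_if_mem: "c \<in> E \<Longrightarrow> \<not> transcendental E c \<and> deg c = 1"
proof -
  assume c: "c \<in> E"
  have alg: "\<not> transcendental E c" using algebraic_self[OF E_subring c] by (simp add: over_def)
  have "pev L (\<lambda>i. if i = 0 then \<ominus> c else \<one>) (Suc 1) c = \<zero>"
    using E_closed[OF c] by (simp add: l_neg)
  then have "deg c \<le> 1"
    using deg_le_if_relation[of c 1 "\<lambda>i. if i = 0 then \<ominus> c else \<one>" 1] alg E_closed c E_sub by auto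
  then show ?thesis using alg Irr_coeffs(5)[of c] E_closed c by auto
qed

lemma mem_if_root:
  assumes c: "c \<in> carrier L" "\<not> transcendental E c" and r: "r \<in> E" "eval (Irr E c) r = \<zero>"
  shows "c \<in> E"
proof (rule ccontr)
  assume nE: "c \<notin> E"
  note I = Irr_coeffs[OF c]
  have rc: "r \<in> carrier L" using r E_closed by simp
  have "\<exists>g. (\<forall>i<deg c. g i \<in> E) \<and> (0 < deg c \<longrightarrow> g (deg c - 1) = coeff (Irr E c) (deg c)) \<and>
    (\<forall>z\<in>carrier L. pev L (coeff (Irr E c)) (Suc (deg c)) z =
      (z \<ominus> r) \<otimes> pev L g (deg c) z \<oplus> pev L (coeff (Irr E c)) (Suc (deg c)) r)"
    using E_subring r(1) I(1) by (rule pev_factor)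
  then obtain g where g': "(\<forall>i<deg c. g i \<in> E) \<and> (0 < deg c \<longrightarrow> g (deg c - 1) = coeff (Irr E c) (deg c)) \<and>
    (\<forall>z\<in>carrier L. pev L (coeff (Irr E c)) (Suc (deg c)) z =
      (z \<ominus> r) \<otimes> pev L g (deg c) z \<oplus> pev L (coeff (Irr E c)) (Suc (deg c)) r)"
    by (rule exE)
  have g: "\<And>i. i < deg c \<Longrightarrow> g i \<in> E" "g (deg c - 1) = \<one>"
    using g' I(2,5) by simp_all
  have g3: "pev L (coeff (Irr E c)) (Suc (deg c)) c =
      (c \<ominus> r) \<otimes> pev L g (deg c) c \<oplus> pev L (coeff (Irr E c)) (Suc (deg c)) r"
    using conjunct2[OF conjunct2[OF g']] c(1) by (rule bspec)
  have "set (Irr E c) \<subseteq> carrier L"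
    using I(7) E_closed by blast
  then have 0: "pev L (coeff (Irr E c)) (Suc (deg c)) r = \<zero>"
    using eval_eq_pev[of "Irr E c" r] r rc I(6) by simp
  have pc: "pev L g (deg c) c \<in> carrier L" using g(1) c E_closed by auto
  have "(c \<ominus> r) \<otimes> pev L g (deg c) c = \<zero>" using g3 0 I(3) pc c(1) rc by simp
  moreover have "c \<ominus> r \<noteq> \<zero>" using nE r rc c by auto
  ultimately have "pev L g (deg c) c = \<zero>" using pc c rc integral by blast
  then have "g (deg c - 1) = \<zero>"
    using deg_minimal[OF c, of "deg c" g "deg c - 1"] g(1) I(5) by simp
  then show False using g(2) by simp
qed

text \<open>
  The derivative of the minimal polynomial vanishes at a multiple root, and its degree is too small for a nonzero polynomial
  with that root.
\<close>

lemma deriv_zero_if_not_simple: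
  assumes c: "c \<in> carrier L" "\<not> transcendental E c"
    and g: "g \<in> carrier (poly_ring L)" "eval g c = \<zero>" "Irr E c = poly_mult [\<one>, \<ominus> c] g"
  shows "deriv_zero L (Irr E c)"
  unfolding deriv_zero_def
proof
  fix i
  note I = Irr_coeffs[OF c]
  have gs: "set g \<subseteq> carrier L"
    using g polynomial_incl by (auto simp: univ_poly_carrier[symmetric])
  have gp: "polynomial (carrier L) g" using g(1) by (simp add: univ_poly_carrier)
  have lp: "polynomial (carrier L) [\<one>, \<ominus> c]" using c by (simp add: polynomial_def)
  have "g \<noteq> []" using g(3) I(6) poly_mult_zero(2)[of "[\<one>, \<ominus> c]"] c by auto
  then have len: "deg c = length g"
    using poly_mult_degree_eq[OF carrier_is_subring lp gp] g(3) by (cases g) (auto simp: deg_def)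
  have "coeff g (deg c) = \<zero>" using coeff_length[of g "deg c"] len by simp
  then have z: "pev L (\<lambda>i. nat_el L (Suc i) \<otimes> coeff (Irr E c) (Suc i)) (deg c) c = \<zero>"
  proof -
    have "pev L (coeff g) (deg c) c = \<zero>" using eval_eq_pev[OF gs c(1)] g(2) len by simp
    then show ?thesis
      unfolding deriv_partial_sum[OF c(1) g(1) g(3), of "deg c"] \<open>coeff g (deg c) = \<zero>\<close>
      using c(1) by simp
  qed
  show "nat_el L i \<otimes> coeff (Irr E c) i = \<zero>"
  proof (cases i)
    case 0
    then show ?thesis using I(1)[of 0] E_closed by simp
  next
    case (Suc j)
    have ne: "nat_el L m \<in> E" for m by (induction m) (auto intro: E_sub)
    show ?thesis
    proof (cases "j < deg c")
      case True
      have "nat_el L (Suc m) \<otimes> coeff (Irr E c) (Suc m) \<in> E" for m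
        using ne I(1) by (rule E_sub(6))
      then show ?thesis using deg_minimal[OF c _ _ z True] Suc by blast
    next
      case False
      then show ?thesis using I(4)[of i] Suc by simp
    qed
  qed
qed

lemma separable_if_not_deriv_zero:
  assumes c: "c \<in> carrier L" "\<not> transcendental E c" and nd: "\<not> deriv_zero L (Irr E c)"
  shows "separable_element L E c"
    and "\<exists>g\<in>carrier (poly_ring L). Irr E c = poly_mult [\<one>, \<ominus> c] g \<and> eval g c \<noteq> \<zero>"
proof -
  interpret UP: domain "poly_ring L" by (rule univ_poly_is_domain[OF carrier_is_subring])
  have alg: "(algebraic over E) c" using c(2) by (simp add: over_def)
  note I = IrrE[OF subE c(1) alg]
  have Ip: "Irr E c \<in> carrier (poly_ring L)" using I(1) carrier_polynomial_shell[OF E_subring] by blast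
  have ne: "Irr E c \<noteq> []" using Irr_coeffs(6)[OF c] by auto
  have lin: "[\<one>, \<ominus> c] \<in> carrier (poly_ring L)" using c by (simp add: univ_poly_def polynomial_def)
  have root: "is_root (Irr E c) c" using c I(4) ne by (simp add: is_root_def)
  obtain g where g: "g \<in> carrier (poly_ring L)" "Irr E c = [\<one>, \<ominus> c] \<otimes>\<^bsub>poly_ring L\<^esub> g"
    using is_root_imp_pdivides[OF Ip root] unfolding pdivides_def factor_def by blast
  then have g2: "Irr E c = poly_mult [\<one>, \<ominus> c] g" by (simp add: univ_poly_mult)
  have gnz: "eval g c \<noteq> \<zero>" using deriv_zero_if_not_simple[OF c g(1) _ g2] nd by blast
  then show "\<exists>g\<in>carrier (poly_ring L). Irr E c = poly_mult [\<one>, \<ominus> c] g \<and> eval g c \<noteq> \<zero>"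
    using g g2 by blast
  have "alg_mult (Irr E c) c = 1"
  proof (rule ccontr)
    assume "alg_mult (Irr E c) c \<noteq> 1"
    moreover have "alg_mult (Irr E c) c > 0" using alg_mult_gt_zero_iff_is_root[OF Ip] root by simp
    ultimately have "2 \<le> alg_mult (Irr E c) c" by simp
    then have "[\<one>, \<ominus> c] [^]\<^bsub>poly_ring L\<^esub> (2::nat) pdivides Irr E c"
      by (rule le_alg_mult_imp_pdivides[OF c(1) Ip])
    then obtain h where h: "h \<in> carrier (poly_ring L)"
      "Irr E c = [\<one>, \<ominus> c] [^]\<^bsub>poly_ring L\<^esub> (2::nat) \<otimes>\<^bsub>poly_ring L\<^esub> h"
      unfolding pdivides_def factor_def by blast
    have "[\<one>, \<ominus> c] [^]\<^bsub>poly_ring L\<^esub> (2::nat) = [\<one>, \<ominus> c] \<otimes>\<^bsub>poly_ring L\<^esub> [\<one>, \<ominus> c]"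
      using lin by (simp add: numeral_2_eq_2)
    then have "[\<one>, \<ominus> c] \<otimes>\<^bsub>poly_ring L\<^esub> g = [\<one>, \<ominus> c] \<otimes>\<^bsub>poly_ring L\<^esub> ([\<one>, \<ominus> c] \<otimes>\<^bsub>poly_ring L\<^esub> h)"
      using h g lin by (simp add: UP.m_assoc)
    then have "g = [\<one>, \<ominus> c] \<otimes>\<^bsub>poly_ring L\<^esub> h"
      using UP.m_lcancel[OF _ lin g(1)] lin h(1) by (simp add: univ_poly_zero)
    then have "eval g c = eval [\<one>, \<ominus> c] c \<otimes> eval h c"
      using ring_hom_memE(2)[OF eval_is_hom[OF carrier_is_subring c(1)] lin h(1)] by simp
    moreover have "eval [\<one>, \<ominus> c] c = \<zero>" using c by (simp add: r_neg)
    moreover have "eval h c \<in> carrier L"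
      using ring_hom_memE(1)[OF eval_is_hom[OF carrier_is_subring c(1)] h(1)] .
    ultimately show False using gnz by simp
  qed
  then show "separable_element L E c" using c by (simp add: separable_element_def)
qed

end

lemma (in domain) prime_char:
  assumes "nat_el R n = \<zero>" "0 < n" shows "\<exists>q. Factorial_Ring.prime q \<and> nat_el R q = \<zero>"
  using assms
proof (induction n rule: less_induct)
  case (less n)
  have "n \<noteq> 1" using less.prems by auto
  then obtain q where q: "Factorial_Ring.prime q" "q dvd n" using prime_factor_nat by blast
  then obtain m where m: "n = q * m" by auto
  have "nat_el R q \<otimes> nat_el R m = \<zero>" using less.prems(1) unfolding m nat_el_mult .
  then consider "nat_el R q = \<zero>" | "nat_el R m = \<zero>" using integral by auto
  then show ?case
  proof cases
    case 2
    have "m < n" "0 < m" using m less.prems(2) prime_gt_1_nat[OF q(1)] by auto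
    then show ?thesis using less.IH 2 by blast
  qed (use q in blast)
qed

text \<open>
  As \<open>X - c\<close> does not divide \<open>u\<close>, all its powers can be cancelled from \<open>h\<close>, and \<open>u\<close> becomes a unit.
\<close>

lemma (in field) degree_zero_if_divides_power:
  assumes c: "c \<in> carrier R" and u: "u \<in> carrier (poly_ring R)" "eval u c \<noteq> \<zero>"
    and h: "h \<in> carrier (poly_ring R)" "u \<otimes>\<^bsub>poly_ring R\<^esub> h = [\<one>, \<ominus> c] [^]\<^bsub>poly_ring R\<^esub> (M::nat)"
  shows "degree u = 0"
  using h
proof (induction M arbitrary: h)
  interpret UP: domain "poly_ring R" by (rule univ_poly_is_domain[OF carrier_is_subring])
  case 0
  have "u \<in> Units (poly_ring R)"
    using 0 u(1) UP.m_comm unfolding Units_def by auto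
  then have "u \<in> {[k] | k. k \<in> carrier R - {\<zero>}}" unfolding univ_poly_carrier_units .
  then show ?case by auto
next
  interpret UP: domain "poly_ring R" by (rule univ_poly_is_domain[OF carrier_is_subring])
  case (Suc M)
  let ?l = "[\<one>, \<ominus> c]"
  have l: "?l \<in> carrier (poly_ring R)" using c by (simp add: univ_poly_def polynomial_def)
  have l0: "?l \<noteq> \<zero>\<^bsub>poly_ring R\<^esub>" by (simp add: univ_poly_zero)
  have pw: "?l [^]\<^bsub>poly_ring R\<^esub> Suc M \<noteq> \<zero>\<^bsub>poly_ring R\<^esub>" by (rule UP.pow_nonzero[OF l l0])
  interpret ev: ring_hom_ring "poly_ring R" R "\<lambda>p. eval p c"
    by (rule eval_ring_hom[OF carrier_is_subring c])
  have "eval u c \<otimes> eval h c = eval (?l [^]\<^bsub>poly_ring R\<^esub> M) c \<otimes> eval ?l c"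
    using ev.hom_mult[OF u(1) Suc.prems(1)] Suc.prems(2) ev.hom_mult[of "?l [^]\<^bsub>poly_ring R\<^esub> M" ?l] l
    by (simp del: eval.simps)
  also have "eval ?l c = \<zero>" using c by (simp add: r_neg)
  finally have "eval u c \<otimes> eval h c = \<zero>" using ev.hom_closed[OF UP.nat_pow_closed[OF l, of M]] by simp
  then have "eval h c = \<zero>" using u ev.hom_closed[OF u(1)] ev.hom_closed[OF Suc.prems(1)] integral by blast
  moreover have "h \<noteq> []" using pw Suc.prems(2) UP.r_null[OF u(1)] by (metis univ_poly_zero)
  ultimately have "is_root h c" using c by (simp add: is_root_def)
  then obtain h' where h': "h' \<in> carrier (poly_ring R)" "h = ?l \<otimes>\<^bsub>poly_ring R\<^esub> h'"
    using is_root_imp_pdivides[OF Suc.prems(1)] unfolding pdivides_def factor_def by blast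
  have "?l \<otimes>\<^bsub>poly_ring R\<^esub> (u \<otimes>\<^bsub>poly_ring R\<^esub> h') = u \<otimes>\<^bsub>poly_ring R\<^esub> (?l \<otimes>\<^bsub>poly_ring R\<^esub> h')"
    by (rule UP.m_lcomm[OF l u(1) h'(1)])
  also have "\<dots> = ?l [^]\<^bsub>poly_ring R\<^esub> Suc M" using Suc.prems(2) h'(2) by simp
  also have "\<dots> = ?l \<otimes>\<^bsub>poly_ring R\<^esub> (?l [^]\<^bsub>poly_ring R\<^esub> M)" using l by (simp add: UP.m_comm)
  finally have "?l \<otimes>\<^bsub>poly_ring R\<^esub> (u \<otimes>\<^bsub>poly_ring R\<^esub> h') = ?l \<otimes>\<^bsub>poly_ring R\<^esub> (?l [^]\<^bsub>poly_ring R\<^esub> M)" .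
  then have "u \<otimes>\<^bsub>poly_ring R\<^esub> h' = ?l [^]\<^bsub>poly_ring R\<^esub> M"
    using UP.m_lcancel[OF l0 l] u(1) h'(1) l by simp
  then show ?case using Suc.IH h'(1) by blast
qed

lemma (in domain) poly_of_const_nat_el:
  "nat_el (poly_ring R) n = poly_of_const (nat_el R n)"
proof -
  interpret UP: ring "poly_ring R" by (rule univ_poly_is_ring[OF carrier_is_subring])
  note h = canonical_embedding_is_hom[OF carrier_is_subring]
  show ?thesis
  proof (induction n)
    case 0
    then show ?case by (simp add: univ_poly_zero poly_of_const_def)
  next
    case (Suc n)
    show ?case using Suc ring_hom_add[OF h, of "nat_el R n" \<one>] ring_hom_one[OF h] by simp
  qed
qed

context field_ext
begin

text \<open>
  With vanishing derivative the minimal polynomial of \<open>c\<close> is a polynomial in \<open>X ^ q\<close>, and then it is a relation of smaller degree for \<open>c ^ q\<close>.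
\<close>

lemma deg_frobenius_less:
  assumes c: "c \<in> carrier L" "\<not> transcendental E c"
    and q: "Factorial_Ring.prime q" "nat_el L q = \<zero>" and d: "deriv_zero L (Irr E c)"
  shows "\<not> transcendental E (c [^] q) \<and> deg (c [^] q) < deg c"
proof -
  note I = Irr_coeffs[OF c]
  let ?m = "coeff (Irr E c)"
  have mc: "?m i \<in> carrier L" for i using I(1) E_closed by blast
  have z: "?m i = \<zero>" if "\<not> q dvd i" for i
  proof (rule ccontr)
    assume "?m i \<noteq> \<zero>"
    moreover have "nat_el L i \<otimes> ?m i = \<zero>" using d by (simp add: deriv_zero_def)
    ultimately have "nat_el L i = \<zero>" using mc integral nat_el_closed by blast
    moreover have "coprime q i" using q(1) that by (rule prime_imp_coprime)
    ultimately show False using nat_el_coprime[of q i] q(2) by simp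
  qed
  have "q dvd deg c" using z[of "deg c"] I(2) by auto
  then obtain k where k: "deg c = q * k" by auto
  have kpos: "0 < k" "k < deg c" using I(5) k prime_gt_1_nat[OF q(1)] by auto
  have "pev L ?m (q * k + 1) c = sumn L (\<lambda>j. ?m (q * j) \<otimes> c [^] (q * j)) (k + 1)"
    unfolding pev_def using prime_gt_0_nat[OF q(1)] mc c(1) z by (intro sumn_multiples) auto
  also have "\<dots> = pev L (\<lambda>j. ?m (q * j)) (Suc k) (c [^] q)"
    unfolding pev_def Suc_eq_plus1 using c(1) by (intro sumn_cong) (simp add: nat_pow_pow)
  finally have rel: "pev L (\<lambda>j. ?m (q * j)) (Suc k) (c [^] q) = \<zero>" using I(3) k by simp
  have top: "?m (q * k) \<noteq> \<zero>" using I(2) k by simp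
  have cq: "c [^] q \<in> carrier L" using c by simp
  have alg: "\<not> transcendental E (c [^] q)"
    unfolding algebraic_iff_pev[OF E_subring cq]
    using rel top I(1) by (intro exI[of _ "\<lambda>j. ?m (q * j)"] exI[of _ "Suc k"]) (auto simp del: pev_Suc)
  have "deg (c [^] q) \<le> k"
    using deg_le_if_relation[OF cq alg, of k "\<lambda>j. ?m (q * j)" k] rel top I(1) by (simp del: pev_Suc)
  then show ?thesis using alg kpos by simp
qed

lemma not_deriv_zero_if_mem: "c \<in> E \<Longrightarrow> \<not> deriv_zero L (Irr E c)"
proof
  assume c: "c \<in> E" and d: "deriv_zero L (Irr E c)"
  have "coeff (Irr E c) 1 = \<one>"
    using deg_one_if_mem[OF c] Irr_coeffs(2)[of c] c E_closed by simp
  then have "nat_el L 1 \<otimes> \<one> = \<zero>" using d unfolding deriv_zero_def by metis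
  then show False by simp
qed

text \<open>
  An element that is both separable and purely inseparable lies in the ground field: its minimal polynomial divides
  \<open>X ^ N - c ^ N = (X - c) ^ N\<close> and has \<open>c\<close> as a simple root.
\<close>

lemma deg_one_if_radical:
  assumes c: "c \<in> carrier L" "\<not> transcendental E c" and nd: "\<not> deriv_zero L (Irr E c)"
    and q: "Factorial_Ring.prime q" "nat_el L q = \<zero>" and r: "c [^] (q ^ m) \<in> E"
  shows "deg c = 1"
proof -
  interpret UP: domain "poly_ring L" by (rule univ_poly_is_domain[OF carrier_is_subring])
  let ?P = "poly_ring L" and ?l = "[\<one>, \<ominus> c]"
  define N where "N = q ^ m"
  have N: "0 < N" using q(1) prime_gt_0_nat by (simp add: N_def)
  have l: "?l \<in> carrier ?P" using c by (simp add: univ_poly_def polynomial_def)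
  have X: "X \<in> carrier ?P" by (rule var_closed[OF carrier_is_subring])
  note h = canonical_embedding_is_hom[OF carrier_is_subring]
  have pc: "poly_of_const a \<in> carrier ?P" if "a \<in> carrier L" for a
    using ring_hom_closed[OF h] that by simp
  have pp: "poly_of_const a [^]\<^bsub>?P\<^esub> n = poly_of_const (a [^] n)" if "a \<in> carrier L" for a and n :: nat
  proof (induction n)
    case 0
    then show ?case using ring_hom_one[OF h] by simp
  next
    case (Suc n)
    then show ?case using ring_hom_mult[OF h, of "a [^] n" a] that by simp
  qed
  have lX: "?l = X \<oplus>\<^bsub>?P\<^esub> poly_of_const (\<ominus> c)"
    using c(1) by (cases "\<ominus> c = \<zero>") (auto simp: univ_poly_add var_def poly_of_const_def)
  have q': "nat_el ?P q = \<zero>\<^bsub>?P\<^esub>"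
    unfolding poly_of_const_nat_el q(2) by (simp add: univ_poly_zero poly_of_const_def)
  have lN: "?l [^]\<^bsub>?P\<^esub> N = X [^]\<^bsub>?P\<^esub> N \<oplus>\<^bsub>?P\<^esub> poly_of_const ((\<ominus> c) [^] N)"
    unfolding N_def lX using UP.frobenius[OF q(1) q' X pc[of "\<ominus> c"], of m] pp c(1) by simp
  have "(\<ominus> c) [^] N \<oplus> c [^] N = (\<ominus> c \<oplus> c) [^] N"
    using frobenius[OF q, of "\<ominus> c" c m] c(1) by (simp add: N_def)
  also have "\<dots> = \<zero>" using c(1) N by (simp add: l_neg nat_pow_zero)
  finally have "(\<ominus> c) [^] N = \<ominus> (c [^] N)" using c(1) by (simp add: minus_unique minus_equality)
  then have e: "(\<ominus> c) [^] N \<in> E" using r E_sub(5) by (simp add: N_def)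
  have "?l [^]\<^bsub>?P\<^esub> N = X [^]\<^bsub>E[X]\<^esub> N \<oplus>\<^bsub>E[X]\<^esub> poly_of_const ((\<ominus> c) [^] N)"
    unfolding lN unitary_monom_eq_var_pow[OF carrier_is_subring, symmetric]
      unitary_monom_eq_var_pow[OF E_subring, symmetric] by (simp add: univ_poly_add)
  moreover have "poly_of_const ((\<ominus> c) [^] N) \<in> carrier (E[X])"
    using ring_hom_closed[OF canonical_embedding_is_hom[OF E_subring]] e by simp
  ultimately have wE: "?l [^]\<^bsub>?P\<^esub> N \<in> carrier (E[X])"
    using var_pow_closed[OF E_subring] ring.ring_simprules(1)[OF univ_poly_is_ring[OF E_subring]] by simp
  interpret ev: ring_hom_ring ?P L "\<lambda>p. eval p c" by (rule eval_ring_hom[OF carrier_is_subring c(1)])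
  have "eval (?l [^]\<^bsub>?P\<^esub> N) c = (eval ?l c) [^] N" by (rule ev.hom_nat_pow[OF l])
  then have w0: "eval (?l [^]\<^bsub>?P\<^esub> N) c = \<zero>" using c(1) N by (simp add: r_neg nat_pow_zero)
  have alg: "(algebraic over E) c" using c(2) by (simp add: over_def)
  have "Irr E c pdivides ?l [^]\<^bsub>?P\<^esub> N" by (rule Irr_minimal[OF subE c(1) alg wE w0])
  then obtain k where k: "k \<in> carrier ?P" "?l [^]\<^bsub>?P\<^esub> N = Irr E c \<otimes>\<^bsub>?P\<^esub> k"
    unfolding pdivides_def factor_def by blast
  obtain g where g: "g \<in> carrier ?P" "Irr E c = poly_mult ?l g" "eval g c \<noteq> \<zero>"
    using separable_if_not_deriv_zero(2)[OF c nd] by blast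
  have g2: "Irr E c = ?l \<otimes>\<^bsub>?P\<^esub> g" using g by (simp add: univ_poly_mult)
  obtain M where M: "N = Suc M" using N by (cases N) auto
  have l0: "?l \<noteq> \<zero>\<^bsub>?P\<^esub>" by (simp add: univ_poly_zero)
  have "?l \<otimes>\<^bsub>?P\<^esub> (g \<otimes>\<^bsub>?P\<^esub> k) = ?l \<otimes>\<^bsub>?P\<^esub> (?l [^]\<^bsub>?P\<^esub> M)"
    using k g2 g(1) l UP.m_assoc UP.m_comm[OF l, of "?l [^]\<^bsub>?P\<^esub> M"] M by simp
  then have "g \<otimes>\<^bsub>?P\<^esub> k = ?l [^]\<^bsub>?P\<^esub> M" using UP.m_lcancel[OF l0 l] g(1) k(1) l by simp
  then have "degree g = 0" by (rule degree_zero_if_divides_power[OF c(1) g(1,3) k(1)])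
  moreover have "g \<noteq> []" using g(3) by auto
  ultimately show ?thesis
    using poly_mult_degree_eq[OF carrier_is_subring, of ?l g] g l
    by (simp add: deg_def univ_poly_carrier del: poly_mult.simps)
qed

text \<open>
  Every element of an extension generated by one separable element is separable. Assumption \<open>H\<close> says that separable
  polynomials of degree smaller than that of \<open>a\<close> already have roots in \<open>E\<close>; it is the induction hypothesis of the next lemma, and with it
  a short argument suffices. Elements of degree less than \<open>deg a\<close> are purely inseparable. An inseparable \<open>b\<close> would have a power \<open>b ^ N\<close> in \<open>E\<close>;
  raising \<open>b = c 0 + c 1 a + \<dots>\<close> to the \<open>N\<close>-th power gives a relation of degree less than \<open>deg a\<close> for \<open>a ^ N\<close>. Then \<open>a\<close> would be purely inseparable as well.
\<close>

lemma separable_simple_extension: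
  assumes a: "a \<in> carrier L" "\<not> transcendental E a" and gen: "carrier L = simple_extension E a"
    and nd: "\<not> deriv_zero L (Irr E a)"
    and H: "\<And>f. f \<in> carrier (E[X]) \<Longrightarrow> degree f < deg a \<Longrightarrow> \<not> deriv_zero L f \<Longrightarrow> \<exists>r\<in>E. eval f r = \<zero>"
    and b: "b \<in> carrier L"
  shows "separable_element L E b"
proof -
  have alg': "(algebraic over E) a" using a(2) by (simp add: over_def)
  have alg: "\<not> transcendental E c" if "c \<in> carrier L" for c
    using simple_extesion_mem_imp_algebraic[OF subE a(1) alg'] that gen by (simp add: over_def)
  have dl: "deg c \<le> deg a" if c: "c \<in> carrier L" for c
  proof -
    have ac: "(algebraic over E) c" using alg[OF c] by (simp add: over_def)
    have "length (exp_base c (deg c)) \<le> deg a"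
    proof (rule independent_length_le_dimension[OF subE])
      show "dimension (deg a) E (carrier L)"
        using dimension_simple_extension[OF subE a(1) alg'] gen by (simp add: deg_def)
      show "independent E (exp_base c (deg c))"
        using exp_base_independent[OF subE c ac] by (simp add: deg_def)
    qed (rule exp_base_closed[OF c])
    then show ?thesis by (simp add: exp_base_def)
  qed
  have radical: "\<exists>m. c [^] (q ^ m) \<in> E"
    if "c \<in> carrier L" "deg c < deg a" and q: "Factorial_Ring.prime q" "nat_el L q = \<zero>" for c q
    using that(1,2)
  proof (induction "deg c" arbitrary: c rule: less_induct)
    case less
    note al = alg[OF less.prems(1)]
    show ?case
    proof (cases "deriv_zero L (Irr E c)")
      case True
      note f = deg_frobenius_less[OF less.prems(1) al q True]
      then obtain m where "(c [^] q) [^] (q ^ m) \<in> E"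
        using less.hyps[of "c [^] q"] less.prems by auto
      then have "c [^] (q ^ Suc m) \<in> E" using less.prems(1) by (simp add: nat_pow_pow)
      then show ?thesis by blast
    next
      case False
      have ac: "(algebraic over E) c" using al by (simp add: over_def)
      obtain r where "r \<in> E" "eval (Irr E c) r = \<zero>"
        using H[OF IrrE(1)[OF subE less.prems(1) ac]] less.prems(2) False by (auto simp: deg_def)
      then have "c \<in> E" by (rule mem_if_root[OF less.prems(1) al])
      then show ?thesis using less.prems(1) by (intro exI[of _ 0]) simp
    qed
  qed
  show ?thesis
  proof (rule ccontr)
    assume "\<not> separable_element L E b"
    then have db: "deriv_zero L (Irr E b)" using separable_if_not_deriv_zero(1)[OF b alg[OF b]] by blast
    note Ib = Irr_coeffs[OF b alg[OF b]]
    have "nat_el L (deg b) \<otimes> \<one> = \<zero>" using db Ib(2) unfolding deriv_zero_def by metis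
    then have "nat_el L (deg b) = \<zero>" by simp
    then obtain q where q: "Factorial_Ring.prime q" "nat_el L q = \<zero>" using prime_char Ib(5) by blast
    have bE: "b \<notin> E" using not_deriv_zero_if_mem db by blast
    have "deg (b [^] q) < deg a" using deg_frobenius_less[OF b alg[OF b] q db] dl[OF b] by simp
    then obtain m where "(b [^] q) [^] (q ^ m) \<in> E" using radical[of "b [^] q" q] b q by auto
    then have bN: "b [^] (q ^ Suc m) \<in> E" using b by (simp add: nat_pow_pow)
    define N where "N = q ^ Suc m"
    have bNE: "b [^] N \<in> E" using bN by (simp only: N_def)
    have "b \<in> Span E (exp_base a (deg a))"
      using Span_exp_base[OF subE a(1) alg'] gen b by (simp add: deg_def)
    then obtain Ks where Ks: "length Ks = deg a" "set Ks \<subseteq> E" "b = combine Ks (exp_base a (deg a))"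
      unfolding Span_eq_combine_set_length_version[OF subE exp_base_closed[OF a(1)]]
      by (auto simp: exp_base_def)
    have Kc: "set Ks \<subseteq> carrier L" using Ks(2) E_closed by blast
    define c where "c = coeff Ks"
    have cE: "c i \<in> E" if "i < deg a" for i
    proof -
      have "c i \<in> set Ks" unfolding coeff_img_restrict[of Ks, symmetric] c_def using that Ks(1) by simp
      then show ?thesis using Ks(2) by blast
    qed
    have bc: "b = pev L c (deg a) a"
      using Ks(3) combine_eq_eval[of Ks a] Ks(1) eval_eq_pev[OF Kc a(1)] by (simp add: c_def)
    have cc: "c i \<in> carrier L" if "i < deg a" for i using cE[OF that] E_closed by simp
    have bN2: "b [^] N = pev L (\<lambda>i. c i [^] N) (deg a) (a [^] N)"
    proof -
      have "b [^] N = sumn L (\<lambda>i. (c i \<otimes> a [^] i) [^] N) (deg a)"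
        unfolding bc pev_def N_def using cc a(1) by (intro frobenius_sumn[OF q]) auto
      also have "\<dots> = pev L (\<lambda>i. c i [^] N) (deg a) (a [^] N)"
        unfolding pev_def using cc a(1)
        by (intro sumn_cong) (simp add: nat_pow_distrib nat_pow_pow mult.commute)
      finally show ?thesis .
    qed
    obtain n where n: "deg a = Suc n" using Irr_coeffs(5)[OF a] by (cases "deg a") auto
    have "\<exists>i<deg a. 0 < i \<and> c i \<noteq> \<zero>"
    proof (rule ccontr)
      assume no: "\<not> (\<exists>i<deg a. 0 < i \<and> c i \<noteq> \<zero>)"
      have "b = c 0 \<otimes> a [^] (0::nat)"
        unfolding bc pev_def using no a(1) cc[of 0] n by (intro sumn_single) auto
      then show False using bE cE[of 0] cc[of 0] n by simp
    qed
    then obtain i where i: "i < deg a" "0 < i" "c i \<noteq> \<zero>" by blast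
    define d where "d j = (if j = 0 then c 0 [^] N \<ominus> b [^] N else c j [^] N)" for j
    have aN: "a [^] N \<in> carrier L" using a(1) by simp
    have dE: "d j \<in> E" if "j \<le> n" for j
      using that cE n bNE E_pow E_sub(5,7) by (auto simp: d_def minus_eq)
    have dc: "d j \<in> carrier L" if "j \<le> n" for j using dE[OF that] E_closed by simp
    have "pev L d (Suc n) (a [^] N) = \<zero>"
    proof -
      have "pev L d (Suc n) (a [^] N) = d 0 \<oplus> sumn L (\<lambda>j. d (Suc j) \<otimes> (a [^] N) [^] Suc j) n"
        unfolding pev_def using dc aN by (subst sumn_Suc_shift) auto
      also have "d 0 = c 0 [^] N \<ominus> b [^] N" by (simp add: d_def)
      also have "sumn L (\<lambda>j. d (Suc j) \<otimes> (a [^] N) [^] Suc j) n = sumn L (\<lambda>j. c (Suc j) [^] N \<otimes> (a [^] N) [^] Suc j) n"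
        by (simp add: d_def)
      finally have 1: "pev L d (Suc n) (a [^] N) =
         (c 0 [^] N \<ominus> b [^] N) \<oplus> sumn L (\<lambda>j. c (Suc j) [^] N \<otimes> (a [^] N) [^] Suc j) n" .
      have 2: "b [^] N = c 0 [^] N \<oplus> sumn L (\<lambda>j. c (Suc j) [^] N \<otimes> (a [^] N) [^] Suc j) n"
        unfolding bN2 n unfolding pev_def using cc n aN by (subst sumn_Suc_shift) auto
      have "u \<ominus> (u \<oplus> w) \<oplus> w = \<zero>" if "u \<in> carrier L" "w \<in> carrier L" for u w
        using that by algebra
      moreover have "sumn L (\<lambda>j. c (Suc j) [^] N \<otimes> (a [^] N) [^] Suc j) n \<in> carrier L"
        using cc n aN by auto
      ultimately show ?thesis unfolding 1 2 using cc[of 0] n by simp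
    qed
    moreover have "d i \<noteq> \<zero>" using pow_nonzero[OF cc[OF i(1)] i(3)] i(2) by (simp add: d_def)
    ultimately have "deg (a [^] N) \<le> n"
      using deg_le_if_relation[OF aN alg[OF aN], of n d i] dE i(1) n by (simp del: pev_Suc)
    then obtain m' where "(a [^] N) [^] (q ^ m') \<in> E" using radical[OF aN _ q] n by auto
    then have "a [^] (q ^ (Suc m + m')) \<in> E"
      using a(1) by (simp add: N_def nat_pow_pow power_add mult.assoc)
    then have "deg a = 1" by (rule deg_one_if_radical[OF a nd q])
    then show False using i by simp
  qed
qed

end


section \<open>Roots in separable-algebraically closed fields\<close>

text \<open>
  Induction on the degree. A reducible polynomial with nonzero derivative has a factor with nonzero derivative. For an irreducible
  one the rupture field is a separable extension, so by hypothesis it is the field itself, and the class of \<open>X\<close> is a root. The rupture field consists of sets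
  of polynomials and thus lives in the type over which separable-algebraic closedness quantifies.
\<close>

lemma (in field) root_if_sep_alg_closed:
  assumes closed: "sep_alg_closed R"
    and p: "p \<in> carrier (poly_ring R)" "\<not> deriv_zero R p"
  shows "\<exists>r\<in>carrier R. eval p r = \<zero>"
  using p
proof (induction "degree p" arbitrary: p rule: less_induct)
  case less
  interpret UP: domain "poly_ring R" by (rule univ_poly_is_domain[OF carrier_is_subring])
  have pp: "polynomial (carrier R) p" using less.prems(1) by (simp add: univ_poly_carrier)
  have pne: "p \<noteq> []" using less.prems(2) by (auto simp: deriv_zero_def)
  have deg_pos: "0 < degree p"
  proof (rule ccontr)
    assume "\<not> 0 < degree p"
    then obtain e where e: "p = [e]" using pne by (cases p) auto
    then have "nat_el R i \<otimes> coeff p i = \<zero>" for i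
      using pp by (cases i) (auto simp: polynomial_def)
    then show False using less.prems(2) by (simp add: deriv_zero_def)
  qed
  show ?case
  proof (cases "pirreducible (carrier R) p")
    case False
    have "p \<notin> Units (poly_ring R)"
    proof
      assume "p \<in> Units (poly_ring R)"
      then have "p \<in> {[k] | k. k \<in> carrier R - {\<zero>}}" unfolding univ_poly_carrier_units .
      then show False using deg_pos by auto
    qed
    then obtain f g where fg: "f \<in> carrier (poly_ring R)" "g \<in> carrier (poly_ring R)"
      "p = f \<otimes>\<^bsub>poly_ring R\<^esub> g" "f \<notin> Units (poly_ring R)" "g \<notin> Units (poly_ring R)"
      using False pirreducibleI[OF carrier_is_subring less.prems(1) pne] by blast
    have fgp: "polynomial (carrier R) f" "polynomial (carrier R) g"
      using fg by (simp_all add: univ_poly_carrier)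
    have pm: "p = poly_mult f g" using fg(3) by (simp add: univ_poly_mult)
    have ne: "f \<noteq> []" "g \<noteq> []" using pm pne poly_mult_zero[of g] poly_mult_zero[of f]
      polynomial_incl[OF fgp(1)] polynomial_incl[OF fgp(2)] by auto
    have nz: "0 < degree h"
      if hc: "h \<in> carrier (poly_ring R)" and h0: "h \<noteq> []" and hU: "h \<notin> Units (poly_ring R)" for h
    proof (rule ccontr)
      assume "\<not> 0 < degree h"
      then obtain e where e: "h = [e]" using h0 by (cases h) auto
      have "polynomial (carrier R) h" using hc by (simp add: univ_poly_carrier)
      then have "h \<in> {[k] | k. k \<in> carrier R - {\<zero>}}" using e by (auto simp: polynomial_def)
      then show False using hU unfolding univ_poly_carrier_units by simp
    qed
    have d: "degree p = degree f + degree g"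
      using poly_mult_degree_eq[OF carrier_is_subring fgp] ne pm by simp
    have less_deg: "degree f < degree p" "degree g < degree p"
      using d nz[OF fg(1) ne(1) fg(4)] nz[OF fg(2) ne(2) fg(5)] by simp_all
    have fgc: "set f \<subseteq> carrier R" "set g \<subseteq> carrier R" using polynomial_incl fgp by auto
    have fc [simp]: "coeff f i \<in> carrier R" and gc [simp]: "coeff g i \<in> carrier R" for i
      using fgc coeff_in_carrier by auto
    have "\<not> deriv_zero R f \<or> \<not> deriv_zero R g"
    proof (rule ccontr)
      assume "\<not> (\<not> deriv_zero R f \<or> \<not> deriv_zero R g)"
      then have fz: "nat_el R i \<otimes> coeff f i = \<zero>" and gz: "nat_el R i \<otimes> coeff g i = \<zero>" for i
        by (simp_all add: deriv_zero_def)
      have "nat_el R n \<otimes> coeff p n = \<zero>" for n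
      proof -
        have "coeff p n = (\<Oplus>k\<in>{..n}. coeff f k \<otimes> coeff g (n - k))"
          unfolding pm poly_mult_coeff[OF fgc] ..
        then have "nat_el R n \<otimes> coeff p n = (\<Oplus>k\<in>{..n}. nat_el R n \<otimes> (coeff f k \<otimes> coeff g (n - k)))"
          by (simp add: finsum_rdistr)
        also have "\<dots> = (\<Oplus>k\<in>{..n}. \<zero>)"
        proof (rule add.finprod_cong')
          fix k assume "k \<in> {..n}"
          then have "n = k + (n - k)" by simp
          then have "nat_el R n = nat_el R k \<oplus> nat_el R (n - k)" using nat_el_add by metis
          moreover have "(A \<oplus> B) \<otimes> (u \<otimes> w) = (A \<otimes> u) \<otimes> w \<oplus> u \<otimes> (B \<otimes> w)"
            if "A \<in> carrier R" "B \<in> carrier R" "u \<in> carrier R" "w \<in> carrier R" for A B u w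
            using that by algebra
          ultimately show "nat_el R n \<otimes> (coeff f k \<otimes> coeff g (n - k)) = \<zero>"
            using fz gz by simp
        qed auto
        finally show ?thesis by simp
      qed
      then show False using less.prems(2) by (simp add: deriv_zero_def)
    qed
    then have "\<exists>r\<in>carrier R. eval f r = \<zero> \<or> eval g r = \<zero>"
      using less.hyps[OF less_deg(1) fg(1)] less.hyps[OF less_deg(2) fg(2)] by blast
    then obtain r where r: "r \<in> carrier R" "eval f r = \<zero> \<or> eval g r = \<zero>" by blast
    have "eval p r = eval f r \<otimes> eval g r" unfolding pm using fgc r(1) by (rule eval_poly_mult)
    moreover have "eval f r \<in> carrier R" "eval g r \<in> carrier R" using fgc r(1) by (auto intro: eval_in_carrier)
    ultimately have "eval p r = \<zero>" using r(2) by auto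
    then show ?thesis using r(1) by blast
  next
    case True
    let ?L = "Rupt (carrier R) p"
    define \<sigma> where "\<sigma> = rupture_surj (carrier R) p"
    define h where "h = \<sigma> \<circ> poly_of_const"
    interpret L: field ?L
      using rupture_is_field_iff_pirreducible[OF carrier_is_subfield less.prems(1)] True by simp
    interpret S: ring_hom_ring "poly_ring R" ?L \<sigma>
      unfolding \<sigma>_def by (rule rupture_surj_hom(2)[OF carrier_is_subring less.prems(1)])
    have hh: "h \<in> ring_hom R ?L"
      using rupture_surj_norm_is_hom[OF carrier_is_subring less.prems(1)] by (simp add: h_def \<sigma>_def)
    interpret H: ring_hom_ring R ?L h
      by (rule ring_hom_ringI2[OF ring_axioms L.ring_axioms hh])
    define E where "E = h ` carrier R"
    have sE: "subfield E ?L" and inj: "inj_on h (carrier R)"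
      unfolding E_def using H.img_is_subfield[OF carrier_is_subfield] L.one_not_zero by auto
    interpret X: field_ext ?L E by (intro field_ext.intro field_ext_axioms.intro sE L.field_axioms)
    define a where "a = \<sigma> X"
    have Xc: "X \<in> carrier (poly_ring R)" by (rule var_closed[OF carrier_is_subring])
    have a: "a \<in> carrier ?L" using Xc by (simp add: a_def)
    have hz: "e = \<zero>" if "e \<in> carrier R" "h e = \<zero>\<^bsub>?L\<^esub>" for e
      using inj_onD[OF inj _ that(1) zero_closed] that(2) by simp
    have evX: "L.eval (map h q) a = \<sigma> q" if q: "q \<in> carrier (poly_ring R)" for q
    proof -
      have "\<sigma> q = \<sigma> (UP.eval (map poly_of_const q) X)"
        using eval_rewrite[OF carrier_is_subring q] by simp
      also have "\<dots> = L.eval (map \<sigma> (map poly_of_const q)) (\<sigma> X)"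
        by (rule S.eval_hom[OF UP.carrier_is_subring Xc map_norm_in_poly_ring_carrier[OF carrier_is_subring q]])
      finally show ?thesis by (simp add: h_def a_def)
    qed
    have mapE: "map h q \<in> carrier (E[X]\<^bsub>?L\<^esub>)" if q: "q \<in> carrier (poly_ring R)" for q
    proof -
      have "polynomial (carrier R) q" using q by (simp add: univ_poly_carrier)
      then have "set q \<subseteq> carrier R \<and> (q = [] \<or> lead_coeff q \<noteq> \<zero>)" by (auto simp: polynomial_def)
      then have "polynomial\<^bsub>?L\<^esub> E (map h q)"
        using hz unfolding polynomial_def E_def by (cases q) auto
      then show ?thesis by (simp add: univ_poly_carrier)
    qed
    have lift: "\<exists>q\<in>carrier (poly_ring R). map h q = f" if f: "f \<in> carrier (E[X]\<^bsub>?L\<^esub>)" for f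
    proof -
      have fp: "polynomial\<^bsub>?L\<^esub> E f" using f by (simp add: univ_poly_carrier)
      then have fs: "set f \<subseteq> h ` carrier R" by (auto simp: polynomial_def E_def)
      define q where "q = map (inv_into (carrier R) h) f"
      have q: "set q \<subseteq> carrier R" using fs by (auto simp: q_def intro!: inv_into_into)
      have fq: "f = map h q" using fs by (auto simp: q_def f_inv_into_f intro!: map_idI[symmetric])
      have "polynomial (carrier R) q"
        using fp q unfolding polynomial_def fq by (cases q) auto
      then show ?thesis using fq by (auto simp: univ_poly_carrier)
    qed
    have pz: "L.eval (map h p) a = \<zero>\<^bsub>?L\<^esub>"
      using polynomial_rupture[OF carrier_is_subring less.prems(1)] by (simp add: h_def \<sigma>_def a_def)
    have "map h p \<noteq> []" using pne by simp
    then have alg': "(L.algebraic over E) a" by (rule L.algebraicI[OF mapE[OF less.prems(1)] _ pz])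
    then have alg: "\<not> L.transcendental E a" by (simp add: over_def)
    have gen: "carrier ?L = L.simple_extension E a"
    proof
      show "L.simple_extension E a \<subseteq> carrier ?L"
        by (rule L.simple_extension_in_carrier[OF X.E_sub(1) a])
      show "carrier ?L \<subseteq> L.simple_extension E a"
      proof
        fix c assume "c \<in> carrier ?L"
        then obtain q where q: "q \<in> carrier (poly_ring R)" "c = \<sigma> q"
          unfolding \<sigma>_def rupture_def FactRing_def A_RCOSETS_def' by auto
        then show "c \<in> L.simple_extension E a"
          unfolding L.simple_extension_as_eval_img[OF X.E_sub(1) a]
          using evX[OF q(1)] mapE[OF q(1)] by auto
      qed
    qed
    let ?I = "L.Irr E a"
    note I = L.IrrE[OF sE a alg']
    have dI: "degree ?I \<le> degree p"
      using L.pdivides_imp_degree_le[OF X.E_subring I(1) mapE[OF less.prems(1)] \<open>map h p \<noteq> []\<close>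
          L.Irr_minimal[OF sE a alg' mapE[OF less.prems(1)] pz]] by simp
    have coh: "h (coeff q i) = L.coeff (map h q) i" if "q \<in> carrier (poly_ring R)" for q i
      using that polynomial_incl by (intro H.coeff_hom') (auto simp: univ_poly_carrier[symmetric])
    have hn: "h (nat_el R n) = nat_el ?L n" for n by (induction n) auto
    have dz: "deriv_zero R q" if "deriv_zero ?L (map h q)" "q \<in> carrier (poly_ring R)" for q
      unfolding deriv_zero_def
    proof
      fix i
      have qc: "coeff q i \<in> carrier R"
        using that(2) polynomial_incl by (intro coeff_in_carrier) (auto simp: univ_poly_carrier[symmetric])
      have "h (nat_el R i \<otimes> coeff q i) = \<zero>\<^bsub>?L\<^esub>"
        using that(1) coh[OF that(2)] hn qc by (simp add: deriv_zero_def)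
      then show "nat_el R i \<otimes> coeff q i = \<zero>" using hz qc by simp
    qed
    have nd: "\<not> deriv_zero ?L ?I"
    proof
      assume dI0: "deriv_zero ?L ?I"
      obtain q where q: "q \<in> carrier (poly_ring R)" "map h q = ?I" using lift[OF I(1)] by blast
      have "\<sigma> q = \<zero>\<^bsub>?L\<^esub>" using evX[OF q(1)] q(2) I(4) by simp
      then have "q \<in> PIdl\<^bsub>poly_ring R\<^esub> p"
        using ideal.rcos_const_imp_mem[OF UP.cgenideal_ideal[OF less.prems(1)] q(1)]
        unfolding \<sigma>_def rupture_def FactRing_def by simp
      then obtain r where r: "r \<in> carrier (poly_ring R)" "q = r \<otimes>\<^bsub>poly_ring R\<^esub> p"
        unfolding cgenideal_def by blast
      have rp: "polynomial (carrier R) r" using r(1) by (simp add: univ_poly_carrier)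
      have qm: "q = poly_mult r p" using r(2) by (simp add: univ_poly_mult)
      have "?I \<noteq> []" using X.Irr_coeffs(6)[OF a alg] by auto
      then have rne: "r \<noteq> []" using q(2) qm by auto
      have "degree q = degree r + degree p"
        using poly_mult_degree_eq[OF carrier_is_subring rp pp] rne pne qm by simp
      moreover have "degree q \<le> degree p" using dI q(2) by (metis length_map)
      ultimately have "degree r = 0" by simp
      then obtain e where re: "r = [e]" using rne by (cases r) auto
      then have e: "e \<in> carrier R - {\<zero>}" using rp by (simp add: polynomial_def)
      have ps: "set p \<subseteq> carrier R" using polynomial_incl[OF pp] .
      have "q = map (\<lambda>b. e \<otimes> b) p" using poly_mult_const(1)[OF carrier_is_subring pp e] qm re by simp
      then have cq: "coeff q i = e \<otimes> coeff p i" for i using scalar_coeff[of e p] e by simp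
      have "deriv_zero R q" using dz q dI0 by simp
      then have "nat_el R i \<otimes> coeff p i = \<zero>" for i
      proof -
        have "e \<otimes> (nat_el R i \<otimes> coeff p i) = \<zero>"
          using \<open>deriv_zero R q\<close> cq e coeff_in_carrier[OF ps] by (simp add: deriv_zero_def m_lcomm)
        then show ?thesis using e integral coeff_in_carrier[OF ps] by blast
      qed
      then show False using less.prems(2) by (simp add: deriv_zero_def)
    qed
    have "separable_element ?L E b" if "b \<in> carrier ?L" for b
    proof (rule X.separable_simple_extension[OF a alg gen nd _ that])
      fix f assume f: "f \<in> carrier (E[X]\<^bsub>?L\<^esub>)" "degree f < X.deg a" "\<not> deriv_zero ?L f"
      obtain q where q: "q \<in> carrier (poly_ring R)" "map h q = f" using lift[OF f(1)] by blast
      have "degree q < degree p" using q(2) f(2) dI unfolding X.deg_def by auto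
      moreover have "\<not> deriv_zero R q"
      proof
        assume z: "deriv_zero R q"
        have "nat_el ?L i \<otimes>\<^bsub>?L\<^esub> L.coeff f i = \<zero>\<^bsub>?L\<^esub>" for i
        proof -
          have qc: "coeff q i \<in> carrier R"
            using q(1) polynomial_incl by (intro coeff_in_carrier) (auto simp: univ_poly_carrier[symmetric])
          have "h (nat_el R i \<otimes> coeff q i) = \<zero>\<^bsub>?L\<^esub>" using z by (simp add: deriv_zero_def)
          then show ?thesis using coh[OF q(1), of i] hn[of i] qc q(2) by simp
        qed
        then show False using f(3) by (simp add: deriv_zero_def)
      qed
      ultimately obtain r where r: "r \<in> carrier R" "eval q r = \<zero>" using less.hyps q(1) by blast
      have "L.eval f (h r) = h (eval q r)"
        using H.eval_hom[OF carrier_is_subring r(1) q(1)] q(2) by simp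
      then show "\<exists>r\<in>E. L.eval f r = \<zero>\<^bsub>?L\<^esub>" using r by (auto simp: E_def)
    qed
    then have "h ` carrier R = carrier ?L"
      using closed hh L.field_axioms unfolding sep_alg_closed_def E_def by blast
    then obtain r where r: "r \<in> carrier R" "h r = a" using a by (metis imageE)
    have "h (eval p r) = \<zero>\<^bsub>?L\<^esub>"
      using H.eval_hom[OF carrier_is_subring r(1) less.prems(1)] r(2) pz by simp
    moreover have "eval p r \<in> carrier R"
      using r(1) polynomial_incl[OF pp] by (intro eval_in_carrier) auto
    ultimately show ?thesis using hz r(1) by blast
  qed
qed

lemma add_pow_consistent: "[n] \<cdot>\<^bsub>R\<lparr>carrier := A\<rparr>\<^esub> a = [(n::nat)] \<cdot>\<^bsub>R\<^esub> a"
  by (simp add: add_pow_def nat_pow_def)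

text \<open>
  The condition on \<open>c j\<close> says that the derivative is not zero.
\<close>

lemma (in field) root_in_sep_alg_closed_subfield:
  assumes k: "subfield k R" and closed: "sep_alg_closed (R\<lparr>carrier := k\<rparr>)"
    and c: "\<And>i. i < n \<Longrightarrow> c i \<in> k" and j: "j < n" "nat_el R j \<otimes> c j \<noteq> \<zero>"
  shows "\<exists>r\<in>k. pev R c n r = \<zero>"
proof -
  note ks = subfieldE(1)[OF k]
  let ?F = "R\<lparr>carrier := k\<rparr>"
  interpret F: field ?F using subfield_iff(2)[OF k] .
  have "\<exists>q\<in>carrier (k[X]). length q \<le> n \<and>
    (\<forall>i. coeff q i = (if i < n then c i else \<zero>)) \<and> (\<forall>z\<in>carrier R. eval q z = pev R c n z)"
    using ks c by (rule pev_as_eval)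
  then obtain q where q: "q \<in> carrier (k[X])" "\<And>i. coeff q i = (if i < n then c i else \<zero>)"
    "\<And>z. z \<in> carrier R \<Longrightarrow> eval q z = pev R c n z" by blast
  have co: "F.coeff q = coeff q" using coeff_consistent[OF ks] by simp
  have "q \<in> carrier (poly_ring ?F)" using q(1) univ_poly_consistent[OF ks] by simp
  moreover have "\<not> deriv_zero ?F q"
  proof
    assume "deriv_zero ?F q"
    then have "nat_el ?F j \<otimes> coeff q j = \<zero>" unfolding deriv_zero_def co by simp
    then show False using j q(2)[of j] by (simp add: add_pow_consistent)
  qed
  ultimately obtain r where r: "r \<in> k" "F.eval q r = \<zero>\<^bsub>?F\<^esub>"
    using F.root_if_sep_alg_closed[OF closed] by auto
  then have "eval q r = \<zero>" using eval_consistent[OF ks] by simp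
  moreover have "r \<in> carrier R" using r(1) subringE(1)[OF ks] by blast
  ultimately show ?thesis using r(1) q(3)[of r] by auto
qed

lemma (in field) nth_root_sep_closed:
  assumes k: "subfield k R" and closed: "sep_alg_closed (R\<lparr>carrier := k\<rparr>)"
    and e: "e \<in> k" "e \<noteq> \<zero>" and n: "0 < n" "nat_el R n \<noteq> \<zero>"
  shows "\<exists>g\<in>k. g \<noteq> \<zero> \<and> g [^] (n::nat) = e"
proof -
  note ks = subringE[OF subfieldE(1)[OF k]]
  let ?c = "\<lambda>i. if i = 0 then \<ominus> e else if i = n then \<one> else \<zero>"
  have ec: "e \<in> carrier R" using e ks(1) by blast
  have ck: "?c i \<in> k" for i using e ks by auto
  have "nat_el R n \<otimes> ?c n \<noteq> \<zero>" using n by simp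
  then obtain g where g: "g \<in> k" "pev R ?c (Suc n) g = \<zero>"
    using root_in_sep_alg_closed_subfield[OF k closed, of "Suc n" ?c n] ck by auto
  have gc: "g \<in> carrier R" using g ks(1) by blast
  have "pev R ?c m g = \<ominus> e" if "0 < m" "m \<le> n" for m
    using that by (induction m rule: nat_induct_non_zero) (use ec gc in auto)
  then have "\<ominus> e \<oplus> g [^] n = \<zero>" using g(2) n gc by simp
  moreover have "E = e \<oplus> (\<ominus> e \<oplus> E)" if "E \<in> carrier R" for E using that ec by algebra
  ultimately have *: "g [^] n = e" using gc ec by (metis nat_pow_closed r_zero)
  then have "g \<noteq> \<zero>" using e n by (auto simp: nat_pow_zero)
  then show ?thesis using g(1) * by blast
qed

section \<open>Valuation rings\<close>

text \<open>
  Up to equivalence a Krull valuation is its valuation ring. Valuation rings can be compared directly, whereas value groups may live in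
  different types.
\<close>

locale val_ring_field = field K for K (structure) + fixes V
  assumes subV: "subring V K"
    and total: "\<And>z. z \<in> carrier K \<Longrightarrow> z \<noteq> \<zero> \<Longrightarrow> z \<in> V \<or> inv z \<in> V"
begin

definition M :: "'a set" where "M = {z \<in> V. z = \<zero> \<or> inv z \<notin> V}"

lemmas V_sub = subringE[OF subV]

lemma V_closed [simp]: "z \<in> V \<Longrightarrow> z \<in> carrier K" using V_sub(1) by blast
lemma M_V: "z \<in> M \<Longrightarrow> z \<in> V" by (simp add: M_def)
lemma zero_M [simp]: "\<zero> \<in> M" by (simp add: M_def V_sub(2))
lemma zero_V [simp]: "\<zero> \<in> V" by (rule V_sub(2))
lemma one_V [simp]: "\<one> \<in> V" by (rule V_sub(3))
lemma V_mult [simp, intro]: "a \<in> V \<Longrightarrow> b \<in> V \<Longrightarrow> a \<otimes> b \<in> V" by (rule V_sub(6))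
lemma V_add [simp, intro]: "a \<in> V \<Longrightarrow> b \<in> V \<Longrightarrow> a \<oplus> b \<in> V" by (rule V_sub(7))
lemma V_minus [simp, intro]: "a \<in> V \<Longrightarrow> \<ominus> a \<in> V" by (rule V_sub(5))
lemma V_diff [simp, intro]: "a \<in> V \<Longrightarrow> b \<in> V \<Longrightarrow> a \<ominus> b \<in> V" by (simp add: minus_eq)
lemma V_pow [simp, intro]: "a \<in> V \<Longrightarrow> a [^] (n::nat) \<in> V" by (induction n) auto
lemma V_nat_el [simp]: "nat_el K n \<in> V" by (induction n) auto

lemma inv_one' [simp]: "inv \<one> = \<one>" by (simp add: comm_inv_char)
lemma one_not_M [simp]: "\<one> \<notin> M" by (simp add: M_def)

lemma inv_closed' [simp]: "a \<in> carrier K \<Longrightarrow> a \<noteq> \<zero> \<Longrightarrow> inv a \<in> carrier K"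
  using field_Units by simp
lemma inv_r [simp]: "a \<in> carrier K \<Longrightarrow> a \<noteq> \<zero> \<Longrightarrow> a \<otimes> inv a = \<one>"
  using field_Units by simp
lemma inv_l [simp]: "a \<in> carrier K \<Longrightarrow> a \<noteq> \<zero> \<Longrightarrow> inv a \<otimes> a = \<one>"
  using field_Units by simp
lemma inv_nz [simp]: "a \<in> carrier K \<Longrightarrow> a \<noteq> \<zero> \<Longrightarrow> inv a \<noteq> \<zero>"
  by (metis inv_r r_null one_not_zero)
lemma inv_mult: "a \<in> carrier K \<Longrightarrow> a \<noteq> \<zero> \<Longrightarrow> b \<in> carrier K \<Longrightarrow> b \<noteq> \<zero> \<Longrightarrow> inv (a \<otimes> b) = inv a \<otimes> inv b"
proof -
  assume a: "a \<in> carrier K" "a \<noteq> \<zero>" and b: "b \<in> carrier K" "b \<noteq> \<zero>"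
  have "(a \<otimes> b) \<otimes> (inv a \<otimes> inv b) = (a \<otimes> inv a) \<otimes> (b \<otimes> inv b)"
    using a(1) b(1) inv_closed'[OF a] inv_closed'[OF b] by (simp only: m_ac m_closed)
  then have "(a \<otimes> b) \<otimes> (inv a \<otimes> inv b) = \<one>" using a b by simp
  then show ?thesis using a b by (intro comm_inv_char) auto
qed
lemma inv_inv' [simp]: "a \<in> carrier K \<Longrightarrow> a \<noteq> \<zero> \<Longrightarrow> inv (inv a) = a"
  by (rule comm_inv_char) auto
lemma inv_pow: "a \<in> carrier K \<Longrightarrow> a \<noteq> \<zero> \<Longrightarrow> inv (a [^] (n::nat)) = inv a [^] n"
proof (induction n)
  case (Suc n)
  then show ?case using pow_nonzero[of a n] by (simp add: inv_mult)
qed simp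

lemma div_cancel: "a \<in> carrier K \<Longrightarrow> b \<in> carrier K \<Longrightarrow> b \<noteq> \<zero> \<Longrightarrow> a \<otimes> inv b \<otimes> b = a"
  by (simp add: m_assoc)

lemma div_chain:
  "a \<in> carrier K \<Longrightarrow> b \<in> carrier K \<Longrightarrow> b \<noteq> \<zero> \<Longrightarrow> c \<in> carrier K \<Longrightarrow> c \<noteq> \<zero> \<Longrightarrow>
    (a \<otimes> inv b) \<otimes> (b \<otimes> inv c) = a \<otimes> inv c"
proof -
  assume a: "a \<in> carrier K" and b: "b \<in> carrier K" "b \<noteq> \<zero>" and c: "c \<in> carrier K" "c \<noteq> \<zero>"
  have "(a \<otimes> inv b \<otimes> b) \<otimes> inv c = (a \<otimes> inv b) \<otimes> (b \<otimes> inv c)"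
    using a b c by (intro m_assoc) auto
  then show ?thesis using div_cancel[OF a b] by simp
qed

lemma unitD: "a \<in> V \<Longrightarrow> a \<notin> M \<Longrightarrow> a \<noteq> \<zero> \<and> inv a \<in> V \<and> inv a \<notin> M"
  by (auto simp: M_def)

lemma not_V_inv: "a \<in> carrier K \<Longrightarrow> a \<notin> V \<Longrightarrow> a \<noteq> \<zero> \<and> inv a \<in> M"
proof -
  assume a: "a \<in> carrier K" "a \<notin> V"
  then have "a \<noteq> \<zero>" using zero_V by blast
  then show ?thesis using total[of a] a by (simp add: M_def)
qed

lemma M_closed: "z \<in> M \<Longrightarrow> z \<in> carrier K" using M_V V_closed by blast

lemma M_mult [intro]: assumes "a \<in> V" "b \<in> M" shows "a \<otimes> b \<in> M"
proof (rule ccontr)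
  assume n: "a \<otimes> b \<notin> M"
  have bV: "b \<in> V" using assms(2) by (rule M_V)
  have u: "a \<otimes> b \<noteq> \<zero>" "inv (a \<otimes> b) \<in> V" using n assms bV by (auto simp: M_def)
  have "b \<noteq> \<zero>" "a \<noteq> \<zero>" using u assms bV by auto
  have "b \<otimes> (a \<otimes> inv (a \<otimes> b)) = (a \<otimes> b) \<otimes> inv (a \<otimes> b)"
    using assms(1) bV u(2) by (simp add: m_assoc m_lcomm)
  also have "\<dots> = \<one>" by (rule inv_r) (use u assms(1) bV in auto)
  finally have "inv b = a \<otimes> inv (a \<otimes> b)" using assms bV u by (intro comm_inv_char) auto
  then have "inv b \<in> V" using assms u by auto
  then show False using assms(2) \<open>b \<noteq> \<zero>\<close> by (simp add: M_def)
qed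

declare M_V [simp]

lemma M_mult_r [intro]: "a \<in> M \<Longrightarrow> b \<in> V \<Longrightarrow> a \<otimes> b \<in> M"
  using M_mult[of b a] by (simp add: m_comm)

lemma M_add [intro]: assumes "a \<in> M" "b \<in> M" shows "a \<oplus> b \<in> M"
proof -
  have aux: "a \<oplus> b \<in> M" if "a \<in> M" "b \<in> M" "b \<noteq> \<zero>" "a \<otimes> inv b \<in> V" for a b
  proof -
    have "a \<oplus> b = (a \<otimes> inv b \<oplus> \<one>) \<otimes> b"
      using that M_closed by (simp add: l_distr div_cancel)
    moreover have "a \<otimes> inv b \<oplus> \<one> \<in> V" using that(4) by auto
    ultimately show ?thesis using that(2) M_mult by simp
  qed
  show ?thesis
  proof (cases "a = \<zero> \<or> b = \<zero>")
    case True
    then show ?thesis using assms by auto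
  next
    case False
    have c: "a \<in> carrier K" "b \<in> carrier K" using assms by auto
    have "a \<otimes> inv b \<in> V \<or> inv (a \<otimes> inv b) \<in> V"
      using c False by (intro total) (auto simp: integral_iff)
    moreover have "inv (a \<otimes> inv b) = b \<otimes> inv a" using c False by (simp add: inv_mult m_comm)
    ultimately show ?thesis using aux[of a b] aux[of b a] assms False c by (auto simp: a_comm)
  qed
qed

lemma M_minus [simp, intro]: "a \<in> M \<Longrightarrow> \<ominus> a \<in> M"
  using M_mult[of "\<ominus> \<one>" a] by (simp add: l_minus)
lemma M_diff [intro]: "a \<in> M \<Longrightarrow> b \<in> M \<Longrightarrow> a \<ominus> b \<in> M"
  by (simp add: minus_eq M_add)

lemma unit_mult: "a \<in> V \<Longrightarrow> a \<notin> M \<Longrightarrow> b \<in> V \<Longrightarrow> b \<notin> M \<Longrightarrow> a \<otimes> b \<notin> M"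
proof
  assume a: "a \<in> V" "a \<notin> M" and b: "b \<in> V" "b \<notin> M" and ab: "a \<otimes> b \<in> M"
  have "inv a \<otimes> (a \<otimes> b) \<in> M" using unitD[OF a] ab by auto
  moreover have "inv a \<otimes> (a \<otimes> b) = b"
    using unitD[OF a] a b by (simp add: m_assoc[symmetric])
  ultimately show False using b by simp
qed

lemma M_prime: "a \<in> V \<Longrightarrow> b \<in> V \<Longrightarrow> a \<otimes> b \<in> M \<Longrightarrow> a \<in> M \<or> b \<in> M"
  using unit_mult by blast

lemma unit_pow: "a \<in> V \<Longrightarrow> a \<notin> M \<Longrightarrow> a [^] (n::nat) \<notin> M"
  by (induction n) (auto simp: unit_mult)

lemma M_pow: "a \<in> M \<Longrightarrow> 0 < n \<Longrightarrow> a [^] (n::nat) \<in> M"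
  by (cases n) auto

lemma V_if_pow: assumes "a \<in> carrier K" "a [^] (n::nat) \<in> V" "0 < n" shows "a \<in> V"
proof (rule ccontr)
  assume n: "a \<notin> V"
  note i = not_V_inv[OF assms(1) n]
  have "inv a [^] n \<otimes> a [^] n \<in> M" using M_pow[of "inv a" n] i assms by blast
  moreover have "inv a [^] n \<otimes> a [^] n = \<one>"
    using assms i by (simp add: nat_pow_distrib[symmetric])
  ultimately show False by simp
qed

lemma unit_add_M: "a \<in> V \<Longrightarrow> a \<notin> M \<Longrightarrow> b \<in> M \<Longrightarrow> a \<oplus> b \<notin> M"
proof
  assume a: "a \<in> V" "a \<notin> M" "b \<in> M" "a \<oplus> b \<in> M"
  then have "(a \<oplus> b) \<ominus> b \<in> M" by blast
  moreover have "(a \<oplus> b) \<ominus> b = a" using a by (simp add: minus_eq a_assoc r_neg)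
  ultimately show False using a by simp
qed

lemma sumn_V [simp, intro]: "(\<And>i. i < n \<Longrightarrow> f i \<in> V) \<Longrightarrow> sumn K f n \<in> V"
  by (rule sumn_in_subgroup) auto
lemma sumn_M [intro]: "(\<And>i. i < n \<Longrightarrow> f i \<in> M) \<Longrightarrow> sumn K f n \<in> M"
  by (rule sumn_in_subgroup) auto
lemma pev_V [simp, intro]: "(\<And>i. i < n \<Longrightarrow> c i \<in> V) \<Longrightarrow> z \<in> V \<Longrightarrow> pev K c n z \<in> V"
  unfolding pev_def by (rule sumn_V) auto
lemma pev_M [intro]: "(\<And>i. i < n \<Longrightarrow> c i \<in> M) \<Longrightarrow> z \<in> V \<Longrightarrow> pev K c n z \<in> M"
  unfolding pev_def by (rule sumn_M) auto

text \<open>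
  Division by a term of least value makes all terms integral and one of them equal to 1.
\<close>

lemma least_value:
  fixes n :: nat
  assumes "\<And>i. i < n \<Longrightarrow> c i \<in> carrier K" "j < n" "c j \<noteq> \<zero>"
  shows "\<exists>i<n. c i \<noteq> \<zero> \<and> (\<forall>l<n. c l \<otimes> inv (c i) \<in> V)"
  using assms
proof (induction n arbitrary: j)
  case (Suc n)
  show ?case
  proof (cases "\<exists>j<n. c j \<noteq> \<zero>")
    case False
    then have "j = n" using Suc.prems by (metis less_Suc_eq)
    then show ?thesis using Suc.prems False
      by (intro exI[of _ n]) (auto simp: less_Suc_eq)
  next
    case True
    then obtain i where i: "i < n" "c i \<noteq> \<zero>" "\<forall>l<n. c l \<otimes> inv (c i) \<in> V"
      using Suc.IH Suc.prems(1) by (metis less_Suc_eq)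
    have cc: "c i \<in> carrier K" "c n \<in> carrier K" using Suc.prems(1) i(1) by auto
    show ?thesis
    proof (cases "c n \<otimes> inv (c i) \<in> V")
      case True
      then show ?thesis using i by (intro exI[of _ i]) (auto simp: less_Suc_eq)
    next
      case False
      then have n0: "c n \<noteq> \<zero>" using cc i by auto
      have "inv (c n \<otimes> inv (c i)) \<in> V" using not_V_inv[OF _ False] cc i by auto
      then have r: "c i \<otimes> inv (c n) \<in> V" using cc i n0 by (simp add: inv_mult m_comm)
      have "c l \<otimes> inv (c n) \<in> V" if "l < n" for l
      proof -
        have "c l \<in> carrier K" using Suc.prems(1) that by auto
        then have "c l \<otimes> inv (c n) = (c l \<otimes> inv (c i)) \<otimes> (c i \<otimes> inv (c n))"
          using div_chain[of "c l" "c i" "c n"] cc i n0 by simp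
        then show ?thesis using i(3) that r by auto
      qed
      then show ?thesis using n0 cc by (intro exI[of _ n]) (auto simp: less_Suc_eq)
    qed
  qed
qed simp

subsection \<open>The residue field\<close>

definition RF :: "'a set ring" where "RF = (K\<lparr>carrier := V\<rparr>) Quot M"
definition res :: "'a \<Rightarrow> 'a set" where "res z = M +>\<^bsub>K\<^esub> z"

lemma coset_V: "M +>\<^bsub>K\<lparr>carrier := V\<rparr>\<^esub> z = res z"
  by (simp add: res_def a_r_coset_def r_coset_def)

lemma cring_V: "cring (K\<lparr>carrier := V\<rparr>)"
  using subcring_iff[OF V_sub(1)] subV by (simp add: subcringI subcring_def subcring_axioms_def m_comm V_closed)

lemma maximal_M: "maximalideal M (K\<lparr>carrier := V\<rparr>)"
proof -
  interpret V: cring "K\<lparr>carrier := V\<rparr>" by (rule cring_V)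
  have am: "a_inv (K\<lparr>carrier := V\<rparr>) a = \<ominus> a" if "a \<in> V" for a
    using that V.minus_equality[of "\<ominus> a" a] by (simp add: l_neg)
  have id: "ideal M (K\<lparr>carrier := V\<rparr>)"
  proof (rule idealI[OF V.ring_axioms])
    show "subgroup M (add_monoid (K\<lparr>carrier := V\<rparr>))"
    proof (rule subgroup.intro)
      fix x assume x: "x \<in> M"
      have "inv\<^bsub>add_monoid (K\<lparr>carrier := V\<rparr>)\<^esub> x = \<ominus> x"
        using am[of x] M_V[OF x] by (simp only: a_inv_def)
      then show "inv\<^bsub>add_monoid (K\<lparr>carrier := V\<rparr>)\<^esub> x \<in> M" using M_minus[OF x] by (simp only:)
    qed auto
  qed (auto)
  show ?thesis
  proof (rule maximalidealI[OF id])
    show "carrier (K\<lparr>carrier := V\<rparr>) \<noteq> M"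
    proof
      assume e: "carrier (K\<lparr>carrier := V\<rparr>) = M"
      have "\<one> \<in> carrier (K\<lparr>carrier := V\<rparr>)" by simp
      then show False unfolding e by simp
    qed
    fix J assume J: "ideal J (K\<lparr>carrier := V\<rparr>)" "M \<subseteq> J" "J \<subseteq> carrier (K\<lparr>carrier := V\<rparr>)"
    interpret J: ideal J "K\<lparr>carrier := V\<rparr>" by (rule J)
    show "J = M \<or> J = carrier (K\<lparr>carrier := V\<rparr>)"
    proof (cases "J \<subseteq> M")
      case True
      then show ?thesis using J by auto
    next
      case False
      then obtain a where a: "a \<in> J" "a \<notin> M" by blast
      have aV: "a \<in> V" using a J(3) by auto
      have "inv a \<otimes> a \<in> J" using J.I_l_closed[OF a(1), of "inv a"] unitD[OF aV a(2)] by simp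
      then have "\<one> \<in> J" using unitD[OF aV a(2)] aV by simp
      then show ?thesis using J.one_imp_carrier by simp
    qed
  qed
qed

lemma field_RF: "field RF"
  unfolding RF_def by (rule maximalideal.quotient_is_field[OF maximal_M cring_V])

sublocale RF: field RF by (rule field_RF)

lemma res_hom: "ring_hom_ring (K\<lparr>carrier := V\<rparr>) RF res"
proof -
  interpret mx: maximalideal M "K\<lparr>carrier := V\<rparr>" by (rule maximal_M)
  show ?thesis using mx.rcos_ring_hom_ring unfolding RF_def coset_V[abs_def] .
qed

lemma res_in_hom: "res \<in> ring_hom (K\<lparr>carrier := V\<rparr>) RF"
  using res_hom by (rule ring_hom_ring.homh)

lemma res_eq_zero_iff: "z \<in> V \<Longrightarrow> res z = \<zero>\<^bsub>RF\<^esub> \<longleftrightarrow> z \<in> M"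
proof -
  assume z: "z \<in> V"
  interpret mx: maximalideal M "K\<lparr>carrier := V\<rparr>" by (rule maximal_M)
  have "\<zero>\<^bsub>RF\<^esub> = M" by (simp add: RF_def FactRing_def)
  then show ?thesis
    using mx.rcos_const_imp_mem[of z] mx.a_rcos_const[of z] z by (auto simp: coset_V)
qed

lemma res_closed [simp]: "z \<in> V \<Longrightarrow> res z \<in> carrier RF" using ring_hom_closed[OF res_in_hom, of z] by simp
lemma res_zero [simp]: "res \<zero> = \<zero>\<^bsub>RF\<^esub>" using res_eq_zero_iff[of \<zero>] by simp
lemma res_one [simp]: "res \<one> = \<one>\<^bsub>RF\<^esub>" using ring_hom_one[OF res_in_hom] by simp
lemma res_add [simp]: "a \<in> V \<Longrightarrow> b \<in> V \<Longrightarrow> res (a \<oplus> b) = res a \<oplus>\<^bsub>RF\<^esub> res b" using ring_hom_add[OF res_in_hom, of a b] by simp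
lemma res_mult [simp]: "a \<in> V \<Longrightarrow> b \<in> V \<Longrightarrow> res (a \<otimes> b) = res a \<otimes>\<^bsub>RF\<^esub> res b" using ring_hom_mult[OF res_in_hom, of a b] by simp

lemma res_pow [simp]: "a \<in> V \<Longrightarrow> res (a [^] (n::nat)) = res a [^]\<^bsub>RF\<^esub> n"
  by (induction n) auto
lemma res_nat_el [simp]: "res (nat_el K n) = nat_el RF n"
  by (induction n) auto
lemma res_minus [simp]: "a \<in> V \<Longrightarrow> res (\<ominus> a) = \<ominus>\<^bsub>RF\<^esub> res a"
proof -
  assume a: "a \<in> V"
  have "res (\<ominus> a) \<oplus>\<^bsub>RF\<^esub> res a = res (\<ominus> a \<oplus> a)" using a by simp
  also have "\<dots> = \<zero>\<^bsub>RF\<^esub>" using a by (simp add: l_neg)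
  finally show ?thesis using RF.minus_equality[of "res (\<ominus> a)" "res a"] a by simp
qed
lemma res_sumn: "(\<And>i. i < n \<Longrightarrow> f i \<in> V) \<Longrightarrow> res (sumn K f n) = sumn RF (\<lambda>i. res (f i)) n"
  by (induction n) auto
lemma res_pev: "(\<And>i. i < n \<Longrightarrow> c i \<in> V) \<Longrightarrow> z \<in> V \<Longrightarrow> res (pev K c n z) = pev RF (\<lambda>i. res (c i)) n (res z)"
  by (induction n) auto

lemma res_eq_iff: "a \<in> V \<Longrightarrow> b \<in> V \<Longrightarrow> res a = res b \<longleftrightarrow> a \<ominus> b \<in> M"
proof -
  assume ab: "a \<in> V" "b \<in> V"
  have "res (a \<ominus> b) = res a \<ominus>\<^bsub>RF\<^esub> res b" using ab by (simp add: minus_eq RF.minus_eq)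
  then show ?thesis using res_eq_zero_iff[of "a \<ominus> b"] ab by (metis RF.r_right_minus_eq V_diff res_closed)
qed

lemma res_inv: "a \<in> V \<Longrightarrow> a \<notin> M \<Longrightarrow> res (inv a) = inv\<^bsub>RF\<^esub> (res a)"
proof -
  assume a: "a \<in> V" "a \<notin> M"
  note u = unitD[OF a]
  have "a \<otimes> inv a = \<one>" using a u by simp
  then have "res a \<otimes>\<^bsub>RF\<^esub> res (inv a) = \<one>\<^bsub>RF\<^esub>" using a u by (metis res_mult res_one)
  then show ?thesis using RF.comm_inv_char[of "res a" "res (inv a)"] a u by simp
qed

lemma carrier_RF: "carrier RF = res ` V"
  unfolding RF_def FactRing_def A_RCOSETS_def' by (auto simp: coset_V)

text \<open>
  The residue field of a subfield, inside the residue field of \<open>K\<close>.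
\<close>

definition resF :: "'a set \<Rightarrow> 'a set set" where "resF F = res ` (V \<inter> F)"

lemma resF_subfield: assumes F: "subfield F K" shows "subfield (resF F) RF"
proof -
  note Fs = subringE[OF subfieldE(1)[OF F]]
  show ?thesis
  proof (rule RF.subfieldI'[OF RF.subringI])
    show "resF F \<subseteq> carrier RF" by (auto simp: resF_def)
    show "\<one>\<^bsub>RF\<^esub> \<in> resF F" unfolding resF_def using Fs(3) by (intro image_eqI[of _ _ \<one>]) auto
    show "\<ominus>\<^bsub>RF\<^esub> h \<in> resF F" if "h \<in> resF F" for h
      using that Fs(5) unfolding resF_def by (auto intro!: image_eqI[of _ _ "\<ominus> _"] simp: res_minus[symmetric] simp del: res_minus)
    show "h1 \<otimes>\<^bsub>RF\<^esub> h2 \<in> resF F" if h: "h1 \<in> resF F" "h2 \<in> resF F" for h1 h2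
    proof -
      obtain a b where "a \<in> V \<inter> F" "b \<in> V \<inter> F" "h1 = res a" "h2 = res b"
        using h by (auto simp: resF_def)
      then show ?thesis unfolding resF_def using Fs(6) by (intro image_eqI[of _ _ "a \<otimes> b"]) auto
    qed
    show "h1 \<oplus>\<^bsub>RF\<^esub> h2 \<in> resF F" if h: "h1 \<in> resF F" "h2 \<in> resF F" for h1 h2
    proof -
      obtain a b where "a \<in> V \<inter> F" "b \<in> V \<inter> F" "h1 = res a" "h2 = res b"
        using h by (auto simp: resF_def)
      then show ?thesis unfolding resF_def using Fs(7) by (intro image_eqI[of _ _ "a \<oplus> b"]) auto
    qed
    show "inv\<^bsub>RF\<^esub> h \<in> resF F" if h: "h \<in> resF F - {\<zero>\<^bsub>RF\<^esub>}" for h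
    proof -
      obtain a where a: "a \<in> V" "a \<in> F" "h = res a" using h by (auto simp: resF_def)
      then have "a \<notin> M" using h res_eq_zero_iff by auto
      note u = unitD[OF a(1) this]
      have "inv a \<in> F" using subfield_m_inv(1)[OF F, of a] a u by simp
      then show ?thesis unfolding resF_def a(3) res_inv[OF a(1) \<open>a \<notin> M\<close>, symmetric] using u by simp
    qed
  qed
qed

end

section \<open>Fields generated by one element\<close>

lemma (in domain) simple_extension_pev:
  assumes A: "subring A R" and t: "t \<in> carrier R"
  shows "f \<in> simple_extension A t \<longleftrightarrow> (\<exists>c n. (\<forall>i<n. c i \<in> A) \<and> f = pev R c n t)"
proof
  assume "f \<in> simple_extension A t"
  then obtain q where q: "q \<in> carrier (A[X])" "f = eval q t"
    unfolding simple_extension_as_eval_img[OF subringE(1)[OF A] t] by auto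
  have "set q \<subseteq> A" using q(1) polynomial_incl by (auto simp: univ_poly_carrier[symmetric])
  then have qs: "set q \<subseteq> A" "set q \<subseteq> carrier R" using subringE(1)[OF A] by auto
  have "coeff q i \<in> A" if "i < length q" for i
  proof -
    have "coeff q i \<in> set q" unfolding coeff_img_restrict[of q, symmetric] using that by simp
    then show ?thesis using qs by blast
  qed
  then show "\<exists>c n. (\<forall>i<n. c i \<in> A) \<and> f = pev R c n t"
    using eval_eq_pev[OF qs(2) t] q(2) by blast
next
  assume "\<exists>c n. (\<forall>i<n. c i \<in> A) \<and> f = pev R c n t"
  then obtain c n where c: "\<And>i. i < n \<Longrightarrow> c i \<in> A" "f = pev R c n t" by blast
  note S = subringE[OF simple_extension_is_subring[OF A t]]
  have At: "A \<subseteq> simple_extension A t" by (rule simple_extension_incl[OF subringE(1)[OF A] t])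
  have tt: "t \<in> simple_extension A t" by (rule simple_extension_mem[OF A t])
  have tp: "t [^] i \<in> simple_extension A t" for i :: nat by (induction i) (auto intro: S(3,6) tt)
  show "f \<in> simple_extension A t"
    unfolding c(2) pev_def
  proof (rule sumn_in_subgroup)
    fix i assume "i < n"
    then have "c i \<in> simple_extension A t" using c(1) At by blast
    then show "c i \<otimes> t [^] i \<in> simple_extension A t" using tp by (rule S(6))
  qed (auto intro: S(2,7))
qed

lemma (in domain) algebraic_if_pev:
  assumes "subring A R" "z \<in> carrier R" "\<forall>i<n. c i \<in> A" "\<exists>i<n. c i \<noteq> \<zero>" "pev R c n z = \<zero>"
  shows "\<not> transcendental A z"
  using assms(3-) unfolding algebraic_iff_pev[OF assms(1,2)] by blast

lemma (in field) inv_nonzero: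
  assumes "a \<in> carrier R" "a \<noteq> \<zero>"
  shows "inv a \<in> carrier R" "a \<otimes> inv a = \<one>" "inv a \<otimes> a = \<one>" "inv a \<noteq> \<zero>"
proof -
  show 1: "inv a \<in> carrier R" "a \<otimes> inv a = \<one>" "inv a \<otimes> a = \<one>" using field_Units assms by auto
  show "inv a \<noteq> \<zero>" using 1 assms by (metis r_null one_not_zero)
qed

lemma (in field) generate_field_fractions:
  assumes A: "subfield A R" and t: "t \<in> carrier R" and z: "z \<in> generate_field R (insert t A)"
  shows "\<exists>f\<in>simple_extension A t. \<exists>g\<in>simple_extension A t. g \<noteq> \<zero> \<and> z = f \<otimes> inv g"
proof -
  note As = subfieldE(1)[OF A]
  note S = subringE[OF simple_extension_is_subring[OF As t]]
  have c: "f \<in> carrier R" if "f \<in> simple_extension A t" for f using S(1) that by blast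
  have inv1: "inv \<one> = \<one>" by (rule comm_inv_char) auto
  have base: "\<exists>f\<in>simple_extension A t. \<exists>g\<in>simple_extension A t. g \<noteq> \<zero> \<and> z = f \<otimes> inv g"
    if "z \<in> simple_extension A t" for z
    using that S(3) c inv1 by (intro bexI[of _ z] bexI[of _ \<one>]) auto
  show ?thesis
    using z
  proof (induction rule: generate_field.induct)
    case one
    show ?case by (rule base[OF S(3)])
  next
    case (incl h)
    have "h \<in> simple_extension A t"
      using incl simple_extension_mem[OF As t] simple_extension_incl[OF subringE(1)[OF As] t] by auto
    then show ?case by (rule base)
  next
    case (a_inv h)
    then obtain f g where fg: "f \<in> simple_extension A t" "g \<in> simple_extension A t" "g \<noteq> \<zero>" "h = f \<otimes> inv g"
      by blast
    then have "\<ominus> h = (\<ominus> f) \<otimes> inv g" using inv_nonzero[OF c[OF fg(2)]] c by (simp add: l_minus)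
    then show ?case using fg S(5) by blast
  next
    case (m_inv h)
    then obtain f g where fg: "f \<in> simple_extension A t" "g \<in> simple_extension A t" "g \<noteq> \<zero>" "h = f \<otimes> inv g"
      by blast
    note ig = inv_nonzero[OF c[OF fg(2)] fg(3)]
    have f0: "f \<noteq> \<zero>" using m_inv fg ig by auto
    note fi = inv_nonzero[OF c[OF fg(1)] f0]
    have "(f \<otimes> u) \<otimes> (g \<otimes> w) = (f \<otimes> w) \<otimes> (u \<otimes> g)" if "u \<in> carrier R" "w \<in> carrier R" for u w
      using that c[OF fg(1)] c[OF fg(2)] by algebra
    then have "(f \<otimes> inv g) \<otimes> (g \<otimes> inv f) = \<one>" using ig fi by simp
    then have "inv h = g \<otimes> inv f"
      using ig fi c[OF fg(1)] c[OF fg(2)] fg(4) by (intro comm_inv_char) auto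
    then show ?case using fg f0 by blast
  next
    case (eng_add h1 h2)
    then obtain f g f' g' where fg: "f \<in> simple_extension A t" "g \<in> simple_extension A t" "g \<noteq> \<zero>" "h1 = f \<otimes> inv g"
      "f' \<in> simple_extension A t" "g' \<in> simple_extension A t" "g' \<noteq> \<zero>" "h2 = f' \<otimes> inv g'" by blast
    note cc = c[OF fg(1)] c[OF fg(2)] c[OF fg(5)] c[OF fg(6)]
    note ig = inv_nonzero[OF c[OF fg(2)] fg(3)] and ig' = inv_nonzero[OF c[OF fg(6)] fg(7)]
    have gg: "g \<otimes> g' \<noteq> \<zero>" using fg cc by (simp add: integral_iff)
    have i: "inv (g \<otimes> g') = inv g \<otimes> inv g'"
    proof (rule comm_inv_char)
      have "(g \<otimes> g') \<otimes> (inv g \<otimes> inv g') = (g \<otimes> inv g) \<otimes> (g' \<otimes> inv g')"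
        using cc ig(1) ig'(1) by (simp only: m_ac m_closed)
      then show "(g \<otimes> g') \<otimes> (inv g \<otimes> inv g') = \<one>" using ig ig' by simp
    qed (use cc ig ig' in auto)
    have "f \<otimes> g' \<otimes> (ug \<otimes> ug') = f \<otimes> ug" if "g' \<otimes> ug' = \<one>" "ug \<in> carrier R" "ug' \<in> carrier R" for ug ug'
    proof -
      have "f \<otimes> g' \<otimes> (ug \<otimes> ug') = f \<otimes> ug \<otimes> (g' \<otimes> ug')" using cc that(2,3) by algebra
      then show ?thesis using that cc by simp
    qed
    moreover have "f' \<otimes> g \<otimes> (ug \<otimes> ug') = f' \<otimes> ug'" if "g \<otimes> ug = \<one>" "ug \<in> carrier R" "ug' \<in> carrier R" for ug ug'
    proof -
      have "f' \<otimes> g \<otimes> (ug \<otimes> ug') = f' \<otimes> ug' \<otimes> (g \<otimes> ug)" using cc that(2,3) by algebra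
      then show ?thesis using that cc by simp
    qed
    ultimately have "h1 \<oplus> h2 = (f \<otimes> g' \<oplus> f' \<otimes> g) \<otimes> inv (g \<otimes> g')"
      unfolding i using fg cc ig ig' by (simp add: l_distr)
    then show ?case using fg gg S(6,7) by (intro bexI[of _ "f \<otimes> g' \<oplus> f' \<otimes> g"] bexI[of _ "g \<otimes> g'"]) auto
  next
    case (eng_mult h1 h2)
    then obtain f g f' g' where fg: "f \<in> simple_extension A t" "g \<in> simple_extension A t" "g \<noteq> \<zero>" "h1 = f \<otimes> inv g"
      "f' \<in> simple_extension A t" "g' \<in> simple_extension A t" "g' \<noteq> \<zero>" "h2 = f' \<otimes> inv g'" by blast
    note cc = c[OF fg(1)] c[OF fg(2)] c[OF fg(5)] c[OF fg(6)]
    note ig = inv_nonzero[OF c[OF fg(2)] fg(3)] and ig' = inv_nonzero[OF c[OF fg(6)] fg(7)]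
    have gg: "g \<otimes> g' \<noteq> \<zero>" using fg cc by (simp add: integral_iff)
    have i: "inv (g \<otimes> g') = inv g \<otimes> inv g'"
    proof (rule comm_inv_char)
      have "(g \<otimes> g') \<otimes> (inv g \<otimes> inv g') = (g \<otimes> inv g) \<otimes> (g' \<otimes> inv g')"
        using cc ig(1) ig'(1) by (simp only: m_ac m_closed)
      then show "(g \<otimes> g') \<otimes> (inv g \<otimes> inv g') = \<one>" using ig ig' by simp
    qed (use cc ig ig' in auto)
    have "h1 \<otimes> h2 = (f \<otimes> f') \<otimes> inv (g \<otimes> g')"
      unfolding i fg(4,8) using cc ig(1) ig'(1) by (simp only: m_ac m_closed)
    then show ?case using fg gg S(6) by (intro bexI[of _ "f \<otimes> f'"] bexI[of _ "g \<otimes> g'"]) auto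
  qed
qed

lemma (in field) generate_field_algebraic:
  assumes F: "subfield F R" and t: "t \<in> carrier R" "\<not> transcendental F t"
  shows "generate_field R (insert t F) = simple_extension F t"
proof -
  have alg: "(algebraic over F) t" using t by (simp add: over_def)
  have Fc: "F \<subseteq> carrier R" by (rule subfieldE(3)[OF F])
  show ?thesis
  proof
    show "generate_field R (insert t F) \<subseteq> simple_extension F t"
      using Fc t simple_extension_is_subfield[OF F t(1)] alg simple_extension_mem[OF subfieldE(1)[OF F] t(1)]
        simple_extension_incl[OF Fc t(1)] by (intro generate_field_min_subfield1) auto
    have "subring (generate_field R (insert t F)) R"
      using generate_field_is_subfield[of "insert t F"] Fc t subfieldE(1) by auto
    then show "simple_extension F t \<subseteq> generate_field R (insert t F)"
      by (rule simple_extension_subring_incl) (auto intro: generate_field.incl)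
  qed
qed

text \<open>
  In transcendence degree one a single generator is automatically transcendental; ruledness is always obtained in this way below, with
  trivial finite part.
\<close>

lemma (in field) ruled_if_generated:
  assumes F: "subfield F R" and t: "t \<in> carrier R" and gen: "carrier R \<subseteq> generate_field R (insert t F)"
    and td: "trdeg_one R F"
  shows "ruled R F"
proof -
  have Fc: "F \<subseteq> carrier R" by (rule subfieldE(3)[OF F])
  have "transcendental F t"
  proof (rule ccontr)
    assume n: "\<not> transcendental F t"
    then have alg: "(algebraic over F) t" by (simp add: over_def)
    obtain u where u: "u \<in> carrier R" "transcendental F u" using td by (auto simp: trdeg_one_def)
    have "u \<in> simple_extension F t" using u(1) gen generate_field_algebraic[OF F t n] by blast
    then show False using simple_extesion_mem_imp_algebraic[OF F t alg] u(2) by (auto simp: over_def)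
  qed
  moreover have "finite_dimension F F" by (rule finite_dimensionI[OF dimension_one[OF F]])
  moreover have "generate_field R (insert t F) = carrier R"
    using gen generate_field_incl[of "insert t F"] Fc t by blast
  ultimately show ?thesis using F t unfolding ruled_def by blast
qed

section \<open>Gauss extensions\<close>

context val_ring_field
begin

text \<open>
  The residue of \<open>t\<close> is transcendental over that of \<open>k\<close>, written with elements of \<open>K\<close> only. Apart from \<open>t\<close> the condition refers to the valuation of \<open>k\<close>
  and to congruences, which makes it easy to transport.
\<close>

definition res_transc :: "'a set \<Rightarrow> 'a \<Rightarrow> bool" where
  "res_transc k t \<longleftrightarrow> t \<in> V \<and>
    (\<forall>c n. (\<forall>i<n. c i \<in> k \<inter> V) \<and> pev K c n t \<in> M \<longrightarrow> (\<forall>i<n. c i \<in> M))"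

text \<open>
  Values at \<open>t\<close> of primitive polynomials over the valuation ring of \<open>k\<close>. This set depends on \<open>V\<close> only through \<open>k \<inter> V\<close>.
\<close>

definition Prim :: "'a set \<Rightarrow> 'a \<Rightarrow> 'a set" where
  "Prim k t = {P. \<exists>c n. (\<forall>i<n. c i \<in> k \<inter> V) \<and> (\<exists>i<n. c i \<notin> M) \<and> P = pev K c n t}"

lemma PrimI: "\<forall>i<n. c i \<in> k \<inter> V \<Longrightarrow> \<exists>i<n. c i \<notin> M \<Longrightarrow> pev K c n t \<in> Prim k t"
  unfolding Prim_def by blast

lemma res_transc_V: "res_transc k t \<Longrightarrow> t \<in> V" by (simp add: res_transc_def)

lemma res_transc_iff:
  assumes k: "subfield k K" and t: "t \<in> V"
  shows "res_transc k t \<longleftrightarrow> RF.transcendental (resF k) (res t)"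
proof
  assume T: "res_transc k t"
  show "RF.transcendental (resF k) (res t)"
  proof (rule ccontr)
    assume "\<not> RF.transcendental (resF k) (res t)"
    then obtain c n j where c: "\<And>i. i < n \<Longrightarrow> c i \<in> resF k" "j < n" "c j \<noteq> \<zero>\<^bsub>RF\<^esub>"
      "pev RF c n (res t) = \<zero>\<^bsub>RF\<^esub>"
      using RF.algebraic_iff_pev[OF subfieldE(1)[OF resF_subfield[OF k]] res_closed[OF t]] by blast
    have "\<forall>i. \<exists>d. i < n \<longrightarrow> d \<in> V \<inter> k \<and> c i = res d" using c(1) by (auto simp: resF_def)
    then obtain d where d: "\<And>i. i < n \<Longrightarrow> d i \<in> V \<and> d i \<in> k \<and> c i = res (d i)"
      by (metis Int_iff)
    have "res (pev K d n t) = pev RF (\<lambda>i. res (d i)) n (res t)" using d t by (intro res_pev) auto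
    also have "\<dots> = pev RF c n (res t)" using d by (intro pev_cong) auto
    finally have "pev K d n t \<in> M" using c(4) res_eq_zero_iff[of "pev K d n t"] d t by auto
    then have "d j \<in> M" using T d c(2) unfolding res_transc_def by (metis Int_iff)
    then show False using c(2,3) d[OF c(2)] res_eq_zero_iff by auto
  qed
next
  assume T: "RF.transcendental (resF k) (res t)"
  show "res_transc k t"
    unfolding res_transc_def
  proof (intro conjI t allI impI, elim conjE)
    fix c n i assume c: "\<forall>i<n. c i \<in> k \<inter> V" "pev K c n t \<in> M" and i: "i < (n::nat)"
    show "c i \<in> M"
    proof (rule ccontr)
      assume ci: "c i \<notin> M"
      have "pev RF (\<lambda>i. res (c i)) n (res t) = res (pev K c n t)"
        using c(1) t by (intro res_pev[symmetric]) auto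
      also have "\<dots> = \<zero>\<^bsub>RF\<^esub>" using res_eq_zero_iff[of "pev K c n t"] c(2) by simp
      finally have "pev RF (\<lambda>i. res (c i)) n (res t) = \<zero>\<^bsub>RF\<^esub>" .
      moreover have "\<forall>i<n. res (c i) \<in> resF k" using c(1) by (auto simp: resF_def)
      moreover have "res (c i) \<noteq> \<zero>\<^bsub>RF\<^esub>" using ci c(1) i res_eq_zero_iff[of "c i"] by auto
      then have "\<exists>i<n. res (c i) \<noteq> \<zero>\<^bsub>RF\<^esub>" using i by blast
      ultimately have "\<not> RF.transcendental (resF k) (res t)"
        by (intro RF.algebraic_if_pev[OF subfieldE(1)[OF resF_subfield[OF k]] res_closed[OF t]])
      then show False using T by simp
    qed
  qed
qed

lemma Prim_unit: "res_transc k t \<Longrightarrow> P \<in> Prim k t \<Longrightarrow> P \<in> V \<and> P \<notin> M"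
proof -
  assume T: "res_transc k t" and P: "P \<in> Prim k t"
  obtain c n where c: "\<forall>i<n. c i \<in> k \<inter> V" "\<exists>i<n. c i \<notin> M" "P = pev K c n t"
    using P unfolding Prim_def by blast
  have "P \<in> V" unfolding c(3) using c(1) res_transc_V[OF T] by (intro pev_V) auto
  moreover have "P \<notin> M" using T c unfolding res_transc_def by blast
  ultimately show ?thesis by blast
qed

lemma pev_Prim:
  assumes k: "subfield k K" and t: "t \<in> carrier K"
    and c: "\<And>i. i < n \<Longrightarrow> c i \<in> k" and j: "j < n" "c j \<noteq> \<zero>"
  shows "\<exists>e\<in>k. e \<noteq> \<zero> \<and> (\<exists>P\<in>Prim k t. pev K c n t = e \<otimes> P)"
proof -
  have kc: "a \<in> carrier K" if "a \<in> k" for a using subfieldE(3)[OF k] that by blast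
  have "\<exists>i<n. c i \<noteq> \<zero> \<and> (\<forall>l<n. c l \<otimes> inv (c i) \<in> V)"
    using c kc j by (intro least_value) auto
  then obtain i where i: "i < n" "c i \<noteq> \<zero>" "\<forall>l<n. c l \<otimes> inv (c i) \<in> V" by blast
  have ik: "inv (c i) \<in> k" using subfield_m_inv(1)[OF k, of "c i"] c i by simp
  have cc: "c i \<in> carrier K" "inv (c i) \<in> carrier K" using kc c i ik by auto
  define d where "d l = c l \<otimes> inv (c i)" for l
  have dk: "\<forall>l<n. d l \<in> k \<inter> V" using i c ik subringE(6)[OF subfieldE(1)[OF k]] by (auto simp: d_def)
  have "d i = \<one>" using i cc by (simp add: d_def)
  then have "\<exists>l<n. d l \<notin> M" using i(1) one_not_M by metis
  then have "pev K d n t \<in> Prim k t" using dk by (intro PrimI)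
  moreover have "pev K c n t = c i \<otimes> pev K d n t"
  proof -
    have dc: "d l \<in> carrier K" if "l < n" for l using dk kc that by blast
    have "c i \<otimes> pev K d n t = pev K (\<lambda>l. c i \<otimes> d l) n t"
      using dc cc t by (intro pev_smult[symmetric]) auto
    also have "\<dots> = pev K c n t"
      using c kc cc i(2) by (intro pev_cong) (simp add: d_def m_lcomm)
    finally show ?thesis by simp
  qed
  ultimately show ?thesis using i c by blast
qed

lemma gauss_form:
  assumes k: "subfield k K" and T: "res_transc k t"
    and z: "z \<in> generate_field K (insert t k)" "z \<noteq> \<zero>"
  shows "\<exists>e\<in>k. e \<noteq> \<zero> \<and> (\<exists>P\<in>Prim k t. \<exists>Q\<in>Prim k t. z = e \<otimes> (P \<otimes> inv Q))"
proof -
  have t: "t \<in> carrier K" using res_transc_V[OF T] by simp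
  have ks: "subring k K" by (rule subfieldE(1)[OF k])
  have kc: "a \<in> carrier K" if "a \<in> k" for a using subfieldE(3)[OF k] that by blast
  obtain f g where fg: "f \<in> simple_extension k t" "g \<in> simple_extension k t" "g \<noteq> \<zero>" "z = f \<otimes> inv g"
    using generate_field_fractions[OF k t z(1)] by blast
  have gc: "g \<in> carrier K" using fg(2) simple_extension_in_carrier[OF subfieldE(3)[OF k] t] by blast
  have f0: "f \<noteq> \<zero>" using fg(4) z(2) gc fg(3) by auto
  have form: "\<exists>e\<in>k. e \<noteq> \<zero> \<and> (\<exists>P\<in>Prim k t. f = e \<otimes> P)" if f: "f \<in> simple_extension k t" "f \<noteq> \<zero>" for f
  proof -
    obtain c n where c: "\<forall>i<n. c i \<in> k" "f = pev K c n t"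
      using f(1) unfolding simple_extension_pev[OF ks t] by blast
    have "\<exists>j<n. c j \<noteq> \<zero>"
    proof (rule ccontr)
      assume "\<not> (\<exists>j<n. c j \<noteq> \<zero>)"
      then have "pev K c n t = \<zero>" unfolding pev_def using t by (intro sumn_zero) auto
      then show False using c(2) f(2) by simp
    qed
    then obtain j where "j < n" "c j \<noteq> \<zero>" by blast
    then show ?thesis unfolding c(2) using pev_Prim[OF k t, of n c j] c(1) by simp
  qed
  obtain e P where e: "e \<in> k" "e \<noteq> \<zero>" "P \<in> Prim k t" "f = e \<otimes> P" using form[OF fg(1) f0] by blast
  obtain e' Q where e': "e' \<in> k" "e' \<noteq> \<zero>" "Q \<in> Prim k t" "g = e' \<otimes> Q" using form[OF fg(2,3)] by blast
  have Pc: "P \<in> carrier K" and Qc: "Q \<in> carrier K" "Q \<noteq> \<zero>"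
    using Prim_unit[OF T e(3)] Prim_unit[OF T e'(3)] by auto
  have "inv e' \<in> k" "inv e' \<noteq> \<zero>" using subfield_m_inv(1)[OF k, of e'] e' by auto
  moreover have "z = (e \<otimes> inv e') \<otimes> (P \<otimes> inv Q)"
  proof -
    have "z = (e \<otimes> P) \<otimes> (inv e' \<otimes> inv Q)" using fg(4) e(4) e'(4) inv_mult[OF kc[OF e'(1)] e'(2) Qc] by simp
    also have "\<dots> = (e \<otimes> inv e') \<otimes> (P \<otimes> inv Q)"
      using kc[OF e(1)] kc[OF \<open>inv e' \<in> k\<close>] Pc inv_closed'[OF Qc] by algebra
    finally show ?thesis .
  qed
  moreover have "e \<otimes> inv e' \<in> k" using subringE(6)[OF ks] e(1) \<open>inv e' \<in> k\<close> by blast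
  moreover have "e \<otimes> inv e' \<noteq> \<zero>" using e e' kc calculation by (auto simp: integral_iff)
  ultimately show ?thesis using e(3) e'(3) by blast
qed

lemma unit_quot: assumes "P \<in> V" "P \<notin> M" "Q \<in> V" "Q \<notin> M" shows "P \<otimes> inv Q \<in> V" "P \<otimes> inv Q \<notin> M"
  using unitD[OF assms(3,4)] assms unit_mult[of P "inv Q"] by auto

lemma mult_unit_cancel:
  assumes "e \<in> carrier K" "u \<in> V" "u \<notin> M"
  shows "e \<otimes> u \<in> V \<longleftrightarrow> e \<in> V" "e \<otimes> u \<in> M \<longleftrightarrow> e \<in> M"
proof -
  note i = unitD[OF assms(2,3)]
  have e: "e = (e \<otimes> u) \<otimes> inv u" using assms i by (simp add: m_assoc)
  show "e \<otimes> u \<in> V \<longleftrightarrow> e \<in> V" using e i assms by (metis V_mult)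
  show "e \<otimes> u \<in> M \<longleftrightarrow> e \<in> M" using e i assms by (metis M_mult_r)
qed

text \<open>
  Primitive polynomials have unit value at \<open>t\<close>, and every rational function in \<open>t\<close> is an element of \<open>k\<close> times a quotient of two primitive ones. So
  integrality is decided by the factor in \<open>k\<close>, and the valuation on \<open>k(t)\<close> is determined by its restriction to \<open>k\<close>.
\<close>

lemma gauss_V:
  assumes k: "subfield k K" and T: "res_transc k t"
  shows "V \<inter> generate_field K (insert t k) =
    {e \<otimes> (P \<otimes> inv Q) | e P Q. e \<in> k \<inter> V \<and> P \<in> Prim k t \<and> Q \<in> Prim k t}" (is "_ = ?R")
proof
  have t: "t \<in> carrier K" using res_transc_V[OF T] by simp
  have ks: "subring k K" by (rule subfieldE(1)[OF k])
  have kc: "a \<in> carrier K" if "a \<in> k" for a using subfieldE(3)[OF k] that by blast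
  have one: "\<one> \<in> Prim k t"
  proof -
    have "pev K (\<lambda>_. \<one>) (Suc 0) t = \<one>" using t by simp
    moreover have "\<forall>i<Suc 0. \<one> \<in> k \<inter> V" "\<exists>i<Suc 0. \<one> \<notin> M" using subringE(3)[OF ks] by auto
    ultimately have "pev K (\<lambda>_. \<one>) (Suc 0) t \<in> Prim k t" by (intro PrimI)
    then show ?thesis using t by simp
  qed
  have R: "e \<otimes> (P \<otimes> inv Q) \<in> ?R" if "e \<in> k \<inter> V" "P \<in> Prim k t" "Q \<in> Prim k t" for e P Q
    using that by blast
  show "V \<inter> generate_field K (insert t k) \<subseteq> ?R"
  proof
    fix z assume z: "z \<in> V \<inter> generate_field K (insert t k)"
    show "z \<in> ?R"
    proof (cases "z = \<zero>")
      case True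
      then have "z = \<zero> \<otimes> (\<one> \<otimes> inv \<one>)" by simp
      then show ?thesis using R[of \<zero> \<one> \<one>] one subringE(2)[OF ks] by simp
    next
      case False
      then obtain e P Q where e: "e \<in> k" "e \<noteq> \<zero>" "P \<in> Prim k t" "Q \<in> Prim k t" "z = e \<otimes> (P \<otimes> inv Q)"
        using gauss_form[OF k T] z by blast
      have "e \<in> V" using z e(5) mult_unit_cancel(1)[OF kc[OF e(1)] unit_quot] Prim_unit[OF T] e(3,4) by auto
      then show ?thesis unfolding e(5) using e(1,3,4) by (intro R) auto
    qed
  qed
  show "?R \<subseteq> V \<inter> generate_field K (insert t k)"
  proof
    fix z assume "z \<in> ?R"
    then obtain e P Q where e: "e \<in> k" "e \<in> V" "P \<in> Prim k t" "Q \<in> Prim k t" "z = e \<otimes> (P \<otimes> inv Q)" by blast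
    note u = Prim_unit[OF T e(3)] Prim_unit[OF T e(4)]
    have zV: "z \<in> V" unfolding e(5) using e(2) unit_quot u by auto
    have sub: "P \<in> generate_field K (insert t k)" if "P \<in> Prim k t" for P
    proof -
      have "P \<in> simple_extension k t"
        using that unfolding Prim_def simple_extension_pev[OF ks t] by blast
      moreover have "simple_extension k t \<subseteq> generate_field K (insert t k)"
        using generate_field_is_subfield[of "insert t k"] kc t subfieldE(1)
        by (intro simple_extension_subring_incl) (auto intro: generate_field.incl)
      ultimately show ?thesis by blast
    qed
    have "z \<in> generate_field K (insert t k)"
      unfolding e(5) using e(1) sub[OF e(3)] sub[OF e(4)] u unitD
      by (intro generate_field.eng_mult generate_field.m_inv) (auto intro: generate_field.incl)
    then show "z \<in> V \<inter> generate_field K (insert t k)" using zV by blast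
  qed
qed

lemma resF_gauss:
  assumes k: "subfield k K" and T: "res_transc k t"
  shows "resF (generate_field K (insert t k)) \<subseteq> generate_field RF (insert (res t) (resF k))"
proof
  let ?G = "generate_field RF (insert (res t) (resF k))"
  have tV: "t \<in> V" by (rule res_transc_V[OF T])
  have kc: "resF k \<subseteq> carrier RF" by (rule subfieldE(3)[OF resF_subfield[OF k]])
  have G: "subfield ?G RF" using RF.generate_field_is_subfield[of "insert (res t) (resF k)"] kc tV by auto
  note Gs = subringE[OF subfieldE(1)[OF G]]
  have tp: "res t [^]\<^bsub>RF\<^esub> i \<in> ?G" for i :: nat
    by (induction i) (auto intro: generate_field.intros)
  have P: "res P \<in> ?G" if P: "P \<in> Prim k t" for P
  proof -
    obtain c n where c: "\<forall>i<n. c i \<in> k \<inter> V" "P = pev K c n t" using P unfolding Prim_def by blast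
    have "res P = pev RF (\<lambda>i. res (c i)) n (res t)" unfolding c(2) using c(1) tV by (intro res_pev) auto
    also have "\<dots> \<in> ?G" unfolding pev_def
    proof (rule sumn_in_subgroup)
      fix i assume "i < n"
      then have "res (c i) \<in> ?G" using c(1) by (auto intro!: generate_field.incl simp: resF_def)
      then show "res (c i) \<otimes>\<^bsub>RF\<^esub> res t [^]\<^bsub>RF\<^esub> i \<in> ?G" using tp by (rule generate_field.eng_mult)
    qed (auto intro: Gs(2,7))
    finally show ?thesis .
  qed
  fix h assume "h \<in> resF (generate_field K (insert t k))"
  then obtain z where z: "z \<in> V \<inter> generate_field K (insert t k)" "h = res z" by (auto simp: resF_def)
  then obtain e P Q where e: "e \<in> k" "e \<in> V" "P \<in> Prim k t" "Q \<in> Prim k t" "z = e \<otimes> (P \<otimes> inv Q)"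
    unfolding gauss_V[OF k T] by blast
  note u = Prim_unit[OF T e(3)] and u' = Prim_unit[OF T e(4)]
  have "res z = res e \<otimes>\<^bsub>RF\<^esub> (res P \<otimes>\<^bsub>RF\<^esub> inv\<^bsub>RF\<^esub> res Q)"
    unfolding e(5) using e(2) u u' unitD[of Q] by (simp add: res_inv)
  moreover have "res e \<in> ?G" using e(1,2) by (auto intro!: generate_field.incl simp: resF_def)
  moreover have "res Q \<noteq> \<zero>\<^bsub>RF\<^esub>" using u' res_eq_zero_iff by blast
  ultimately show "h \<in> ?G" using z(2) P[OF e(3)] P[OF e(4)] by (simp add: generate_field.intros)
qed

end

section \<open>Kummer extensions of valued fields\<close>

locale kummer_val = val_ring_field K V + kummer K k0 s \<zeta> p
  for K (structure) and V k0 s \<zeta> p +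
  assumes sV: "s \<in> V" and sM: "s \<notin> M" and pM: "nat_el K p \<notin> M"
    and gen: "carrier K = simple_extension k0 s"
begin

lemma zV: "\<zeta> \<in> V"
  using V_if_pow[OF zc, of p] zp p_pos by simp

lemma zM: "\<zeta> \<notin> M"
  using M_pow[of \<zeta> p] zp p_pos by auto

lemma res_zeta: "res \<zeta> \<noteq> \<one>\<^bsub>RF\<^esub>"
proof
  assume e: "res \<zeta> = \<one>\<^bsub>RF\<^esub>"
  have "res (sumn K (\<lambda>j. \<zeta> [^] j) p) = sumn RF (\<lambda>j. res (\<zeta> [^] j)) p"
    using zV by (intro res_sumn) auto
  also have "\<dots> = sumn RF (\<lambda>_. \<one>\<^bsub>RF\<^esub>) p" using e zV by (intro sumn_cong) simp
  also have "\<dots> = res (nat_el K p)" by (simp add: RF.sumn_const)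
  finally have "res (nat_el K p) = \<zero>\<^bsub>RF\<^esub>" using geometric_zero[OF zc zp z1] by simp
  then show False using pM res_eq_zero_iff[of "nat_el K p"] V_nat_el by blast
qed

text \<open>
  As \<open>p\<close> is a unit of \<open>V\<close>, the root of unity stays nontrivial modulo \<open>M\<close>, and the results on Kummer extensions apply to the residue fields.
\<close>

lemma kummer_RF: "kummer RF (resF k0) (res s) (res \<zeta>) p"
proof (intro kummer.intro kummer_axioms.intro)
  show "field RF" by (rule field_RF)
  show "subfield (resF k0) RF" by (rule resF_subfield[OF subF])
  show "res s \<in> carrier RF" using sV by simp
  show "Factorial_Ring.prime p" by (rule p)
  have "res (s [^] p) \<in> resF k0" using sV sp by (auto simp: resF_def simp del: res_pow)
  then show "res s [^]\<^bsub>RF\<^esub> p \<in> resF k0" using sV by simp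
  show "res \<zeta> \<in> resF k0" using zV z by (auto simp: resF_def)
  show "res \<zeta> [^]\<^bsub>RF\<^esub> p = \<one>\<^bsub>RF\<^esub>" using zp res_pow[OF zV, of p] by simp
  show "res \<zeta> \<noteq> \<one>\<^bsub>RF\<^esub>" by (rule res_zeta)
  show "nat_el RF p \<noteq> \<zero>\<^bsub>RF\<^esub>" using pM res_eq_zero_iff[of "nat_el K p"] by simp
qed

lemma zeta_diff:
  assumes "i < j" "j < p" shows "\<zeta> [^] j \<ominus> \<zeta> [^] i \<notin> M"
proof
  interpret RFk: kummer RF "resF k0" "res s" "res \<zeta>" p by (rule kummer_RF)
  assume "\<zeta> [^] j \<ominus> \<zeta> [^] i \<in> M"
  then have "res (\<zeta> [^] j) = res (\<zeta> [^] i)"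
    by (intro res_eq_iff[THEN iffD2] V_pow zV)
  then have "res \<zeta> [^]\<^bsub>RF\<^esub> (i + (j - i)) = res \<zeta> [^]\<^bsub>RF\<^esub> i" using zV assms by simp
  then have "res \<zeta> [^]\<^bsub>RF\<^esub> i \<otimes>\<^bsub>RF\<^esub> res \<zeta> [^]\<^bsub>RF\<^esub> (j - i) = res \<zeta> [^]\<^bsub>RF\<^esub> i \<otimes>\<^bsub>RF\<^esub> \<one>\<^bsub>RF\<^esub>"
    using zV by (simp add: RF.nat_pow_mult)
  moreover have "res \<zeta> [^]\<^bsub>RF\<^esub> i \<noteq> \<zero>\<^bsub>RF\<^esub>"
    using RF.pow_nonzero[of "res \<zeta>" i] zV zM res_eq_zero_iff by simp
  ultimately have "res \<zeta> [^]\<^bsub>RF\<^esub> (j - i) = \<one>\<^bsub>RF\<^esub>"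
    using RF.m_lcancel zV by (metis RF.nat_pow_closed RF.one_closed res_closed)
  then have "p dvd j - i" using RFk.zpow_eq_one_iff by simp
  then show False using assms by (auto dest: dvd_imp_le)
qed

lemma ex_conjs: "z \<in> carrier K \<Longrightarrow> \<exists>P\<in>conjs. P 0 = z"
  unfolding gen
proof (induction rule: simple_extension.induct)
  case zero
  show ?case using conjs_const[OF F_sub(2)] by (rule bexI[rotated]) simp
next
  case (lin k1 k2)
  then obtain P where P: "P \<in> conjs" "P 0 = k1" by blast
  have "(\<lambda>j. (\<zeta> [^] j \<otimes> s) \<otimes> P j \<oplus> k2) \<in> conjs"
    by (rule conjs_add[OF conjs_S[OF P(1)] conjs_const[OF lin(2)]])
  then show ?case
    by (rule bexI[rotated]) (use P s conjs_closed[OF P(1), of 0] in \<open>simp add: m_comm\<close>)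
qed

lemma ex_coeffs: "z \<in> carrier K \<Longrightarrow> \<exists>c. (\<forall>i<p. c i \<in> k0) \<and> z = pev K c p s"
proof -
  assume "z \<in> carrier K"
  then obtain P where P: "P \<in> conjs" "P 0 = z" using ex_conjs by blast
  then obtain c where c: "\<forall>i<p. c i \<in> k0" "P = (\<lambda>j. pev K c p (\<zeta> [^] j \<otimes> s))"
    unfolding conjs_def by blast
  have "z = pev K c p s" using P(2) c(2) s by auto
  then show ?thesis using c(1) by blast
qed

text \<open>
  If all conjugates of \<open>w\<close> avoid one residue \<open>\<theta>\<close>, then all conjugates of \<open>1 / (w - \<theta>)\<close> are integral, and by Fourier inversion so are its
  coefficients with respect to \<open>s\<close>. Among the \<open>p + 1\<close> pairwise incongruent elements 0, 1, \<open>\<zeta>\<close>, \<dots> of \<open>k0\<close> one is avoided by the \<open>p\<close> conjugates.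
  Only \<open>w\<close> itself is known to be integral; its conjugates may have poles.
\<close>

lemma residue_decomposition:
  assumes zV': "w \<in> V"
  shows "\<exists>\<theta> h. (\<theta> = \<zero> \<or> (\<exists>i::nat. \<theta> = \<zeta> [^] i)) \<and> (\<forall>i<p. h i \<in> k0 \<inter> V) \<and>
    pev K h p s \<notin> M \<and> w = \<theta> \<oplus> inv (pev K h p s)"
proof -
  obtain P where P: "P \<in> conjs" "P 0 = w" using ex_conjs[of w] zV' by auto
  have Pc: "P j \<in> carrier K" for j by (rule conjs_closed[OF P(1)])
  \<comment> \<open>The \<open>p + 1\<close> candidates are 0 and the \<open>p\<close> powers of \<open>\<zeta>\<close>.\<close>
  define \<theta> where "\<theta> m = (if m = 0 then \<zero> else \<zeta> [^] (m - 1))" for m :: nat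
  have tV: "\<theta> m \<in> V" and tk: "\<theta> m \<in> k0" for m
    using zV z F_pow F_sub(2) by (auto simp: \<theta>_def)
  have td: "\<theta> m' \<ominus> \<theta> m \<notin> M" if "m < m'" "m' \<le> p" for m m'
  proof (cases "m = 0")
    case True
    then show ?thesis using that unit_pow[OF zV zM, of "m' - 1"] zV by (simp add: \<theta>_def minus_eq)
  next
    case False
    then show ?thesis using that zeta_diff[of "m - 1" "m' - 1"] by (simp add: \<theta>_def)
  qed
  have "\<exists>m\<le>p. \<forall>j<p. P j \<ominus> \<theta> m \<notin> M"
  proof (rule ccontr)
    assume no: "\<not> (\<exists>m\<le>p. \<forall>j<p. P j \<ominus> \<theta> m \<notin> M)"
    \<comment> \<open>Otherwise each candidate is congruent to a conjugate, and the pigeonhole principle is violated.\<close>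
    define f where "f m = (SOME j. j < p \<and> P j \<ominus> \<theta> m \<in> M)" for m
    have f: "f m < p \<and> P (f m) \<ominus> \<theta> m \<in> M" if "m \<le> p" for m
    proof -
      have "\<exists>j. j < p \<and> P j \<ominus> \<theta> m \<in> M" using no that by blast
      then show ?thesis unfolding f_def by (rule someI_ex)
    qed
    have ne: "f m \<noteq> f m'" if "m < m'" "m' \<le> p" for m m'
    proof
      assume e: "f m = f m'"
      have m: "m \<le> p" using that by simp
      have a: "P (f m) \<ominus> \<theta> m \<in> M" using f[OF m] by blast
      have b: "P (f m) \<ominus> \<theta> m' \<in> M" using f[OF that(2)] e by simp
      have "(P (f m) \<ominus> \<theta> m) \<ominus> (P (f m) \<ominus> \<theta> m') \<in> M" by (rule M_diff[OF a b])
      moreover have "(a \<ominus> b) \<ominus> (a \<ominus> b') = b' \<ominus> b"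
        if "a \<in> carrier K" "b \<in> carrier K" "b' \<in> carrier K" for a b b' using that by algebra
      ultimately show False using td[OF that] Pc tV V_closed by simp
    qed
    have "inj_on f {..p}"
      using ne by (intro linorder_inj_onI) auto
    moreover have "f ` {..p} \<subseteq> {..<p}" using f by auto
    ultimately have "card {..p} \<le> card {..<p}" by (intro card_inj_on_le) auto
    then show False by simp
  qed
  then obtain m where m: "m \<le> p" "\<And>j. j < p \<Longrightarrow> P j \<ominus> \<theta> m \<notin> M" by blast
  define Q where "Q = (\<lambda>j. P j \<oplus> \<ominus> \<theta> m)"
  have Qc: "Q \<in> conjs" unfolding Q_def by (rule conjs_add[OF P(1) conjs_const[OF F_sub(5)[OF tk]]])
  have QM: "Q j \<notin> M" if "j < p" for j using m(2)[OF that] by (simp add: Q_def minus_eq)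
  have Qcl: "Q j \<in> carrier K" for j by (rule conjs_closed[OF Qc])
  have Q0: "Q j \<noteq> \<zero>" if "j < p" for j using QM[OF that] by auto
  have Qi: "inv (Q j) \<in> V" if "j < p" for j
    using QM[OF that] not_V_inv[OF Qcl, of j] unitD[of "Q j"] M_V by blast
  have "(\<lambda>j. inv (Q j)) \<in> conjs" by (rule conjs_inverse[OF Qc Q0])
  then obtain h where h: "\<forall>i<p. h i \<in> k0" "(\<lambda>j. inv (Q j)) = (\<lambda>j. pev K h p (\<zeta> [^] j \<otimes> s))"
    unfolding conjs_def by blast
  have hj: "inv (Q j) = pev K h p (\<zeta> [^] j \<otimes> s)" for j using fun_cong[OF h(2), of j] .
  have hV: "h l \<in> V" if l: "l < p" for l
  proof -
    have hc: "h l \<in> carrier K" using h(1) l F_closed by blast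
    have "[p] \<cdot> (h l \<otimes> s [^] l) =
      sumn K (\<lambda>j. \<zeta> [^] ((p - l) * j) \<otimes> pev K h p (\<zeta> [^] j \<otimes> s)) p"
      using h(1) l by (intro fourier) auto
    also have "\<dots> \<in> V"
      using Qi zV by (intro sumn_V V_mult V_pow) (auto simp: hj[symmetric])
    finally have "[p] \<cdot> (h l \<otimes> s [^] l) \<in> V" .
    moreover have "[p] \<cdot> (h l \<otimes> s [^] l) = nat_el K p \<otimes> (h l \<otimes> s [^] l)"
      using hc s by (intro add_pow_eq_nat_el) auto
    moreover have "nat_el K p \<otimes> (h l \<otimes> s [^] l) = h l \<otimes> (nat_el K p \<otimes> s [^] l)"
      using hc s by (intro m_lcomm) auto
    ultimately have "h l \<otimes> (nat_el K p \<otimes> s [^] l) \<in> V" by simp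
    moreover have "nat_el K p \<otimes> s [^] l \<in> V" "nat_el K p \<otimes> s [^] l \<notin> M"
      using unit_mult[of "nat_el K p" "s [^] l"] unit_pow[OF sV sM, of l] pM sV by auto
    ultimately show ?thesis using mult_unit_cancel(1)[OF hc] by blast
  qed
  have Q0w: "Q 0 = w \<ominus> \<theta> m" using P(2) by (simp add: Q_def minus_eq)
  have y: "pev K h p s = inv (w \<ominus> \<theta> m)" using hj[of 0] s Q0w by simp
  have wt: "w \<ominus> \<theta> m \<in> V" "w \<ominus> \<theta> m \<notin> M" using zV' tV QM[of 0] Q0w p_pos by auto
  have "w = \<theta> m \<oplus> (w \<ominus> \<theta> m)" using zV' tV[of m] V_closed by algebra
  then have "w = \<theta> m \<oplus> inv (pev K h p s)" unfolding y using wt unitD[OF wt] by simp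
  moreover have "pev K h p s \<notin> M" unfolding y using unitD[OF wt] by simp
  moreover have "\<theta> m = \<zero> \<or> (\<exists>i::nat. \<theta> m = \<zeta> [^] i)" by (auto simp: \<theta>_def)
  moreover have "\<forall>i<p. h i \<in> k0 \<inter> V" using h(1) hV by blast
  ultimately show ?thesis by (intro exI[of _ "\<theta> m"] exI[of _ h] conjI)
qed

text \<open>
  The coefficients of an integral element with respect to \<open>s\<close> need not be integral; those in its decomposition are.
\<close>

lemma carrier_RF_generated: "carrier RF \<subseteq> generate_field RF (insert (res s) (resF k0))"
proof
  let ?G = "generate_field RF (insert (res s) (resF k0))"
  have kc: "resF k0 \<subseteq> carrier RF" by (rule subfieldE(3)[OF resF_subfield[OF subF]])
  have G: "subfield ?G RF" using RF.generate_field_is_subfield[of "insert (res s) (resF k0)"] kc sV by auto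
  note Gs = subringE[OF subfieldE(1)[OF G]]
  fix r assume "r \<in> carrier RF"
  then obtain w where w: "w \<in> V" "r = res w" unfolding carrier_RF by blast
  obtain \<theta> h where d: "\<theta> = \<zero> \<or> (\<exists>i::nat. \<theta> = \<zeta> [^] i)" "\<forall>i<p. h i \<in> k0 \<inter> V"
    "pev K h p s \<notin> M" "w = \<theta> \<oplus> inv (pev K h p s)"
    using residue_decomposition[OF w(1)] by blast
  have tV: "\<theta> \<in> V" and tk: "\<theta> \<in> k0" using d(1) zV z F_pow F_sub(2) by auto
  have yV: "pev K h p s \<in> V" using d(2) sV by (intro pev_V) auto
  have sp': "res s [^]\<^bsub>RF\<^esub> i \<in> ?G" for i :: nat by (induction i) (auto intro: generate_field.intros)
  have "res (pev K h p s) = pev RF (\<lambda>i. res (h i)) p (res s)" using d(2) sV by (intro res_pev) auto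
  also have "\<dots> \<in> ?G" unfolding pev_def
  proof (rule sumn_in_subgroup)
    fix i assume "i < p"
    then have "res (h i) \<in> ?G" using d(2) by (auto intro!: generate_field.incl simp: resF_def)
    then show "res (h i) \<otimes>\<^bsub>RF\<^esub> res s [^]\<^bsub>RF\<^esub> i \<in> ?G" using sp' by (rule generate_field.eng_mult)
  qed (auto intro: Gs(2,7))
  finally have yG: "res (pev K h p s) \<in> ?G" .
  have y0: "res (pev K h p s) \<noteq> \<zero>\<^bsub>RF\<^esub>" using d(3) yV res_eq_zero_iff by blast
  have "res w = res \<theta> \<oplus>\<^bsub>RF\<^esub> inv\<^bsub>RF\<^esub> (res (pev K h p s))"
    using d(4) tV yV unitD[OF yV d(3)] res_inv[OF yV d(3)] by simp
  moreover have "res \<theta> \<in> ?G" using tV tk by (auto intro!: generate_field.incl simp: resF_def)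
  ultimately show "r \<in> ?G" using w(2) yG y0 by (simp add: generate_field.intros)
qed

text \<open>
  If the residual equation is irreducible, then the powers of \<open>s\<close> form a valuation basis: dividing an integral element with a nonintegral
  coefficient by the coefficient of least value would give a nontrivial relation for the residue of \<open>s\<close> of degree less than \<open>p\<close>.
\<close>

lemma val_ring_eq:
  assumes irr: "res s \<notin> resF k0"
  shows "V = {w. \<exists>a. (\<forall>i<p. a i \<in> k0 \<inter> V) \<and> w = pev K a p s}"
proof
  show "{w. \<exists>a. (\<forall>i<p. a i \<in> k0 \<inter> V) \<and> w = pev K a p s} \<subseteq> V" using sV by (auto intro!: pev_V)
  show "V \<subseteq> {w. \<exists>a. (\<forall>i<p. a i \<in> k0 \<inter> V) \<and> w = pev K a p s}"
  proof
    fix w assume w: "w \<in> V"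
    obtain c where c: "\<forall>i<p. c i \<in> k0" "w = pev K c p s" using ex_coeffs[of w] w by auto
    have cc: "c i \<in> carrier K" if "i < p" for i using c(1) that F_closed by blast
    have "\<forall>i<p. c i \<in> V"
    proof (cases "\<exists>j<p. c j \<noteq> \<zero>")
      case False
      then show ?thesis by auto
    next
      case True
      then obtain j where j: "j < p" "c j \<noteq> \<zero>" by blast
      have "\<exists>i<p. c i \<noteq> \<zero> \<and> (\<forall>l<p. c l \<otimes> inv (c i) \<in> V)" using cc j by (rule least_value)
      then obtain i where i: "i < p" "c i \<noteq> \<zero>" "\<forall>l<p. c l \<otimes> inv (c i) \<in> V" by blast
      have ci: "c i \<in> carrier K" "inv (c i) \<in> carrier K" using cc[OF i(1)] i(2) by auto
      show ?thesis
      proof (cases "c i \<in> V")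
        case True
        have "c l \<in> V" if "l < p" for l
        proof -
          have "c l = (c l \<otimes> inv (c i)) \<otimes> c i" using cc[OF that] ci i(2) by (simp add: div_cancel)
          then show ?thesis using i(3) that True V_mult by metis
        qed
        then show ?thesis by blast
      next
        case False
        interpret RFk: kummer RF "resF k0" "res s" "res \<zeta>" p by (rule kummer_RF)
        define d where "d l = inv (c i) \<otimes> c l" for l
        have d: "d l \<in> k0 \<inter> V" if "l < p" for l
          using i(3) that cc ci c(1) F_inv[of "c i"] i(1,2) F_sub(6) by (auto simp: d_def m_comm)
        have "pev K d p s = inv (c i) \<otimes> w"
          unfolding c(2) d_def using cc ci s by (intro pev_smult) auto
        also have "\<dots> \<in> M" using not_V_inv[OF ci(1) False] w by auto
        finally have "res (pev K d p s) = \<zero>\<^bsub>RF\<^esub>" using res_eq_zero_iff[of "pev K d p s"] by auto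
        moreover have "res (pev K d p s) = pev RF (\<lambda>l. res (d l)) p (res s)"
          using d sV by (intro res_pev) auto
        ultimately have rel: "pev RF (\<lambda>l. res (d l)) p (res s) = \<zero>\<^bsub>RF\<^esub>" by simp
        have "d i = \<one>" using ci i(2) by (simp add: d_def)
        then have "\<exists>l<p. res (d l) \<noteq> \<zero>\<^bsub>RF\<^esub>" using i(1) by (intro exI[of _ i]) simp
        moreover have "res (d l) \<in> resF k0" if "l < p" for l using d[OF that] by (auto simp: resF_def)
        ultimately have "res s \<in> resF k0"
          using rel by (intro RFk.kummer_dichotomy[of "\<lambda>l. res (d l)"]) auto
        then show ?thesis using irr by simp
      qed
    qed
    then show "w \<in> {w. \<exists>a. (\<forall>i<p. a i \<in> k0 \<inter> V) \<and> w = pev K a p s}"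
      using c by (intro CollectI exI[of _ c]) auto
  qed
qed

lemma res_root_of_unity:
  assumes "s [^] p \<ominus> \<one> \<in> M" shows "\<exists>i::nat. res s = res (\<zeta> [^] i)"
proof -
  interpret RFk: kummer RF "resF k0" "res s" "res \<zeta>" p by (rule kummer_RF)
  have "res (s [^] p) = res \<one>" using assms res_eq_iff[of "s [^] p" \<one>] sV by simp
  then have "res s [^]\<^bsub>RF\<^esub> p = \<one>\<^bsub>RF\<^esub>" using sV by simp
  then obtain m :: nat where "res s = res \<zeta> [^]\<^bsub>RF\<^esub> m" by (rule RFk.root_of_unity)
  then show ?thesis using zV by auto
qed

end

section \<open>Exchange of transcendental elements\<close>

lemma (in field) common_denominator:
  fixes n :: nat
  assumes S: "subring S R" and c: "\<And>j. j < n \<Longrightarrow> \<exists>f\<in>S. \<exists>g\<in>S. g \<noteq> \<zero> \<and> c j = f \<otimes> inv g"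
  shows "\<exists>D\<in>S. D \<noteq> \<zero> \<and> (\<forall>j<n. D \<otimes> c j \<in> S)"
  using c
proof (induction n)
  case 0
  then show ?case using subringE(3)[OF S] by (intro bexI[of _ \<one>]) auto
next
  case (Suc n)
  note Ss = subringE[OF S]
  have Sc: "a \<in> carrier R" if "a \<in> S" for a using Ss(1) that by blast
  have "\<exists>D\<in>S. D \<noteq> \<zero> \<and> (\<forall>j<n. D \<otimes> c j \<in> S)" using Suc.prems by (intro Suc.IH) auto
  then obtain D where D: "D \<in> S" "D \<noteq> \<zero>" "\<forall>j<n. D \<otimes> c j \<in> S" by blast
  obtain f g where fg: "f \<in> S" "g \<in> S" "g \<noteq> \<zero>" "c n = f \<otimes> inv g" using Suc.prems[of n] by auto
  note ig = inv_nonzero[OF Sc[OF fg(2)] fg(3)]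
  have cc: "c j \<in> carrier R" if "j < Suc n" for j
    using Suc.prems[OF that] inv_nonzero(1) Sc by auto
  have "(g \<otimes> D) \<otimes> c j \<in> S" if "j < Suc n" for j
  proof (cases "j = n")
    case True
    have "(g \<otimes> D) \<otimes> (f \<otimes> u) = D \<otimes> f \<otimes> (g \<otimes> u)" if "u \<in> carrier R" for u
      using that Sc[OF fg(1)] Sc[OF fg(2)] Sc[OF D(1)] by algebra
    then have "(g \<otimes> D) \<otimes> c n = D \<otimes> f" using fg(4) ig Sc[OF fg(1)] Sc[OF D(1)] by simp
    then show ?thesis using True Ss(6) D(1) fg(1) by simp
  next
    case False
    then have "(g \<otimes> D) \<otimes> c j = g \<otimes> (D \<otimes> c j)"
      using Sc[OF fg(2)] Sc[OF D(1)] cc[OF that] by (simp add: m_assoc)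
    then show ?thesis using False that D(3) Ss(6) fg(2) by simp
  qed
  moreover have "g \<otimes> D \<noteq> \<zero>" using fg D Sc by (simp add: integral_iff)
  ultimately show ?case using Ss(6)[OF fg(2) D(1)] by blast
qed

text \<open>
  Clearing denominators in a relation for \<open>t\<close> over \<open>k(x)\<close> gives a relation in two variables, which is sorted by powers of \<open>x\<close>. The new coefficients do
  not all vanish, as \<open>t\<close> is transcendental over \<open>k\<close>.
\<close>

lemma (in field) exchange:
  assumes k: "subfield k R" and x: "x \<in> carrier R" and t: "t \<in> carrier R"
    and alg: "\<not> transcendental (generate_field R (insert x k)) t" and tr: "transcendental k t"
  shows "\<not> transcendental (generate_field R (insert t k)) x"
proof -
  have ks: "subring k R" by (rule subfieldE(1)[OF k])
  have kc: "a \<in> carrier R" if "a \<in> k" for a using subfieldE(3)[OF k] that by blast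
  let ?S = "simple_extension k x"
  have S: "subring ?S R" by (rule simple_extension_is_subring[OF ks x])
  have Sc: "a \<in> carrier R" if "a \<in> ?S" for a using subringE(1)[OF S] that by blast
  have subf: "subfield (generate_field R (insert u k)) R" if "u \<in> carrier R" for u
    using generate_field_is_subfield[of "insert u k"] kc that by auto
  obtain c n j0 where c: "\<forall>i<n. c i \<in> generate_field R (insert x k)" "j0 < n" "c j0 \<noteq> \<zero>" "pev R c n t = \<zero>"
    using alg unfolding algebraic_iff_pev[OF subfieldE(1)[OF subf[OF x]] t] by blast
  have cc: "c i \<in> carrier R" if "i < n" for i
    using c(1) that subringE(1)[OF subfieldE(1)[OF subf[OF x]]] by blast
  have "\<exists>D\<in>?S. D \<noteq> \<zero> \<and> (\<forall>j<n. D \<otimes> c j \<in> ?S)"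
    using generate_field_fractions[OF k x] c(1) by (intro common_denominator[OF S]) simp
  then obtain D where D: "D \<in> ?S" "D \<noteq> \<zero>" "\<forall>j<n. D \<otimes> c j \<in> ?S" by blast
  have "\<forall>j. \<exists>e m. j < n \<longrightarrow> (\<forall>i<m. e i \<in> k) \<and> D \<otimes> c j = pev R e m x"
    using D(3) unfolding simple_extension_pev[OF ks x] by blast
  then obtain e m where e: "\<And>j. j < n \<Longrightarrow> (\<forall>i<m j. e j i \<in> k) \<and> D \<otimes> c j = pev R (e j) (m j) x"
    by metis
  define N where "N = (\<Sum>j<n. m j)"
  have mN: "m j \<le> N" if "j < n" for j unfolding N_def using that by (intro member_le_sum) auto
  define E where "E j i = (if i < m j then e j i else \<zero>)" for j i
  have Ek: "E j i \<in> k" if "j < n" for j i using e[OF that] subringE(2)[OF ks] by (simp add: E_def)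
  have Ec: "E j i \<in> carrier R" if "j < n" for j i using Ek[OF that] kc by simp
  have Ex: "D \<otimes> c j = pev R (E j) N x" if "j < n" for j
    unfolding E_def using e[OF that] kc x mN[OF that] by (subst pev_pad) auto
  have tk: "generate_field R (insert t k) \<subseteq> carrier R" by (rule subringE(1)[OF subfieldE(1)[OF subf[OF t]]])
  note Ts = subringE[OF subfieldE(1)[OF subf[OF t]]]
  define b where "b i = pev R (\<lambda>j. E j i) n t" for i
  have tp: "t [^] i \<in> generate_field R (insert t k)" for i :: nat
    by (induction i) (auto intro: generate_field.intros)
  have bT: "b i \<in> generate_field R (insert t k)" for i
    unfolding b_def pev_def
  proof (rule sumn_in_subgroup)
    fix j assume "j < n"
    then have "E j i \<in> generate_field R (insert t k)" using Ek by (auto intro: generate_field.incl)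
    then show "E j i \<otimes> t [^] j \<in> generate_field R (insert t k)" using tp by (rule Ts(6))
  qed (auto intro: Ts(2,7))
  have "pev R b N x = sumn R (\<lambda>i. sumn R (\<lambda>j. E j i \<otimes> t [^] j \<otimes> x [^] i) n) N"
    unfolding pev_def b_def using Ec t x by (intro sumn_cong sumn_rdistr) auto
  also have "\<dots> = sumn R (\<lambda>j. sumn R (\<lambda>i. E j i \<otimes> t [^] j \<otimes> x [^] i) N) n"
    using Ec t x by (intro sumn_swap) auto
  also have "\<dots> = sumn R (\<lambda>j. D \<otimes> (c j \<otimes> t [^] j)) n"
  proof (rule sumn_cong)
    fix j assume j: "j < n"
    have "sumn R (\<lambda>i. E j i \<otimes> t [^] j \<otimes> x [^] i) N = sumn R (\<lambda>i. t [^] j \<otimes> (E j i \<otimes> x [^] i)) N"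
      using Ec[OF j] t x by (intro sumn_cong) (simp add: m_ac)
    also have "\<dots> = t [^] j \<otimes> pev R (E j) N x"
      unfolding pev_def using Ec[OF j] t x by (intro sumn_ldistr[symmetric]) auto
    also have "\<dots> = D \<otimes> (c j \<otimes> t [^] j)"
      unfolding Ex[OF j, symmetric] using cc[OF j] Sc[OF D(1)] t by (simp add: m_ac)
    finally show "sumn R (\<lambda>i. E j i \<otimes> t [^] j \<otimes> x [^] i) N = D \<otimes> (c j \<otimes> t [^] j)" .
  qed
  also have "\<dots> = D \<otimes> pev R c n t"
    unfolding pev_def using cc Sc[OF D(1)] t by (intro sumn_ldistr[symmetric]) auto
  finally have rel: "pev R b N x = \<zero>" using c(4) Sc[OF D(1)] by simp
  have "\<exists>i<N. b i \<noteq> \<zero>"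
  proof (rule ccontr)
    assume no: "\<not> (\<exists>i<N. b i \<noteq> \<zero>)"
    have Ez: "E j0 i = \<zero>" if "i < N" for i
    proof (rule ccontr)
      assume "E j0 i \<noteq> \<zero>"
      then have "\<not> transcendental k t"
        using no that c(2) Ek unfolding b_def
        by (intro algebraic_if_pev[OF ks t, of n "\<lambda>j. E j i"]) auto
      then show False using tr by simp
    qed
    have "pev R (E j0) N x = \<zero>" unfolding pev_def using Ez x by (intro sumn_zero) simp
    then have "D \<otimes> c j0 = \<zero>" using Ex[OF c(2)] by simp
    then show False using D(2) c(3) Sc[OF D(1)] cc[OF c(2)] by (simp add: integral_iff)
  qed
  then show ?thesis using bT rel by (intro algebraic_if_pev[OF subfieldE(1)[OF subf[OF t]] x, of N b]) auto
qed

text \<open>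
  \<open>K\<close> is finite over \<open>k(t)(x)\<close>, and \<open>x\<close> is algebraic over \<open>k(t)\<close> by exchange.
\<close>

lemma (in field) all_algebraic_over:
  assumes k: "subfield k R" and x: "x \<in> carrier R" and s: "s \<in> carrier R"
    and salg: "\<not> transcendental (generate_field R (insert x k)) s"
    and gen: "carrier R = simple_extension (generate_field R (insert x k)) s"
    and t: "t \<in> carrier R" and tr: "transcendental k t" and w: "w \<in> carrier R"
  shows "\<not> transcendental (generate_field R (insert t k)) w"
proof -
  let ?k0 = "generate_field R (insert x k)" and ?k1 = "generate_field R (insert t k)"
  have kc: "k \<subseteq> carrier R" using subfieldE(3)[OF k] .
  have k0: "subfield ?k0 R" and k1: "subfield ?k1 R"
    using generate_field_is_subfield kc x t by auto
  have salg': "(algebraic over ?k0) s" using salg by (simp add: over_def)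
  have talg: "\<not> transcendental ?k0 t"
    using simple_extesion_mem_imp_algebraic[OF k0 s salg'] t gen by (simp add: over_def)
  have xalg: "(algebraic over ?k1) x" using exchange[OF k x t talg tr] by (simp add: over_def)
  let ?E = "simple_extension ?k1 x"
  have E: "subfield ?E R" using simple_extension_is_subfield[OF k1 x] xalg by simp
  have k1E: "?k1 \<subseteq> ?E" by (rule simple_extension_incl[OF subfieldE(3)[OF k1] x])
  have "k \<subseteq> ?k1" by (auto intro: generate_field.incl)
  then have "insert x k \<subseteq> ?E" using k1E simple_extension_mem[OF subfieldE(1)[OF k1] x] by auto
  then have k0E: "?k0 \<subseteq> ?E" using kc x E by (intro generate_field_min_subfield1) auto
  have sE: "(algebraic over ?E) s" by (rule algebraic_mono[OF k0E salg'])
  have "finite_dimension ?k1 ?E" using finite_dimension_simple_extension[OF k1 x] xalg by simp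
  moreover have "finite_dimension ?E (simple_extension ?E s)"
    using finite_dimension_simple_extension[OF E s] sE by simp
  moreover have "simple_extension ?E s = carrier R"
    using gen mono_simple_extension[OF k0E, of s] simple_extension_in_carrier[OF subfieldE(3)[OF E] s] by auto
  ultimately have "finite_dimension ?k1 (carrier R)" using telescopic_base_dim(1)[OF k1 E] by simp
  then have "(algebraic over ?k1) w"
    using finite_dimension_imp_algebraic[OF k1 carrier_is_subring] w by simp
  then show ?thesis by (simp add: over_def)
qed

context val_ring_field
begin

lemma res_transc_transcendental:
  assumes k: "subfield k K" and T: "res_transc k t" shows "transcendental k t"
proof (rule ccontr)
  assume "\<not> transcendental k t"
  then obtain c n j where c: "\<forall>i<n. c i \<in> k" "j < n" "c j \<noteq> \<zero>" "pev K c n t = \<zero>"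
    unfolding algebraic_iff_pev[OF subfieldE(1)[OF k] V_closed[OF res_transc_V[OF T]]] by blast
  then obtain e P where e: "e \<in> k" "e \<noteq> \<zero>" "P \<in> Prim k t" "pev K c n t = e \<otimes> P"
    using pev_Prim[OF k V_closed[OF res_transc_V[OF T]], of n c j] by auto
  have "P \<noteq> \<zero>" "P \<in> carrier K" using Prim_unit[OF T e(3)] by auto
  moreover have "e \<in> carrier K" using e(1) subfieldE(3)[OF k] by blast
  moreover have "e \<otimes> P = \<zero>" using e(4) c(4) by simp
  ultimately show False using e(2) integral by blast
qed

text \<open>
  For two terms of equal value in an algebraic relation for \<open>z\<close>: their quotient is a power of \<open>z\<close> up to elements of \<open>k\<close> and units.
\<close>

lemma torsion_aux:
  assumes k: "subfield k K" and z: "z \<in> carrier K" "z \<noteq> \<zero>"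
    and e: "eA \<in> k" "eA \<noteq> \<zero>" "eB \<in> k" "eB \<noteq> \<zero>"
    and w: "wA \<in> V" "wA \<notin> M" "wB \<in> V" "wB \<notin> M"
    and eq: "z [^] a \<otimes> (eA \<otimes> wA) = z [^] b \<otimes> (eB \<otimes> wB)" and ab: "b < (a::nat)"
  shows "\<exists>n>0. \<exists>e\<in>k. e \<noteq> \<zero> \<and> z [^] (n::nat) \<otimes> inv e \<in> V \<and> z [^] n \<otimes> inv e \<notin> M"
proof -
  have kc: "u \<in> carrier K" if "u \<in> k" for u using subfieldE(3)[OF k] that by blast
  have ec: "eA \<in> carrier K" "eB \<in> carrier K" "inv eA \<in> carrier K" "inv eB \<in> carrier K"
    using e kc by auto
  have wc: "wA \<in> carrier K" "wB \<in> carrier K" "inv wA \<in> carrier K" using w unitD[OF w(1,2)] by auto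
  have zb: "z [^] b \<in> carrier K" "z [^] b \<noteq> \<zero>" using z pow_nonzero by auto
  have "z [^] a = z [^] b \<otimes> z [^] (a - b)" using z ab by (simp add: nat_pow_mult)
  then have "z [^] b \<otimes> (z [^] (a - b) \<otimes> (eA \<otimes> wA)) = z [^] b \<otimes> (eB \<otimes> wB)"
    using eq z ec wc by (simp add: m_assoc)
  then have "z [^] (a - b) \<otimes> (eA \<otimes> wA) = eB \<otimes> wB"
    using m_lcancel[OF zb(2,1)] z ec wc by simp
  then have "z [^] (a - b) \<otimes> (eA \<otimes> wA) \<otimes> (inv eB \<otimes> inv wA) = eB \<otimes> wB \<otimes> (inv eB \<otimes> inv wA)" by simp
  moreover have "z [^] (a - b) \<otimes> (eA \<otimes> wA) \<otimes> (inv eB \<otimes> inv wA) = z [^] (a - b) \<otimes> (eA \<otimes> inv eB)"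
  proof -
    have "Z \<otimes> (eA \<otimes> wA) \<otimes> (u \<otimes> w) = Z \<otimes> (eA \<otimes> u) \<otimes> (wA \<otimes> w)"
      if "Z \<in> carrier K" "u \<in> carrier K" "w \<in> carrier K" for Z u w using that ec(1) wc(1) by algebra
    from this[of "z [^] (a - b)" "inv eB" "inv wA"] show ?thesis
      using z ec wc unitD[OF w(1,2)] by simp
  qed
  moreover have "eB \<otimes> wB \<otimes> (inv eB \<otimes> inv wA) = wB \<otimes> inv wA"
  proof -
    have "eB \<otimes> wB \<otimes> (u \<otimes> w) = (eB \<otimes> u) \<otimes> (wB \<otimes> w)" if "u \<in> carrier K" "w \<in> carrier K" for u w
      using that ec(2) wc(2) by algebra
    from this[of "inv eB" "inv wA"] show ?thesis using ec wc e(4) by simp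
  qed
  ultimately have r: "z [^] (a - b) \<otimes> (eA \<otimes> inv eB) = wB \<otimes> inv wA" by simp
  define e' where "e' = eB \<otimes> inv eA"
  have ie: "inv e' = eA \<otimes> inv eB" unfolding e'_def using ec e by (simp add: inv_mult m_comm)
  have "inv eA \<in> k" using subfield_m_inv(1)[OF k, of eA] e by simp
  then have e'k: "e' \<in> k" "e' \<noteq> \<zero>"
    using e ec subringE(6)[OF subfieldE(1)[OF k]] by (auto simp: e'_def integral_iff)
  have "z [^] (a - b) \<otimes> inv e' \<in> V \<and> z [^] (a - b) \<otimes> inv e' \<notin> M"
    unfolding ie r using unit_quot[OF w(3,4,1,2)] by simp
  then show ?thesis using e'k ab by (intro exI[of _ "a - b"] conjI bexI[of _ e']) auto
qed

text \<open>
  In an algebraic relation for \<open>z\<close> over \<open>k(t)\<close> two different terms share the least value, since otherwise the sum could not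
  vanish. The coefficients have values in \<open>vk\<close>, because a residually transcendental \<open>t\<close> adds no new values.
\<close>

lemma value_torsion:
  assumes k: "subfield k K" and T: "res_transc k t"
    and alg: "\<not> transcendental (generate_field K (insert t k)) z" and z: "z \<in> carrier K" "z \<noteq> \<zero>"
  shows "\<exists>n>0. \<exists>e\<in>k. e \<noteq> \<zero> \<and> z [^] (n::nat) \<otimes> inv e \<in> V \<and> z [^] n \<otimes> inv e \<notin> M"
proof -
  let ?k1 = "generate_field K (insert t k)"
  have tc: "t \<in> carrier K" using res_transc_V[OF T] by simp
  have k1: "subfield ?k1 K" using generate_field_is_subfield[of "insert t k"] tc subfieldE(3)[OF k] by auto
  have k1c: "u \<in> carrier K" if "u \<in> ?k1" for u using subfieldE(3)[OF k1] that by blast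
  have kc: "u \<in> carrier K" if "u \<in> k" for u using subfieldE(3)[OF k] that by blast
  obtain c n j where c: "\<forall>i<n. c i \<in> ?k1" "j < n" "c j \<noteq> \<zero>" "pev K c n z = \<zero>"
    using alg unfolding algebraic_iff_pev[OF subfieldE(1)[OF k1] z(1)] by blast
  have cc: "c i \<in> carrier K" if "i < n" for i using c(1) that k1c by blast
  define T' where "T' i = c i \<otimes> z [^] i" for i
  have Tc: "T' i \<in> carrier K" if "i < n" for i using cc[OF that] z by (simp add: T'_def)
  have "T' j \<noteq> \<zero>" using c(2,3) cc[OF c(2)] z pow_nonzero[OF z] by (simp add: T'_def integral_iff)
  with Tc c(2) have "\<exists>i<n. T' i \<noteq> \<zero> \<and> (\<forall>l<n. T' l \<otimes> inv (T' i) \<in> V)" by (rule least_value)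
  then obtain i where i: "i < n" "T' i \<noteq> \<zero>" "\<forall>l<n. T' l \<otimes> inv (T' i) \<in> V" by blast
  have Ti: "T' i \<in> carrier K" "inv (T' i) \<in> carrier K" using Tc[OF i(1)] i(2) by auto
  have "\<exists>l<n. l \<noteq> i \<and> T' l \<otimes> inv (T' i) \<notin> M"
  proof (rule ccontr)
    assume no: "\<not> (\<exists>l<n. l \<noteq> i \<and> T' l \<otimes> inv (T' i) \<notin> M)"
    define f where "f l = T' l \<otimes> inv (T' i)" for l
    have fc: "f l \<in> carrier K" if "l < n" for l using Tc[OF that] Ti by (simp add: f_def)
    have "sumn K f n = sumn K T' n \<otimes> inv (T' i)"
      unfolding f_def using Tc Ti by (intro sumn_rdistr[symmetric]) auto
    also have "sumn K T' n = \<zero>" using c(4) by (simp add: pev_def T'_def[abs_def])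
    finally have s0: "sumn K f n = \<zero>" using Ti by simp
    have "sumn K f n = sumn K (\<lambda>l. (if l = i then \<one> else \<zero>) \<oplus> (if l = i then \<zero> else f l)) n"
      using fc Ti i(2) by (intro sumn_cong) (auto simp: f_def)
    also have "\<dots> = sumn K (\<lambda>l. if l = i then \<one> else \<zero>) n \<oplus> sumn K (\<lambda>l. if l = i then \<zero> else f l) n"
      using fc by (intro sumn_add) auto
    also have "sumn K (\<lambda>l. if l = i then \<one> else \<zero>) n = \<one>"
      using i(1) by (subst sumn_single[of i]) auto
    finally have "\<one> \<oplus> sumn K (\<lambda>l. if l = i then \<zero> else f l) n = \<zero>" using s0 by simp
    moreover have "sumn K (\<lambda>l. if l = i then \<zero> else f l) n \<in> M"
      using no by (intro sumn_M) (auto simp: f_def)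
    ultimately show False using unit_add_M[OF one_V one_not_M] zero_M by metis
  qed
  then obtain l where l: "l < n" "l \<noteq> i" "T' l \<otimes> inv (T' i) \<notin> M" by blast
  define r where "r = T' l \<otimes> inv (T' i)"
  have r: "r \<in> V" "r \<notin> M" using i(3) l by (auto simp: r_def)
  have rT: "T' l = r \<otimes> T' i" using Tc[OF l(1)] Ti i(2) by (simp add: r_def div_cancel)
  have Tl0: "T' l \<noteq> \<zero>" using rT r Ti i(2) by (auto simp: integral_iff)
  have form: "\<exists>e\<in>k. e \<noteq> \<zero> \<and> (\<exists>w. w \<in> V \<and> w \<notin> M \<and> c m = e \<otimes> w)" if m: "m < n" "T' m \<noteq> \<zero>" for m
  proof -
    have "c m \<noteq> \<zero>" using m z by (auto simp: T'_def)
    then obtain e P Q where e: "e \<in> k" "e \<noteq> \<zero>" "P \<in> Prim k t" "Q \<in> Prim k t" "c m = e \<otimes> (P \<otimes> inv Q)"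
      using gauss_form[OF k T, of "c m"] c(1) m(1) by blast
    have "P \<otimes> inv Q \<in> V" "P \<otimes> inv Q \<notin> M"
      using unit_quot Prim_unit[OF T e(3)] Prim_unit[OF T e(4)] by auto
    then show ?thesis using e by blast
  qed
  obtain el wl where el: "el \<in> k" "el \<noteq> \<zero>" "wl \<in> V" "wl \<notin> M" "c l = el \<otimes> wl" using form[OF l(1) Tl0] by blast
  obtain ei wi where ei: "ei \<in> k" "ei \<noteq> \<zero>" "wi \<in> V" "wi \<notin> M" "c i = ei \<otimes> wi" using form[OF i(1,2)] by blast
  have rw: "r \<otimes> wi \<in> V" "r \<otimes> wi \<notin> M" using r ei unit_mult by auto
  have eq: "z [^] l \<otimes> (el \<otimes> wl) = z [^] i \<otimes> (ei \<otimes> (r \<otimes> wi))"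
  proof -
    have "z [^] l \<otimes> (el \<otimes> wl) = T' l" using el z kc[OF el(1)] by (simp add: T'_def m_comm)
    also have "\<dots> = r \<otimes> ((ei \<otimes> wi) \<otimes> z [^] i)" using rT ei(5) by (simp add: T'_def)
    also have "\<dots> = z [^] i \<otimes> (ei \<otimes> (r \<otimes> wi))" using r ei(3) kc[OF ei(1)] z by (simp add: m_ac)
    finally show ?thesis .
  qed
  consider "i < l" | "l < i" using l(2) by linarith
  then show ?thesis
  proof cases
    case 1
    then show ?thesis using torsion_aux[OF k z el(1,2) ei(1,2) el(3,4) rw eq] by blast
  next
    case 2
    then show ?thesis using torsion_aux[OF k z ei(1,2) el(1,2) rw el(3,4) eq[symmetric]] by blast
  qed
qed

end

section \<open>Separable-algebraically closed ground fields\<close>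

lemma (in ring) pev_trinomial:
  assumes "a \<in> carrier R" "b \<in> carrier R" "d \<in> carrier R" "z \<in> carrier R" "2 \<le> n"
  shows "pev R (\<lambda>i. if i = 0 then a else if i = 1 then b else if i = n then d else \<zero>) (Suc n) z =
    a \<oplus> b \<otimes> z \<oplus> d \<otimes> z [^] n"
proof -
  let ?c = "\<lambda>i. if i = 0 then a else if i = 1 then b else if i = n then d else \<zero>"
  have "pev R ?c m z = a \<oplus> b \<otimes> z" if "2 \<le> m" "m \<le> n" for m
    using that
  proof (induction m rule: dec_induct)
    case base
    then show ?case using assms by (simp add: numeral_2_eq_2)
  next
    case (step m)
    then show ?case using assms by simp
  qed
  from this[of n] show ?thesis using assms by simp
qed

lemma (in val_ring_field) integral_V:
  assumes c: "\<And>i. i < n \<Longrightarrow> c i \<in> V" and z: "z \<in> carrier K" and eq: "pev K c n z \<oplus> z [^] n = \<zero>"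
  shows "z \<in> V"
proof (rule ccontr)
  assume nV: "z \<notin> V"
  define u where "u = inv z"
  have z0: "z \<noteq> \<zero>" and u: "u \<in> M" using not_V_inv[OF z nV] by (auto simp: u_def)
  have uc: "u \<in> carrier K" using u by simp
  have zu: "z [^] i \<otimes> u [^] i = \<one>" for i :: nat
    using z uc z0 by (simp add: nat_pow_distrib[symmetric] u_def)
  have cc: "c i \<in> carrier K" if "i < n" for i using c[OF that] by simp
  have t: "c i \<otimes> z [^] i \<otimes> u [^] n \<in> M" if "i < n" for i
  proof -
    have "u [^] n = u [^] i \<otimes> u [^] (n - i)" using that uc by (simp add: nat_pow_mult)
    then have "c i \<otimes> z [^] i \<otimes> u [^] n = c i \<otimes> (z [^] i \<otimes> u [^] i) \<otimes> u [^] (n - i)"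
      using cc[OF that] z uc by (simp add: m_assoc)
    also have "\<dots> = c i \<otimes> u [^] (n - i)" using zu cc[OF that] by simp
    also have "\<dots> \<in> M" using c[OF that] M_pow[OF u, of "n - i"] that by auto
    finally show ?thesis .
  qed
  have "pev K c n z \<otimes> u [^] n = sumn K (\<lambda>i. c i \<otimes> z [^] i \<otimes> u [^] n) n"
    unfolding pev_def using cc z uc by (intro sumn_rdistr) auto
  also have "\<dots> \<in> M" using t by (rule sumn_M)
  finally have m: "pev K c n z \<otimes> u [^] n \<in> M" .
  have "(pev K c n z \<oplus> z [^] n) \<otimes> u [^] n = pev K c n z \<otimes> u [^] n \<oplus> \<one>"
    using cc z uc zu by (simp add: l_distr)
  then have "\<one> \<oplus> pev K c n z \<otimes> u [^] n = \<zero>"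
    using eq uc M_V[OF m] by (simp add: a_comm)
  then show False using unit_add_M[OF one_V one_not_M m] zero_M by metis
qed

text \<open>
  A nontrivial valuation on \<open>k\<close>. Small perturbations make the derivative of a polynomial nonzero, so that over \<open>k\<close> every polynomial has approximate
  roots, whether or not it is separable.
\<close>

locale sep_val = val_ring_field K V for K (structure) and V +
  fixes k :: "'a set"
  assumes subk: "subfield k K" and closed: "sep_alg_closed (K\<lparr>carrier := k\<rparr>)"
    and nontriv: "\<exists>\<eta>\<in>k. \<eta> \<noteq> \<zero> \<and> \<eta> \<in> M"
begin

lemmas k_sub = subringE[OF subfieldE(1)[OF subk]]
lemma kc: "a \<in> k \<Longrightarrow> a \<in> carrier K" using k_sub(1) by blast
lemma k_inv: "a \<in> k \<Longrightarrow> a \<noteq> \<zero> \<Longrightarrow> inv a \<in> k" using subfield_m_inv(1)[OF subk, of a] by simp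
lemma k_pow: "a \<in> k \<Longrightarrow> a [^] (n::nat) \<in> k" by (induction n) (auto intro: k_sub(3,6))
lemma k_diff: "a \<in> k \<Longrightarrow> b \<in> k \<Longrightarrow> a \<ominus> b \<in> k" unfolding minus_eq by (intro k_sub(5,7))

lemma subring_kV: "subring (k \<inter> V) K"
  by (rule subringI) (use kc k_sub in auto)

lemma root: "(\<And>i. i < n \<Longrightarrow> c i \<in> k) \<Longrightarrow> j < n \<Longrightarrow> nat_el K j \<otimes> c j \<noteq> \<zero> \<Longrightarrow> \<exists>r\<in>k. pev K c n r = \<zero>"
  using root_in_sep_alg_closed_subfield[OF subk closed] by blast

text \<open>
  The value group of \<open>k\<close> is divisible: for integral \<open>e\<close> the polynomial \<open>X ^ n + e \<eta> X - e\<close> with \<open>\<eta>\<close> in \<open>M\<close> has nonzero derivative, and its root \<open>r\<close> satisfies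
  \<open>r ^ n = e (1 - \<eta> r)\<close>.
\<close>

lemma divisible:
  assumes e: "e \<in> k" "e \<noteq> \<zero>" and n: "0 < n"
  shows "\<exists>r\<in>k. r \<noteq> \<zero> \<and> r [^] (n::nat) \<otimes> inv e \<in> V \<and> r [^] n \<otimes> inv e \<notin> M"
proof (cases "n = 1")
  case True
  then show ?thesis using e kc by (intro bexI[of _ e]) auto
next
  case False
  then have n2: "2 \<le> n" using n by simp
  obtain \<eta> where \<eta>: "\<eta> \<in> k" "\<eta> \<noteq> \<zero>" "\<eta> \<in> M" using nontriv by blast
  have main: "\<exists>r\<in>k. r \<noteq> \<zero> \<and> r [^] n \<otimes> inv e \<in> V \<and> r [^] n \<otimes> inv e \<notin> M"
    if e: "e \<in> k" "e \<noteq> \<zero>" "e \<in> V" for e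
  proof -
    let ?c = "\<lambda>i. if i = 0 then \<ominus> e else if i = 1 then e \<otimes> \<eta> else if i = n then \<one> else \<zero>"
    have ec: "e \<in> carrier K" "\<eta> \<in> carrier K" using e \<eta> kc by auto
    have ck: "?c i \<in> k" for i using e \<eta> k_sub by auto
    have "nat_el K 1 \<otimes> ?c 1 \<noteq> \<zero>" using e \<eta> ec by (simp add: integral_iff)
    then obtain r where r: "r \<in> k" "pev K ?c (Suc n) r = \<zero>" using root[of "Suc n" ?c 1] ck n2 by auto
    have rc: "r \<in> carrier K" using r kc by simp
    have eq: "\<ominus> e \<oplus> e \<otimes> \<eta> \<otimes> r \<oplus> r [^] n = \<zero>"
      using r(2) pev_trinomial[of "\<ominus> e" "e \<otimes> \<eta>" \<one> r n] ec rc n2 by simp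
    have rV: "r \<in> V"
    proof (rule integral_V[of n ?c, OF _ rc])
      show "?c i \<in> V" for i using e \<eta> M_V by auto
      show "pev K ?c n r \<oplus> r [^] n = \<zero>" using r(2) n2 rc by simp
    qed
    have "r [^] n = e \<otimes> (\<one> \<ominus> \<eta> \<otimes> r)"
    proof -
      have "R = e \<otimes> (\<one> \<ominus> \<eta> \<otimes> r) \<oplus> (\<ominus> e \<oplus> e \<otimes> \<eta> \<otimes> r \<oplus> R)" if "R \<in> carrier K" for R
        using that ec rc by algebra
      from this[of "r [^] n"] show ?thesis unfolding eq using ec rc by simp
    qed
    then have q: "r [^] n \<otimes> inv e = \<one> \<ominus> \<eta> \<otimes> r"
      using ec e rc by (simp add: m_comm m_assoc[symmetric])
    have m: "\<eta> \<otimes> r \<in> M" using \<eta>(3) rV by (rule M_mult_r)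
    have u: "\<one> \<ominus> \<eta> \<otimes> r \<notin> M" unfolding minus_eq by (rule unit_add_M[OF one_V one_not_M M_minus[OF m]])
    have "\<one> \<ominus> \<eta> \<otimes> r \<in> V" using m by auto
    moreover have "r \<noteq> \<zero>"
    proof
      assume "r = \<zero>"
      then have "\<ominus> e = \<zero>" using eq ec n2 by (simp add: nat_pow_zero)
      then have "e = \<zero>" using ec by (metis minus_minus minus_zero)
      then show False using e by simp
    qed
    ultimately show ?thesis using r(1) u q by (intro bexI[of _ r]) auto
  qed
  show ?thesis
  proof (cases "e \<in> V")
    case True
    then show ?thesis using main e by blast
  next
    case False
    have ie: "inv e \<in> k" "inv e \<noteq> \<zero>" "inv e \<in> V" using not_V_inv[of e] False e kc k_inv by auto
    obtain r where r: "r \<in> k" "r \<noteq> \<zero>" "r [^] n \<otimes> inv (inv e) \<in> V" "r [^] n \<otimes> inv (inv e) \<notin> M"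
      using main[OF ie] by blast
    have rc: "r \<in> carrier K" "e \<in> carrier K" using r e kc by auto
    have "inv (r [^] n \<otimes> inv (inv e)) = inv r [^] n \<otimes> inv e"
      using rc r(2) e pow_nonzero[OF rc(1) r(2), of n] by (simp add: inv_mult inv_pow)
    then show ?thesis using unitD[OF r(3,4)] r(2) rc k_inv[OF r(1,2)] by (intro bexI[of _ "inv r"]) auto
  qed
qed

text \<open>
  The residue field of \<open>k\<close> is algebraically closed in that of \<open>K\<close>. Changing the linear coefficient by an element of \<open>M\<close> makes the derivative nonzero without
  changing the residual polynomial; a root \<open>r\<close> is split off, and either \<open>t\<close> is congruent to \<open>r\<close> or the quotient is again a residual equation.
\<close>

lemma residue_root:
  assumes t: "t \<in> V" and c: "\<And>i. i < n \<Longrightarrow> c i \<in> k \<inter> V" and m: "pev K c n t \<in> M" and j: "j < n" "c j \<notin> M"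
  shows "\<exists>r\<in>k \<inter> V. t \<ominus> r \<in> M"
  using c m j
proof (induction n arbitrary: c j)
  case (Suc n)
  have cV: "c i \<in> V" if "i < Suc n" for i using Suc.prems(1)[OF that] by simp
  show ?case
  proof (cases "c n \<in> M")
    case True
    have cn: "c n \<otimes> t [^] n \<in> M" using True t by auto
    have "pev K c n t = pev K c (Suc n) t \<ominus> c n \<otimes> t [^] n"
    proof -
      have "A = (A \<oplus> B) \<ominus> B" if "A \<in> carrier K" "B \<in> carrier K" for A B using that by algebra
      from this[of "pev K c n t" "c n \<otimes> t [^] n"] show ?thesis using cV t by simp
    qed
    then have "pev K c n t \<in> M" using Suc.prems(2) cn M_diff by metis
    moreover have "j < n" using Suc.prems(3,4) True by (cases "j = n") auto
    ultimately show ?thesis using Suc.IH[of c j] Suc.prems(1,4) by simp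
  next
    case False
    have n0: "n \<noteq> 0"
    proof
      assume "n = 0"
      then show False using Suc.prems(2) False cV[of 0] by simp
    qed
    obtain \<eta> where \<eta>: "\<eta> \<in> k" "\<eta> \<noteq> \<zero>" "\<eta> \<in> M" using nontriv by blast
    define \<delta> where "\<delta> i = (if i = 1 \<and> c 1 = \<zero> then \<eta> else \<zero>)" for i :: nat
    define d where "d i = c i \<oplus> \<delta> i" for i
    have \<delta>: "\<delta> i \<in> k" "\<delta> i \<in> M" for i using \<eta> k_sub(2) by (auto simp: \<delta>_def)
    have dkV: "d i \<in> k \<inter> V" if "i < Suc n" for i
      using Suc.prems(1)[OF that] \<delta>[of i] k_sub(7) by (auto simp: d_def)
    have d1: "d 1 \<noteq> \<zero>" using \<eta> cV[of 1] n0 by (auto simp: d_def \<delta>_def)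
    have dn: "d n \<notin> M" unfolding d_def using unit_add_M[OF cV[of n] False \<delta>(2)] by simp
    have dV: "d i \<in> V" if "i < Suc n" for i using dkV[OF that] by simp
    have "nat_el K 1 \<otimes> d 1 \<noteq> \<zero>" using d1 dV[of 1] n0 by simp
    then obtain r where r: "r \<in> k" "pev K d (Suc n) r = \<zero>"
      using root[of "Suc n" d 1] dkV n0 by auto
    have rc: "r \<in> carrier K" using r kc by simp
    note un = unitD[OF dV[of n, simplified] dn]
    have dcn: "d n \<in> carrier K" "inv (d n) \<in> carrier K" using dV[of n] un by auto
    have rV: "r \<in> V"
    proof (rule integral_V[of n "\<lambda>i. inv (d n) \<otimes> d i", OF _ rc])
      show "inv (d n) \<otimes> d i \<in> V" if "i < n" for i using un dV[of i] that by auto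
      have "pev K (\<lambda>i. inv (d n) \<otimes> d i) n r = inv (d n) \<otimes> pev K d n r"
        using dV un rc by (intro pev_smult) auto
      moreover have "inv (d n) \<otimes> (pev K d n r \<oplus> d n \<otimes> r [^] n) = inv (d n) \<otimes> pev K d n r \<oplus> r [^] n"
        using dV un rc dcn by (simp add: r_distr m_assoc[symmetric])
      ultimately show "pev K (\<lambda>i. inv (d n) \<otimes> d i) n r \<oplus> r [^] n = \<zero>"
        using r(2) dcn by simp
    qed
    have dM: "pev K d (Suc n) t \<in> M"
    proof -
      have "pev K d (Suc n) t = pev K c (Suc n) t \<oplus> pev K \<delta> (Suc n) t"
        unfolding d_def using cV \<delta> t by (intro pev_add) auto
      moreover have "pev K \<delta> (Suc n) t \<in> M" using \<delta>(2) t by (intro pev_M) auto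
      ultimately show ?thesis using Suc.prems(2) by auto
    qed
    have rkV: "r \<in> k \<inter> V" using r rV by simp
    have "\<exists>g. (\<forall>i<n. g i \<in> k \<inter> V) \<and> (0 < n \<longrightarrow> g (n - 1) = d n) \<and>
      (\<forall>z\<in>carrier K. pev K d (Suc n) z = (z \<ominus> r) \<otimes> pev K g n z \<oplus> pev K d (Suc n) r)"
      using dkV by (intro pev_factor[OF subring_kV rkV]) simp
    then obtain g where g: "\<forall>i<n. g i \<in> k \<inter> V" "0 < n \<longrightarrow> g (n - 1) = d n"
      "\<forall>z\<in>carrier K. pev K d (Suc n) z = (z \<ominus> r) \<otimes> pev K g n z \<oplus> pev K d (Suc n) r" by (elim exE conjE)
    have gV: "pev K g n t \<in> V" using g(1) t by (intro pev_V) auto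
    have "pev K d (Suc n) t = (t \<ominus> r) \<otimes> pev K g n t"
      using bspec[OF g(3), of t] t rV gV unfolding r(2) by simp
    then have "t \<ominus> r \<in> M \<or> pev K g n t \<in> M" using dM M_prime[of "t \<ominus> r" "pev K g n t"] t rV gV by auto
    then show ?thesis
    proof
      assume "t \<ominus> r \<in> M"
      then show ?thesis using rkV by blast
    next
      assume "pev K g n t \<in> M"
      moreover have "g (n - 1) \<notin> M" using g(2) dn n0 by simp
      ultimately show ?thesis using Suc.IH[of g "n - 1"] g(1) n0 by simp
    qed
  qed
qed simp

text \<open>
  Used to bound the roots of a perturbed polynomial independently of the size of the perturbation.
\<close>

lemma common_multiple:
  fixes n :: nat
  assumes "\<And>i. i < n \<Longrightarrow> f i \<in> k" shows "\<exists>\<mu>\<in>k \<inter> V. \<mu> \<noteq> \<zero> \<and> (\<forall>i<n. \<mu> \<otimes> f i \<in> V)"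
  using assms
proof (induction n)
  case 0
  then show ?case using k_sub(3) by (intro bexI[of _ \<one>]) auto
next
  case (Suc n)
  have "\<exists>\<mu>\<in>k \<inter> V. \<mu> \<noteq> \<zero> \<and> (\<forall>i<n. \<mu> \<otimes> f i \<in> V)" using Suc.prems by (intro Suc.IH) simp
  then obtain \<mu> where \<mu>: "\<mu> \<in> k" "\<mu> \<in> V" "\<mu> \<noteq> \<zero>" "\<forall>i<n. \<mu> \<otimes> f i \<in> V" by blast
  have fk: "f i \<in> k" if "i < Suc n" for i using Suc.prems[OF that] .
  have \<mu>c: "\<mu> \<in> carrier K" using \<mu> by simp
  show ?case
  proof (cases "f n \<in> V")
    case True
    then show ?thesis using \<mu> by (intro bexI[of _ \<mu>]) (auto simp: less_Suc_eq)
  next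
    case False
    have fn: "f n \<noteq> \<zero>" "inv (f n) \<in> M" "f n \<in> carrier K" using not_V_inv[of "f n"] False fk[of n] kc by auto
    define \<nu> where "\<nu> = \<mu> \<otimes> inv (f n)"
    have "\<nu> \<in> k \<inter> V" "\<nu> \<noteq> \<zero>" using \<mu> fn k_inv[of "f n"] fk[of n] k_sub(6) \<mu>c by (auto simp: \<nu>_def integral_iff)
    moreover have "\<nu> \<otimes> f i \<in> V" if "i < Suc n" for i
    proof (cases "i = n")
      case True
      then show ?thesis using fn \<mu>c \<mu>(2) by (simp add: \<nu>_def div_cancel)
    next
      case False
      then have "\<mu> \<otimes> f i \<in> V" using \<mu>(4) that by simp
      moreover have "\<nu> \<otimes> f i = inv (f n) \<otimes> (\<mu> \<otimes> f i)"
        using fn \<mu>c kc[OF fk[OF that]] by (simp add: \<nu>_def m_ac)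
      ultimately show ?thesis using fn(2) by simp
    qed
    ultimately show ?thesis by blast
  qed
qed

text \<open>
  If the linear coefficient vanishes, it is replaced by a small \<open>\<tau>\<close>. A root \<open>d\<close> of the perturbed polynomial satisfies \<open>c(d) = - \<tau> d\<close>, and \<open>\<mu> d\<close> is
  integral for a multiplier \<open>\<mu>\<close> that depends on \<open>c\<close> and \<open>\<epsilon>\<close> only; so \<open>\<tau> = \<epsilon> \<mu> \<eta>\<close> is small enough.
\<close>

lemma approx_root:
  assumes c: "\<And>i. i \<le> n \<Longrightarrow> c i \<in> k" and n: "0 < n" "c n \<noteq> \<zero>" and \<epsilon>: "\<epsilon> \<in> k" "\<epsilon> \<noteq> \<zero>"
  shows "\<exists>d\<in>k. pev K c (Suc n) d \<otimes> inv \<epsilon> \<in> M"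
proof -
  have cc: "c i \<in> carrier K" if "i \<le> n" for i using c[OF that] kc by simp
  have \<epsilon>c: "\<epsilon> \<in> carrier K" "inv \<epsilon> \<in> carrier K" using \<epsilon> kc by auto
  show ?thesis
  proof (cases "c 1 = \<zero>")
    case False
    then have "nat_el K 1 \<otimes> c 1 \<noteq> \<zero>" using cc[of 1] n by simp
    then obtain d where "d \<in> k" "pev K c (Suc n) d = \<zero>" using root[of "Suc n" c 1] c n by auto
    then show ?thesis using \<epsilon>c by (intro bexI[of _ d]) auto
  next
    case True
    have n2: "2 \<le> n" using True n by (cases "n = 1") auto
    obtain \<eta> where \<eta>: "\<eta> \<in> k" "\<eta> \<noteq> \<zero>" "\<eta> \<in> M" using nontriv by blast
    have \<eta>c: "\<eta> \<in> carrier K" using \<eta> kc by simp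
    define L where "L = inv (c n)"
    have L: "L \<in> k" "L \<in> carrier K" "L \<otimes> c n = \<one>" using k_inv[of "c n"] c[of n] n kc by (auto simp: L_def)
    \<comment> \<open>The bound \<open>\<mu>\<close> has to cover the coefficients of the monic polynomial, including the perturbed one: \<open>\<tau> L\<close> is \<open>(\<mu> \<epsilon>) L \<eta>\<close>.\<close>
    define f where "f i = (if i < n then c i \<otimes> L else if i = n then L else \<epsilon>)" for i
    have "f i \<in> k" for i using c L \<epsilon> k_sub(6) by (auto simp: f_def)
    then obtain \<mu> where \<mu>: "\<mu> \<in> k" "\<mu> \<in> V" "\<mu> \<noteq> \<zero>" "\<forall>i<n+2. \<mu> \<otimes> f i \<in> V"
      using common_multiple[of "n + 2" f] by blast
    have \<mu>c: "\<mu> \<in> carrier K" using \<mu> by simp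
    have \<mu>cL: "\<mu> \<otimes> (c i \<otimes> L) \<in> V" if "i < n" for i using \<mu>(4)[rule_format, of i] that by (simp add: f_def)
    have \<mu>L: "\<mu> \<otimes> L \<in> V" using \<mu>(4)[rule_format, of n] by (simp add: f_def)
    have \<mu>\<epsilon>: "\<mu> \<otimes> \<epsilon> \<in> V" using \<mu>(4)[rule_format, of "n + 1"] by (simp add: f_def)
    define \<tau> where "\<tau> = \<epsilon> \<otimes> \<mu> \<otimes> \<eta>"
    have \<tau>: "\<tau> \<in> k" "\<tau> \<noteq> \<zero>" "\<tau> \<in> carrier K"
      using \<epsilon> \<mu> \<eta> k_sub(6) \<epsilon>c \<mu>c \<eta>c by (auto simp: \<tau>_def integral_iff)
    define \<delta> where "\<delta> i = (if i = 1 then \<tau> else \<zero>)" for i :: nat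
    define b where "b i = c i \<oplus> \<delta> i" for i
    have \<delta>k: "\<delta> i \<in> k" for i using \<tau> k_sub(2) by (simp add: \<delta>_def)
    have bk: "b i \<in> k" if "i \<le> n" for i using c[OF that] \<delta>k k_sub(7) by (simp add: b_def)
    have bc: "b i \<in> carrier K" if "i \<le> n" for i using bk[OF that] kc by simp
    have b1: "b 1 = \<tau>" using True \<tau> by (simp add: b_def \<delta>_def)
    have bn: "b n = c n" using n2 cc[of n] by (simp add: b_def \<delta>_def)
    have "nat_el K 1 \<otimes> b 1 \<noteq> \<zero>" using b1 \<tau> by simp
    then obtain d where d: "d \<in> k" "pev K b (Suc n) d = \<zero>" using root[of "Suc n" b 1] bk n2 by auto
    have dc: "d \<in> carrier K" using d kc by simp
    have \<mu>b: "\<mu> \<otimes> (b i \<otimes> L) \<in> V" if "i < n" for i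
    proof (cases "i = 1")
      case True
      have "\<mu> \<otimes> (b i \<otimes> L) = (\<mu> \<otimes> L) \<otimes> (\<mu> \<otimes> \<epsilon>) \<otimes> \<eta>"
        unfolding True b1 \<tau>_def using \<mu>c L(2) \<epsilon>c(1) \<eta>c by (simp add: m_ac)
      then show ?thesis using \<mu>L \<mu>\<epsilon> \<eta>(3) by simp
    next
      case False
      then show ?thesis using \<mu>cL[OF that] cc[of i] that by (simp add: b_def \<delta>_def)
    qed
    define z where "z = \<mu> \<otimes> d"
    have zc: "z \<in> carrier K" using \<mu>c dc by (simp add: z_def)
    have zV: "z \<in> V"
    \<comment> \<open>The monic equation of \<open>d\<close> multiplied by \<open>\<mu> ^ n\<close> is a monic integral equation of \<open>\<mu> d\<close>.\<close>
    proof (rule integral_V[of n "\<lambda>i. (\<mu> \<otimes> (b i \<otimes> L)) \<otimes> \<mu> [^] (n - 1 - i)", OF _ zc])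
      show "(\<mu> \<otimes> (b i \<otimes> L)) \<otimes> \<mu> [^] (n - 1 - i) \<in> V" if "i < n" for i using \<mu>b[OF that] \<mu>(2) by auto
      have t: "(\<mu> \<otimes> (b i \<otimes> L)) \<otimes> \<mu> [^] (n - 1 - i) \<otimes> z [^] i = (L \<otimes> \<mu> [^] n) \<otimes> (b i \<otimes> d [^] i)" if "i < n" for i
      proof -
        have "n = Suc (n - 1 - i) + i" using that by simp
        then have "\<mu> [^] n = \<mu> [^] Suc (n - 1 - i) \<otimes> \<mu> [^] i" using \<mu>c by (metis nat_pow_mult)
        then show ?thesis using \<mu>c L(2) dc bc[of i] that by (simp add: z_def nat_pow_distrib m_ac)
      qed
      have "pev K (\<lambda>i. (\<mu> \<otimes> (b i \<otimes> L)) \<otimes> \<mu> [^] (n - 1 - i)) n z = sumn K (\<lambda>i. (L \<otimes> \<mu> [^] n) \<otimes> (b i \<otimes> d [^] i)) n"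
        unfolding pev_def using t by (intro sumn_cong) auto
      also have "\<dots> = (L \<otimes> \<mu> [^] n) \<otimes> pev K b n d"
        unfolding pev_def using bc dc L(2) \<mu>c by (intro sumn_ldistr[symmetric]) auto
      finally have 1: "pev K (\<lambda>i. (\<mu> \<otimes> (b i \<otimes> L)) \<otimes> \<mu> [^] (n - 1 - i)) n z = (L \<otimes> \<mu> [^] n) \<otimes> pev K b n d" .
      have 2: "z [^] n = (L \<otimes> \<mu> [^] n) \<otimes> (b n \<otimes> d [^] n)"
      proof -
        have "(L \<otimes> A) \<otimes> (C \<otimes> B) = (L \<otimes> C) \<otimes> (A \<otimes> B)" if "A \<in> carrier K" "B \<in> carrier K" "C \<in> carrier K" for A B C
          using that L(2) by algebra
        from this[of "\<mu> [^] n" "d [^] n" "c n"] show ?thesis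
          unfolding bn z_def using L(3) \<mu>c dc cc[of n] by (simp add: nat_pow_distrib)
      qed
      have "pev K b n d \<in> carrier K" using bc dc by auto
      then have "(L \<otimes> \<mu> [^] n) \<otimes> pev K b n d \<oplus> (L \<otimes> \<mu> [^] n) \<otimes> (b n \<otimes> d [^] n) = (L \<otimes> \<mu> [^] n) \<otimes> pev K b (Suc n) d"
        using bc[of n] dc L(2) \<mu>c by (simp add: r_distr)
      then show "pev K (\<lambda>i. (\<mu> \<otimes> (b i \<otimes> L)) \<otimes> \<mu> [^] (n - 1 - i)) n z \<oplus> z [^] n = \<zero>"
        unfolding 1 2 using d(2) L(2) \<mu>c by simp
    qed
    have "pev K b (Suc n) d = pev K c (Suc n) d \<oplus> pev K \<delta> (Suc n) d"
      unfolding b_def using cc \<delta>k kc dc by (intro pev_add) auto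
    moreover have "pev K \<delta> (Suc n) d = \<tau> \<otimes> d"
      unfolding pev_def using n2 \<tau> dc by (subst sumn_single[of 1]) (auto simp: \<delta>_def)
    moreover have "pev K c (Suc n) d \<in> carrier K" using cc dc by (intro pev_closed) auto
    ultimately have "pev K c (Suc n) d = \<ominus> (\<tau> \<otimes> d)" using d(2) \<tau>(3) dc by (metis m_closed minus_equality)
    moreover have "\<ominus> (\<tau> \<otimes> d) \<otimes> inv \<epsilon> = \<ominus> (\<eta> \<otimes> z)"
    proof -
      have "\<ominus> (\<epsilon> \<otimes> \<mu> \<otimes> \<eta> \<otimes> d) \<otimes> i = \<ominus> (\<eta> \<otimes> (\<mu> \<otimes> d)) \<otimes> (\<epsilon> \<otimes> i)" if "i \<in> carrier K" for i
        using that \<epsilon>c(1) \<mu>c \<eta>c dc by algebra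
      from this[of "inv \<epsilon>"] show ?thesis using \<epsilon>c \<epsilon>(2) \<mu>c \<eta>c dc by (simp add: \<tau>_def z_def)
    qed
    ultimately have "pev K c (Suc n) d \<otimes> inv \<epsilon> \<in> M" using M_mult_r[OF \<eta>(3) zV] by simp
    then show ?thesis using d(1) by blast
  qed
qed

end

section \<open>Radical extensions of a rational function field\<close>

locale radical_ext = val_ring_field K V for K (structure) and V +
  fixes k :: "'a set" and x y \<zeta> :: 'a and p :: nat
  assumes subk': "subfield k K" and x: "x \<in> carrier K"
    and prime_p: "Factorial_Ring.prime p" and \<zeta>: "\<zeta> \<in> k" "\<zeta> [^] p = \<one>" "\<zeta> \<noteq> \<one>" and pM': "nat_el K p \<notin> M"
    and y: "y \<in> carrier K" "y \<noteq> \<zero>" and yp: "y [^] p \<in> generate_field K (insert x k)"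
    and gen': "carrier K = generate_field K (insert y (generate_field K (insert x k)))"
begin

abbreviation "k0 \<equiv> generate_field K (insert x k)"

lemma kc': "a \<in> k \<Longrightarrow> a \<in> carrier K" using subfieldE(3)[OF subk'] by blast
lemma k0: "subfield k0 K" using generate_field_is_subfield[of "insert x k"] kc' x by auto
lemma k0c: "a \<in> k0 \<Longrightarrow> a \<in> carrier K" using subfieldE(3)[OF k0] by blast
lemma kk0: "a \<in> k \<Longrightarrow> a \<in> k0" by (auto intro: generate_field.incl)
lemma xk0: "x \<in> k0" by (auto intro: generate_field.incl)
lemmas k0_sub = subringE[OF subfieldE(1)[OF k0]]
lemma k0_inv: "a \<in> k0 \<Longrightarrow> a \<noteq> \<zero> \<Longrightarrow> inv a \<in> k0" using subfield_m_inv(1)[OF k0, of a] by simp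
lemma k0_pow: "a \<in> k0 \<Longrightarrow> a [^] (n::nat) \<in> k0" by (induction n) (auto intro: k0_sub(3,6))

lemma nat_el_p: "nat_el K p \<noteq> \<zero>" using pM' by auto

lemma algebraic_if_pow:
  assumes s: "s \<in> carrier K" "s [^] p \<in> k0" shows "\<not> transcendental k0 s"
proof -
  have p2: "2 \<le> p" using prime_p prime_ge_2_nat by blast
  let ?c = "\<lambda>i. if i = 0 then \<ominus> (s [^] p) else if i = 1 then \<zero> else if i = p then \<one> else \<zero>"
  have "pev K ?c (Suc p) s = \<ominus> (s [^] p) \<oplus> \<zero> \<otimes> s \<oplus> \<one> \<otimes> s [^] p"
    using s p2 by (intro pev_trinomial) auto
  then have "pev K ?c (Suc p) s = \<zero>" using s by (simp add: l_neg)
  moreover have "\<forall>i<Suc p. ?c i \<in> k0" using s k0_sub by auto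
  moreover have "\<exists>i<Suc p. ?c i \<noteq> \<zero>" using p2 by (intro exI[of _ p]) auto
  ultimately show ?thesis by (intro algebraic_if_pev[OF subfieldE(1)[OF k0] s(1)])
qed

lemma gen_s:
  assumes g: "g \<in> k0" "g \<noteq> \<zero>" and s: "s = y \<otimes> inv g"
  shows "s \<in> carrier K" "s [^] p \<in> k0" "s [^] p = y [^] p \<otimes> inv (g [^] p)"
    "carrier K = simple_extension k0 s"
proof -
  have gc: "g \<in> carrier K" "inv g \<in> carrier K" "inv g \<in> k0" using g k0c k0_inv by auto
  show sc: "s \<in> carrier K" using s y gc by simp
  show sp: "s [^] p = y [^] p \<otimes> inv (g [^] p)"
    using s y gc g by (simp add: nat_pow_distrib inv_pow)
  show spk: "s [^] p \<in> k0"
    using s y gc g yp k0_pow[OF gc(3)] k0_sub(6) by (simp add: nat_pow_distrib)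
  have ys: "y = s \<otimes> g" using s y gc g by (simp add: m_assoc)
  have sub: "insert s k0 \<subseteq> carrier K" using sc k0c by auto
  have S: "subfield (generate_field K (insert s k0)) K" by (rule generate_field_is_subfield[OF sub])
  have "y \<in> generate_field K (insert s k0)"
    unfolding ys using g(1) by (intro generate_field.eng_mult) (auto intro: generate_field.incl)
  then have "insert y k0 \<subseteq> generate_field K (insert s k0)" by (auto intro: generate_field.incl)
  then have "carrier K \<subseteq> generate_field K (insert s k0)"
    unfolding gen' using y k0c S by (intro generate_field_min_subfield1) auto
  moreover have "generate_field K (insert s k0) = simple_extension k0 s"
    by (rule generate_field_algebraic[OF k0 sc algebraic_if_pow[OF sc spk]])
  moreover have "simple_extension k0 s \<subseteq> carrier K"
    by (rule simple_extension_in_carrier[OF subfieldE(3)[OF k0] sc])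
  ultimately show "carrier K = simple_extension k0 s" by blast
qed

text \<open>
  The generator \<open>y\<close> may be divided by any element of \<open>k(x)\<close>; the quotient is used once its \<open>p\<close>-th power is a unit.
\<close>

lemma kummer_valI:
  assumes g: "g \<in> k0" "g \<noteq> \<zero>" and s: "s = y \<otimes> inv g" and u: "s [^] p \<in> V" "s [^] p \<notin> M"
  shows "kummer_val K V k0 s \<zeta> p"
proof -
  note G = gen_s[OF g s]
  have p0: "0 < p" using prime_p prime_gt_0_nat by blast
  have sV: "s \<in> V" by (rule V_if_pow[OF G(1) u(1) p0])
  have sM: "s \<notin> M" using M_pow[of s p] u(2) p0 by blast
  show ?thesis
    using G(1,2,4) k0 prime_p kk0[OF \<zeta>(1)] \<zeta>(2,3) nat_el_p sV sM pM'
    by (intro kummer_val.intro kummer_val_axioms.intro kummer.intro kummer_axioms.intro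
        val_ring_field_axioms field_axioms)
qed

lemma all_algebraic:
  assumes T: "res_transc k t" and w: "w \<in> carrier K"
  shows "\<not> transcendental (generate_field K (insert t k)) w"
proof -
  have s: "y = y \<otimes> inv \<one>" using y by simp
  note G = gen_s[OF k0_sub(3) one_not_zero s]
  show ?thesis
    by (rule all_algebraic_over[OF subk' x y(1) algebraic_if_pow[OF y(1) yp] G(4)
          V_closed[OF res_transc_V[OF T]] res_transc_transcendental[OF subk' T] w])
qed

lemma torsion:
  assumes T: "res_transc k t" and z: "z \<in> carrier K" "z \<noteq> \<zero>"
  shows "\<exists>n>0. \<exists>e\<in>k. e \<noteq> \<zero> \<and> z [^] (n::nat) \<otimes> inv e \<in> V \<and> z [^] n \<otimes> inv e \<notin> M"
  by (rule value_torsion[OF subk' T all_algebraic[OF T z(1)] z])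

text \<open>
  All values are torsion over \<open>vk\<close>, so the valuation is trivial if it is trivial on \<open>k\<close>.
\<close>

lemma trivial_V:
  assumes T: "res_transc k t" and tr: "\<not> (\<exists>\<eta>\<in>k. \<eta> \<noteq> \<zero> \<and> \<eta> \<in> M)"
  shows "V = carrier K"
proof
  show "carrier K \<subseteq> V"
  proof
    fix z assume z: "z \<in> carrier K"
    show "z \<in> V"
    proof (cases "z = \<zero>")
      case False
      obtain n e where n: "0 < (n::nat)" "e \<in> k" "e \<noteq> \<zero>" "z [^] n \<otimes> inv e \<in> V"
        using torsion[OF T z False] by blast
      have ec: "e \<in> carrier K" using n kc' by simp
      have ie: "inv e \<in> k" "inv e \<noteq> \<zero>" using subfield_m_inv(1)[OF subk', of e] n by auto
      have eV: "e \<in> V"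
      proof (rule ccontr)
        assume "e \<notin> V"
        then have "inv e \<in> M" using not_V_inv[OF ec] by blast
        then show False using tr ie by blast
      qed
      have "z [^] n = (z [^] n \<otimes> inv e) \<otimes> e" using z ec n(3) by (simp add: div_cancel)
      then have "z [^] n \<in> V" using n(4) eV V_mult by metis
      then show ?thesis by (rule V_if_pow[OF z _ n(1)])
    qed simp
  qed
qed auto

lemma k0_affine:
  assumes d: "d \<in> k" and e: "e \<in> k" "e \<noteq> \<zero>" and t: "t = (x \<ominus> d) \<otimes> inv e"
  shows "generate_field K (insert t k) = k0"
proof -
  have c: "d \<in> carrier K" "e \<in> carrier K" "inv e \<in> carrier K" "inv e \<in> k"
    using d e kc' subfield_m_inv(1)[OF subk', of e] by auto
  have tc: "t \<in> carrier K" using t x c by simp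
  have xt: "x = t \<otimes> e \<oplus> d"
  proof -
    have "t \<otimes> e = x \<ominus> d" unfolding t using x c e by (simp add: div_cancel)
    then show ?thesis using x c by (simp add: minus_eq a_assoc l_neg)
  qed
  have sub: "insert t k \<subseteq> carrier K" using tc kc' by auto
  have T: "subfield (generate_field K (insert t k)) K" by (rule generate_field_is_subfield[OF sub])
  have "t \<in> k0" unfolding t minus_eq
    using xk0 kk0[OF d] kk0[OF c(4)] k0_sub by (intro k0_sub(6,7,5))
  then have "insert t k \<subseteq> k0" using kk0 by auto
  then have 1: "generate_field K (insert t k) \<subseteq> k0" by (intro generate_field_min_subfield1[OF sub k0])
  have "t \<otimes> e \<oplus> d \<in> generate_field K (insert t k)"
    using d e by (intro generate_field.eng_add generate_field.eng_mult) (auto intro: generate_field.incl)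
  then have "insert x k \<subseteq> generate_field K (insert t k)"
    using xt by (auto intro: generate_field.incl)
  then have 2: "k0 \<subseteq> generate_field K (insert t k)"
    using x kc' by (intro generate_field_min_subfield1[OF _ T]) auto
  show ?thesis using 1 2 by blast
qed

lemma resF_k0:
  assumes d: "d \<in> k" and e: "e \<in> k" "e \<noteq> \<zero>" and t: "t = (x \<ominus> d) \<otimes> inv e" and T: "res_transc k t"
  shows "resF k0 \<subseteq> generate_field RF (insert (res t) (resF k))"
  using resF_gauss[OF subk' T] unfolding k0_affine[OF d e t] .

text \<open>
  The residue field of \<open>K\<close> is generated by the residues of \<open>k\<close>, \<open>t\<close> and \<open>s\<close>.
\<close>

lemma ruled_if_both:
  assumes td: "trdeg_one RF (resF k)"
    and d: "d \<in> k" and e: "e \<in> k" "e \<noteq> \<zero>" and t: "t = (x \<ominus> d) \<otimes> inv e" and T: "res_transc k t"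
    and kv: "kummer_val K V k0 s \<zeta> p"
    and r: "r \<in> carrier RF" "res t \<in> generate_field RF (insert r (resF k))"
      "res s \<in> generate_field RF (insert r (resF k))"
  shows "ruled RF (resF k)"
proof -
  let ?G = "generate_field RF (insert r (resF k))"
  interpret kummer_val K V k0 s \<zeta> p by (rule kv)
  have Fc: "resF k \<subseteq> carrier RF" by (rule subfieldE(3)[OF resF_subfield[OF subk']])
  have G: "subfield ?G RF" using RF.generate_field_is_subfield[of "insert r (resF k)"] Fc r by auto
  have tc: "res t \<in> carrier RF" using res_transc_V[OF T] by simp
  have "insert (res t) (resF k) \<subseteq> ?G" using r(2) by (auto intro: generate_field.incl)
  then have "generate_field RF (insert (res t) (resF k)) \<subseteq> ?G"
    using Fc tc by (intro RF.generate_field_min_subfield1[OF _ G]) auto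
  then have "insert (res s) (resF k0) \<subseteq> ?G" using resF_k0[OF d e t T] r(3) by blast
  then have "generate_field RF (insert (res s) (resF k0)) \<subseteq> ?G"
    using subfieldE(3)[OF resF_subfield[OF k0]] sV by (intro RF.generate_field_min_subfield1[OF _ G]) auto
  then have "carrier RF \<subseteq> ?G" using carrier_RF_generated by blast
  then show ?thesis by (rule RF.ruled_if_generated[OF resF_subfield[OF subk'] r(1) _ td])
qed

lemma res_power_mem:
  assumes kv: "kummer_val K V k0 s \<zeta> p" and s1: "s [^] p \<ominus> \<one> \<in> M"
  shows "res s \<in> resF k"
proof -
  interpret kummer_val K V k0 s \<zeta> p by (rule kv)
  obtain i :: nat where i: "res s = res (\<zeta> [^] i)" using res_root_of_unity[OF s1] by blast
  have "\<zeta> [^] i \<in> k" by (induction i) (auto intro: subringE(3,6)[OF subfieldE(1)[OF subk']] \<zeta>(1))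
  then show ?thesis using i zV by (auto simp: resF_def simp del: res_pow)
qed

text \<open>
  If \<open>s ^ p\<close> is congruent to 1, then \<open>s\<close> is congruent to a power of \<open>\<zeta>\<close> and the residue field is generated by \<open>t\<close>.
\<close>

lemma ruled_if_pow_one:
  assumes td: "trdeg_one RF (resF k)"
    and d: "d \<in> k" and e: "e \<in> k" "e \<noteq> \<zero>" and t: "t = (x \<ominus> d) \<otimes> inv e" and T: "res_transc k t"
    and g: "g \<in> k0" "g \<noteq> \<zero>" and s: "s = y \<otimes> inv g" and s1: "s [^] p \<ominus> \<one> \<in> M"
  shows "ruled RF (resF k)"
proof -
  have sc: "s [^] p \<in> carrier K" using gen_s(1)[OF g s] by simp
  have "s [^] p = \<one> \<oplus> (s [^] p \<ominus> \<one>)" using sc by algebra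
  then have u: "s [^] p \<in> V" "s [^] p \<notin> M"
    using s1 unit_add_M[OF one_V one_not_M s1] by (metis M_V V_add one_V, metis)
  have kv: "kummer_val K V k0 s \<zeta> p" by (rule kummer_valI[OF g s u])
  show ?thesis
  proof (rule ruled_if_both[OF td d e t T kv])
    show "res t \<in> carrier RF" using res_transc_V[OF T] by simp
    show "res t \<in> generate_field RF (insert (res t) (resF k))" by (auto intro: generate_field.incl)
    show "res s \<in> generate_field RF (insert (res t) (resF k))"
      using res_power_mem[OF kv s1] by (auto intro: generate_field.incl)
  qed
qed

lemma nonruled_irreducible:
  assumes td: "trdeg_one RF (resF k)" and nr: "\<not> ruled RF (resF k)"
    and d: "d \<in> k" and e: "e \<in> k" "e \<noteq> \<zero>" and t: "t = (x \<ominus> d) \<otimes> inv e" and T: "res_transc k t"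
    and kv: "kummer_val K V k0 s \<zeta> p"
  shows "res s \<notin> resF k0"
proof
  assume "res s \<in> resF k0"
  then have s: "res s \<in> generate_field RF (insert (res t) (resF k))" using resF_k0[OF d e t T] by blast
  have "ruled RF (resF k)"
    by (rule ruled_if_both[OF td d e t T kv _ _ s]) (use res_transc_V[OF T] in \<open>auto intro: generate_field.incl\<close>)
  then show False using nr by simp
qed

end

locale curve_val = radical_ext K V k x y \<zeta> p + sep_val K V k
  for K (structure) and V k x y \<zeta> p +
  assumes xtr: "transcendental k x" and rt: "\<exists>t. res_transc k t"
begin

lemma value_in_k:
  assumes z: "z \<in> carrier K" "z \<noteq> \<zero>"
  shows "\<exists>e\<in>k. e \<noteq> \<zero> \<and> z \<otimes> inv e \<in> V \<and> z \<otimes> inv e \<notin> M"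
proof -
  obtain t where T: "res_transc k t" using rt by blast
  obtain n e where n: "0 < (n::nat)" "e \<in> k" "e \<noteq> \<zero>" "z [^] n \<otimes> inv e \<in> V" "z [^] n \<otimes> inv e \<notin> M"
    using torsion[OF T z] by blast
  obtain r where r: "r \<in> k" "r \<noteq> \<zero>" "r [^] n \<otimes> inv e \<in> V" "r [^] n \<otimes> inv e \<notin> M"
    using divisible[OF n(2,3,1)] by blast
  have c: "e \<in> carrier K" "inv e \<in> carrier K" "r \<in> carrier K" "inv r \<in> carrier K" using n r kc by auto
  have rn: "r [^] n \<in> carrier K" "r [^] n \<noteq> \<zero>" using c pow_nonzero r by auto
  have i: "inv (r [^] n \<otimes> inv e) = e \<otimes> inv (r [^] n)"
    using rn c n by (simp add: inv_mult m_comm)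
  have "(z \<otimes> inv r) [^] n = z [^] n \<otimes> inv (r [^] n)"
    using z c r by (simp add: nat_pow_distrib inv_pow)
  also have "\<dots> = (z [^] n \<otimes> inv e) \<otimes> (e \<otimes> inv (r [^] n))"
    using z c n rn by (intro div_chain[symmetric]) auto
  finally have "(z \<otimes> inv r) [^] n = (z [^] n \<otimes> inv e) \<otimes> inv (r [^] n \<otimes> inv e)" unfolding i .
  then have u: "(z \<otimes> inv r) [^] n \<in> V" "(z \<otimes> inv r) [^] n \<notin> M" using unit_quot[OF n(4,5) r(3,4)] by auto
  have "z \<otimes> inv r \<in> V" by (rule V_if_pow[OF _ u(1) n(1)]) (use z c in auto)
  moreover have "z \<otimes> inv r \<notin> M" using M_pow[of "z \<otimes> inv r" n] u(2) n(1) by blast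
  ultimately show ?thesis using r by blast
qed

text \<open>
  Elements that agree up to a factor \<open>1 + m\<close>, \<open>m \<in> M\<close>, with an element of \<open>k\<close>. If \<open>k(x)\<close> consists of these, then \<open>w\<close> is an immediate extension on \<open>k(x)\<close>.
\<close>

definition asymp_k :: "'a set" where
  "asymp_k = {z \<in> carrier K. z \<noteq> \<zero> \<and> (\<exists>e\<in>k. e \<noteq> \<zero> \<and> z \<otimes> inv e \<ominus> \<one> \<in> M)}"

lemma asymp_kI: "z \<in> carrier K \<Longrightarrow> z \<noteq> \<zero> \<Longrightarrow> e \<in> k \<Longrightarrow> e \<noteq> \<zero> \<Longrightarrow> z \<otimes> inv e \<ominus> \<one> \<in> M \<Longrightarrow> z \<in> asymp_k"
  unfolding asymp_k_def by blast

lemma asymp_kE: assumes "z \<in> asymp_k"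
  obtains e m where "z \<in> carrier K" "z \<noteq> \<zero>" "e \<in> k" "e \<noteq> \<zero>" "e \<in> carrier K" "m \<in> M" "z = e \<otimes> (\<one> \<oplus> m)"
proof -
  obtain e where e: "z \<in> carrier K" "z \<noteq> \<zero>" "e \<in> k" "e \<noteq> \<zero>" "z \<otimes> inv e \<ominus> \<one> \<in> M" using assms unfolding asymp_k_def by blast
  have ec: "e \<in> carrier K" "inv e \<in> carrier K" using e kc by auto
  have "e \<otimes> (\<one> \<oplus> (z \<otimes> i \<ominus> \<one>)) = z \<otimes> (e \<otimes> i)" if "i \<in> carrier K" for i using that e(1) ec(1) by algebra
  from this[of "inv e"] have "z = e \<otimes> (\<one> \<oplus> (z \<otimes> inv e \<ominus> \<one>))" using e ec by simp
  then show ?thesis using that e ec by blast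
qed

lemma asymp_k_form: assumes "e \<in> k" "e \<noteq> \<zero>" "m \<in> M" shows "e \<otimes> (\<one> \<oplus> m) \<in> asymp_k"
proof -
  have c: "e \<in> carrier K" "inv e \<in> carrier K" "m \<in> carrier K" using assms kc by auto
  have "\<one> \<oplus> m \<notin> M" by (rule unit_add_M[OF one_V one_not_M assms(3)])
  then have "\<one> \<oplus> m \<noteq> \<zero>" by auto
  moreover have "e \<otimes> (\<one> \<oplus> m) \<otimes> inv e \<ominus> \<one> = m"
  proof -
    have "e \<otimes> (\<one> \<oplus> m) \<otimes> i \<ominus> \<one> = (e \<otimes> i) \<otimes> (\<one> \<oplus> m) \<ominus> \<one>" if "i \<in> carrier K" for i using that c by algebra
    moreover have "(\<one> \<oplus> m) \<ominus> \<one> = m" using c by algebra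
    ultimately show ?thesis using c assms(2) by simp
  qed
  ultimately show ?thesis using c assms by (intro asymp_kI[of _ e]) (auto simp: integral_iff)
qed

lemma asymp_k_mult: assumes "a \<in> asymp_k" "b \<in> asymp_k" shows "a \<otimes> b \<in> asymp_k"
proof -
  obtain e m where e: "e \<in> k" "e \<noteq> \<zero>" "e \<in> carrier K" "m \<in> M" "a = e \<otimes> (\<one> \<oplus> m)" using assms(1) by (rule asymp_kE)
  obtain e' m' where e': "e' \<in> k" "e' \<noteq> \<zero>" "e' \<in> carrier K" "m' \<in> M" "b = e' \<otimes> (\<one> \<oplus> m')" using assms(2) by (rule asymp_kE)
  have mc: "m \<in> carrier K" "m' \<in> carrier K" using e e' by auto
  have "a \<otimes> b = (e \<otimes> e') \<otimes> (\<one> \<oplus> (m \<oplus> m' \<oplus> m \<otimes> m'))"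
    unfolding e(5) e'(5) using e(3) e'(3) mc by algebra
  moreover have "m \<oplus> m' \<oplus> m \<otimes> m' \<in> M" using e(4) e'(4) by (intro M_add M_mult) auto
  ultimately show ?thesis using asymp_k_form[of "e \<otimes> e'"] e e' k_sub(6) by (simp add: integral_iff)
qed

lemma asymp_k_inv: assumes "a \<in> asymp_k" shows "inv a \<in> asymp_k"
proof -
  obtain e m where e: "e \<in> k" "e \<noteq> \<zero>" "e \<in> carrier K" "m \<in> M" "a = e \<otimes> (\<one> \<oplus> m)" using assms by (rule asymp_kE)
  have u: "\<one> \<oplus> m \<in> V" "\<one> \<oplus> m \<notin> M" using e(4) unit_add_M[OF one_V one_not_M e(4)] by auto
  note i = unitD[OF u]
  have mc: "m \<in> carrier K" "inv (\<one> \<oplus> m) \<in> carrier K" using e i by auto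
  have "\<one> \<oplus> (\<ominus> m \<otimes> w) = w" if "w \<in> carrier K" "(\<one> \<oplus> m) \<otimes> w = \<one>" for w
  proof -
    have "(\<one> \<oplus> m) \<otimes> w \<oplus> (\<ominus> m \<otimes> w) = w" using that(1) mc by algebra
    then show ?thesis using that(2) by simp
  qed
  from this[of "inv (\<one> \<oplus> m)"] have w: "\<one> \<oplus> (\<ominus> m \<otimes> inv (\<one> \<oplus> m)) = inv (\<one> \<oplus> m)" using mc i by simp
  have "inv a = inv e \<otimes> inv (\<one> \<oplus> m)" unfolding e(5) using e i mc by (intro inv_mult) auto
  then have "inv a = inv e \<otimes> (\<one> \<oplus> (\<ominus> m \<otimes> inv (\<one> \<oplus> m)))" unfolding w .
  then show ?thesis using asymp_k_form[of "inv e" "\<ominus> m \<otimes> inv (\<one> \<oplus> m)"] e k_inv i by auto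
qed

lemma x_not_k: "d \<in> k \<Longrightarrow> x \<ominus> d \<noteq> \<zero>"
proof
  assume d: "d \<in> k" "x \<ominus> d = \<zero>"
  then have "x = d" using x kc by simp
  then have "\<not> transcendental k x" using algebraic_self[OF subfieldE(1)[OF subk'] d(1)] by (simp add: over_def)
  then show False using xtr by simp
qed

lemma pev_x_nonzero: "(\<And>i. i < n \<Longrightarrow> c i \<in> k) \<Longrightarrow> j < n \<Longrightarrow> c j \<noteq> \<zero> \<Longrightarrow> pev K c n x \<noteq> \<zero>"
  using algebraic_if_pev[OF subfieldE(1)[OF subk'] x, of n c] xtr by blast

text \<open>
  \<open>d\<close> is an approximate root, so up to an error whose value exceeds that of the polynomial at \<open>x\<close> the factor \<open>X - d\<close> splits off; induction on the degree does the rest.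
\<close>

lemma poly_in_asymp_k:
  assumes lin: "\<And>d. d \<in> k \<Longrightarrow> x \<ominus> d \<in> asymp_k"
    and c: "\<And>i. i \<le> n \<Longrightarrow> c i \<in> k" and n: "c n \<noteq> \<zero>"
  shows "pev K c (Suc n) x \<in> asymp_k"
  using c n
proof (induction n arbitrary: c)
  case 0
  have "c 0 \<in> carrier K" using 0 kc by simp
  then have "pev K c (Suc 0) x = c 0 \<otimes> (\<one> \<oplus> \<zero>)" by simp
  then show ?case using asymp_k_form[of "c 0" \<zero>] 0 by simp
next
  case (Suc n)
  have cc: "c i \<in> carrier K" if "i \<le> Suc n" for i using Suc.prems(1)[OF that] kc by simp
  define w where "w = pev K c (Suc (Suc n)) x"
  have wc: "w \<in> carrier K" unfolding w_def using cc x by (intro pev_closed) auto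
  have w0: "w \<noteq> \<zero>" unfolding w_def by (rule pev_x_nonzero[of _ c "Suc n"]) (use Suc.prems in auto)
  obtain \<epsilon> where \<epsilon>: "\<epsilon> \<in> k" "\<epsilon> \<noteq> \<zero>" "w \<otimes> inv \<epsilon> \<in> V" "w \<otimes> inv \<epsilon> \<notin> M" using value_in_k[OF wc w0] by blast
  have \<epsilon>c: "\<epsilon> \<in> carrier K" "inv \<epsilon> \<in> carrier K" using \<epsilon> kc by auto
  have "\<exists>d\<in>k. pev K c (Suc (Suc n)) d \<otimes> inv \<epsilon> \<in> M"
    using Suc.prems by (intro approx_root \<epsilon>(1,2)) auto
  then obtain d where d: "d \<in> k" "pev K c (Suc (Suc n)) d \<otimes> inv \<epsilon> \<in> M" by blast
  define \<pi> where "\<pi> = pev K c (Suc (Suc n)) d"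
  have dc: "d \<in> carrier K" using d kc by simp
  have \<pi>c: "\<pi> \<in> carrier K" unfolding \<pi>_def using cc dc by (intro pev_closed) auto
  have "\<exists>g. (\<forall>i<Suc n. g i \<in> k) \<and> (0 < Suc n \<longrightarrow> g (Suc n - 1) = c (Suc n)) \<and>
    (\<forall>z\<in>carrier K. pev K c (Suc (Suc n)) z = (z \<ominus> d) \<otimes> pev K g (Suc n) z \<oplus> pev K c (Suc (Suc n)) d)"
    using Suc.prems(1) by (intro pev_factor[OF subfieldE(1)[OF subk'] d(1)]) simp
  then obtain g where g: "\<forall>i<Suc n. g i \<in> k" "0 < Suc n \<longrightarrow> g (Suc n - 1) = c (Suc n)"
    "\<forall>z\<in>carrier K. pev K c (Suc (Suc n)) z = (z \<ominus> d) \<otimes> pev K g (Suc n) z \<oplus> pev K c (Suc (Suc n)) d" by (elim exE conjE)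
  have gG: "pev K g (Suc n) x \<in> asymp_k" using g(1,2) Suc.prems(2) by (intro Suc.IH) auto
  define w1 where "w1 = (x \<ominus> d) \<otimes> pev K g (Suc n) x"
  have w1G: "w1 \<in> asymp_k" unfolding w1_def by (rule asymp_k_mult[OF lin[OF d(1)] gG])
  have ww: "w = w1 \<oplus> \<pi>" using bspec[OF g(3) x] by (simp only: w_def w1_def \<pi>_def)
  obtain e m where e: "w1 \<in> carrier K" "w1 \<noteq> \<zero>" "e \<in> k" "e \<noteq> \<zero>" "e \<in> carrier K" "m \<in> M" "w1 = e \<otimes> (\<one> \<oplus> m)"
    using w1G by (rule asymp_kE)
  have ie: "inv e \<in> carrier K" using e by simp
  have u: "\<one> \<oplus> m \<in> V" "\<one> \<oplus> m \<notin> M" using e(6) unit_add_M[OF one_V one_not_M e(6)] by auto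
  have "w1 \<otimes> inv \<epsilon> = w \<otimes> inv \<epsilon> \<ominus> \<pi> \<otimes> inv \<epsilon>"
  proof -
    have "A \<otimes> i = (A \<oplus> B) \<otimes> i \<ominus> B \<otimes> i" if "A \<in> carrier K" "B \<in> carrier K" "i \<in> carrier K" for A B i
      using that by algebra
    then show ?thesis unfolding ww using e(1) \<pi>c \<epsilon>c by blast
  qed
  then have w1u: "w1 \<otimes> inv \<epsilon> \<in> V" "w1 \<otimes> inv \<epsilon> \<notin> M"
    using \<epsilon>(3,4) d(2) unit_add_M[OF \<epsilon>(3,4), of "\<ominus> (\<pi> \<otimes> inv \<epsilon>)"] by (auto simp: minus_eq \<pi>_def)
  have "(e \<otimes> inv \<epsilon>) \<otimes> (\<one> \<oplus> m) = w1 \<otimes> inv \<epsilon>" unfolding e(7) using e(5) \<epsilon>c u by (simp add: m_ac)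
  then have eu: "e \<otimes> inv \<epsilon> \<in> V" "e \<otimes> inv \<epsilon> \<notin> M"
    using w1u mult_unit_cancel[of "e \<otimes> inv \<epsilon>" "\<one> \<oplus> m"] u e(5) \<epsilon>c by auto
  have "\<pi> \<otimes> inv e = (\<pi> \<otimes> inv \<epsilon>) \<otimes> inv (e \<otimes> inv \<epsilon>)"
  proof -
    have "inv (e \<otimes> inv \<epsilon>) = \<epsilon> \<otimes> inv e" using e \<epsilon> \<epsilon>c by (simp add: inv_mult m_comm)
    then show ?thesis using div_chain[OF \<pi>c \<epsilon>c(1) \<epsilon>(2) e(5,4)] by simp
  qed
  then have \<pi>e: "\<pi> \<otimes> inv e \<in> M" using d(2) unitD[OF eu] by (auto simp: \<pi>_def)
  have "w = e \<otimes> (\<one> \<oplus> (m \<oplus> \<pi> \<otimes> inv e))"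
  proof -
    have "e \<otimes> (\<one> \<oplus> (m \<oplus> \<pi> \<otimes> i)) = e \<otimes> (\<one> \<oplus> m) \<oplus> \<pi> \<otimes> (e \<otimes> i)" if "i \<in> carrier K" for i
      using that e(5) M_closed[OF e(6)] \<pi>c by algebra
    from this[of "inv e"] show ?thesis unfolding ww e(7) using ie e(4,5) \<pi>c by simp
  qed
  moreover have "m \<oplus> \<pi> \<otimes> inv e \<in> M" using e(6) \<pi>e by (rule M_add)
  ultimately show ?case using asymp_k_form[OF e(3,4)] by (simp only: w_def)
qed

lemma k0_in_asymp_k:
  assumes lin: "\<And>d. d \<in> k \<Longrightarrow> x \<ominus> d \<in> asymp_k" and z: "z \<in> k0" "z \<noteq> \<zero>"
  shows "z \<in> asymp_k"
proof -
  have pol: "f \<in> asymp_k" if f: "f \<in> simple_extension k x" "f \<noteq> \<zero>" for f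
  proof -
    obtain c n where c: "\<forall>i<n. c i \<in> k" "f = pev K c n x"
      using f(1) unfolding simple_extension_pev[OF subfieldE(1)[OF subk'] x] by blast
    have "\<forall>i<n. c i \<in> k \<Longrightarrow> pev K c n x \<noteq> \<zero> \<Longrightarrow> pev K c n x \<in> asymp_k" for n
    proof (induction n)
      case (Suc n)
      show ?case
      proof (cases "c n = \<zero>")
        case True
        have "pev K c n x \<in> carrier K" using Suc.prems(1) kc x by (intro pev_closed) auto
        then have e: "pev K c (Suc n) x = pev K c n x" using True x by simp
        show ?thesis unfolding e using Suc.IH Suc.prems e by simp
      next
        case False
        then show ?thesis using Suc.prems(1) lin by (intro poly_in_asymp_k) auto
      qed
    qed simp
    then show ?thesis using c f(2) by simp
  qed
  obtain f g where fg: "f \<in> simple_extension k x" "g \<in> simple_extension k x" "g \<noteq> \<zero>" "z = f \<otimes> inv g"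
    using generate_field_fractions[OF subk' x z(1)] by blast
  have gc: "g \<in> carrier K" using fg(2) simple_extension_in_carrier[OF subfieldE(3)[OF subk'] x] by blast
  have "f \<noteq> \<zero>" using fg(4) z(2) gc fg(3) by auto
  then show ?thesis unfolding fg(4) using pol fg by (intro asymp_k_mult asymp_k_inv) auto
qed

lemma pth_root: "e \<in> k \<Longrightarrow> e \<noteq> \<zero> \<Longrightarrow> \<exists>g\<in>k. g \<noteq> \<zero> \<and> g [^] p = e"
  using nth_root_sep_closed[OF subk closed, of e p] nat_el_p prime_gt_0_nat[OF prime_p] by blast

text \<open>
  Suppose that no \<open>(x - d) / e\<close> is residually transcendental. Since \<open>kv\<close> is algebraically closed in the residue field, every \<open>x - d\<close> is asymptotic to an
  element of \<open>k\<close>, and hence so is every element of \<open>k(x)\<close>. In particular \<open>y ^ p\<close> is asymptotic to some \<open>g ^ p\<close>, so \<open>y / g\<close> has residue in \<open>kv\<close>,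
  and the residue field of \<open>K\<close> is \<open>kv\<close>. This contradicts the existence of a residually transcendental element.
\<close>

lemma exists_center:
  "\<exists>d\<in>k. \<exists>e\<in>k. e \<noteq> \<zero> \<and> res_transc k ((x \<ominus> d) \<otimes> inv e)"
proof (rule ccontr)
  assume no: "\<not> (\<exists>d\<in>k. \<exists>e\<in>k. e \<noteq> \<zero> \<and> res_transc k ((x \<ominus> d) \<otimes> inv e))"
  have lin: "x \<ominus> d \<in> asymp_k" if d: "d \<in> k" for d
  proof -
    have c: "x \<ominus> d \<in> carrier K" using x kc[OF d] by simp
    obtain e where e: "e \<in> k" "e \<noteq> \<zero>" "(x \<ominus> d) \<otimes> inv e \<in> V" "(x \<ominus> d) \<otimes> inv e \<notin> M"
      using value_in_k[OF c x_not_k[OF d]] by blast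
    define \<tau> where "\<tau> = (x \<ominus> d) \<otimes> inv e"
    have "\<not> res_transc k \<tau>" using no d e(1,2) unfolding \<tau>_def by blast
    then obtain b n j where b: "\<forall>i<n. b i \<in> k \<inter> V" "pev K b n \<tau> \<in> M" "j < n" "b j \<notin> M"
      using e(3) unfolding res_transc_def \<tau>_def[symmetric] by blast
    have "\<exists>r\<in>k \<inter> V. \<tau> \<ominus> r \<in> M"
      using b e(3) by (intro residue_root[of \<tau> n b j]) (auto simp: \<tau>_def)
    then obtain r where r: "r \<in> k" "r \<in> V" "\<tau> \<ominus> r \<in> M" by blast
    have tV: "\<tau> \<in> V" "\<tau> \<notin> M" using e by (auto simp: \<tau>_def)
    have tr: "\<tau> = r \<oplus> (\<tau> \<ominus> r)" using tV(1) r(2) V_closed by algebra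
    have rM: "r \<notin> M" using tr tV(2) r(3) M_add by metis
    note ir = unitD[OF r(2) rM]
    have rc: "r \<in> carrier K" "inv r \<in> carrier K" "e \<in> carrier K" "\<tau> \<in> carrier K" using r ir e kc tV by auto
    have m: "(\<tau> \<ominus> r) \<otimes> inv r \<in> M" using r(3) ir by blast
    have "x \<ominus> d = \<tau> \<otimes> e" unfolding \<tau>_def using c rc e by (simp add: div_cancel)
    also have "\<dots> = (e \<otimes> r) \<otimes> (\<one> \<oplus> (\<tau> \<ominus> r) \<otimes> inv r)"
    proof -
      have "(e \<otimes> r) \<otimes> (\<one> \<oplus> (\<tau> \<ominus> r) \<otimes> i) = e \<otimes> (r \<oplus> (\<tau> \<ominus> r) \<otimes> (r \<otimes> i))" if "i \<in> carrier K" for i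
        using that rc by algebra
      from this[of "inv r"] have "(e \<otimes> r) \<otimes> (\<one> \<oplus> (\<tau> \<ominus> r) \<otimes> inv r) = e \<otimes> (r \<oplus> (\<tau> \<ominus> r))" using rc ir by simp
      then show ?thesis using tr rc by (simp add: m_comm)
    qed
    finally show ?thesis using asymp_k_form[of "e \<otimes> r", OF _ _ m] e r ir rc k_sub(6) by (simp add: integral_iff)
  qed
  have "y [^] p \<noteq> \<zero>" by (rule pow_nonzero[OF y])
  with lin yp have "y [^] p \<in> asymp_k" by (rule k0_in_asymp_k)
  then obtain e m where e: "e \<in> k" "e \<noteq> \<zero>" "e \<in> carrier K" "m \<in> M" "y [^] p = e \<otimes> (\<one> \<oplus> m)" by (rule asymp_kE)
  obtain g where g: "g \<in> k" "g \<noteq> \<zero>" "g [^] p = e" using pth_root[OF e(1,2)] by blast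
  define s where "s = y \<otimes> inv g"
  note gs = gen_s[OF kk0[OF g(1)] g(2) s_def]
  have mc: "m \<in> carrier K" using e by simp
  have "s [^] p = \<one> \<oplus> m"
  proof -
    have "e \<otimes> (\<one> \<oplus> m) \<otimes> i = (e \<otimes> i) \<otimes> (\<one> \<oplus> m)" if "i \<in> carrier K" for i using that e(3) mc by algebra
    then show ?thesis unfolding gs(3) g(3) e(5) using e mc by simp
  qed
  moreover have "(\<one> \<oplus> m) \<ominus> \<one> = m" using mc by algebra
  ultimately have s1: "s [^] p \<ominus> \<one> \<in> M" and u: "s [^] p \<in> V" "s [^] p \<notin> M"
    using e(4) unit_add_M[OF one_V one_not_M e(4)] by auto
  have kv: "kummer_val K V k0 s \<zeta> p" by (rule kummer_valI[OF kk0[OF g(1)] g(2) s_def u])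
  have sk: "res s \<in> resF k" by (rule res_power_mem[OF kv s1])
  have F: "subfield (resF k) RF" by (rule resF_subfield[OF subk'])
  have "resF k0 \<subseteq> resF k"
  proof
    fix r assume "r \<in> resF k0"
    then obtain z where z: "z \<in> V" "z \<in> k0" "r = res z" by (auto simp: resF_def)
    show "r \<in> resF k"
    proof (cases "z = \<zero>")
      case True
      then show ?thesis using z(3) subringE(2)[OF subfieldE(1)[OF F]] by simp
    next
      case False
      with lin z(2) have "z \<in> asymp_k" by (rule k0_in_asymp_k)
      then obtain e m where e: "e \<in> k" "e \<noteq> \<zero>" "e \<in> carrier K" "m \<in> M" "z = e \<otimes> (\<one> \<oplus> m)" by (rule asymp_kE)
      have u: "\<one> \<oplus> m \<in> V" "\<one> \<oplus> m \<notin> M" using e(4) unit_add_M[OF one_V one_not_M e(4)] by auto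
      have eV: "e \<in> V" using z(1) mult_unit_cancel(1)[OF e(3) u] e(5) by simp
      have "res z = res e" unfolding e(5) using eV e(4) res_eq_zero_iff[of m] by simp
      then show ?thesis using z(3) eV e(1) by (auto simp: resF_def)
    qed
  qed
  then have "insert (res s) (resF k0) \<subseteq> resF k" using sk by blast
  moreover have "insert (res s) (resF k0) \<subseteq> carrier RF"
    using calculation subfieldE(3)[OF F] by blast
  ultimately have "generate_field RF (insert (res s) (resF k0)) \<subseteq> resF k"
    using F by (intro RF.generate_field_min_subfield1)
  then have all: "carrier RF \<subseteq> resF k" using kummer_val.carrier_RF_generated[OF kv] by blast
  obtain t where T: "res_transc k t" using rt by blast
  have "res t \<in> resF k" using all res_transc_V[OF T] by auto
  then have "\<not> RF.transcendental (resF k) (res t)"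
    using RF.algebraic_self[OF subfieldE(1)[OF F]] by (simp add: over_def)
  then show False using res_transc_iff[OF subk' res_transc_V[OF T]] T by simp
qed

end

section \<open>Taylor expansion\<close>

text \<open>
  The remainder is kept in a subring, which will be \<open>V\<close> or \<open>k \<inter> V\<close>.
\<close>

lemma (in cring) taylor1:
  assumes A: "subring A R" and d: "d \<in> A" and h: "h \<in> A"
  shows "\<exists>r\<in>A. (d \<oplus> h) [^] Suc m = d [^] Suc m \<oplus> nat_el R (Suc m) \<otimes> d [^] m \<otimes> h \<oplus> h \<otimes> h \<otimes> r"
proof -
  note As = subringE[OF A]
  have c: "d \<in> carrier R" "h \<in> carrier R" using As(1) d h by auto
  have pA: "d [^] n \<in> A" for n :: nat by (induction n) (auto intro: As(3,6) d)
  have nA: "nat_el R n \<in> A" for n by (induction n) (auto intro: As(2,3,7))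
  show ?thesis
  proof (induction m)
    case 0
    show ?case using c As(2) by (intro bexI[of _ \<zero>]) (simp_all add: l_one)
  next
    case (Suc m)
    then obtain r where r: "r \<in> A"
      "(d \<oplus> h) [^] Suc m = d [^] Suc m \<oplus> nat_el R (Suc m) \<otimes> d [^] m \<otimes> h \<oplus> h \<otimes> h \<otimes> r" by blast
    define r' where "r' = nat_el R (Suc m) \<otimes> d [^] m \<oplus> (d \<oplus> h) \<otimes> r"
    have r'A: "r' \<in> A" unfolding r'_def using nA[of "Suc m"] pA r(1) d h by (intro As(6,7))
    have rc: "r \<in> carrier R" using r As(1) by blast
    have "(D \<otimes> d \<oplus> N \<otimes> D \<otimes> h \<oplus> h \<otimes> h \<otimes> r) \<otimes> (d \<oplus> h) =
      D \<otimes> d \<otimes> d \<oplus> (N \<oplus> \<one>) \<otimes> (D \<otimes> d) \<otimes> h \<oplus> h \<otimes> h \<otimes> (N \<otimes> D \<oplus> (d \<oplus> h) \<otimes> r)"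
      if "D \<in> carrier R" "N \<in> carrier R" for D N using that c rc by algebra
    from this[of "d [^] m" "nat_el R (Suc m)"] c r(2) r'A show ?case
      by (intro bexI[of _ r']) (simp_all add: r'_def)
  qed
qed

text \<open>
  The binomial coefficient stands for half of the second derivative, which makes sense also where 2 is not invertible.
\<close>

lemma (in cring) taylor2:
  assumes A: "subring A R" and d: "d \<in> A" and h: "h \<in> A"
  shows "\<exists>r\<in>A. (d \<oplus> h) [^] Suc (Suc m) = d [^] Suc (Suc m) \<oplus> nat_el R (Suc (Suc m)) \<otimes> d [^] Suc m \<otimes> h
    \<oplus> nat_el R (Suc (Suc m) choose 2) \<otimes> d [^] m \<otimes> (h \<otimes> h) \<oplus> h \<otimes> h \<otimes> h \<otimes> r"
proof -
  note As = subringE[OF A]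
  have c: "d \<in> carrier R" "h \<in> carrier R" using As(1) d h by auto
  have pA: "d [^] n \<in> A" for n :: nat by (induction n) (auto intro: As(3,6) d)
  have nA: "nat_el R n \<in> A" for n by (induction n) (auto intro: As(2,3,7))
  show ?thesis
  proof (induction m)
    case 0
    have "(d \<oplus> h) \<otimes> (d \<oplus> h) = d \<otimes> d \<oplus> (\<one> \<oplus> \<one>) \<otimes> d \<otimes> h \<oplus> \<one> \<otimes> \<one> \<otimes> (h \<otimes> h) \<oplus> h \<otimes> h \<otimes> h \<otimes> \<zero>"
      using c by algebra
    then show ?case using c As(2) by (intro bexI[of _ \<zero>]) (simp_all add: numeral_2_eq_2)
  next
    case (Suc m)
    let ?C = "\<lambda>n. nat_el R (n choose 2)"
    obtain r where r: "r \<in> A"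
      "(d \<oplus> h) [^] Suc (Suc m) = d [^] Suc (Suc m) \<oplus> nat_el R (Suc (Suc m)) \<otimes> d [^] Suc m \<otimes> h
        \<oplus> ?C (Suc (Suc m)) \<otimes> d [^] m \<otimes> (h \<otimes> h) \<oplus> h \<otimes> h \<otimes> h \<otimes> r" using Suc by blast
    have CS: "?C (Suc (Suc (Suc m))) = nat_el R (Suc (Suc m)) \<oplus> ?C (Suc (Suc m))"
      using nat_el_add[of "Suc (Suc m)" "Suc (Suc m) choose 2"] by (simp add: numeral_2_eq_2 del: nat_el_add)
    have rc: "r \<in> carrier R" using r As(1) by blast
    define r' where "r' = ?C (Suc (Suc m)) \<otimes> d [^] m \<oplus> (d \<oplus> h) \<otimes> r"
    have r'A: "r' \<in> A" unfolding r'_def using nA[of "Suc (Suc m) choose 2"] pA r(1) d h by (intro As(6,7))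
    have "(D \<otimes> d \<otimes> d \<oplus> N \<otimes> (D \<otimes> d) \<otimes> h \<oplus> C \<otimes> D \<otimes> (h \<otimes> h) \<oplus> h \<otimes> h \<otimes> h \<otimes> r) \<otimes> (d \<oplus> h) =
      D \<otimes> d \<otimes> d \<otimes> d \<oplus> (N \<oplus> \<one>) \<otimes> (D \<otimes> d \<otimes> d) \<otimes> h \<oplus> (N \<oplus> C) \<otimes> (D \<otimes> d) \<otimes> (h \<otimes> h)
      \<oplus> h \<otimes> h \<otimes> h \<otimes> (C \<otimes> D \<oplus> (d \<oplus> h) \<otimes> r)"
      if "D \<in> carrier R" "N \<in> carrier R" "C \<in> carrier R" for D N C using that c rc by algebra
    from this[of "d [^] m" "nat_el R (Suc (Suc m))" "?C (Suc (Suc m))"]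
    have "(d \<oplus> h) [^] Suc (Suc (Suc m)) = d [^] Suc (Suc (Suc m)) \<oplus> nat_el R (Suc (Suc (Suc m))) \<otimes> d [^] Suc (Suc m) \<otimes> h
      \<oplus> ?C (Suc (Suc (Suc m))) \<otimes> d [^] Suc m \<otimes> (h \<otimes> h) \<oplus> h \<otimes> h \<otimes> h \<otimes> r'"
      unfolding r'_def nat_pow_Suc[of "d \<oplus> h" "Suc (Suc m)"] r(2) CS using c by simp
    then show ?case using r'A by blast
  qed
qed

context sep_val begin

lemma res_transcD: "res_transc k t \<Longrightarrow> \<forall>i<n. c i \<in> k \<inter> V \<Longrightarrow> pev K c n t \<in> M \<Longrightarrow> i < n \<Longrightarrow> c i \<in> M"
  unfolding res_transc_def by blast

text \<open>
  A rephrasing of \<open>residue_root\<close>: residues that are algebraic over \<open>kv\<close> already lie in \<open>kv\<close>.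
\<close>

lemma residue_transc_or:
  assumes t: "t \<in> V" shows "\<not> res_transc k t \<longleftrightarrow> (\<exists>r\<in>k \<inter> V. t \<ominus> r \<in> M)"
proof
  assume "\<not> res_transc k t"
  then obtain b n j where b: "\<forall>i<n. b i \<in> k \<inter> V" "pev K b n t \<in> M" "j < n" "b j \<notin> M"
    using t unfolding res_transc_def by blast
  show "\<exists>r\<in>k \<inter> V. t \<ominus> r \<in> M" using b t by (intro residue_root[of t n b j]) auto
next
  assume "\<exists>r\<in>k \<inter> V. t \<ominus> r \<in> M"
  then obtain r where r: "r \<in> k" "r \<in> V" "t \<ominus> r \<in> M" by blast
  let ?c = "\<lambda>i :: nat. if i = 0 then \<ominus> r else \<one>"
  have "pev K ?c 2 t = t \<ominus> r" using r t by (simp add: numeral_2_eq_2 minus_eq a_comm)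
  moreover have "\<forall>i<2. ?c i \<in> k \<inter> V" using r k_sub(3,5) by auto
  moreover have "?c 1 \<notin> M" by simp
  ultimately show "\<not> res_transc k t" using r(3) res_transcD[of t 2 ?c 1] by auto
qed

lemma res_transc_linear:
  assumes T: "res_transc k t" and a: "\<alpha> \<in> k \<inter> V" and b: "\<beta> \<in> k \<inter> V" and u: "\<alpha> \<notin> M \<or> \<beta> \<notin> M"
  shows "\<alpha> \<oplus> \<beta> \<otimes> t \<notin> M"
proof
  let ?c = "\<lambda>i :: nat. if i = 0 then \<alpha> else \<beta>"
  assume "\<alpha> \<oplus> \<beta> \<otimes> t \<in> M"
  moreover have "pev K ?c 2 t = \<alpha> \<oplus> \<beta> \<otimes> t" using a b res_transc_V[OF T] by (simp add: numeral_2_eq_2)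
  ultimately have m: "pev K ?c 2 t \<in> M" by simp
  have "\<forall>i<2. ?c i \<in> k \<inter> V" using a b by auto
  then have "?c 0 \<in> M" "?c 1 \<in> M" using res_transcD[OF T _ m, of 0] res_transcD[OF T _ m, of 1] by auto
  then show False using u by simp
qed

lemma res_transc_affine:
  assumes T: "res_transc k t" and u: "u \<in> k \<inter> V" "u \<notin> M" and r: "r \<in> k \<inter> V"
  shows "res_transc k (u \<otimes> t \<oplus> r)"
proof (rule ccontr)
  assume n: "\<not> res_transc k (u \<otimes> t \<oplus> r)"
  have tV: "t \<in> V" using res_transc_V[OF T] .
  obtain q where q: "q \<in> k" "q \<in> V" "(u \<otimes> t \<oplus> r) \<ominus> q \<in> M"
    using n residue_transc_or[of "u \<otimes> t \<oplus> r"] u r tV by blast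
  have "t \<in> carrier K" "q \<in> carrier K" "u \<in> carrier K" "r \<in> carrier K" using u r tV q by auto
  then have "(u \<otimes> t \<oplus> r) \<ominus> q = (r \<ominus> q) \<oplus> u \<otimes> t" by algebra
  moreover have "(r \<ominus> q) \<oplus> u \<otimes> t \<notin> M" using u r q k_diff by (intro res_transc_linear[OF T]) auto
  ultimately show False using q by simp
qed

end

section \<open>The normal form\<close>

context cring begin

text \<open>
  The polynomial \<open>X ^ p + X + c\<close>, its derivative and half of its second derivative.
\<close>

definition tri :: "nat \<Rightarrow> 'a \<Rightarrow> 'a \<Rightarrow> 'a" where "tri p c z = z [^] p \<oplus> z \<oplus> c"
definition tri1 :: "nat \<Rightarrow> 'a \<Rightarrow> 'a" where "tri1 p z = nat_el R p \<otimes> z [^] (p - 1) \<oplus> \<one>"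
definition tri2 :: "nat \<Rightarrow> 'a \<Rightarrow> 'a" where "tri2 p z = nat_el R (p choose 2) \<otimes> z [^] (p - 2)"

lemma tri_closed [simp]: "z \<in> carrier R \<Longrightarrow> c \<in> carrier R \<Longrightarrow> tri p c z \<in> carrier R"
  "z \<in> carrier R \<Longrightarrow> tri1 p z \<in> carrier R" "z \<in> carrier R \<Longrightarrow> tri2 p z \<in> carrier R"
  by (simp_all add: tri_def tri1_def tri2_def)

lemma tri_subring:
  assumes A: "subring A R" and z: "z \<in> A"
  shows "c \<in> A \<Longrightarrow> tri p c z \<in> A" "tri1 p z \<in> A" "tri2 p z \<in> A"
proof -
  note As = subringE[OF A]
  have pA: "z [^] n \<in> A" for n :: nat by (induction n) (auto intro: As(3,6) z)
  have nA: "nat_el R n \<in> A" for n by (induction n) (auto intro: As(2,3,7))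
  show "c \<in> A \<Longrightarrow> tri p c z \<in> A" unfolding tri_def using pA z by (intro As(7))
  show "tri1 p z \<in> A" unfolding tri1_def using pA nA by (intro As(3,6,7))
  show "tri2 p z \<in> A" unfolding tri2_def using pA nA by (intro As(6))
qed

lemma tri2_double:
  assumes "2 \<le> p" "d \<in> carrier R"
  shows "nat_el R 2 \<otimes> tri2 p d = nat_el R p \<otimes> nat_el R (p - 1) \<otimes> d [^] (p - 2)"
proof -
  have "2 * (p choose 2) = p * (p - 1)" unfolding choose_two by (rule dvd_mult_div_cancel) auto
  then have "nat_el R 2 \<otimes> nat_el R (p choose 2) = nat_el R p \<otimes> nat_el R (p - 1)"
    by (simp only: nat_el_mult[symmetric])
  then show ?thesis unfolding tri2_def using assms by (simp add: m_assoc[symmetric])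
qed

lemma taylor_tri:
  assumes A: "subring A R" and d: "d \<in> A" and h: "h \<in> A" and c: "c \<in> carrier R" and p: "2 \<le> p"
  shows "\<exists>r\<in>A. tri p c (d \<oplus> h) = tri p c d \<oplus> tri1 p d \<otimes> h \<oplus> tri2 p d \<otimes> (h \<otimes> h) \<oplus> h \<otimes> h \<otimes> h \<otimes> r"
proof -
  obtain m where m: "p = Suc (Suc m)" using p by (metis Suc_le_D numeral_2_eq_2 Suc_le_mono)
  have cc: "d \<in> carrier R" "h \<in> carrier R" using subringE(1)[OF A] d h by auto
  obtain r where r: "r \<in> A" "(d \<oplus> h) [^] Suc (Suc m) = d [^] Suc (Suc m) \<oplus> nat_el R (Suc (Suc m)) \<otimes> d [^] Suc m \<otimes> h
    \<oplus> nat_el R (Suc (Suc m) choose 2) \<otimes> d [^] m \<otimes> (h \<otimes> h) \<oplus> h \<otimes> h \<otimes> h \<otimes> r"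
    using taylor2[OF A d h, of m] by blast
  have rc: "r \<in> carrier R" using r subringE(1)[OF A] by blast
  have "(P \<oplus> N \<otimes> Q \<otimes> h \<oplus> S \<otimes> (h \<otimes> h) \<oplus> h \<otimes> h \<otimes> h \<otimes> r) \<oplus> (d \<oplus> h) \<oplus> c =
    (P \<oplus> d \<oplus> c) \<oplus> (N \<otimes> Q \<oplus> \<one>) \<otimes> h \<oplus> S \<otimes> (h \<otimes> h) \<oplus> h \<otimes> h \<otimes> h \<otimes> r"
    if "P \<in> carrier R" "N \<in> carrier R" "Q \<in> carrier R" "S \<in> carrier R" for P N Q S
    using that cc rc c by algebra
  from this[of "d [^] Suc (Suc m)" "nat_el R (Suc (Suc m))" "d [^] Suc m" "nat_el R (Suc (Suc m) choose 2) \<otimes> d [^] m"]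
  have "tri p c (d \<oplus> h) = tri p c d \<oplus> tri1 p d \<otimes> h \<oplus> tri2 p d \<otimes> (h \<otimes> h) \<oplus> h \<otimes> h \<otimes> h \<otimes> r"
    unfolding tri_def tri1_def tri2_def m r(2) diff_Suc_1 using cc
    by (simp del: nat_pow_Suc add.nat_pow_Suc binomial_Suc_Suc add: numeral_2_eq_2)
  then show ?thesis using r(1) by blast
qed

lemma taylor_tri1:
  assumes A: "subring A R" and d: "d \<in> A" and h: "h \<in> A" and p: "2 \<le> p"
  shows "\<exists>r\<in>A. tri1 p (d \<oplus> h) = tri1 p d \<oplus> (nat_el R 2 \<otimes> tri2 p d) \<otimes> h \<oplus> h \<otimes> h \<otimes> r"
proof -
  obtain m where m: "p = Suc (Suc m)" using p by (metis Suc_le_D numeral_2_eq_2 Suc_le_mono)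
  note As = subringE[OF A]
  have cc: "d \<in> carrier R" "h \<in> carrier R" using As(1) d h by auto
  have nA: "nat_el R n \<in> A" for n by (induction n) (auto intro: As(2,3,7))
  obtain r where r: "r \<in> A" "(d \<oplus> h) [^] Suc m = d [^] Suc m \<oplus> nat_el R (Suc m) \<otimes> d [^] m \<otimes> h \<oplus> h \<otimes> h \<otimes> r"
    using taylor1[OF A d h, of m] by blast
  have rc: "r \<in> carrier R" using r As(1) by blast
  have "N \<otimes> (P \<oplus> S \<otimes> Q \<otimes> h \<oplus> h \<otimes> h \<otimes> r) \<oplus> \<one> = (N \<otimes> P \<oplus> \<one>) \<oplus> (N \<otimes> S \<otimes> Q) \<otimes> h \<oplus> h \<otimes> h \<otimes> (N \<otimes> r)"
    if "P \<in> carrier R" "N \<in> carrier R" "Q \<in> carrier R" "S \<in> carrier R" for P N Q S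
    using that cc rc by algebra
  from this[of "d [^] Suc m" "nat_el R p" "d [^] m" "nat_el R (Suc m)"]
  have "tri1 p (d \<oplus> h) = tri1 p d \<oplus> (nat_el R p \<otimes> nat_el R (p - 1) \<otimes> d [^] (p - 2)) \<otimes> h \<oplus> h \<otimes> h \<otimes> (nat_el R p \<otimes> r)"
    unfolding tri1_def m diff_Suc_1 r(2) using cc
    by (simp del: nat_pow_Suc add.nat_pow_Suc add: numeral_2_eq_2)
  then show ?thesis unfolding tri2_double[OF p cc(1)] using r(1) nA As(6) by blast
qed

end

context val_ring_field begin

text \<open>
  \<open>p d ^ (p - 1)\<close> is congruent to \<open>-1\<close>, so \<open>d\<close> is a unit, and \<open>2 (p choose 2) = p (p - 1)\<close> is one. In particular 2 is a unit and the square can be completed.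
\<close>

lemma tri2_unit:
  assumes d: "d \<in> V" and m: "tri1 p d \<in> M" and p: "2 \<le> p" "nat_el K p \<notin> M" "nat_el K (p - 1) \<notin> M"
  shows "tri2 p d \<notin> M" "nat_el K 2 \<notin> M"
proof -
  have dM: "d \<notin> M"
  proof
    assume "d \<in> M"
    then have "nat_el K p \<otimes> d [^] (p - 1) \<in> M" using p(1) by (intro M_mult M_pow) auto
    then have "\<one> \<oplus> nat_el K p \<otimes> d [^] (p - 1) \<notin> M" by (rule unit_add_M[OF one_V one_not_M])
    then show False using m d by (simp add: tri1_def a_comm)
  qed
  have "nat_el K p \<otimes> nat_el K (p - 1) \<otimes> d [^] (p - 2) \<notin> M"
    using d dM p(2,3) by (intro unit_mult unit_pow) auto
  then have u: "nat_el K 2 \<otimes> tri2 p d \<notin> M" using tri2_double[OF p(1)] d by simp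
  have V: "tri2 p d \<in> V" using d by (simp add: tri2_def)
  show "tri2 p d \<notin> M" using u M_mult[of "nat_el K 2" "tri2 p d"] by (meson V_nat_el)
  show "nat_el K 2 \<notin> M" using u M_mult_r[of "nat_el K 2" "tri2 p d"] V by blast
qed

text \<open>
  \<open>f(d)\<close> has exactly the value of \<open>e ^ 2\<close>, and \<open>f'(d)\<close> has larger value than \<open>e\<close>. Then for \<open>x = d + e t\<close> the residue of \<open>f(x) / e ^ 2\<close> is \<open>A + D t ^ 2\<close> with \<open>A\<close> and \<open>D\<close> nonzero.
\<close>

definition near_double_root :: "'a set \<Rightarrow> nat \<Rightarrow> 'a \<Rightarrow> 'a \<Rightarrow> 'a \<Rightarrow> bool" where
  "near_double_root k p c d e \<longleftrightarrow> d \<in> k \<inter> V \<and> e \<in> k \<and> e \<in> M \<and> e \<noteq> \<zero> \<and>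
     tri1 p d \<otimes> inv e \<in> M \<and> tri p c d \<otimes> inv (e \<otimes> e) \<in> V \<and> tri p c d \<otimes> inv (e \<otimes> e) \<notin> M"

end

locale normal_curve = curve_val K V k x y \<zeta> p for K (structure) and V k x y \<zeta> p +
  fixes c :: 'a
  assumes cV: "c \<in> k \<inter> V" and eq: "y [^] p = tri p c x" and p1M: "nat_el K (p - 1) \<notin> M"
begin

lemma p2: "2 \<le> p" using prime_p prime_ge_2_nat by blast

lemma t_k0:
  assumes d: "d \<in> k" and e: "e \<in> k" "e \<noteq> \<zero>" shows "(x \<ominus> d) \<otimes> inv e \<in> k0"
  unfolding minus_eq using xk0 kk0[OF d] kk0[OF k_inv[OF e]] by (intro k0_sub(6,7,5))

lemma expand_x:
  assumes d: "d \<in> k \<inter> V" and e: "e \<in> k" "e \<noteq> \<zero>" "e \<in> V" and t: "t = (x \<ominus> d) \<otimes> inv e" "t \<in> V"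
  shows "\<exists>r\<in>V. y [^] p = tri p c d \<oplus> tri1 p d \<otimes> (e \<otimes> t) \<oplus> tri2 p d \<otimes> ((e \<otimes> t) \<otimes> (e \<otimes> t))
    \<oplus> (e \<otimes> t) \<otimes> (e \<otimes> t) \<otimes> (e \<otimes> t) \<otimes> r"
proof -
  have cc: "d \<in> carrier K" "e \<in> carrier K" "c \<in> carrier K" "t \<in> carrier K" using d e cV t by auto
  have "e \<otimes> t = x \<ominus> d" using cc x e by (simp add: t(1) m_comm[of e] div_cancel)
  moreover have "x = d \<oplus> (x \<ominus> d)" using x cc by algebra
  ultimately have xe: "x = d \<oplus> e \<otimes> t" by simp
  have V: "d \<in> V" "e \<otimes> t \<in> V" using d e(3) t(2) by auto
  show ?thesis using taylor_tri[OF subV V cc(3) p2] unfolding eq xe[symmetric] .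
qed

end

locale nonruled_curve = normal_curve +
  assumes td: "trdeg_one RF (resF k)" and nr: "\<not> ruled RF (resF k)"
begin

lemma no_pow: "g \<in> k0 \<Longrightarrow> g \<noteq> \<zero> \<Longrightarrow> y [^] p \<otimes> inv (g [^] p) \<ominus> \<one> \<notin> M"
proof
  assume g: "g \<in> k0" "g \<noteq> \<zero>" and m: "y [^] p \<otimes> inv (g [^] p) \<ominus> \<one> \<in> M"
  obtain d e where de: "d \<in> k" "e \<in> k" "e \<noteq> \<zero>" "res_transc k ((x \<ominus> d) \<otimes> inv e)"
    using exists_center by blast
  have "ruled RF (resF k)"
    by (rule ruled_if_pow_one[OF td de(1-3) refl de(4) g refl]) (use m gen_s(3)[OF g refl] in simp)
  then show False using nr by simp
qed

lemma no_const: "\<epsilon> \<in> k \<Longrightarrow> \<epsilon> \<noteq> \<zero> \<Longrightarrow> y [^] p \<otimes> inv \<epsilon> \<ominus> \<one> \<notin> M"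
  using pth_root[of \<epsilon>] no_pow kk0 by metis

text \<open>
  A residual equation \<open>s ^ p = \<alpha> + \<beta> t\<close> makes the residue field rational, generated by \<open>s\<close> if \<open>\<beta> \<noteq> 0\<close> and by \<open>t\<close> otherwise.
\<close>

lemma no_linear:
  assumes d: "d \<in> k" and e: "e \<in> k" "e \<noteq> \<zero>" and t: "t = (x \<ominus> d) \<otimes> inv e" and T: "res_transc k t"
    and eps: "\<epsilon> \<in> k" "\<epsilon> \<noteq> \<zero>" and a: "\<alpha> \<in> k \<inter> V" and b: "\<beta> \<in> k \<inter> V" and u: "\<alpha> \<notin> M \<or> \<beta> \<notin> M"
    and m: "y [^] p \<otimes> inv \<epsilon> \<ominus> (\<alpha> \<oplus> \<beta> \<otimes> t) \<in> M"
  shows False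
proof -
  have tV: "t \<in> V" by (rule res_transc_V[OF T])
  have cc: "\<epsilon> \<in> carrier K" "inv \<epsilon> \<in> carrier K" "\<alpha> \<in> carrier K" "\<beta> \<in> carrier K" "t \<in> carrier K" "y [^] p \<in> carrier K"
    using eps a b tV y kc by auto
  define w where "w = y [^] p \<otimes> inv \<epsilon>"
  have wc: "w \<in> carrier K" using cc by (simp add: w_def)
  have abV: "\<alpha> \<oplus> \<beta> \<otimes> t \<in> V" using a b tV by auto
  have abM: "\<alpha> \<oplus> \<beta> \<otimes> t \<notin> M" by (rule res_transc_linear[OF T a b u])
  have "w = (\<alpha> \<oplus> \<beta> \<otimes> t) \<oplus> (w \<ominus> (\<alpha> \<oplus> \<beta> \<otimes> t))" using wc cc by algebra
  then have wV: "w \<in> V" "w \<notin> M" using m abV unit_add_M[OF abV abM] unfolding w_def[symmetric] by (metis V_add M_V)+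
  show False
  proof (cases "\<beta> \<in> M")
    case True
    then have aM: "\<alpha> \<notin> M" using u by simp
    have aV: "\<alpha> \<in> V" "\<alpha> \<in> k" using a by auto
    note ia = unitD[OF aV(1) aM]
    have "w \<otimes> i \<ominus> \<alpha> \<otimes> i = ((w \<ominus> (\<alpha> \<oplus> \<beta> \<otimes> t)) \<oplus> \<beta> \<otimes> t) \<otimes> i" if "i \<in> carrier K" for i
      using that wc cc by algebra
    from this[of "inv \<alpha>"] have "w \<otimes> inv \<alpha> \<ominus> \<one> = ((w \<ominus> (\<alpha> \<oplus> \<beta> \<otimes> t)) \<oplus> \<beta> \<otimes> t) \<otimes> inv \<alpha>" using ia cc by simp
    also have "\<dots> \<in> M" using m True tV ia by (intro M_mult_r M_add) (auto simp: w_def)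
    finally have "w \<otimes> inv \<alpha> \<ominus> \<one> \<in> M" .
    moreover have "w \<otimes> inv \<alpha> = y [^] p \<otimes> inv (\<epsilon> \<otimes> \<alpha>)" unfolding w_def using cc ia eps by (simp add: inv_mult m_assoc)
    ultimately show False using no_const[of "\<epsilon> \<otimes> \<alpha>"] eps aV ia cc k_sub(6) by (simp add: integral_iff)
  next
    case False
    obtain g where g: "g \<in> k" "g \<noteq> \<zero>" "g [^] p = \<epsilon>" using pth_root[OF eps] by blast
    define s where "s = y \<otimes> inv g"
    note S = gen_s[OF kk0[OF g(1)] g(2) s_def]
    have sp: "s [^] p = w" unfolding S(3) g(3) w_def ..
    have kv: "kummer_val K V k0 s \<zeta> p"
      by (rule kummer_valI[OF kk0[OF g(1)] g(2) s_def]) (use sp wV in auto)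
    have sV: "s \<in> V" by (rule kummer_val.sV[OF kv])
    have bV: "\<beta> \<in> V" "\<beta> \<in> k" "\<alpha> \<in> k" "\<alpha> \<in> V" using a b by auto
    note ib = unitD[OF bV(1) False]
    have "t \<otimes> (\<beta> \<otimes> i) \<ominus> (w \<ominus> \<alpha>) \<otimes> i = \<ominus> ((w \<ominus> (\<alpha> \<oplus> \<beta> \<otimes> t)) \<otimes> i)" if "i \<in> carrier K" for i
      using that wc cc by algebra
    from this[of "inv \<beta>"] have "t \<ominus> (w \<ominus> \<alpha>) \<otimes> inv \<beta> = \<ominus> ((w \<ominus> (\<alpha> \<oplus> \<beta> \<otimes> t)) \<otimes> inv \<beta>)" using ib cc by simp
    also have "\<dots> \<in> M" using m ib by (intro M_minus M_mult_r) (auto simp: w_def)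
    finally have "res t = res ((s [^] p \<oplus> \<ominus> \<alpha>) \<otimes> inv \<beta>)"
      using res_eq_iff[of t "(w \<ominus> \<alpha>) \<otimes> inv \<beta>"] tV wV bV ib sp by (simp add: minus_eq)
    also have "\<dots> = (res s [^]\<^bsub>RF\<^esub> p \<oplus>\<^bsub>RF\<^esub> \<ominus>\<^bsub>RF\<^esub> res \<alpha>) \<otimes>\<^bsub>RF\<^esub> res (inv \<beta>)"
      using sV bV ib by simp
    finally have rt: "res t = (res s [^]\<^bsub>RF\<^esub> p \<oplus>\<^bsub>RF\<^esub> \<ominus>\<^bsub>RF\<^esub> res \<alpha>) \<otimes>\<^bsub>RF\<^esub> res (inv \<beta>)" .
    let ?G = "generate_field RF (insert (res s) (resF k))"
    have G: "subfield ?G RF" using RF.generate_field_is_subfield[of "insert (res s) (resF k)"]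
      subfieldE(3)[OF resF_subfield[OF subk]] sV by auto
    note Gs = subringE[OF subfieldE(1)[OF G]]
    have in1: "res z \<in> ?G" if "z \<in> k" "z \<in> V" for z
      using that by (auto simp: resF_def intro!: generate_field.incl)
    have in2: "res s \<in> ?G" by (auto intro: generate_field.incl)
    have in3: "res s [^]\<^bsub>RF\<^esub> n \<in> ?G" for n :: nat by (induction n) (auto intro: Gs(3,6) in2)
    have rtG: "res t \<in> ?G" unfolding rt
      by (intro Gs(6,7,5) in3 in1 bV k_inv) (use ib in auto)
    have "ruled RF (resF k)"
      by (rule ruled_if_both[OF td d e t T kv _ rtG in2]) (use sV in simp)
    then show False using nr by simp
  qed
qed

text \<open>
  The same holds for \<open>s ^ p = D t ^ 2\<close>. For \<open>p = 2\<close> the quotient \<open>s / t\<close> has residue in \<open>kv\<close>. For odd \<open>p = 2 n + 1\<close> the curve is a cusp, parametrised by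
  \<open>\<tau> = t / s ^ n\<close>: then \<open>s = D \<tau> ^ 2\<close> and \<open>t = \<tau> s ^ n\<close>.
\<close>

lemma no_square:
  assumes d: "d \<in> k" and e: "e \<in> k" "e \<noteq> \<zero>" and t: "t = (x \<ominus> d) \<otimes> inv e" and T: "res_transc k t"
    and eps: "\<epsilon> \<in> k" "\<epsilon> \<noteq> \<zero>" and D: "D \<in> k \<inter> V" "D \<notin> M"
    and m: "y [^] p \<otimes> inv \<epsilon> \<ominus> D \<otimes> (t \<otimes> t) \<in> M"
  shows False
proof -
  have tV: "t \<in> V" by (rule res_transc_V[OF T])
  have tM: "t \<notin> M" using res_transc_linear[OF T, of \<zero> \<one>] k_sub(2,3) tV by simp
  note it = unitD[OF tV tM]
  have DV: "D \<in> V" "D \<in> k" using D by auto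
  note iD = unitD[OF DV(1) D(2)]
  have cc: "\<epsilon> \<in> carrier K" "inv \<epsilon> \<in> carrier K" "D \<in> carrier K" "t \<in> carrier K" "y [^] p \<in> carrier K"
    using eps DV tV y kc by auto
  define w where "w = y [^] p \<otimes> inv \<epsilon>"
  have wc: "w \<in> carrier K" using cc by (simp add: w_def)
  have DtV: "D \<otimes> (t \<otimes> t) \<in> V" using DV tV by auto
  have DtM: "D \<otimes> (t \<otimes> t) \<notin> M" using DV D(2) tV tM by (intro unit_mult) auto
  have "w = D \<otimes> (t \<otimes> t) \<oplus> (w \<ominus> D \<otimes> (t \<otimes> t))" using wc cc by algebra
  then have wV: "w \<in> V" "w \<notin> M" using m DtV unit_add_M[OF DtV DtM] unfolding w_def[symmetric] by (metis V_add M_V)+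
  show False
  proof (cases "p = 2")
    case True
    have "\<epsilon> \<otimes> D \<in> k" "\<epsilon> \<otimes> D \<noteq> \<zero>" using eps DV iD cc k_sub(6) by (auto simp: integral_iff)
    then obtain g0 where g0: "g0 \<in> k" "g0 \<noteq> \<zero>" "g0 [^] p = \<epsilon> \<otimes> D" using pth_root by blast
    have g0c: "g0 \<in> carrier K" using g0 kc by simp
    define g where "g = g0 \<otimes> t"
    have g: "g \<in> k0" "g \<noteq> \<zero>" unfolding g_def using g0 kk0[OF g0(1)] t_k0[OF d e] it g0c cc t k0_sub(6)
      by (auto simp: integral_iff)
    have "g [^] p = \<epsilon> \<otimes> (D \<otimes> (t \<otimes> t))"
    proof -
      have "g [^] p = g0 [^] p \<otimes> t [^] p" unfolding g_def using g0c cc by (simp add: nat_pow_distrib)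
      also have "t [^] p = t \<otimes> t" using True cc by (simp add: numeral_2_eq_2)
      finally show ?thesis using g0(3) cc by (simp add: m_assoc)
    qed
    then have "y [^] p \<otimes> inv (g [^] p) = w \<otimes> inv (D \<otimes> (t \<otimes> t))"
      unfolding w_def using cc eps unitD[OF DtV DtM] DtV by (simp add: inv_mult[of \<epsilon>] m_assoc)
    moreover have "w \<otimes> inv (D \<otimes> (t \<otimes> t)) \<ominus> \<one> \<in> M"
    proof -
      have "w \<otimes> i \<ominus> z \<otimes> i = (w \<ominus> z) \<otimes> i" if "i \<in> carrier K" "z \<in> carrier K" for i z using that wc by algebra
      from this[of "inv (D \<otimes> (t \<otimes> t))" "D \<otimes> (t \<otimes> t)"]
      have "w \<otimes> inv (D \<otimes> (t \<otimes> t)) \<ominus> \<one> = (w \<ominus> D \<otimes> (t \<otimes> t)) \<otimes> inv (D \<otimes> (t \<otimes> t))"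
        using unitD[OF DtV DtM] DtV by simp
      then show ?thesis using m unitD[OF DtV DtM] M_mult_r by (simp add: w_def)
    qed
    ultimately show False using no_pow[OF g] by simp
  next
    case False
    then have "odd p" using prime_p p2 prime_odd_nat[of p] by simp
    then obtain n where n: "p = Suc (2 * n)" by (elim oddE) simp
    obtain g where g: "g \<in> k" "g \<noteq> \<zero>" "g [^] p = \<epsilon>" using pth_root[OF eps] by blast
    define s where "s = y \<otimes> inv g"
    note S = gen_s[OF kk0[OF g(1)] g(2) s_def]
    have sp: "s [^] p = w" unfolding S(3) g(3) w_def ..
    have kv: "kummer_val K V k0 s \<zeta> p"
      by (rule kummer_valI[OF kk0[OF g(1)] g(2) s_def]) (use sp wV in auto)
    have sV: "s \<in> V" "s \<notin> M" using kummer_val.sV[OF kv] kummer_val.sM[OF kv] by auto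
    define q where "q = s [^] n"
    have qV: "q \<in> V" "q \<notin> M" unfolding q_def using sV unit_pow[OF sV] by auto
    note iq = unitD[OF qV]
    define \<tau> where "\<tau> = t \<otimes> inv q"
    have tauV: "\<tau> \<in> V" using tV iq by (auto simp: \<tau>_def)
    have t_eq: "t = \<tau> \<otimes> q" unfolding \<tau>_def using cc qV iq by (simp add: div_cancel)
    have w_eq: "w = s \<otimes> (q \<otimes> q)"
      unfolding sp[symmetric] q_def n using sV(1) by (simp add: nat_pow_mult mult_2 m_comm)
    have sc: "s \<in> carrier K" "q \<in> carrier K" "\<tau> \<in> carrier K" using sV qV tauV by auto
    have "w \<ominus> D \<otimes> (t \<otimes> t) = (s \<ominus> D \<otimes> (\<tau> \<otimes> \<tau>)) \<otimes> (q \<otimes> q)"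
      unfolding w_eq t_eq using sc cc by algebra
    then have "(s \<ominus> D \<otimes> (\<tau> \<otimes> \<tau>)) \<otimes> (q \<otimes> q) \<in> M" using m by (simp add: w_def)
    then have "s \<ominus> D \<otimes> (\<tau> \<otimes> \<tau>) \<in> M"
      using mult_unit_cancel(2)[of "s \<ominus> D \<otimes> (\<tau> \<otimes> \<tau>)" "q \<otimes> q"] sc cc qV unit_mult[OF qV qV] by auto
    then have rs: "res s = res D \<otimes>\<^bsub>RF\<^esub> (res \<tau> \<otimes>\<^bsub>RF\<^esub> res \<tau>)"
      using res_eq_iff[of s "D \<otimes> (\<tau> \<otimes> \<tau>)"] sV DV tauV by simp
    have rt: "res t = res \<tau> \<otimes>\<^bsub>RF\<^esub> res s [^]\<^bsub>RF\<^esub> n" unfolding t_eq q_def using tauV sV by simp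
    let ?G = "generate_field RF (insert (res \<tau>) (resF k))"
    have G: "subfield ?G RF" using RF.generate_field_is_subfield[of "insert (res \<tau>) (resF k)"]
      subfieldE(3)[OF resF_subfield[OF subk]] tauV by auto
    note Gs = subringE[OF subfieldE(1)[OF G]]
    have in1: "res D \<in> ?G" using DV by (auto simp: resF_def intro!: generate_field.incl)
    have in2: "res \<tau> \<in> ?G" by (auto intro: generate_field.incl)
    have sG: "res s \<in> ?G" unfolding rs using in1 in2 by (intro Gs(6))
    have in3: "res s [^]\<^bsub>RF\<^esub> j \<in> ?G" for j :: nat by (induction j) (auto intro: Gs(3,6) sG)
    have tG: "res t \<in> ?G" unfolding rt using in2 in3 by (intro Gs(6))
    have "ruled RF (resF k)"
      by (rule ruled_if_both[OF td d e t T kv _ tG sG]) (use tauV in simp)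
    then show False using nr by simp
  qed
qed

end

context nonruled_curve begin

section \<open>The two types of non-ruled residue field extensions\<close>

text \<open>
  Among \<open>f(d)\<close>, \<open>f'(d) e\<close> and \<open>e ^ 2\<close> the last attains the least value. Otherwise division by the least one leaves a linear residual equation: the quadratic and
  higher terms, all divisible by \<open>e ^ 2\<close>, disappear, and one of the two remaining coefficients is 1.
\<close>

lemma center_bounds:
  assumes d: "d \<in> k \<inter> V" and e: "e \<in> k" "e \<noteq> \<zero>" "e \<in> M" and t: "t = (x \<ominus> d) \<otimes> inv e" and T: "res_transc k t"
  shows "tri p c d \<otimes> inv (e \<otimes> e) \<in> V" "tri1 p d \<otimes> inv e \<in> V"
proof -
  have tV: "t \<in> V" by (rule res_transc_V[OF T])
  obtain r where r: "r \<in> V" "y [^] p = tri p c d \<oplus> tri1 p d \<otimes> (e \<otimes> t) \<oplus> tri2 p d \<otimes> ((e \<otimes> t) \<otimes> (e \<otimes> t))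
    \<oplus> (e \<otimes> t) \<otimes> (e \<otimes> t) \<otimes> (e \<otimes> t) \<otimes> r"
    using expand_x[OF d e(1,2) M_V[OF e(3)] t tV] by blast
  define A where "A = tri p c d" define B where "B = tri1 p d \<otimes> e" define E where "E = e \<otimes> e"
  define D where "D = tri2 p d"
  have dk: "d \<in> k" "d \<in> V" "c \<in> k" "c \<in> V" using d cV by auto
  have ec: "e \<in> carrier K" using e kc by simp
  have k1: "tri1 p d \<in> k" "A \<in> k" using tri_subring[OF subfieldE(1)[OF subk] dk(1)] dk(3) by (auto simp: A_def)
  have ABE: "A \<in> k" "B \<in> k" "E \<in> k" using k1 e(1) k_sub(6) by (auto simp: B_def E_def)
  have DV: "D \<in> V" unfolding D_def using tri_subring(3)[OF subV dk(2)] .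
  have E0: "E \<noteq> \<zero>" using e ec by (simp add: E_def integral_iff)
  have cc: "A \<in> carrier K" "B \<in> carrier K" "E \<in> carrier K" "D \<in> carrier K" "t \<in> carrier K" "r \<in> carrier K"
    "tri1 p d \<in> carrier K"
    using ABE kc DV tV r(1) k1 by auto
  \<comment> \<open>The competing terms; division by the one of least value, \<open>\<epsilon>\<close>, turns them into \<open>\<alpha>\<close>, \<open>\<beta>\<close>, \<open>\<gamma>\<close>.\<close>
  define f where "f i = (if i = 0 then A else if i = 1 then B else E)" for i :: nat
  have fk: "f i \<in> k" "f i \<in> carrier K" for i using ABE cc by (auto simp: f_def)
  obtain i where i: "i < 3" "f i \<noteq> \<zero>" "\<forall>l<3. f l \<otimes> inv (f i) \<in> V"
    using least_value[of 3 f 2] fk E0 by (auto simp: f_def)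
  define \<epsilon> where "\<epsilon> = f i"
  have eps: "\<epsilon> \<in> k" "\<epsilon> \<noteq> \<zero>" "\<epsilon> \<in> carrier K" "inv \<epsilon> \<in> k" "inv \<epsilon> \<in> carrier K"
    using fk i k_inv[of "f i"] by (auto simp: \<epsilon>_def)
  define \<alpha> where "\<alpha> = A \<otimes> inv \<epsilon>" define \<beta> where "\<beta> = B \<otimes> inv \<epsilon>" define \<gamma> where "\<gamma> = E \<otimes> inv \<epsilon>"
  have V: "\<alpha> \<in> V" "\<beta> \<in> V" "\<gamma> \<in> V"
    using spec[OF i(3), of 0] spec[OF i(3), of 1] spec[OF i(3), of 2] by (auto simp: f_def \<epsilon>_def \<alpha>_def \<beta>_def \<gamma>_def)
  have kk: "\<alpha> \<in> k" "\<beta> \<in> k" using ABE eps k_sub(6) by (auto simp: \<alpha>_def \<beta>_def)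
  have gM: "\<gamma> \<notin> M"
  proof
    assume g: "\<gamma> \<in> M"
    have "i \<noteq> 2"
    proof
      assume "i = 2"
      then have "\<gamma> = \<one>" using E0 cc by (simp add: \<gamma>_def \<epsilon>_def f_def)
      then show False using g by simp
    qed
    then have "i = 0 \<or> i = 1" using i(1) by auto
    then have "\<alpha> = \<one> \<or> \<beta> = \<one>" using i(2) cc by (auto simp: \<alpha>_def \<beta>_def \<epsilon>_def f_def)
    then have u: "\<alpha> \<notin> M \<or> \<beta> \<notin> M" by auto
    have "(A \<oplus> b \<otimes> (e \<otimes> t) \<oplus> D \<otimes> ((e \<otimes> t) \<otimes> (e \<otimes> t)) \<oplus> (e \<otimes> t) \<otimes> (e \<otimes> t) \<otimes> (e \<otimes> t) \<otimes> r) \<otimes> z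
        \<ominus> (A \<otimes> z \<oplus> ((b \<otimes> e) \<otimes> z) \<otimes> t) = ((e \<otimes> e) \<otimes> z) \<otimes> (D \<otimes> (t \<otimes> t) \<oplus> e \<otimes> (t \<otimes> t \<otimes> t) \<otimes> r)"
      if "z \<in> carrier K" "b \<in> carrier K" for z b using that cc ec by algebra
    from this[of "inv \<epsilon>" "tri1 p d"]
    have "y [^] p \<otimes> inv \<epsilon> \<ominus> (\<alpha> \<oplus> \<beta> \<otimes> t) = \<gamma> \<otimes> (D \<otimes> (t \<otimes> t) \<oplus> e \<otimes> (t \<otimes> t \<otimes> t) \<otimes> r)"
      unfolding r(2) \<alpha>_def \<beta>_def \<gamma>_def A_def B_def E_def D_def using eps cc by simp
    also have "\<dots> \<in> M" using g DV tV M_V[OF e(3)] r(1) by (intro M_mult_r V_add V_mult) auto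
    finally have m: "y [^] p \<otimes> inv \<epsilon> \<ominus> (\<alpha> \<oplus> \<beta> \<otimes> t) \<in> M" .
    show False by (rule no_linear[OF dk(1) e(1,2) t T eps(1,2) _ _ u m]) (use V kk in auto)
  qed
  note ig = unitD[OF V(3) gM]
  have ie: "inv e \<in> carrier K" using e ec by simp
  have iE: "inv \<epsilon> = \<gamma> \<otimes> inv E" unfolding \<gamma>_def using E0 cc eps by (simp add: m_comm[of E] m_assoc)
  have cg: "\<gamma> \<in> carrier K" "inv \<gamma> \<in> carrier K" "inv E \<in> carrier K" using V ig cc E0 by auto
  have "z \<otimes> inv E = (z \<otimes> inv \<epsilon>) \<otimes> inv \<gamma>" if "z \<in> carrier K" for z
  proof -
    have "z \<otimes> (g \<otimes> b) \<otimes> h = z \<otimes> b \<otimes> (g \<otimes> h)" if "g \<in> carrier K" "h \<in> carrier K" "b \<in> carrier K" for g h b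
      using that \<open>z \<in> carrier K\<close> by algebra
    from this[of \<gamma> "inv \<gamma>" "inv E"] show ?thesis unfolding iE using that cg ig by simp
  qed
  from this[of A] this[of B] have ab: "A \<otimes> inv E \<in> V" "B \<otimes> inv E \<in> V"
    using cc V ig by (simp_all add: \<alpha>_def[symmetric] \<beta>_def[symmetric])
  then show "tri p c d \<otimes> inv (e \<otimes> e) \<in> V" by (simp add: A_def E_def)
  have "b \<otimes> e \<otimes> (i \<otimes> i) = (b \<otimes> i) \<otimes> (e \<otimes> i)" if "b \<in> carrier K" "i \<in> carrier K" for b i using that ec by algebra
  from this[of "tri1 p d" "inv e"] have "B \<otimes> inv E = tri1 p d \<otimes> inv e"
    unfolding B_def E_def using cc ie e(2) ec by (simp add: inv_mult)
  then show "tri1 p d \<otimes> inv e \<in> V" using ab by simp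
qed

text \<open>
  Completing the square: \<open>d' = d - f'(d) / (2 D)\<close> is a Newton step for \<open>f'\<close>, so \<open>f'(d')\<close> is of second order in \<open>f'(d)\<close>. The shift is a multiple of \<open>e\<close>, so \<open>(x - d') / e\<close> is again
  residually transcendental and \<open>f(d') / e ^ 2\<close> is again integral; it is a unit because of \<open>no_square\<close>.
\<close>

lemma double_root_center:
  assumes d: "d \<in> k \<inter> V" and e: "e \<in> k" "e \<noteq> \<zero>" "e \<in> M" and T: "res_transc k ((x \<ominus> d) \<otimes> inv e)"
  shows "\<exists>d'. near_double_root k p c d' e \<and> res_transc k ((x \<ominus> d') \<otimes> inv e)"
proof -
  have dk: "d \<in> k" "d \<in> V" "c \<in> k" "c \<in> V" "c \<in> carrier K" "d \<in> carrier K" using d cV by auto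
  have ec: "e \<in> carrier K" "inv e \<in> carrier K" "inv e \<in> k" using e kc k_inv by auto
  have B: "tri1 p d \<otimes> inv e \<in> V" by (rule center_bounds(2)[OF d e refl T])
  have Bc: "tri1 p d \<in> carrier K" "tri1 p d \<in> k" using dk tri_subring(2)[OF subfieldE(1)[OF subk] dk(1)] by auto
  have inM: "b \<in> M" if "b \<otimes> inv e \<in> V" "b \<in> carrier K" for b
  proof -
    have "b = (b \<otimes> inv e) \<otimes> e" using that ec e by (simp add: div_cancel)
    then show ?thesis using that(1) e(3) M_mult by metis
  qed
  have BM: "tri1 p d \<in> M" by (rule inM[OF B Bc(1)])
  note U = tri2_unit[OF dk(2) BM p2 pM' p1M]
  define N where "N = nat_el K 2 \<otimes> tri2 p d"
  have nk: "nat_el K 2 \<in> k" by (simp add: numeral_2_eq_2 k_sub)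
  have NV: "N \<in> V" "N \<notin> M" "N \<in> k"
    using U tri_subring(3)[OF subV dk(2)] tri_subring(3)[OF subfieldE(1)[OF subk] dk(1)] nk k_sub(6) unit_mult
    by (auto simp: N_def simp del: V_mult)
  note iN = unitD[OF NV(1,2)]
  define h where "h = \<ominus> (tri1 p d \<otimes> inv N)"
  have hk: "h \<in> k" "h \<in> carrier K" unfolding h_def using Bc NV iN k_inv[of N] k_sub(5,6) by auto
  have h_e: "h \<otimes> inv e = \<ominus> ((tri1 p d \<otimes> inv e) \<otimes> inv N)"
    unfolding h_def using Bc iN ec by (simp add: l_minus r_minus m_ac)
  have hV: "h \<otimes> inv e \<in> V" unfolding h_e using B iN by auto
  have hM: "h \<in> M" by (rule inM[OF hV hk(2)])
  define d' where "d' = d \<oplus> h"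
  have d'V: "d' \<in> k \<inter> V" unfolding d'_def using dk hM hk k_sub(7) by auto
  define t' where "t' = (x \<ominus> d') \<otimes> inv e"
  have "(x \<ominus> (d \<oplus> h)) \<otimes> i = \<one> \<otimes> ((x \<ominus> d) \<otimes> i) \<oplus> \<ominus> (h \<otimes> i)" if "i \<in> carrier K" for i
    using that x hk dk by algebra
  from this[OF ec(2)] have t'_eq: "t' = \<one> \<otimes> ((x \<ominus> d) \<otimes> inv e) \<oplus> \<ominus> (h \<otimes> inv e)" unfolding t'_def d'_def .
  have he: "\<ominus> (h \<otimes> inv e) \<in> k \<inter> V" using hV hk ec k_sub(5,6) by auto
  have T': "res_transc k t'" unfolding t'_eq using k_sub(3) by (intro res_transc_affine[OF T _ _ he]) auto
  obtain r where r: "r \<in> k \<inter> V" "tri1 p d' = tri1 p d \<oplus> N \<otimes> h \<oplus> h \<otimes> h \<otimes> r"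
    using taylor_tri1[OF subring_kV d _ p2, of h] hk hM unfolding N_def d'_def by auto
  have rV: "r \<in> V" using r by simp
  have "N \<otimes> h = \<ominus> tri1 p d"
  proof -
    have "N \<otimes> \<ominus> (b \<otimes> i) = \<ominus> (b \<otimes> (N \<otimes> i))" if "b \<in> carrier K" "i \<in> carrier K" for b i
      using that NV by (simp add: r_minus m_lcomm)
    from this[of "tri1 p d" "inv N"] show ?thesis unfolding h_def using Bc iN NV by simp
  qed
  then have B'_eq: "tri1 p d' = h \<otimes> h \<otimes> r" unfolding r(2) using Bc hk rV by (simp add: r_neg)
  have "tri1 p d' \<otimes> inv e = (h \<otimes> inv e) \<otimes> r \<otimes> h"
    unfolding B'_eq using hk ec rV by (simp add: m_ac)
  then have B'M: "tri1 p d' \<otimes> inv e \<in> M" using hV rV hM by (metis M_mult V_mult)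
  have A'V: "tri p c d' \<otimes> inv (e \<otimes> e) \<in> V" by (rule center_bounds(1)[OF d'V e t'_def T'])
  have A'M: "tri p c d' \<otimes> inv (e \<otimes> e) \<notin> M"
  proof
    assume AM: "tri p c d' \<otimes> inv (e \<otimes> e) \<in> M"
    have d'c: "d' \<in> carrier K" "d' \<in> k" "d' \<in> V" using d'V by auto
    have t'V: "t' \<in> V" by (rule res_transc_V[OF T'])
    obtain q where q: "q \<in> V" "y [^] p = tri p c d' \<oplus> tri1 p d' \<otimes> (e \<otimes> t') \<oplus> tri2 p d' \<otimes> ((e \<otimes> t') \<otimes> (e \<otimes> t'))
      \<oplus> (e \<otimes> t') \<otimes> (e \<otimes> t') \<otimes> (e \<otimes> t') \<otimes> q"
      using expand_x[OF d'V e(1,2) M_V[OF e(3)] t'_def t'V] by blast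
    have B'1: "tri1 p d' \<in> M" using inM[of "tri1 p d'"] B'M d'c by simp
    have D'V: "tri2 p d' \<in> k \<inter> V" "tri2 p d' \<notin> M"
      using tri2_unit(1)[OF d'c(3) B'1 p2 pM' p1M] tri_subring(3)[OF subring_kV d'V] by auto
    have ee: "e \<otimes> e \<in> k" "e \<otimes> e \<noteq> \<zero>" using e ec k_sub(6) by (auto simp: integral_iff)
    have cc: "t' \<in> carrier K" "q \<in> carrier K" "tri2 p d' \<in> carrier K" using t'V q D'V by auto
    have "(A \<oplus> B \<otimes> (e \<otimes> t') \<oplus> D \<otimes> ((e \<otimes> t') \<otimes> (e \<otimes> t')) \<oplus> (e \<otimes> t') \<otimes> (e \<otimes> t') \<otimes> (e \<otimes> t') \<otimes> q) \<otimes> (i \<otimes> i) =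
       A \<otimes> (i \<otimes> i) \<oplus> (B \<otimes> i) \<otimes> (t' \<otimes> (e \<otimes> i)) \<oplus> D \<otimes> (t' \<otimes> t') \<otimes> ((e \<otimes> i) \<otimes> (e \<otimes> i)) \<oplus> e \<otimes> (t' \<otimes> t' \<otimes> t' \<otimes> q) \<otimes> ((e \<otimes> i) \<otimes> (e \<otimes> i))"
      if "i \<in> carrier K" "A \<in> carrier K" "B \<in> carrier K" "D \<in> carrier K" for i A B D using that cc ec by algebra
    from this[OF ec(2), of "tri p c d'" "tri1 p d'" "tri2 p d'"]
    have w: "y [^] p \<otimes> inv (e \<otimes> e) = tri p c d' \<otimes> inv (e \<otimes> e) \<oplus> (tri1 p d' \<otimes> inv e) \<otimes> t' \<oplus>
        tri2 p d' \<otimes> (t' \<otimes> t') \<oplus> e \<otimes> (t' \<otimes> t' \<otimes> t' \<otimes> q)"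
      unfolding q(2) using e ec cc d'c dk by (simp add: inv_mult)
    have "(a \<oplus> b \<oplus> D \<oplus> z) \<ominus> D = a \<oplus> b \<oplus> z" if "a \<in> carrier K" "b \<in> carrier K" "D \<in> carrier K" "z \<in> carrier K" for a b D z
      using that by algebra
    then have "y [^] p \<otimes> inv (e \<otimes> e) \<ominus> tri2 p d' \<otimes> (t' \<otimes> t') =
      tri p c d' \<otimes> inv (e \<otimes> e) \<oplus> (tri1 p d' \<otimes> inv e) \<otimes> t' \<oplus> e \<otimes> (t' \<otimes> t' \<otimes> t' \<otimes> q)"
      unfolding w using cc ec d'c dk AM B'M M_closed by auto
    also have "\<dots> \<in> M" using AM B'M t'V e(3) q(1) by (intro M_add M_mult_r[of "tri1 p d' \<otimes> inv e"] M_mult_r[of e]) auto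
    finally show False by (intro no_square[OF d'c(2) e(1,2) t'_def T' ee D'V])
  qed
  show ?thesis using d'V e B'M A'V A'M T' unfolding near_double_root_def t'_def by blast
qed

text \<open>
  If \<open>x\<close> is not integral, then \<open>(y / x) ^ p\<close> is congruent to 1. If \<open>x\<close> is integral but its residue is not transcendental, then \<open>x\<close> is congruent to an element
  of \<open>k\<close>, and the radius \<open>e\<close> of any centre must lie in \<open>M\<close>.
\<close>

lemma dichotomy:
  "(x \<in> V \<and> res_transc k x) \<or> (\<exists>d e. near_double_root k p c d e \<and> res_transc k ((x \<ominus> d) \<otimes> inv e))"
proof -
  have xV: "x \<in> V"
  proof (rule ccontr)
    assume nx: "x \<notin> V"
    define u where "u = inv x"
    have x0: "x \<noteq> \<zero>" and uM: "u \<in> M" using not_V_inv[OF x nx] by (auto simp: u_def)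
    have uc: "u \<in> carrier K" "c \<in> carrier K" using uM cV by auto
    obtain m where m: "p = Suc (Suc m)" using p2 by (metis Suc_le_D numeral_2_eq_2 Suc_le_mono)
    define U where "U = u [^] m"
    have UV: "U \<in> V" unfolding U_def using uM by simp
    have xu: "x \<otimes> u = \<one>" using x x0 by (simp add: u_def)
    have up: "inv (x [^] p) = U \<otimes> (u \<otimes> u)"
      using x x0 uc unfolding inv_pow[OF x x0] U_def m u_def[symmetric] by (simp add: m_assoc)
    have xpu: "x [^] p \<otimes> (U \<otimes> (u \<otimes> u)) = \<one>" unfolding up[symmetric] using x x0 pow_nonzero[OF x x0, of p] by simp
    have "(P \<oplus> x \<oplus> c) \<otimes> (U \<otimes> (u \<otimes> u)) \<ominus> \<one> = P \<otimes> (U \<otimes> (u \<otimes> u)) \<ominus> \<one> \<oplus> (x \<otimes> u) \<otimes> U \<otimes> u \<oplus> c \<otimes> U \<otimes> u \<otimes> u"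
      if "P \<in> carrier K" for P using that x uc V_closed[OF UV] by algebra
    from this[of "x [^] p"] have "y [^] p \<otimes> inv (x [^] p) \<ominus> \<one> = U \<otimes> u \<oplus> c \<otimes> U \<otimes> u \<otimes> u"
      unfolding eq tri_def up using x uc UV xu xpu by (simp add: minus_eq r_neg)
    also have "\<dots> \<in> M" using uM UV cV by (intro M_add M_mult) auto
    finally show False using no_pow[OF xk0 x0] by simp
  qed
  show ?thesis
  proof (cases "res_transc k x")
    case False
    then obtain \<delta> where \<delta>: "\<delta> \<in> k" "\<delta> \<in> V" "x \<ominus> \<delta> \<in> M" using residue_transc_or[OF xV] by blast
    obtain d e where de: "d \<in> k" "e \<in> k" "e \<noteq> \<zero>" "res_transc k ((x \<ominus> d) \<otimes> inv e)"
      using exists_center by blast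
    define t where "t = (x \<ominus> d) \<otimes> inv e"
    have tV: "t \<in> V" unfolding t_def by (rule res_transc_V[OF de(4)])
    have cc: "d \<in> carrier K" "e \<in> carrier K" "inv e \<in> carrier K" "t \<in> carrier K" "\<delta> \<in> carrier K"
      using de kc tV \<delta> by auto
    have eM: "e \<in> M"
    proof (rule ccontr)
      assume "e \<notin> M"
      then have ie: "inv e \<in> V" using unitD[of e] not_V_inv[OF cc(2)] M_V by blast
      have m: "(x \<ominus> \<delta>) \<otimes> inv e \<in> M" using \<delta>(3) ie by (rule M_mult_r)
      define r where "r = (\<delta> \<ominus> d) \<otimes> inv e"
      have rt: "t \<ominus> r = (x \<ominus> \<delta>) \<otimes> inv e" unfolding t_def r_def using cc x by algebra
      have "r = t \<ominus> (t \<ominus> r)" unfolding r_def using cc by algebra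
      then have "r \<in> V" using tV m unfolding rt by (metis V_diff M_V)
      moreover have "r \<in> k" unfolding r_def using \<delta> de k_diff k_inv k_sub(6) by blast
      ultimately have "\<not> res_transc k t" using residue_transc_or[OF tV] m unfolding rt[symmetric] by blast
      then show False using de(4) by (simp add: t_def)
    qed
    have "t \<otimes> e = x \<ominus> d" unfolding t_def using x cc de by (simp add: div_cancel)
    moreover have "d = x \<ominus> (x \<ominus> d)" using x cc by algebra
    ultimately have "d \<in> V" using xV tV M_V[OF eM] by (metis V_mult V_diff)
    then show ?thesis using double_root_center[of d e] de eM by blast
  qed (use xV in simp)
qed

end

section \<open>Uniqueness within each type\<close>

lemma same_maximal_ideal:
  assumes 1: "val_ring_field K V1" and 2: "val_ring_field K V2" and k: "subfield k K" and e: "V1 \<inter> k = V2 \<inter> k"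
    and z: "z \<in> k"
  shows "z \<in> val_ring_field.M K V1 \<longleftrightarrow> z \<in> val_ring_field.M K V2"
proof -
  interpret val_ring_field K V1 by (rule 1)
  have "inv\<^bsub>K\<^esub> z \<in> k" if "z \<noteq> \<zero>\<^bsub>K\<^esub>"
    using subfield_m_inv(1)[OF k, of z] z that by simp
  then show ?thesis using z e unfolding val_ring_field.M_def[OF 1] val_ring_field.M_def[OF 2] by blast
qed

lemma same_Prim:
  assumes 1: "val_ring_field K V1" and 2: "val_ring_field K V2" and k: "subfield k K" and e: "V1 \<inter> k = V2 \<inter> k"
  shows "val_ring_field.Prim K V1 k t = val_ring_field.Prim K V2 k t"
proof -
  have sub: "val_ring_field.Prim K U k t \<subseteq> val_ring_field.Prim K W k t"
    if U: "val_ring_field K U" and W: "val_ring_field K W" and e: "U \<inter> k = W \<inter> k" for U W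
  proof
    fix P assume "P \<in> val_ring_field.Prim K U k t"
    then obtain c n where c: "\<forall>i<n. c i \<in> k \<inter> U" "\<exists>i<n. c i \<notin> val_ring_field.M K U" "P = pev K c n t"
      unfolding val_ring_field.Prim_def[OF U] by blast
    have "\<forall>i<n. c i \<in> k \<inter> W" using c(1) e by blast
    moreover have "\<exists>i<n. c i \<notin> val_ring_field.M K W" using c(1,2) same_maximal_ideal[OF U W k e] by blast
    ultimately show "P \<in> val_ring_field.Prim K W k t" unfolding c(3) by (rule val_ring_field.PrimI[OF W])
  qed
  show ?thesis using sub[OF 1 2 e] sub[OF 2 1 e[symmetric]] by blast
qed

lemma gauss_unique:
  assumes 1: "val_ring_field K V1" and 2: "val_ring_field K V2" and k: "subfield k K" and e: "V1 \<inter> k = V2 \<inter> k"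
    and T: "val_ring_field.res_transc K V1 k t" "val_ring_field.res_transc K V2 k t"
  shows "V1 \<inter> generate_field K (insert t k) = V2 \<inter> generate_field K (insert t k)"
proof -
  have e': "k \<inter> V1 = k \<inter> V2" using e by blast
  show ?thesis
    unfolding val_ring_field.gauss_V[OF 1 k T(1)] val_ring_field.gauss_V[OF 2 k T(2)] same_Prim[OF 1 2 k e] e' ..
qed

lemma kummer_unique:
  assumes 1: "kummer_val K V1 F s \<zeta> p" and 2: "kummer_val K V2 F s \<zeta> p" and e: "V1 \<inter> F = V2 \<inter> F"
    and i: "val_ring_field.res K V1 s \<notin> val_ring_field.resF K V1 F"
      "val_ring_field.res K V2 s \<notin> val_ring_field.resF K V2 F"
  shows "V1 = V2"
proof -
  have e': "F \<inter> V1 = F \<inter> V2" using e by blast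
  have "V1 = {w. \<exists>a. (\<forall>i<p. a i \<in> F \<inter> V1) \<and> w = pev K a p s}" by (rule kummer_val.val_ring_eq[OF 1 i(1)])
  also have "\<dots> = {w. \<exists>a. (\<forall>i<p. a i \<in> F \<inter> V2) \<and> w = pev K a p s}" unfolding e' ..
  also have "\<dots> = V2" by (rule kummer_val.val_ring_eq[OF 2 i(2), symmetric])
  finally show ?thesis .
qed

context normal_curve begin

lemma gauss_unit:
  assumes T: "res_transc k x" shows "y [^] p \<in> V" "y [^] p \<notin> M"
proof -
  let ?c = "\<lambda>i. if i = 0 then c else if i = 1 then \<one> else if i = p then \<one> else \<zero>"
  have cc: "c \<in> carrier K" "c \<in> k" "c \<in> V" using cV by auto
  have e: "pev K ?c (Suc p) x = y [^] p"
    using pev_trinomial[of c \<one> \<one> x p] p2 cc x unfolding eq tri_def by (simp add: a_ac)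
  have ck: "\<forall>i<Suc p. ?c i \<in> k \<inter> V" using cc k_sub(2,3) by auto
  show "y [^] p \<in> V" unfolding e[symmetric] using ck res_transc_V[OF T] by (intro pev_V) auto
  show "y [^] p \<notin> M"
  proof
    assume "y [^] p \<in> M"
    then have "?c 1 \<in> M" unfolding e[symmetric] using p2 by (intro res_transcD[OF T ck]) auto
    then show False by simp
  qed
qed

lemma near_double_rootD:
  assumes "near_double_root k p c d e"
  shows "d \<in> k" "d \<in> V" "d \<in> carrier K" "e \<in> k" "e \<in> M" "e \<in> carrier K" "e \<noteq> \<zero>"
    "inv e \<in> k" "inv e \<in> carrier K" "tri1 p d \<otimes> inv e \<in> M"
    "tri p c d \<otimes> inv (e \<otimes> e) \<in> V" "tri p c d \<otimes> inv (e \<otimes> e) \<notin> M" "tri1 p d \<in> M" "tri p c d \<in> M"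
    "inv (e \<otimes> e) = inv e \<otimes> inv e" "tri2 p d \<in> V" "tri2 p d \<in> k" "tri2 p d \<notin> M" "nat_el K 2 \<otimes> tri2 p d \<notin> M"
    "tri1 p d \<in> k" "tri p c d \<in> k"
proof -
  show *: "d \<in> k" "d \<in> V" "d \<in> carrier K" "e \<in> k" "e \<in> M" "e \<in> carrier K" "e \<noteq> \<zero>"
    "tri1 p d \<otimes> inv e \<in> M" "tri p c d \<otimes> inv (e \<otimes> e) \<in> V" "tri p c d \<otimes> inv (e \<otimes> e) \<notin> M"
    using assms by (auto simp: near_double_root_def)
  show "inv e \<in> k" "inv e \<in> carrier K" "inv (e \<otimes> e) = inv e \<otimes> inv e" using * k_inv by (auto simp: inv_mult)
  have cc: "c \<in> carrier K" "c \<in> k" using cV by auto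
  have "tri1 p d = (tri1 p d \<otimes> inv e) \<otimes> e" using * by (simp add: div_cancel)
  then show B: "tri1 p d \<in> M" using *(8) M_mult_r[OF *(8), of e] *(5) by simp
  have ee: "e \<otimes> e \<in> M" "e \<otimes> e \<noteq> \<zero>" "e \<otimes> e \<in> carrier K" using * by (auto simp: integral_iff)
  have "tri p c d = (tri p c d \<otimes> inv (e \<otimes> e)) \<otimes> (e \<otimes> e)" using * cc ee by (simp add: div_cancel del: m_closed)
  then show "tri p c d \<in> M" using M_mult[OF *(9) ee(1)] by simp
  note U = tri2_unit[OF *(2) B p2 pM' p1M]
  show "tri2 p d \<in> V" "tri2 p d \<in> k" "tri1 p d \<in> k" "tri p c d \<in> k"
    using tri_subring[OF subV *(2)] tri_subring[OF subfieldE(1)[OF subk] *(1)] cc by auto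
  then show "tri2 p d \<notin> M" "nat_el K 2 \<otimes> tri2 p d \<notin> M" using U unit_mult[OF V_nat_el U(2)] by auto
qed

text \<open>
  The residue of \<open>y ^ p / e ^ 2\<close> is \<open>A + D t ^ 2\<close> with nonzero \<open>A\<close>, hence not zero as \<open>t\<close> is residually transcendental.
\<close>

lemma double_root_unit:
  assumes N: "near_double_root k p c d e" and t: "t = (x \<ominus> d) \<otimes> inv e" and T: "res_transc k t"
  shows "y [^] p \<otimes> inv (e \<otimes> e) \<in> V" "y [^] p \<otimes> inv (e \<otimes> e) \<notin> M"
proof -
  note D = near_double_rootD[OF N]
  have tV: "t \<in> V" by (rule res_transc_V[OF T])
  have cc: "c \<in> carrier K" "c \<in> k" using cV by auto
  obtain q where q: "q \<in> V" "y [^] p = tri p c d \<oplus> tri1 p d \<otimes> (e \<otimes> t) \<oplus> tri2 p d \<otimes> ((e \<otimes> t) \<otimes> (e \<otimes> t))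
      \<oplus> (e \<otimes> t) \<otimes> (e \<otimes> t) \<otimes> (e \<otimes> t) \<otimes> q"
    using expand_x[OF _ D(4,7) M_V[OF D(5)] t tV] D by blast
  have tc: "t \<in> carrier K" "q \<in> carrier K" "tri2 p d \<in> carrier K" using tV q D by auto
  have "(A \<oplus> B \<otimes> (e \<otimes> t) \<oplus> C \<otimes> ((e \<otimes> t) \<otimes> (e \<otimes> t)) \<oplus> (e \<otimes> t) \<otimes> (e \<otimes> t) \<otimes> (e \<otimes> t) \<otimes> q) \<otimes> (i \<otimes> i) =
     (A \<otimes> (i \<otimes> i) \<oplus> \<zero> \<otimes> t \<oplus> C \<otimes> (t \<otimes> t) \<otimes> ((e \<otimes> i) \<otimes> (e \<otimes> i))) \<oplus> ((B \<otimes> i) \<otimes> (t \<otimes> (e \<otimes> i)) \<oplus> e \<otimes> (t \<otimes> t \<otimes> t \<otimes> q) \<otimes> ((e \<otimes> i) \<otimes> (e \<otimes> i)))"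
    if "i \<in> carrier K" "A \<in> carrier K" "B \<in> carrier K" "C \<in> carrier K" for i A B C using that tc D(6) by algebra
  from this[OF D(9), of "tri p c d" "tri1 p d" "tri2 p d"]
  have w: "y [^] p \<otimes> inv (e \<otimes> e) = (tri p c d \<otimes> inv (e \<otimes> e) \<oplus> \<zero> \<otimes> t \<oplus> tri2 p d \<otimes> (t \<otimes> t)) \<oplus>
     ((tri1 p d \<otimes> inv e) \<otimes> t \<oplus> e \<otimes> (t \<otimes> t \<otimes> t \<otimes> q))"
    unfolding q(2) D(15) using D(3,6,7,9) tc cc by simp
  have m: "(tri1 p d \<otimes> inv e) \<otimes> t \<oplus> e \<otimes> (t \<otimes> t \<otimes> t \<otimes> q) \<in> M"
    using D(5,10) tV q(1) by (intro M_add M_mult_r[of "tri1 p d \<otimes> inv e"] M_mult_r[of e]) auto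
  let ?c = "\<lambda>i. if i = 0 then tri p c d \<otimes> inv (e \<otimes> e) else if i = 1 then \<zero> else if i = (2::nat) then tri2 p d else \<zero>"
  have tt: "t \<otimes> t = t [^] (2::nat)" using tc by (simp add: numeral_2_eq_2)
  have e: "pev K ?c (Suc 2) t = tri p c d \<otimes> inv (e \<otimes> e) \<oplus> \<zero> \<otimes> t \<oplus> tri2 p d \<otimes> (t \<otimes> t)"
    unfolding tt using D tc cc by (intro pev_trinomial) auto
  have ck: "\<forall>i<Suc 2. ?c i \<in> k \<inter> V" using D k_sub(2,6) by simp
  have gV: "pev K ?c (Suc 2) t \<in> V" using ck tV by (intro pev_V) auto
  have gM: "pev K ?c (Suc 2) t \<notin> M"
  proof
    assume "pev K ?c (Suc 2) t \<in> M"
    then have "?c 0 \<in> M" by (intro res_transcD[OF T ck]) auto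
    then show False using D(12) by simp
  qed
  show "y [^] p \<otimes> inv (e \<otimes> e) \<in> V" "y [^] p \<otimes> inv (e \<otimes> e) \<notin> M"
    unfolding w e[symmetric] using gV M_V[OF m] unit_add_M[OF gV gM m] by auto
qed

lemma telescope: "a \<in> carrier K \<Longrightarrow> b \<in> carrier K \<Longrightarrow> d \<in> carrier K \<Longrightarrow> d \<ominus> a = (d \<ominus> b) \<oplus> (b \<ominus> a)"
  by algebra

text \<open>
  The combination \<open>p f(d) - d f'(d) = (p - 1) d + p c\<close> is linear in \<open>d\<close>, and \<open>p - 1\<close> is a unit: there is only one residual double root.
\<close>

lemma double_root_residue:
  assumes 1: "near_double_root k p c d1 e1" and 2: "near_double_root k p c d2 e2" shows "d2 \<ominus> d1 \<in> M"
proof -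
  let ?\<Phi> = "\<lambda>d. nat_el K p \<otimes> tri p c d \<ominus> d \<otimes> tri1 p d"
  have cc: "c \<in> carrier K" using cV by auto
  have "?\<Phi> d = nat_el K (p - 1) \<otimes> d \<oplus> nat_el K p \<otimes> c" if d: "d \<in> carrier K" for d
  proof -
    obtain m where m: "p = Suc m" using p2 by (cases p) auto
    have "(n \<oplus> \<one>) \<otimes> (D \<otimes> d \<oplus> d \<oplus> c) \<ominus> d \<otimes> ((n \<oplus> \<one>) \<otimes> D \<oplus> \<one>) = n \<otimes> d \<oplus> (n \<oplus> \<one>) \<otimes> c"
      if "n \<in> carrier K" "D \<in> carrier K" for n D using that d cc by algebra
    from this[of "nat_el K m" "d [^] m"] show ?thesis unfolding tri_def tri1_def m using d cc by simp
  qed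
  then have e: "?\<Phi> d1 = nat_el K (p - 1) \<otimes> d1 \<oplus> nat_el K p \<otimes> c" "?\<Phi> d2 = nat_el K (p - 1) \<otimes> d2 \<oplus> nat_el K p \<otimes> c"
    using near_double_rootD(3)[OF 1] near_double_rootD(3)[OF 2] by auto
  have c12: "d1 \<in> carrier K" "d2 \<in> carrier K" using near_double_rootD(3)[OF 1] near_double_rootD(3)[OF 2] by auto
  have "n \<otimes> (d2 \<ominus> d1) = (n \<otimes> d2 \<oplus> q \<otimes> c) \<ominus> (n \<otimes> d1 \<oplus> q \<otimes> c)" if "n \<in> carrier K" "q \<in> carrier K" for n q
    using that c12 cc by algebra
  then have "nat_el K (p - 1) \<otimes> (d2 \<ominus> d1) = ?\<Phi> d2 \<ominus> ?\<Phi> d1" unfolding e by simp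
  also have "\<dots> \<in> M"
    using near_double_rootD(2,13,14)[OF 1] near_double_rootD(2,13,14)[OF 2] by (intro M_diff M_mult V_nat_el)
  finally show ?thesis
    using M_prime[of "nat_el K (p - 1)" "d2 \<ominus> d1"] p1M near_double_rootD(2)[OF 1] near_double_rootD(2)[OF 2] by auto
qed

text \<open>
  \<open>f'(d2) - f'(d1)\<close> is \<open>d2 - d1\<close> times a unit, which bounds \<open>d2 - d1\<close> by \<open>e1\<close>. Expanding \<open>f\<close> at \<open>d1\<close> then shows that \<open>f(d2)\<close> and \<open>f(d1)\<close> have the same value, and these
  values are those of \<open>e2 ^ 2\<close> and \<open>e1 ^ 2\<close>.
\<close>

lemma double_root_radii:
  assumes 1: "near_double_root k p c d1 e1" and 2: "near_double_root k p c d2 e2" and V: "e2 \<otimes> inv e1 \<in> V"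
  shows "e2 \<otimes> inv e1 \<notin> M" "(d2 \<ominus> d1) \<otimes> inv e1 \<in> V"
proof -
  note D1 = near_double_rootD[OF 1] and D2 = near_double_rootD[OF 2]
  define h where "h = d2 \<ominus> d1"
  have hM: "h \<in> M" unfolding h_def by (rule double_root_residue[OF 1 2])
  have hV: "h \<in> V" "h \<in> carrier K" using hM by auto
  have d2: "d2 = d1 \<oplus> h" unfolding h_def using D1(3) D2(3) by algebra
  have cc: "c \<in> carrier K" using cV by auto
  define N where "N = nat_el K 2 \<otimes> tri2 p d1"
  obtain r where r: "r \<in> V" "tri1 p d2 = tri1 p d1 \<oplus> N \<otimes> h \<oplus> h \<otimes> h \<otimes> r"
    using taylor_tri1[OF subV D1(2) hV(1) p2] unfolding N_def d2 by blast
  have NV: "N \<in> V" "N \<notin> M" unfolding N_def using D1(16,19) V_nat_el V_mult by blast+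
  have hr: "h \<otimes> r \<in> M" using hM r(1) by auto
  have UV: "N \<oplus> h \<otimes> r \<in> V" "N \<oplus> h \<otimes> r \<notin> M" using NV hr unit_add_M[OF NV hr] by auto
  have rc: "r \<in> carrier K" "N \<in> carrier K" using r NV by auto
  have B: "tri1 p d1 \<in> carrier K" "tri1 p d2 \<in> carrier K" using D1(3) D2(3) by auto
  have "(h \<otimes> i) \<otimes> (N \<oplus> h \<otimes> r) = (b \<oplus> N \<otimes> h \<oplus> h \<otimes> h \<otimes> r) \<otimes> i \<ominus> b \<otimes> i"
    if "b \<in> carrier K" "i \<in> carrier K" for b i using that hV rc by algebra
  from this[OF B(1) D1(9)] have hi: "(h \<otimes> inv e1) \<otimes> (N \<oplus> h \<otimes> r) = tri1 p d2 \<otimes> inv e1 \<ominus> tri1 p d1 \<otimes> inv e1"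
    unfolding r(2) .
  have "tri1 p d2 \<otimes> inv e1 = (tri1 p d2 \<otimes> inv e2) \<otimes> (e2 \<otimes> inv e1)"
    using div_chain[OF B(2) D2(6,7) D1(6,7)] by simp
  also have "\<dots> \<in> M" using D2(10) V by (rule M_mult_r)
  finally have "(h \<otimes> inv e1) \<otimes> (N \<oplus> h \<otimes> r) \<in> M" unfolding hi using D1(10) by (rule M_diff)
  then have hM1: "h \<otimes> inv e1 \<in> M" using mult_unit_cancel(2)[OF _ UV, of "h \<otimes> inv e1"] hV D1(9) by simp
  then show "(d2 \<ominus> d1) \<otimes> inv e1 \<in> V" by (simp add: h_def)
  obtain q where q: "q \<in> V" "tri p c d2 = tri p c d1 \<oplus> tri1 p d1 \<otimes> h \<oplus> tri2 p d1 \<otimes> (h \<otimes> h) \<oplus> h \<otimes> h \<otimes> h \<otimes> q"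
    using taylor_tri[OF subV D1(2) hV(1) cc p2] unfolding d2 by blast
  have qc: "q \<in> carrier K" "tri2 p d1 \<in> carrier K" "tri p c d1 \<in> carrier K" using q D1 cc by auto
  have "(A \<oplus> B \<otimes> h \<oplus> C \<otimes> (h \<otimes> h) \<oplus> h \<otimes> h \<otimes> h \<otimes> q) \<otimes> (i \<otimes> i) =
     A \<otimes> (i \<otimes> i) \<oplus> ((B \<otimes> i) \<otimes> (h \<otimes> i) \<oplus> (h \<otimes> i) \<otimes> ((h \<otimes> i) \<otimes> (C \<oplus> h \<otimes> q)))"
    if "A \<in> carrier K" "B \<in> carrier K" "C \<in> carrier K" "i \<in> carrier K" for A B C i using that qc hV by algebra
  from this[OF qc(3) B(1) qc(2) D1(9)]
  have A2: "tri p c d2 \<otimes> (inv e1 \<otimes> inv e1) = tri p c d1 \<otimes> inv (e1 \<otimes> e1) \<oplus>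
     ((tri1 p d1 \<otimes> inv e1) \<otimes> (h \<otimes> inv e1) \<oplus> (h \<otimes> inv e1) \<otimes> ((h \<otimes> inv e1) \<otimes> (tri2 p d1 \<oplus> h \<otimes> q)))"
    unfolding q(2) D1(15) .
  have "(tri1 p d1 \<otimes> inv e1) \<otimes> (h \<otimes> inv e1) \<oplus> (h \<otimes> inv e1) \<otimes> ((h \<otimes> inv e1) \<otimes> (tri2 p d1 \<oplus> h \<otimes> q)) \<in> M"
    using hM1 D1(10,16) hV(1) q(1) by (intro M_add M_mult_r[OF hM1] M_mult[of "tri1 p d1 \<otimes> inv e1"]) auto
  then have u: "tri p c d2 \<otimes> (inv e1 \<otimes> inv e1) \<notin> M" unfolding A2 by (rule unit_add_M[OF D1(11,12)])
  have "A \<otimes> (i \<otimes> i) = (A \<otimes> (j \<otimes> j)) \<otimes> ((e2 \<otimes> i) \<otimes> (e2 \<otimes> i))"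
    if "A \<in> carrier K" "i \<in> carrier K" "j \<in> carrier K" "e2 \<otimes> j = \<one>" for A i j
  proof -
    have "(A \<otimes> (j \<otimes> j)) \<otimes> ((e2 \<otimes> i) \<otimes> (e2 \<otimes> i)) = (A \<otimes> (i \<otimes> i)) \<otimes> ((e2 \<otimes> j) \<otimes> (e2 \<otimes> j))"
      using that(1-3) D2(6) by algebra
    then show ?thesis using that by simp
  qed
  from this[of "tri p c d2" "inv e1" "inv e2"]
  have "tri p c d2 \<otimes> (inv e1 \<otimes> inv e1) = (tri p c d2 \<otimes> inv (e2 \<otimes> e2)) \<otimes> ((e2 \<otimes> inv e1) \<otimes> (e2 \<otimes> inv e1))"
    unfolding D2(15) using D1(9) D2(3,6,7,9) cc by simp
  then show "e2 \<otimes> inv e1 \<notin> M" using u D2(11) V by (metis M_mult V_mult)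
qed

lemma double_root_comparison:
  assumes 1: "near_double_root k p c d1 e1" and 2: "near_double_root k p c d2 e2"
  shows "e2 \<otimes> inv e1 \<in> V" "e2 \<otimes> inv e1 \<notin> M" "(d2 \<ominus> d1) \<otimes> inv e1 \<in> V"
proof -
  note D1 = near_double_rootD[OF 1] and D2 = near_double_rootD[OF 2]
  show V: "e2 \<otimes> inv e1 \<in> V"
  proof (rule ccontr)
    assume n: "e2 \<otimes> inv e1 \<notin> V"
    have "inv (e2 \<otimes> inv e1) \<in> M" using not_V_inv[OF _ n] D1(9) D2(6) by simp
    moreover have "inv (e2 \<otimes> inv e1) = e1 \<otimes> inv e2" using D1(6,7,9) D2(6,7,9) by (simp add: inv_mult m_comm)
    ultimately have m: "e1 \<otimes> inv e2 \<in> M" by simp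
    then show False using double_root_radii(1)[OF 2 1 M_V[OF m]] by simp
  qed
  show "e2 \<otimes> inv e1 \<notin> M" "(d2 \<ominus> d1) \<otimes> inv e1 \<in> V" using double_root_radii[OF 1 2 V] by auto
qed

end

lemma same_near_double_root:
  assumes 1: "normal_curve K V1 k x y \<zeta> p c" and 2: "normal_curve K V2 k x y \<zeta> p c" and e: "V1 \<inter> k = V2 \<inter> k"
    and N: "val_ring_field.near_double_root K V2 k p c d e"
  shows "val_ring_field.near_double_root K V1 k p c d e"
proof -
  interpret N1: normal_curve K V1 k x y \<zeta> p c by (rule 1)
  interpret N2: normal_curve K V2 k x y \<zeta> p c by (rule 2)
  note D = N2.near_double_rootD[OF N]
  note s = same_maximal_ideal[OF N1.val_ring_field_axioms N2.val_ring_field_axioms N1.subk e]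
  have kk: "N1.tri1 p d \<otimes>\<^bsub>K\<^esub> inv\<^bsub>K\<^esub> e \<in> k" "N1.tri p c d \<otimes>\<^bsub>K\<^esub> inv\<^bsub>K\<^esub> (e \<otimes>\<^bsub>K\<^esub> e) \<in> k"
    unfolding D(15) by (intro N1.k_sub(6) D(8,20,21))+
  show ?thesis unfolding N1.near_double_root_def using D(1,2,4,5,7,10,11,12) s[OF D(4)] s[OF kk(1)] s[OF kk(2)] kk e by blast
qed

text \<open>
  A common residually transcendental \<open>t\<close> fixes the valuation on \<open>k(x)\<close>, and a common unit \<open>s = y / g\<close> with \<open>g ^ p = \<epsilon>\<close> extends it to \<open>K\<close> in only one way.
\<close>

lemma same_generator:
  assumes 1: "nonruled_curve K V1 k x y \<zeta> p c" and 2: "nonruled_curve K V2 k x y \<zeta> p c" and e: "V1 \<inter> k = V2 \<inter> k"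
    and de: "d \<in> k" "e \<in> k" "e \<noteq> \<zero>\<^bsub>K\<^esub>" and t: "t = (x \<ominus>\<^bsub>K\<^esub> d) \<otimes>\<^bsub>K\<^esub> inv\<^bsub>K\<^esub> e"
    and T: "val_ring_field.res_transc K V1 k t" "val_ring_field.res_transc K V2 k t"
    and eps: "\<epsilon> \<in> k" "\<epsilon> \<noteq> \<zero>\<^bsub>K\<^esub>"
    and u1: "y [^]\<^bsub>K\<^esub> p \<otimes>\<^bsub>K\<^esub> inv\<^bsub>K\<^esub> \<epsilon> \<in> V1" "y [^]\<^bsub>K\<^esub> p \<otimes>\<^bsub>K\<^esub> inv\<^bsub>K\<^esub> \<epsilon> \<notin> val_ring_field.M K V1"
    and u2: "y [^]\<^bsub>K\<^esub> p \<otimes>\<^bsub>K\<^esub> inv\<^bsub>K\<^esub> \<epsilon> \<in> V2" "y [^]\<^bsub>K\<^esub> p \<otimes>\<^bsub>K\<^esub> inv\<^bsub>K\<^esub> \<epsilon> \<notin> val_ring_field.M K V2"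
  shows "V1 = V2"
proof -
  interpret N1: nonruled_curve K V1 k x y \<zeta> p c by (rule 1)
  interpret N2: nonruled_curve K V2 k x y \<zeta> p c by (rule 2)
  obtain g where g: "g \<in> k" "g \<noteq> \<zero>\<^bsub>K\<^esub>" "g [^]\<^bsub>K\<^esub> p = \<epsilon>" using N1.pth_root[OF eps] by blast
  define s where "s = y \<otimes>\<^bsub>K\<^esub> inv\<^bsub>K\<^esub> g"
  note S = N1.gen_s[OF N1.kk0[OF g(1)] g(2) s_def]
  have k1: "kummer_val K V1 (generate_field K (insert x k)) s \<zeta> p"
    by (rule N1.kummer_valI[OF N1.kk0[OF g(1)] g(2) s_def]) (use S(3) g(3) u1 in simp_all)
  have k2: "kummer_val K V2 (generate_field K (insert x k)) s \<zeta> p"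
    by (rule N2.kummer_valI[OF N2.kk0[OF g(1)] g(2) s_def]) (use S(3) g(3) u2 in simp_all)
  have "V1 \<inter> generate_field K (insert t k) = V2 \<inter> generate_field K (insert t k)"
    by (rule gauss_unique[OF N1.val_ring_field_axioms N2.val_ring_field_axioms N1.subk e T])
  then have e0: "V1 \<inter> generate_field K (insert x k) = V2 \<inter> generate_field K (insert x k)"
    unfolding N1.k0_affine[OF de t] .
  show ?thesis
    by (rule kummer_unique[OF k1 k2 e0 N1.nonruled_irreducible[OF N1.td N1.nr de t T(1) k1]
          N2.nonruled_irreducible[OF N2.td N2.nr de t T(2) k2]])
qed

lemma gauss_valuation_unique:
  assumes 1: "nonruled_curve K V1 k x y \<zeta> p c" and 2: "nonruled_curve K V2 k x y \<zeta> p c" and e: "V1 \<inter> k = V2 \<inter> k"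
    and T: "val_ring_field.res_transc K V1 k x" "val_ring_field.res_transc K V2 k x"
  shows "V1 = V2"
proof -
  interpret N1: nonruled_curve K V1 k x y \<zeta> p c by (rule 1)
  interpret N2: nonruled_curve K V2 k x y \<zeta> p c by (rule 2)
  have t: "x = (x \<ominus>\<^bsub>K\<^esub> \<zero>\<^bsub>K\<^esub>) \<otimes>\<^bsub>K\<^esub> inv\<^bsub>K\<^esub> \<one>\<^bsub>K\<^esub>" using N1.x by (simp add: N1.minus_eq)
  show ?thesis
    by (rule same_generator[OF 1 2 e N1.k_sub(2,3) N1.one_not_zero t T N1.k_sub(3) N1.one_not_zero])
      (use N1.gauss_unit[OF T(1)] N2.gauss_unit[OF T(2)] N1.y in simp_all)
qed

text \<open>
  The two centres and radii differ so little that the parameter \<open>t\<close> of one valuation serves for the other as well.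
\<close>

lemma double_root_valuation_unique:
  assumes 1: "nonruled_curve K V1 k x y \<zeta> p c" and 2: "nonruled_curve K V2 k x y \<zeta> p c" and e: "V1 \<inter> k = V2 \<inter> k"
    and n1: "val_ring_field.near_double_root K V1 k p c d1 e1" "val_ring_field.res_transc K V1 k ((x \<ominus>\<^bsub>K\<^esub> d1) \<otimes>\<^bsub>K\<^esub> inv\<^bsub>K\<^esub> e1)"
    and n2: "val_ring_field.near_double_root K V2 k p c d2 e2" "val_ring_field.res_transc K V2 k ((x \<ominus>\<^bsub>K\<^esub> d2) \<otimes>\<^bsub>K\<^esub> inv\<^bsub>K\<^esub> e2)"
  shows "V1 = V2"
proof -
  interpret N1: nonruled_curve K V1 k x y \<zeta> p c by (rule 1)
  interpret N2: nonruled_curve K V2 k x y \<zeta> p c by (rule 2)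
  have n12: "N2.near_double_root k p c d1 e1"
    by (rule same_near_double_root[OF N2.normal_curve_axioms N1.normal_curve_axioms e[symmetric] n1(1)])
  note D1 = N1.near_double_rootD[OF n1(1)] and D2 = N2.near_double_rootD[OF n2(1)]
  note U = N2.double_root_comparison[OF n12 n2(1)]
  define t where "t = (x \<ominus>\<^bsub>K\<^esub> d1) \<otimes>\<^bsub>K\<^esub> inv\<^bsub>K\<^esub> e1"
  define u where "u = e2 \<otimes>\<^bsub>K\<^esub> inv\<^bsub>K\<^esub> e1"
  define r where "r = (d2 \<ominus>\<^bsub>K\<^esub> d1) \<otimes>\<^bsub>K\<^esub> inv\<^bsub>K\<^esub> e1"
  have ur: "u \<in> k \<inter> V2" "u \<notin> N2.M" "r \<in> k \<inter> V2"
    using U N1.k_sub(6)[OF D2(4) D1(8)] N1.k_sub(6)[OF N1.k_diff[OF D2(1) D1(1)] D1(8)] by (simp_all add: u_def r_def)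
  have "e2 \<otimes>\<^bsub>K\<^esub> i \<otimes>\<^bsub>K\<^esub> ((x \<ominus>\<^bsub>K\<^esub> d2) \<otimes>\<^bsub>K\<^esub> j) \<oplus>\<^bsub>K\<^esub> (d2 \<ominus>\<^bsub>K\<^esub> d1) \<otimes>\<^bsub>K\<^esub> i = (x \<ominus>\<^bsub>K\<^esub> d1) \<otimes>\<^bsub>K\<^esub> i"
    if ij: "i \<in> carrier K" "j \<in> carrier K" "e2 \<otimes>\<^bsub>K\<^esub> j = \<one>\<^bsub>K\<^esub>" for i j
  proof -
    have "e2 \<otimes>\<^bsub>K\<^esub> i \<otimes>\<^bsub>K\<^esub> ((x \<ominus>\<^bsub>K\<^esub> d2) \<otimes>\<^bsub>K\<^esub> j) \<oplus>\<^bsub>K\<^esub> (d2 \<ominus>\<^bsub>K\<^esub> d1) \<otimes>\<^bsub>K\<^esub> i =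
      (e2 \<otimes>\<^bsub>K\<^esub> j) \<otimes>\<^bsub>K\<^esub> ((x \<ominus>\<^bsub>K\<^esub> d2) \<otimes>\<^bsub>K\<^esub> i) \<oplus>\<^bsub>K\<^esub> (d2 \<ominus>\<^bsub>K\<^esub> d1) \<otimes>\<^bsub>K\<^esub> i"
      using ij(1,2) D1(3) D2(3,6) N1.x by (simp add: N1.m_ac N1.minus_eq)
    also have "\<dots> = (x \<ominus>\<^bsub>K\<^esub> d2) \<otimes>\<^bsub>K\<^esub> i \<oplus>\<^bsub>K\<^esub> (d2 \<ominus>\<^bsub>K\<^esub> d1) \<otimes>\<^bsub>K\<^esub> i"
      using ij D2(3) N1.x by simp
    also have "\<dots> = (x \<ominus>\<^bsub>K\<^esub> d1) \<otimes>\<^bsub>K\<^esub> i"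
    proof -
      have "x \<ominus>\<^bsub>K\<^esub> d1 = (x \<ominus>\<^bsub>K\<^esub> d2) \<oplus>\<^bsub>K\<^esub> (d2 \<ominus>\<^bsub>K\<^esub> d1)" using D1(3) D2(3) N1.x by (rule_tac N1.telescope)
      then show ?thesis using ij D1(3) D2(3) N1.x by (simp add: N1.l_distr)
    qed
    finally show ?thesis .
  qed
  from this[OF D1(9) D2(9)] have tu: "t = u \<otimes>\<^bsub>K\<^esub> ((x \<ominus>\<^bsub>K\<^esub> d2) \<otimes>\<^bsub>K\<^esub> inv\<^bsub>K\<^esub> e2) \<oplus>\<^bsub>K\<^esub> r"
    unfolding t_def u_def r_def using D2(6,7) by simp
  have T2: "N2.res_transc k t" unfolding tu by (rule N2.res_transc_affine[OF n2(2) ur])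
  have ee: "e1 \<otimes>\<^bsub>K\<^esub> e1 \<in> k" "e1 \<otimes>\<^bsub>K\<^esub> e1 \<noteq> \<zero>\<^bsub>K\<^esub>" using D1(4,6,7) N1.k_sub(6) by (auto simp: N1.integral_iff)
  show ?thesis
    by (rule same_generator[OF 1 2 e D1(1,4,7) t_def _ T2 ee N1.double_root_unit[OF n1(1) t_def] N2.double_root_unit[OF n12 t_def T2]])
      (use n1(2) in \<open>simp_all add: t_def\<close>)
qed

section \<open>Valuation rings of valuations\<close>

lemma (in field) nat_el_eq_zero_iff: "nat_el R n = \<zero> \<longleftrightarrow> ring_char R dvd n"
  unfolding ring_char_def add.pow_eq_id[OF one_closed, symmetric] by simp

lemma (in field) ring_char_not_one: "ring_char R \<noteq> 1"
proof
  assume "ring_char R = 1"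
  then have "nat_el R 1 = \<zero>" unfolding nat_el_eq_zero_iff by simp
  then show False by simp
qed

lemma (in field) nat_el_prime: "Factorial_Ring.prime p \<Longrightarrow> p \<noteq> ring_char R \<Longrightarrow> nat_el R p \<noteq> \<zero>"
  unfolding nat_el_eq_zero_iff using ring_char_not_one prime_nat_iff by auto

context field begin

context
  fixes w :: "'a \<Rightarrow> 'g::linordered_ab_group_add vinf"
  assumes w: "valuation R w"
begin

lemma valuation_Infty: "z \<in> carrier R \<Longrightarrow> w z = Infty \<longleftrightarrow> z = \<zero>" using w by (simp add: valuation_def)
lemma valuation_mult: "z \<in> carrier R \<Longrightarrow> z' \<in> carrier R \<Longrightarrow> w (z \<otimes> z') = w z + w z'"
  using w by (simp add: valuation_def)
lemma valuation_add: "z \<in> carrier R \<Longrightarrow> z' \<in> carrier R \<Longrightarrow> min (w z) (w z') \<le> w (z \<oplus> z')"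
  using w by (simp add: valuation_def)

lemma valuation_Val: "z \<in> carrier R \<Longrightarrow> z \<noteq> \<zero> \<Longrightarrow> \<exists>g. w z = Val g"
  using valuation_Infty[of z] by (cases "w z") auto

lemma valuation_one: "w \<one> = 0"
proof -
  obtain g where g: "w \<one> = Val g" using valuation_Val[of \<one>] by auto
  have "w \<one> = w \<one> + w \<one>" using valuation_mult[of \<one> \<one>] by simp
  then show ?thesis using g by (simp add: zero_vinf_def)
qed

lemma valuation_uminus: "z \<in> carrier R \<Longrightarrow> w (\<ominus> z) = w z"
proof -
  assume z: "z \<in> carrier R"
  obtain g where g: "w (\<ominus> \<one>) = Val g" using valuation_Val[of "\<ominus> \<one>"] by (metis a_inv_closed minus_minus minus_zero one_closed one_not_zero)
  have "w (\<ominus> \<one>) + w (\<ominus> \<one>) = 0"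
    using valuation_mult[of "\<ominus> \<one>" "\<ominus> \<one>"] valuation_one by (simp add: l_minus)
  then have "g = 0" using g by (simp add: zero_vinf_def)
  then have "w (\<ominus> \<one>) = 0" using g by (simp add: zero_vinf_def)
  then show ?thesis using valuation_mult[of "\<ominus> \<one>" z] z by (simp add: l_minus)
qed

lemma valuation_inv: "z \<in> carrier R \<Longrightarrow> z \<noteq> \<zero> \<Longrightarrow> w z + w (inv z) = 0"
proof -
  assume z: "z \<in> carrier R" "z \<noteq> \<zero>"
  then have "z \<in> Units R" using field_Units by simp
  then show ?thesis using valuation_mult[of z "inv z"] z valuation_one by simp
qed

lemma valuation_inv_nonneg: "z \<in> carrier R \<Longrightarrow> z \<noteq> \<zero> \<Longrightarrow> 0 \<le> w (inv z) \<longleftrightarrow> w z \<le> 0"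
  using valuation_inv[of z] by (cases "w z"; cases "w (inv z)") (auto simp: zero_vinf_def add_eq_0_iff2)

lemma val_ring_field_valuation: "val_ring_field R (val_ring R w)"
proof (intro val_ring_field.intro val_ring_field_axioms.intro field_axioms)
  have z: "w \<zero> = Infty" using valuation_Infty[of \<zero>] by simp
  show "subring (val_ring R w) R"
  proof (rule subringI)
    fix h1 h2 assume h: "h1 \<in> val_ring R w" "h2 \<in> val_ring R w"
    show "h1 \<otimes> h2 \<in> val_ring R w"
      using h add_nonneg_nonneg[of "w h1" "w h2"] by (auto simp: val_ring_def valuation_mult)
    show "h1 \<oplus> h2 \<in> val_ring R w"
      using h valuation_add[of h1 h2] by (auto simp: val_ring_def min_def split: if_splits)
  qed (auto simp: val_ring_def valuation_one valuation_uminus)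
  fix z assume z: "z \<in> carrier R" "z \<noteq> \<zero>"
  then have "inv z \<in> carrier R" using field_Units by simp
  then show "z \<in> val_ring R w \<or> inv z \<in> val_ring R w"
    using z valuation_inv_nonneg[OF z] by (auto simp: val_ring_def)
qed

lemma val_ideal_eq: "val_ideal R w = val_ring_field.M R (val_ring R w)"
proof -
  have "0 < w z \<longleftrightarrow> 0 \<le> w z \<and> (z = \<zero> \<or> \<not> 0 \<le> w (inv z))" if z: "z \<in> carrier R" for z
  proof (cases "z = \<zero>")
    case True
    then show ?thesis using valuation_Infty[of \<zero>] by (simp add: zero_vinf_def less_vinf_def)
  next
    case False
    then show ?thesis using valuation_inv_nonneg[OF z False] by auto
  qed
  note 1 = this
  have 2: "inv z \<in> carrier R" if "z \<in> carrier R" "z \<noteq> \<zero>" for z using that field_Units by simp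
  show ?thesis
    unfolding val_ideal_def val_ring_field.M_def[OF val_ring_field_valuation]
    unfolding val_ring_def
  proof (rule Set.set_eqI)
    fix z
    show "z \<in> {z \<in> carrier R. 0 < w z} \<longleftrightarrow>
      z \<in> {z \<in> {z \<in> carrier R. 0 \<le> w z}. z = \<zero> \<or> inv z \<notin> {z \<in> carrier R. 0 \<le> w z}}"
      using 1[of z] 2[of z] by (cases "z \<in> carrier R"; cases "z = \<zero>") simp_all
  qed
qed

lemma residue_field_eq: "residue_field R w = val_ring_field.RF R (val_ring R w)"
  unfolding residue_field_def val_ring_field.RF_def[OF val_ring_field_valuation] val_ideal_eq ..

lemma residue_subfield_eq: "residue_subfield R F w = val_ring_field.resF R (val_ring R w) F"
  unfolding residue_subfield_def val_ring_field.resF_def[OF val_ring_field_valuation] val_ideal_eq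
    val_ring_field.res_def[OF val_ring_field_valuation] ..

lemma valuation_quot_le:
  assumes "z \<in> carrier R" "z' \<in> carrier R" "z' \<noteq> \<zero>"
  shows "w z' \<le> w z \<longleftrightarrow> z \<otimes> inv z' \<in> val_ring R w"
proof -
  have i: "inv z' \<in> carrier R" using assms field_Units by simp
  obtain g where g: "w z' = Val g" using valuation_Val assms by blast
  obtain h where h: "w (inv z') = Val h" "h = - g"
    using valuation_inv[of z'] assms g by (cases "w (inv z')") (auto simp: zero_vinf_def eq_neg_iff_add_eq_0 add.commute)
  show ?thesis using assms i g h by (cases "w z") (auto simp: val_ring_def valuation_mult zero_vinf_def)
qed

lemma valuation_pow: "z \<in> carrier R \<Longrightarrow> w z = Val g \<Longrightarrow> w (z [^] (n::nat)) = Val (ntimes n g)"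
  by (induction n) (simp_all add: valuation_one valuation_mult zero_vinf_def add.commute)

end

lemma valuation_restrict:
  assumes "valuation R u" "subfield F R" shows "valuation (R\<lparr>carrier := F\<rparr>) u"
proof -
  have F: "z \<in> carrier R" if "z \<in> F" for z using subfieldE(3)[OF assms(2)] that by blast
  show ?thesis using assms(1) F unfolding valuation_def by simp
qed

lemma extends_valuation_cut:
  assumes "extends_valuation R k v w" "subfield k R"
  shows "val_ring R w \<inter> k = val_ring (R\<lparr>carrier := k\<rparr>) v"
proof -
  have F: "z \<in> carrier R" if "z \<in> k" for z using subfieldE(3)[OF assms(2)] that by blast
  show ?thesis using assms(1) F by (auto simp: extends_valuation_def equiv_valuations_def val_ring_def)
qed

text \<open>
  The residue characteristic is given for \<open>(k, v)\<close>; an integer is a unit of \<open>V\<close> if and only if it is one in \<open>k \<inter> V\<close>.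
\<close>

lemma residue_nat_el:
  fixes v :: "'a \<Rightarrow> 'g::linordered_ab_group_add vinf"
  assumes k: "subfield k R" and v: "valuation (R\<lparr>carrier := k\<rparr>) v" and V: "val_ring_field R V"
    and e: "V \<inter> k = val_ring (R\<lparr>carrier := k\<rparr>) v" and n: "\<not> ring_char (residue_field (R\<lparr>carrier := k\<rparr>) v) dvd n"
  shows "nat_el R n \<notin> val_ring_field.M R V"
proof -
  let ?F = "R\<lparr>carrier := k\<rparr>"
  interpret F: field ?F using subfield_iff(2)[OF k] .
  have vF: "val_ring_field ?F (val_ring ?F v)" by (rule F.val_ring_field_valuation[OF v])
  interpret v: val_ring_field ?F "val_ring ?F v" by (rule vF)
  interpret V: val_ring_field R V by (rule V)
  have "nat_el v.RF n \<noteq> \<zero>\<^bsub>v.RF\<^esub>"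
    using n unfolding F.residue_field_eq[OF v] v.RF.nat_el_eq_zero_iff .
  then have nM: "nat_el ?F n \<notin> v.M"
    using v.res_eq_zero_iff[OF v.V_nat_el[of n]] unfolding v.res_nat_el by blast
  have ne: "nat_el ?F n = nat_el R n" by (simp add: add_pow_consistent)
  have nk: "nat_el R n \<in> k" using F.nat_el_closed[of n] unfolding ne by simp
  show ?thesis
  proof
    assume m: "nat_el R n \<in> V.M"
    have nv: "nat_el R n \<in> val_ring ?F v" using V.V_nat_el[of n] nk unfolding e[symmetric] by blast
    have "nat_el R n = \<zero> \<or> m_inv ?F (nat_el R n) \<notin> val_ring ?F v"
    proof (cases "nat_el R n = \<zero>")
      case False
      have ik: "inv (nat_el R n) \<in> k" using subfield_m_inv(1)[OF k, of "nat_el R n"] nk False by simp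
      have "m_inv ?F (nat_el R n) = inv (nat_el R n)"
        using F.comm_inv_char[of "nat_el R n" "inv (nat_el R n)"] nk ik False by simp
      moreover have "inv (nat_el R n) \<notin> V" using m False unfolding V.M_def by simp
      ultimately show ?thesis unfolding e[symmetric] by simp
    qed simp
    then show False using nM nv unfolding ne v.M_def by simp
  qed
qed

end

lemma divby_zero_1: "divby 0 1 = 0"
  by transfer (simp add: frac_rel_def)

lemma ntimes_divby_1: "ntimes n (divby s 1) = divby (ntimes n s) 1"
  by (induction n) (simp_all add: divby_1_add divby_zero_1 del: One_nat_def)

lemma divby_ntimes: "0 < n \<Longrightarrow> divby (ntimes n s) n = divby s 1"
  using ntimes_divby[of n "ntimes n s"] ntimes_divby_1[of n s] ntimes_eq_iff[of n] by metis

lemma val_ring_field_trdeg_one: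
  assumes V: "val_ring_field K V" and k: "subfield k K" and td: "trdeg_one (val_ring_field.RF K V) (val_ring_field.resF K V k)"
  shows "\<exists>t. val_ring_field.res_transc K V k t"
proof -
  interpret val_ring_field K V by (rule V)
  obtain T where "T \<in> carrier RF" "RF.transcendental (resF k) T" using td unfolding trdeg_one_def by blast
  then show ?thesis using carrier_RF res_transc_iff[OF k] by auto
qed

section \<open>The Gauss valuation\<close>

lemma vdivby_1_le_iff: "vdivby \<alpha> 1 \<le> vdivby \<beta> 1 \<longleftrightarrow> \<alpha> \<le> \<beta>"
  unfolding vdivby_def by (cases \<alpha>; cases \<beta>) (simp_all add: divby_1_le_iff del: One_nat_def)

lemma vdivby_1_add: "vdivby (\<alpha> + \<beta>) 1 = vdivby \<alpha> 1 + vdivby \<beta> 1"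
  unfolding vdivby_def by (cases \<alpha>; cases \<beta>) (simp_all add: divby_1_add del: One_nat_def)

lemma (in field) inv_subfield:
  assumes "subfield k R" "z \<in> k" "z \<noteq> \<zero>" shows "m_inv (R\<lparr>carrier := k\<rparr>) z = inv z"
proof -
  interpret F: field "R\<lparr>carrier := k\<rparr>" using subfield_iff(2)[OF assms(1)] .
  show ?thesis using F.comm_inv_char[of z "inv z"] subfield_m_inv[OF assms(1), of z] assms by simp
qed

context curve_val begin

context
  fixes v :: "'a \<Rightarrow> 'g::linordered_ab_group_add vinf"
  assumes v: "valuation (K\<lparr>carrier := k\<rparr>) v" and cut: "V \<inter> k = val_ring (K\<lparr>carrier := k\<rparr>) v"
begin

lemma v_le: "e \<in> k \<Longrightarrow> e' \<in> k \<Longrightarrow> e' \<noteq> \<zero> \<Longrightarrow> v e' \<le> v e \<longleftrightarrow> e \<otimes> inv e' \<in> V"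
proof -
  assume e: "e \<in> k" "e' \<in> k" "e' \<noteq> \<zero>"
  interpret F: field "K\<lparr>carrier := k\<rparr>" using subfield_iff(2)[OF subk] .
  have ek: "e \<otimes> inv e' \<in> k" using e k_inv k_sub(6) by blast
  have "v e' \<le> v e \<longleftrightarrow> e \<otimes> inv e' \<in> val_ring (K\<lparr>carrier := k\<rparr>) v"
    using F.valuation_quot_le[OF v, of e e'] e inv_subfield[OF subk e(2,3)] by simp
  then show ?thesis unfolding cut[symmetric] using ek by simp
qed

lemma v_mult: "e \<in> k \<Longrightarrow> e' \<in> k \<Longrightarrow> v (e \<otimes> e') = v e + v e'"
  using v by (simp add: valuation_def)

lemma v_Infty: "e \<in> k \<Longrightarrow> v e = Infty \<longleftrightarrow> e = \<zero>"
  using v by (simp add: valuation_def)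

text \<open>
  Every nonzero element of \<open>K\<close> has the value of some \<open>e \<in> k\<close>. This gives a valuation on \<open>K\<close>, equivalent to \<open>w\<close>, with values in the divisible hull of
  \<open>vk\<close>, where the Gauss valuation takes its values.
\<close>

definition "scale z e \<longleftrightarrow> e \<in> k \<and> e \<noteq> \<zero> \<and> z \<otimes> inv e \<in> V \<and> z \<otimes> inv e \<notin> M"

definition hull_val :: "'a \<Rightarrow> 'g divhull vinf" where
  "hull_val z = (if z = \<zero> then Infty else vdivby (v (SOME e. scale z e)) 1)"

lemma hull_val_eq:
  assumes z: "z \<in> carrier K" "z \<noteq> \<zero>" and e: "scale z e" shows "hull_val z = vdivby (v e) 1"
proof -
  have le: "v e' \<le> v e" if e: "scale z e" and e': "scale z e'" for e e'
  proof -
    have c: "e \<in> k" "e \<noteq> \<zero>" "e' \<in> k" "e' \<noteq> \<zero>" "e \<in> carrier K" "e' \<in> carrier K" "inv e \<in> carrier K" "inv e' \<in> carrier K"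
      and u: "z \<otimes> inv e \<in> V" "z \<otimes> inv e \<notin> M" "z \<otimes> inv e' \<in> V"
      using e e' kc by (auto simp: scale_def)
    have "(e \<otimes> inv e') \<otimes> (z \<otimes> inv e) = z \<otimes> inv e'"
      using div_chain[OF z(1) c(5,2) c(6,4)] z c by (simp add: m_comm[of "e \<otimes> inv e'"])
    then have "e \<otimes> inv e' \<in> V" using mult_unit_cancel(1)[OF _ u(1,2), of "e \<otimes> inv e'"] u(3) c by simp
    then show ?thesis using v_le[OF c(1,3,4)] by simp
  qed
  have "scale z (SOME e. scale z e)" using e by (rule someI)
  then have "v (SOME e. scale z e) = v e" using le e by (meson order_antisym)
  then show ?thesis using z by (simp add: hull_val_def)
qed

lemma ex_scale: "z \<in> carrier K \<Longrightarrow> z \<noteq> \<zero> \<Longrightarrow> \<exists>e. scale z e"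
  using value_in_k[of z] unfolding scale_def by blast

lemma hull_val_le:
  assumes z: "z \<in> carrier K" and e: "e \<in> k" "e \<noteq> \<zero>"
  shows "vdivby (v e) 1 \<le> hull_val z \<longleftrightarrow> z \<otimes> inv e \<in> V"
proof (cases "z = \<zero>")
  case True
  then show ?thesis using e kc by (simp add: hull_val_def)
next
  case False
  obtain f where f: "scale z f" using ex_scale[OF z False] by blast
  then have c: "f \<in> k" "f \<noteq> \<zero>" "f \<in> carrier K" "inv f \<in> carrier K" "e \<in> carrier K" "inv e \<in> carrier K"
    and u: "z \<otimes> inv f \<in> V" "z \<otimes> inv f \<notin> M"
    using e kc by (auto simp: scale_def)
  have "z \<otimes> inv e = (f \<otimes> inv e) \<otimes> (z \<otimes> inv f)"
    using div_chain[OF z c(3,2,5) e(2)] z c by (simp add: m_comm[of "f \<otimes> inv e"])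
  then have "z \<otimes> inv e \<in> V \<longleftrightarrow> f \<otimes> inv e \<in> V" using mult_unit_cancel(1)[OF _ u, of "f \<otimes> inv e"] c by simp
  then show ?thesis unfolding hull_val_eq[OF z False f] vdivby_1_le_iff using v_le[OF c(1) e] by simp
qed

lemma valuation_hull_val: "valuation K hull_val"
proof -
  have add: "hull_val z \<le> hull_val (z \<oplus> z')" if z: "z \<in> carrier K" "z' \<in> carrier K" "hull_val z \<le> hull_val z'" for z z'
  proof (cases "z = \<zero>")
    case True
    then show ?thesis using z by simp
  next
    case False
    obtain e where e: "scale z e" using ex_scale[OF z(1) False] by blast
    then have c: "e \<in> k" "e \<noteq> \<zero>" "inv e \<in> carrier K" "z \<otimes> inv e \<in> V" using kc by (auto simp: scale_def)
    note eq = hull_val_eq[OF z(1) False e]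
    have "z' \<otimes> inv e \<in> V" using hull_val_le[OF z(2) c(1,2)] z(3) eq by simp
    then have "(z \<oplus> z') \<otimes> inv e \<in> V" using c z by (simp add: l_distr)
    then show ?thesis using hull_val_le[OF _ c(1,2), of "z \<oplus> z'"] z eq by simp
  qed
  have mult: "hull_val (z \<otimes> z') = hull_val z + hull_val z'" if z: "z \<in> carrier K" "z' \<in> carrier K" for z z'
  proof (cases "z = \<zero> \<or> z' = \<zero>")
    case True
    then have "hull_val z = Infty \<or> hull_val z' = Infty" "z \<otimes> z' = \<zero>" using z by (auto simp: hull_val_def)
    then show ?thesis by (cases "hull_val z"; cases "hull_val z'") (auto simp: hull_val_def)
  next
    case False
    obtain e e' where e: "scale z e" "scale z' e'" using ex_scale z False by blast
    then have c: "e \<in> k" "e \<noteq> \<zero>" "e \<in> carrier K" "inv e \<in> carrier K" "e' \<in> k" "e' \<noteq> \<zero>" "e' \<in> carrier K" "inv e' \<in> carrier K"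
      and u: "z \<otimes> inv e \<in> V" "z \<otimes> inv e \<notin> M" "z' \<otimes> inv e' \<in> V" "z' \<otimes> inv e' \<notin> M"
      using kc by (auto simp: scale_def)
    have "(z \<otimes> z') \<otimes> inv (e \<otimes> e') = (z \<otimes> inv e) \<otimes> (z' \<otimes> inv e')"
      using z c by (simp add: inv_mult m_ac)
    then have "scale (z \<otimes> z') (e \<otimes> e')"
      using c u unit_mult[OF u] k_sub(6) V_mult[OF u(1,3)] unfolding scale_def by (simp add: integral_iff)
    then have "hull_val (z \<otimes> z') = vdivby (v (e \<otimes> e')) 1"
      using False z by (intro hull_val_eq) (auto simp: integral_iff)
    then show ?thesis using hull_val_eq[OF z(1) _ e(1)] hull_val_eq[OF z(2) _ e(2)] False c
      by (simp add: v_mult vdivby_1_add del: One_nat_def)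
  qed
  have inf: "hull_val z = Infty \<longleftrightarrow> z = \<zero>" if z: "z \<in> carrier K" for z
  proof (cases "z = \<zero>")
    case False
    then obtain e where e: "scale z e" using ex_scale[OF z] by blast
    then have "v e \<noteq> Infty" using v_Infty by (auto simp: scale_def)
    then have "vdivby (v e) 1 \<noteq> Infty" by (cases "v e") (auto simp: vdivby_def)
    then show ?thesis using False hull_val_eq[OF z False e] by simp
  qed (simp add: hull_val_def)
  have min: "min (hull_val z) (hull_val z') \<le> hull_val (z \<oplus> z')" if z: "z \<in> carrier K" "z' \<in> carrier K" for z z'
    using add[OF z] add[OF z(2,1)] a_comm[OF z] by (cases "hull_val z \<le> hull_val z'") (auto simp: min_def)
  show ?thesis unfolding valuation_def using inf mult min by simp
qed

lemma hull_val_nonneg: "z \<in> carrier K \<Longrightarrow> 0 \<le> hull_val z \<longleftrightarrow> z \<in> V"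
proof -
  assume z: "z \<in> carrier K"
  interpret F: field "K\<lparr>carrier := k\<rparr>" using subfield_iff(2)[OF subk] .
  have "v \<one> = 0" using F.valuation_one[OF v] by simp
  then have "vdivby (v \<one>) 1 = 0" by (simp add: vdivby_def zero_vinf_def divby_zero_1[simplified])
  then show ?thesis using hull_val_le[OF z k_sub(3) one_not_zero] z by simp
qed

text \<open>
  After division by a coefficient of least value the polynomial is primitive, hence a unit at a residually transcendental element.
\<close>

lemma hull_val_pev:
  assumes T: "res_transc k x" and c: "\<And>i. i \<le> m \<Longrightarrow> c i \<in> k"
  shows "hull_val (pev K c (Suc m) x) = (MIN i\<in>{..m}. vdivby (v (c i)) 1)"
proof (cases "\<exists>j\<le>m. c j \<noteq> \<zero>")
  case False
  then have z: "c i = \<zero>" if "i \<le> m" for i using that by blast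
  have "pev K c (Suc m) x = pev K (\<lambda>_. \<zero>) (Suc m) x" by (rule pev_cong) (simp add: z)
  also have "\<dots> = \<zero>" unfolding pev_def using x by (intro sumn_zero) simp
  finally have p: "pev K c (Suc m) x = \<zero>" .
  have "v \<zero> = Infty" using v_Infty k_sub(2) by simp
  then have "(MIN i\<in>{..m}. vdivby (v (c i)) 1) = Infty"
    by (intro Min_eqI) (use z in \<open>auto simp: vdivby_def image_iff\<close>)
  then show ?thesis unfolding p by (simp add: hull_val_def)
next
  case True
  then obtain j where j: "j < Suc m" "c j \<noteq> \<zero>" by (auto simp: less_Suc_eq_le)
  have cc: "c i \<in> carrier K" if "i < Suc m" for i using c[of i] kc that by simp
  obtain i where i: "i < Suc m" "c i \<noteq> \<zero>" "\<forall>l<Suc m. c l \<otimes> inv (c i) \<in> V"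
    using least_value[of "Suc m" c j] cc j by blast
  have ik: "c i \<in> k" "inv (c i) \<in> k" "inv (c i) \<in> carrier K" using c[of i] i k_inv kc by auto
  define P where "P = pev K (\<lambda>l. inv (c i) \<otimes> c l) (Suc m) x"
  have Pk: "inv (c i) \<otimes> c l \<in> k \<inter> V" if "l < Suc m" for l
    using i(3) that ik c[of l] k_sub(6) cc[OF that] by (simp add: m_comm)
  have "P \<in> Prim k x" unfolding P_def
    by (rule PrimI) (use Pk i cc in \<open>auto intro!: exI[of _ i]\<close>)
  then have PV: "P \<in> V" "P \<notin> M" using Prim_unit[OF T] by auto
  have PP: "P = inv (c i) \<otimes> pev K c (Suc m) x" unfolding P_def using cc ik x by (intro pev_smult) auto
  have pc: "pev K c (Suc m) x \<in> carrier K" using cc x by (intro pev_closed) auto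
  have p0: "pev K c (Suc m) x \<noteq> \<zero>" using PV(2) unfolding PP using ik by auto
  have "scale (pev K c (Suc m) x) (c i)" unfolding scale_def
    using PV ik i(2) pc unfolding PP by (simp add: m_comm)
  then have 1: "hull_val (pev K c (Suc m) x) = vdivby (v (c i)) 1" by (rule hull_val_eq[OF pc p0])
  have "(MIN l\<in>{..m}. vdivby (v (c l)) 1) = vdivby (v (c i)) 1"
  proof (rule Min_eqI)
    show "vdivby (v (c i)) 1 \<in> (\<lambda>l. vdivby (v (c l)) 1) ` {..m}" using i(1) by auto
    fix a assume "a \<in> (\<lambda>l. vdivby (v (c l)) 1) ` {..m}"
    then obtain l where l: "l < Suc m" "a = vdivby (v (c l)) 1" by (auto simp: less_Suc_eq_le)
    then show "vdivby (v (c i)) 1 \<le> a"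
      unfolding l(2) vdivby_1_le_iff using v_le[of "c l" "c i"] c[of l] ik i by simp
  qed simp
  then show ?thesis using 1 by simp
qed

text \<open>
  The coefficients of a polynomial in \<open>\<xi> = \<beta> x\<close>, rewritten as a polynomial in \<open>x\<close>, acquire the factors \<open>\<beta> ^ i\<close>, which account for the multiples of \<open>v \<beta>\<close> in the Gauss valuation.
\<close>

lemma gauss_extension_if_transc:
  fixes w :: "'a \<Rightarrow> 'h::linordered_ab_group_add vinf"
  assumes ext: "extends_valuation K k v w" and Vw: "V = val_ring K w"
    and b: "\<beta> \<in> k" "\<beta> \<noteq> \<zero>" "v \<beta> = Val s" and \<xi>: "\<xi> = \<beta> \<otimes> x" and T: "res_transc k x"
  shows "gauss_extension K k v \<xi> (divby s 1) w"
proof -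
  interpret F: field "K\<lparr>carrier := k\<rparr>" using subfield_iff(2)[OF subk] .
  have bc: "\<beta> \<in> carrier K" "inv \<beta> \<in> k" "inv \<beta> \<noteq> \<zero>" using b kc k_inv by auto
  have xic: "\<xi> \<in> carrier K" unfolding \<xi> using bc x by simp
  have "\<xi> = (x \<ominus> \<zero>) \<otimes> inv (inv \<beta>)" unfolding \<xi> using bc b x by (simp add: minus_eq m_comm)
  then have k0xi: "generate_field K (insert \<xi> k) = k0" by (intro k0_affine[OF k_sub(2) bc(2,3)])
  have vp: "v (\<beta> [^] i) = Val (ntimes i s)" for i :: nat
    using F.valuation_pow[OF v, of \<beta> s i] b by (simp add: nat_pow_consistent[symmetric])
  have eq: "hull_val (ring.eval K f \<xi>) =
      (MIN i\<in>{..Polynomials.degree f}. vdivby (v (ring.coeff K f i)) 1 + Val (ntimes i (divby s 1)))"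
    if f: "f \<in> carrier (univ_poly K k)" for f
  proof -
    define m where "m = Polynomials.degree f"
    have fk: "set f \<subseteq> k" using f polynomial_incl[of k f] by (simp add: univ_poly_carrier)
    have fc: "set f \<subseteq> carrier K" using fk kc by blast
    have ck: "coeff f i \<in> k" for i
    proof (cases "i < length f")
      case True
      then have "coeff f i = f ! (length f - 1 - i)" by (rule coeff_nth)
      then show ?thesis using fk True by (metis (no_types) diff_less less_imp_diff_less length_greater_0_conv nth_mem
            subsetD zero_less_one list.size(3) not_less0 diff_Suc_less)
    next
      case False
      then show ?thesis using coeff_degree[of f i] coeff_length[of f i] k_sub(2) by simp
    qed
    have cc: "coeff f i \<in> carrier K" for i using ck kc by blast
    have "eval f \<xi> = pev K (coeff f) (Suc m) \<xi>"
    proof (cases "f = []")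
      case True
      then show ?thesis using xic by (simp add: m_def)
    next
      case False
      then have "Suc m = length f" by (simp add: m_def)
      then show ?thesis using eval_eq_pev[OF fc xic] by simp
    qed
    also have "\<dots> = pev K (\<lambda>i. coeff f i \<otimes> \<beta> [^] i) (Suc m) x"
      unfolding pev_def \<xi> using bc x cc by (intro sumn_cong) (simp add: nat_pow_distrib m_assoc)
    finally have e: "eval f \<xi> = pev K (\<lambda>i. coeff f i \<otimes> \<beta> [^] i) (Suc m) x" .
    have "vdivby (v (coeff f i \<otimes> \<beta> [^] i)) 1 = vdivby (v (coeff f i)) 1 + Val (ntimes i (divby s 1))" for i
    proof -
      have "vdivby (v (\<beta> [^] i)) 1 = Val (ntimes i (divby s 1))"
        unfolding vp ntimes_divby_1 by (simp add: vdivby_def)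
      then show ?thesis using v_mult[OF ck k_pow[OF b(1)]] vdivby_1_add by metis
    qed
    moreover have "hull_val (eval f \<xi>) = (MIN i\<in>{..m}. vdivby (v (coeff f i \<otimes> \<beta> [^] i)) 1)"
      unfolding e by (rule hull_val_pev[OF T]) (intro k_sub(6) ck k_pow b(1))
    ultimately show ?thesis unfolding m_def by simp
  qed
  have "val_ring (K\<lparr>carrier := k0\<rparr>) hull_val = val_ring (K\<lparr>carrier := k0\<rparr>) w"
  proof -
    have "0 \<le> hull_val z \<longleftrightarrow> 0 \<le> w z" if "z \<in> k0" for z
      using hull_val_nonneg[OF k0c[OF that]] k0c[OF that] unfolding Vw val_ring_def by simp
    then show ?thesis unfolding val_ring_def by auto
  qed
  then show ?thesis
    unfolding gauss_extension_def k0xi equiv_valuations_def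
    using ext valuation_restrict[OF valuation_hull_val k0] eq by blast
qed

end

end

section \<open>Reduction to the normal form\<close>

locale radical_curve = field K for K (structure) +
  fixes k :: "'a set" and x y a b c \<zeta> :: 'a and p :: nat
    and v :: "'a \<Rightarrow> 'g::linordered_ab_group_add vinf"
  assumes subk: "subfield k K" and x: "x \<in> carrier K" "transcendental k x"
    and p: "Factorial_Ring.prime p" and abc: "a \<in> k" "b \<in> k" "c \<in> k" "a \<noteq> \<zero>"
    and y: "y \<in> carrier K" "y [^] p = a \<otimes> x [^] p \<oplus> b \<otimes> x \<oplus> c"
    and gen: "carrier K = generate_field K (insert y (generate_field K (insert x k)))"
    and \<zeta>: "primitive_root (K\<lparr>carrier := k\<rparr>) p \<zeta>"
    and v: "valuation (K\<lparr>carrier := k\<rparr>) v"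
    and rp: "p \<noteq> ring_char (residue_field (K\<lparr>carrier := k\<rparr>) v)"
    and slope: "vdivby (v (b \<otimes> inv a)) (p - 1) \<le> vdivby (v (c \<otimes> inv a)) p"
    and closed: "sep_alg_closed (K\<lparr>carrier := k\<rparr>)"
    and rp1: "\<not> ring_char (residue_field (K\<lparr>carrier := k\<rparr>) v) dvd p - 1"
begin

lemma kc: "z \<in> k \<Longrightarrow> z \<in> carrier K" using subfieldE(3)[OF subk] by blast
lemmas k_sub = subringE[OF subfieldE(1)[OF subk]]
lemma k_inv: "z \<in> k \<Longrightarrow> z \<noteq> \<zero> \<Longrightarrow> inv z \<in> k" using subfield_m_inv(1)[OF subk, of z] by simp
lemma p2: "2 \<le> p" using p prime_ge_2_nat by blast

definition nonruled_ring :: "'a set \<Rightarrow> bool" where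
  "nonruled_ring V \<longleftrightarrow> val_ring_field K V \<and> V \<inter> k = val_ring (K\<lparr>carrier := k\<rparr>) v \<and>
    trdeg_one (val_ring_field.RF K V) (val_ring_field.resF K V k) \<and>
    \<not> ruled (val_ring_field.RF K V) (val_ring_field.resF K V k)"

lemma nonruled_ring_if_extension: "nonruled_rt_extension K k v w \<Longrightarrow> nonruled_ring (val_ring K w)"
proof -
  assume "nonruled_rt_extension K k v w"
  then have e: "extends_valuation K k v w" and t: "trdeg_one (residue_field K w) (residue_subfield K k w)"
    and n: "\<not> ruled (residue_field K w) (residue_subfield K k w)"
    by (auto simp: nonruled_rt_extension_def residue_transcendental_extension_def)
  have w: "valuation K w" using e by (simp add: extends_valuation_def)
  show ?thesis unfolding nonruled_ring_def
    using val_ring_field_valuation[OF w] extends_valuation_cut[OF e subk] t n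
    unfolding residue_field_eq[OF w] residue_subfield_eq[OF w] by blast
qed

context
  fixes V assumes V: "nonruled_ring V"
begin

interpretation V: val_ring_field K V using V by (simp add: nonruled_ring_def)

lemma cut: "V \<inter> k = val_ring (K\<lparr>carrier := k\<rparr>) v" using V by (simp add: nonruled_ring_def)
lemma td: "trdeg_one V.RF (V.resF k)" using V by (simp add: nonruled_ring_def)
lemma nr: "\<not> ruled V.RF (V.resF k)" using V by (simp add: nonruled_ring_def)

lemma p_unit: "nat_el K p \<notin> V.M" "nat_el K (p - 1) \<notin> V.M"
proof -
  interpret F: field "K\<lparr>carrier := k\<rparr>" using subfield_iff(2)[OF subk] .
  interpret v: val_ring_field "K\<lparr>carrier := k\<rparr>" "val_ring (K\<lparr>carrier := k\<rparr>) v"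
    by (rule F.val_ring_field_valuation[OF v])
  have "\<not> ring_char (residue_field (K\<lparr>carrier := k\<rparr>) v) dvd p"
    using v.RF.nat_el_prime[OF p] rp unfolding F.residue_field_eq[OF v] v.RF.nat_el_eq_zero_iff by blast
  then show "nat_el K p \<notin> V.M" by (rule residue_nat_el[OF subk v V.val_ring_field_axioms cut])
  show "nat_el K (p - 1) \<notin> V.M" by (rule residue_nat_el[OF subk v V.val_ring_field_axioms cut rp1])
qed

lemma y_nonzero: "y \<noteq> \<zero>"
proof
  assume "y = \<zero>"
  then have z: "c \<oplus> b \<otimes> x \<oplus> a \<otimes> x [^] p = \<zero>"
    using y(2) p2 x(1) kc[OF abc(1)] kc[OF abc(2)] kc[OF abc(3)] by (simp add: nat_pow_zero a_ac)
  let ?c = "\<lambda>i. if i = 0 then c else if i = 1 then b else if i = p then a else \<zero>"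
  have "pev K ?c (Suc p) x = \<zero>" using pev_trinomial[of c b a x p] z p2 x(1) abc kc by simp
  moreover have "\<forall>i<Suc p. ?c i \<in> k" using abc k_sub(2) by auto
  moreover have "\<exists>i<Suc p. ?c i \<noteq> \<zero>" using p2 abc by (intro exI[of _ p]) auto
  ultimately have "\<not> transcendental k x" by (intro algebraic_if_pev[OF subfieldE(1)[OF subk] x(1)])
  then show False using x by simp
qed

lemma yp_mem: "y [^] p \<in> generate_field K (insert x k)"
proof -
  have sub: "insert x k \<subseteq> carrier K" using x kc by auto
  note k0 = generate_field_is_subfield[OF sub]
  note S = subringE[OF subfieldE(1)[OF k0]]
  have i: "z \<in> generate_field K (insert x k)" if "z \<in> insert x k" for z using that by (rule generate_field.incl)
  have xp: "x [^] n \<in> generate_field K (insert x k)" for n :: nat by (induction n) (auto intro: S(3,6) i)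
  show ?thesis unfolding y(2)
    by (intro S(6,7) xp) (auto intro: i abc)
qed

lemma zeta: "\<zeta> \<in> k" "\<zeta> [^] p = \<one>" "\<zeta> \<noteq> \<one>"
proof -
  have z: "\<zeta> \<in> k" "\<zeta> [^]\<^bsub>K\<lparr>carrier := k\<rparr>\<^esub> p = \<one>"
    "\<And>m :: nat. 0 < m \<Longrightarrow> m < p \<Longrightarrow> \<zeta> [^]\<^bsub>K\<lparr>carrier := k\<rparr>\<^esub> m \<noteq> \<one>"
    using \<zeta> by (auto simp: primitive_root_def)
  show "\<zeta> \<in> k" by (rule z(1))
  show "\<zeta> [^] p = \<one>" using z(2) by (simp add: nat_pow_consistent[symmetric])
  have "\<zeta> [^] (1::nat) \<noteq> \<one>" using z(3)[of 1] p2 unfolding nat_pow_consistent[symmetric] by linarith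
  then show "\<zeta> \<noteq> \<one>" using kc[OF z(1)] by auto
qed

lemma radical: "radical_ext K V k x y \<zeta> p"
  by (intro radical_ext.intro radical_ext_axioms.intro V.val_ring_field_axioms subk x(1) p zeta p_unit(1)
      y(1) y_nonzero yp_mem gen)

lemma ex_transc: "\<exists>t. V.res_transc k t"
  by (rule val_ring_field_trdeg_one[OF V.val_ring_field_axioms subk td])

lemma trivial: "\<not> (\<exists>\<eta>\<in>k. \<eta> \<noteq> \<zero> \<and> \<eta> \<in> V.M) \<Longrightarrow> V = carrier K"
  using ex_transc radical_ext.trivial_V[OF radical] by blast

lemma curve_valI:
  assumes "\<exists>\<eta>\<in>k. \<eta> \<noteq> \<zero> \<and> \<eta> \<in> V.M" "radical_ext K V k x' y' \<zeta> p" "transcendental k x'"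
  shows "curve_val K V k x' y' \<zeta> p"
  using assms ex_transc
  by (intro curve_val.intro curve_val_axioms.intro sep_val.intro sep_val_axioms.intro subk closed V.val_ring_field_axioms)

text \<open>
  For \<open>b = 0\<close> the inequality of values forces \<open>c = 0\<close>, so \<open>y = \<alpha> \<zeta> ^ i x\<close> and all residue fields in question are rational.
\<close>

lemma b_nonzero:
  assumes nt: "\<exists>\<eta>\<in>k. \<eta> \<noteq> \<zero> \<and> \<eta> \<in> V.M" shows "b \<noteq> \<zero>"
proof
  assume b: "b = \<zero>"
  interpret C: curve_val K V k x y \<zeta> p by (rule curve_valI[OF nt radical x(2)])
  have ac: "a \<in> carrier K" "inv a \<in> carrier K" "inv a \<noteq> \<zero>" "c \<in> carrier K" using abc kc by auto
  have k: "c \<otimes> inv a \<in> k" using abc k_inv k_sub(6) by blast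
  have vI: "v z = Infty \<longleftrightarrow> z = \<zero>" if "z \<in> k" for z using v that by (simp add: valuation_def)
  have "v (b \<otimes> inv a) = Infty" unfolding b using vI[OF k_sub(2)] ac by simp
  then have "vdivby (v (c \<otimes> inv a)) p = Infty"
    using slope by (cases "v (c \<otimes> inv a)") (auto simp: vdivby_def)
  then have "v (c \<otimes> inv a) = Infty" by (cases "v (c \<otimes> inv a)") (auto simp: vdivby_def)
  then have c: "c = \<zero>" using vI[OF k] ac by (simp add: integral_iff)
  obtain \<alpha> where al: "\<alpha> \<in> k" "\<alpha> \<noteq> \<zero>" "\<alpha> [^] p = a" using C.pth_root[OF abc(1,4)] by blast
  have alc: "\<alpha> \<in> carrier K" using al kc by simp
  have x0: "x \<noteq> \<zero>" using C.x_not_k[OF k_sub(2)] x(1) by (simp add: minus_eq)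
  have g: "\<alpha> \<otimes> x \<in> C.k0" "\<alpha> \<otimes> x \<noteq> \<zero>" using C.k0_sub(6) C.kk0 C.xk0 al x0 x(1) alc by (auto simp: integral_iff)
  have "y [^] p = (\<alpha> \<otimes> x) [^] p"
    unfolding y(2) b c using al x(1) alc ac by (simp add: nat_pow_distrib)
  moreover have "(\<alpha> \<otimes> x) [^] p \<noteq> \<zero>" by (rule pow_nonzero) (use g x alc in auto)
  ultimately have "y [^] p \<otimes> inv ((\<alpha> \<otimes> x) [^] p) \<ominus> \<one> \<in> V.M" using x(1) alc by (simp add: minus_eq r_neg)
  then have s1: "(y \<otimes> inv (\<alpha> \<otimes> x)) [^] p \<ominus> \<one> \<in> V.M" unfolding C.gen_s(3)[OF g refl] .
  obtain d e where de: "d \<in> k" "e \<in> k" "e \<noteq> \<zero>" "V.res_transc k ((x \<ominus> d) \<otimes> inv e)"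
    using C.exists_center by blast
  have "ruled V.RF (V.resF k)" by (rule C.ruled_if_pow_one[OF td de(1-3) refl de(4) g refl s1])
  then show False using nr by simp
qed

end

text \<open>
  The new parameters do not depend on the valuation of \<open>K\<close>, so they serve for all non-ruled extensions at once. A first such extension \<open>V\<close> ensures
  that \<open>p\<close> and \<open>p - 1\<close> are nonzero in \<open>k\<close>, whence \<open>\<alpha>\<close> and \<open>\<beta>\<close> exist.
\<close>

lemma normal_form:
  assumes V: "nonruled_ring V" and b: "b \<noteq> \<zero>"
  obtains \<beta> s x' y' c' where "\<beta> \<in> k" "\<beta> \<noteq> \<zero>" "v \<beta> = Val s" "vdivby (v (b \<otimes> inv a)) (p - 1) = Val (divby s 1)"
    "x = \<beta> \<otimes> x'"
    "\<And>W. nonruled_ring W \<Longrightarrow> \<exists>\<eta>\<in>k. \<eta> \<noteq> \<zero> \<and> \<eta> \<in> val_ring_field.M K W \<Longrightarrow> nonruled_curve K W k x' y' \<zeta> p c'"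
proof -
  interpret R: radical_ext K V k x y \<zeta> p by (rule radical[OF V])
  interpret F: field "K\<lparr>carrier := k\<rparr>" using subfield_iff(2)[OF subk] .
  have pp: "0 < p - 1" "0 < p" "p = Suc (p - 1)" using p2 by auto
  have n0: "nat_el K p \<noteq> \<zero>" "nat_el K (p - 1) \<noteq> \<zero>" using p_unit[OF V] by auto
  have ac: "a \<in> carrier K" "b \<in> carrier K" "c \<in> carrier K" "inv a \<in> carrier K" "inv a \<in> k" using abc kc k_inv by auto
  have ba: "b \<otimes> inv a \<in> k" "b \<otimes> inv a \<noteq> \<zero>" using abc b ac k_sub(6) by (auto simp: integral_iff)
  obtain \<beta> where be: "\<beta> \<in> k" "\<beta> \<noteq> \<zero>" "\<beta> [^] (p - 1) = b \<otimes> inv a"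
    using nth_root_sep_closed[OF subk closed ba pp(1) n0(2)] by blast
  obtain \<alpha> where al: "\<alpha> \<in> k" "\<alpha> \<noteq> \<zero>" "\<alpha> [^] p = a"
    using nth_root_sep_closed[OF subk closed abc(1,4) pp(2) n0(1)] by blast
  have bc: "\<beta> \<in> carrier K" "inv \<beta> \<in> carrier K" "inv \<beta> \<in> k" "\<alpha> \<in> carrier K" "inv \<alpha> \<in> carrier K" using be al kc k_inv by auto
  define x' where "x' = x \<otimes> inv \<beta>"
  define g where "g = \<alpha> \<otimes> \<beta>"
  define y' where "y' = y \<otimes> inv g"
  define c' where "c' = c \<otimes> inv (g [^] p)"
  have gk: "g \<in> k" "g \<noteq> \<zero>" "g \<in> carrier K" unfolding g_def using al be bc k_sub(6) by (auto simp: integral_iff)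
  have gp: "g [^] p = a \<otimes> \<beta> [^] p" unfolding g_def using al bc by (simp add: nat_pow_distrib)
  have gpk: "g [^] n \<in> k" for n :: nat by (induction n) (auto intro: k_sub(3,6) gk(1))
  have gp0: "g [^] p \<noteq> \<zero>" "g [^] p \<in> carrier K" "g [^] p \<in> k"
    using pow_nonzero[OF gk(3,2), of p] gk(3) gpk[of p] by simp_all
  have c'k: "c' \<in> k" unfolding c'_def using abc k_inv gp0 k_sub(6) by blast
  have x'c: "x' \<in> carrier K" unfolding x'_def using x bc by simp
  have xx': "x = \<beta> \<otimes> x'" unfolding x'_def using m_lcomm[OF bc(1) x(1) bc(2)] x(1) bc be by simp
  have y'c: "y' \<in> carrier K" unfolding y'_def using y gk by simp
  have y'0: "y' \<noteq> \<zero>" unfolding y'_def using y R.y gk by (simp add: integral_iff)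
  have y'p: "y' [^] p = tri p c' x'"
  proof -
    have xp: "x [^] p = \<beta> [^] p \<otimes> x' [^] p" unfolding xx' using bc x'c by (simp add: nat_pow_distrib)
    have bb: "b \<otimes> \<beta> = a \<otimes> \<beta> [^] p"
    proof -
      have "\<beta> [^] p = \<beta> [^] (p - 1) \<otimes> \<beta>" using nat_pow_Suc[of \<beta> "p - 1"] pp(3) by metis
      then have bp: "\<beta> [^] p = (b \<otimes> inv a) \<otimes> \<beta>" unfolding be(3) .
      have "a \<otimes> ((b \<otimes> i) \<otimes> \<beta>) = (a \<otimes> i) \<otimes> (b \<otimes> \<beta>)" if "i \<in> carrier K" for i
        using that ac(1,2) bc(1) by algebra
      from this[OF ac(4)] have "a \<otimes> \<beta> [^] p = (a \<otimes> inv a) \<otimes> (b \<otimes> \<beta>)" unfolding bp .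
      then show ?thesis using R.inv_r[OF ac(1) abc(4)] ac(2) bc(1) by simp
    qed
    have bx: "b \<otimes> x = g [^] p \<otimes> x'" unfolding gp bb[symmetric] xx' using ac bc x'c by (simp add: m_assoc)
    have ax: "a \<otimes> x [^] p = g [^] p \<otimes> x' [^] p" unfolding gp xp using ac bc x'c by (simp add: m_assoc)
    have "y' [^] p = (g [^] p \<otimes> x' [^] p \<oplus> g [^] p \<otimes> x' \<oplus> c) \<otimes> inv (g [^] p)"
      unfolding y'_def R.gen_s(3)[OF R.kk0[OF gk(1)] gk(2) refl] y(2) ax bx ..
    moreover have "(G \<otimes> P \<oplus> G \<otimes> x' \<oplus> c) \<otimes> i = (G \<otimes> i) \<otimes> P \<oplus> (G \<otimes> i) \<otimes> x' \<oplus> c \<otimes> i"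
      if "G \<in> carrier K" "P \<in> carrier K" "i \<in> carrier K" for G P i using that x'c ac by algebra
    ultimately show ?thesis unfolding tri_def c'_def using gp0 x'c ac by simp
  qed
  obtain s where s: "v \<beta> = Val s" using F.valuation_Val[OF v, of \<beta>] be by auto
  have vp: "v (\<beta> [^] n) = Val (ntimes n s)" for n :: nat
    using F.valuation_pow[OF v, of \<beta> s n] be s by (simp add: nat_pow_consistent[symmetric])
  have vba: "vdivby (v (b \<otimes> inv a)) (p - 1) = Val (divby s 1)"
    unfolding be(3)[symmetric] vp vdivby_def using divby_ntimes[OF pp(1), of s] by simp
  have v0: "0 \<le> v c'"
  proof (cases "v c'")
    case (Val u)
    have bp: "\<beta> [^] p \<in> k" for p :: nat by (induction p) (auto intro: k_sub(3,6) be)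
    have "c \<otimes> inv a = c' \<otimes> \<beta> [^] p"
    proof -
      have "\<beta> [^] p \<noteq> \<zero>" "\<beta> [^] p \<in> carrier K" using pow_nonzero[OF bc(1) be(2)] bc by auto
      then show ?thesis unfolding c'_def gp using ac abc by (simp add: R.inv_mult m_assoc)
    qed
    then have "v (c \<otimes> inv a) = Val (u + ntimes p s)"
      using v c'k bp[of p] Val vp[of p] by (simp add: valuation_def)
    then have "divby s 1 \<le> divby (u + ntimes p s) p" using slope unfolding vba by (simp add: vdivby_def)
    then have "ntimes p (divby s 1) \<le> ntimes p (divby (u + ntimes p s) p)" using ntimes_le_iff[OF pp(2)] by blast
    then have "divby (ntimes p s) 1 \<le> divby (u + ntimes p s) 1"
      unfolding ntimes_divby[OF pp(2)] ntimes_divby_1 .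
    then have "0 \<le> u" unfolding divby_1_le_iff by simp
    then show ?thesis using Val by (simp add: zero_vinf_def)
  qed simp
  have x't: "transcendental k x'"
  proof (rule ccontr)
    assume "\<not> transcendental k x'"
    then obtain q n j where q: "\<forall>i<n. q i \<in> k" "j < n" "q j \<noteq> \<zero>" "pev K q n x' = \<zero>"
      using algebraic_iff_pev[OF subfieldE(1)[OF subk] x'c] by blast
    have ibp: "inv \<beta> [^] i \<in> k" "inv \<beta> [^] i \<noteq> \<zero>" for i :: nat
    proof -
      show "inv \<beta> [^] i \<in> k" by (induction i) (auto intro: k_sub(3,6) bc(3))
      show "inv \<beta> [^] i \<noteq> \<zero>" by (rule pow_nonzero) (use bc be in auto)
    qed
    have qc: "q i \<in> carrier K" if "i < n" for i using q(1) that kc by blast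
    have "pev K (\<lambda>i. q i \<otimes> inv \<beta> [^] i) n x = pev K q n x'"
      unfolding pev_def x'_def using x bc qc by (intro sumn_cong) (simp add: nat_pow_distrib m_ac)
    then have "pev K (\<lambda>i. q i \<otimes> inv \<beta> [^] i) n x = \<zero>" using q(4) by simp
    moreover have "\<forall>i<n. q i \<otimes> inv \<beta> [^] i \<in> k" using q(1) ibp k_sub(6) by blast
    moreover have "\<exists>i<n. q i \<otimes> inv \<beta> [^] i \<noteq> \<zero>"
      using q(2,3) ibp qc kc by (intro exI[of _ j]) (simp add: integral_iff)
    ultimately have "\<not> transcendental k x" by (intro algebraic_if_pev[OF subfieldE(1)[OF subk] x(1)])
    then show False using x by simp
  qed
  have "x' = (x \<ominus> \<zero>) \<otimes> inv \<beta>" unfolding x'_def using x by (simp add: minus_eq)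
  then have k0': "generate_field K (insert x' k) = generate_field K (insert x k)"
    by (rule R.k0_affine[OF k_sub(2) be(1,2)])
  have y'gen: "carrier K = generate_field K (insert y' (generate_field K (insert x k)))"
    and y'k0: "y' [^] p \<in> generate_field K (insert x k)"
  proof -
    note G = R.gen_s[OF R.kk0[OF gk(1)] gk(2) y'_def]
    show "y' [^] p \<in> generate_field K (insert x k)" by (rule G(2))
    show "carrier K = generate_field K (insert y' (generate_field K (insert x k)))"
      unfolding generate_field_algebraic[OF R.k0 G(1) R.algebraic_if_pow[OF G(1,2)]] by (rule G(4))
  qed
  have "nonruled_curve K W k x' y' \<zeta> p c'"
    if W: "nonruled_ring W" and nt: "\<exists>\<eta>\<in>k. \<eta> \<noteq> \<zero> \<and> \<eta> \<in> val_ring_field.M K W" for W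
  proof -
    interpret W: val_ring_field K W using W by (simp add: nonruled_ring_def)
    have R': "radical_ext K W k x' y' \<zeta> p"
      by (intro radical_ext.intro radical_ext_axioms.intro W.val_ring_field_axioms subk x'c p zeta[OF W] p_unit(1)[OF W] y'c y'0)
        (use y'gen y'k0 k0' in simp_all)
    have "c' \<in> k \<inter> W" using cut[OF W] c'k v0 by (auto simp: val_ring_def)
    then show ?thesis
      by (intro nonruled_curve.intro nonruled_curve_axioms.intro normal_curve.intro normal_curve_axioms.intro
          curve_valI[OF W nt R' x't] y'p p_unit(2)[OF W] td[OF W] nr[OF W])
  qed
  then show thesis using that[of \<beta> s x' y' c'] be s vba xx' by blast
qed

text \<open>
  A trivial valuation of \<open>k\<close> has only the trivial residue transcendental extension.
\<close>

lemma nontrivial_if_distinct: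
  assumes V: "nonruled_ring V" and W: "nonruled_ring W" "V \<noteq> W"
  shows "\<exists>\<eta>\<in>k. \<eta> \<noteq> \<zero> \<and> \<eta> \<in> val_ring_field.M K V"
proof (rule ccontr)
  assume n: "\<not> (\<exists>\<eta>\<in>k. \<eta> \<noteq> \<zero> \<and> \<eta> \<in> val_ring_field.M K V)"
  have v: "val_ring_field K V" "val_ring_field K W" using V W by (auto simp: nonruled_ring_def)
  have e: "V \<inter> k = W \<inter> k" using cut[OF V] cut[OF W(1)] by simp
  have "\<not> (\<exists>\<eta>\<in>k. \<eta> \<noteq> \<zero> \<and> \<eta> \<in> val_ring_field.M K W)"
    using n same_maximal_ideal[OF v subk e] by blast
  then show False using trivial[OF V n] trivial[OF W(1)] W(2) by simp
qed

end

theorem proposition1p5: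
  fixes K :: "('a, 'm) ring_scheme" (structure)
    and k :: "'a set" and x y a b c \<zeta> :: 'a and p :: nat
    and v :: "'a \<Rightarrow> 'g::linordered_ab_group_add vinf"
    and w1 :: "'a \<Rightarrow> 'h1::linordered_ab_group_add vinf"
    and w2 :: "'a \<Rightarrow> 'h2::linordered_ab_group_add vinf"
    and w3 :: "'a \<Rightarrow> 'h3::linordered_ab_group_add vinf"
  assumes "field K" and "subfield k K"
    and "x \<in> carrier K" and "ring.transcendental K k x"
    and "Factorial_Ring.prime p" and "p \<noteq> ring_char (K\<lparr>carrier := k\<rparr>)"
    and "a \<in> k" and "b \<in> k" and "c \<in> k" and "a \<noteq> \<zero>"
    and "y \<in> carrier K" and "y [^] p = a \<otimes> x [^] p \<oplus> b \<otimes> x \<oplus> c"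
    and "carrier K = generate_field K (insert y (generate_field K (insert x k)))"
    and "primitive_root (K\<lparr>carrier := k\<rparr>) p \<zeta>"
    and "valuation (K\<lparr>carrier := k\<rparr>) v"
    and "p \<noteq> ring_char (residue_field (K\<lparr>carrier := k\<rparr>) v)"
    and "vdivby (v (b \<otimes> inv a)) (p - 1) \<le> vdivby (v (c \<otimes> inv a)) p"
    and "sep_alg_closed (K\<lparr>carrier := k\<rparr>)"
    and "ring_char (K\<lparr>carrier := k\<rparr>) = ring_char (residue_field (K\<lparr>carrier := k\<rparr>) v)"
    and "\<not> ring_char (K\<lparr>carrier := k\<rparr>) dvd p - 1"
  shows "(nonruled_rt_extension K k v w1 \<and> nonruled_rt_extension K k v w2 \<and>
           nonruled_rt_extension K k v w3 \<longrightarrow>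
           equiv_valuations K w1 w2 \<or> equiv_valuations K w1 w3 \<or> equiv_valuations K w2 w3) \<and>
         (nonruled_rt_extension K k v w1 \<and> nonruled_rt_extension K k v w2 \<and>
           \<not> equiv_valuations K w1 w2 \<longrightarrow>
           (\<exists>\<gamma>. vdivby (v (b \<otimes> inv a)) (p - 1) = Val \<gamma> \<and>
             (gauss_extension K k v x \<gamma> w1 \<or> gauss_extension K k v x \<gamma> w2)))"
proof -
  have "\<not> ring_char (residue_field (K\<lparr>carrier := k\<rparr>) v) dvd p - 1" using assms(19,20) by simp
  then interpret radical_curve K k x y a b c \<zeta> p v
    by (intro radical_curve.intro radical_curve_axioms.intro assms)
  have eqv: "equiv_valuations K w w' \<longleftrightarrow> val_ring K w = val_ring K w'"
    for w :: "'a \<Rightarrow> 'x::linordered_ab_group_add vinf" and w' :: "'a \<Rightarrow> 'y::linordered_ab_group_add vinf"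
    by (simp add: equiv_valuations_def)
  \<comment> \<open>Two distinct extensions exclude the degenerate cases, and all extensions share one normal form.\<close>
  have main: "\<exists>\<beta> s x' y' c'. \<beta> \<in> k \<and> \<beta> \<noteq> \<zero> \<and> v \<beta> = Val s \<and>
      vdivby (v (b \<otimes> inv a)) (p - 1) = Val (divby s 1) \<and> x = \<beta> \<otimes> x' \<and>
      (\<forall>U. nonruled_ring U \<longrightarrow> nonruled_curve K U k x' y' \<zeta> p c')"
    if V: "nonruled_ring V" and W: "nonruled_ring W" "V \<noteq> W" for V W
  proof -
    note nt = nontrivial_if_distinct[OF V W]
    have v: "val_ring_field K V" using V by (simp add: nonruled_ring_def)
    have ntU: "\<exists>\<eta>\<in>k. \<eta> \<noteq> \<zero> \<and> \<eta> \<in> val_ring_field.M K U" if U: "nonruled_ring U" for U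
    proof -
      have u: "val_ring_field K U" using U by (simp add: nonruled_ring_def)
      have "V \<inter> k = U \<inter> k" using cut[OF V] cut[OF U] by simp
      then show ?thesis using nt same_maximal_ideal[OF v u subk] by blast
    qed
    obtain \<beta> s x' y' c' where "\<beta> \<in> k" "\<beta> \<noteq> \<zero>" "v \<beta> = Val s" "vdivby (v (b \<otimes> inv a)) (p - 1) = Val (divby s 1)"
      "x = \<beta> \<otimes> x'"
      "\<And>W. nonruled_ring W \<Longrightarrow> \<exists>\<eta>\<in>k. \<eta> \<noteq> \<zero> \<and> \<eta> \<in> val_ring_field.M K W \<Longrightarrow> nonruled_curve K W k x' y' \<zeta> p c'"
      by (rule normal_form[OF V b_nonzero[OF V nt]]) blast
    then show ?thesis using ntU by blast
  qed
  \<comment> \<open>The type of an extension is decided by whether \<open>x'\<close> is residually transcendental.\<close>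
  have same: "V = W"
    if c: "nonruled_curve K V k x' y' \<zeta> p c'" "nonruled_curve K W k x' y' \<zeta> p c'" and n: "nonruled_ring V" "nonruled_ring W"
      and g: "val_ring_field.res_transc K V k x' \<longleftrightarrow> val_ring_field.res_transc K W k x'" for V W x' y' c'
  proof -
    have e: "V \<inter> k = W \<inter> k" using cut[OF n(1)] cut[OF n(2)] by simp
    show ?thesis
    proof (cases "val_ring_field.res_transc K V k x'")
      case True
      then show ?thesis using gauss_valuation_unique[OF c e] g by blast
    next
      case False
      then show ?thesis
        using nonruled_curve.dichotomy[OF c(1)] nonruled_curve.dichotomy[OF c(2)] g double_root_valuation_unique[OF c e] by blast
    qed
  qed
  have three: "V1 = V2 \<or> V1 = V3 \<or> V2 = V3"
    if n: "nonruled_ring V1" "nonruled_ring V2" "nonruled_ring V3" for V1 V2 V3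
  proof (rule ccontr)
    assume ne: "\<not> (V1 = V2 \<or> V1 = V3 \<or> V2 = V3)"
    then obtain x' y' c' where "\<forall>U. nonruled_ring U \<longrightarrow> nonruled_curve K U k x' y' \<zeta> p c'"
      using main[OF n(1,2)] by blast
    then show False using same[of _ x' y' c'] n ne by metis
  qed
  have two: "\<exists>\<gamma>. vdivby (v (b \<otimes> inv a)) (p - 1) = Val \<gamma> \<and>
      (gauss_extension K k v x \<gamma> w1 \<or> gauss_extension K k v x \<gamma> w2)"
    if w: "nonruled_rt_extension K k v w1" "nonruled_rt_extension K k v w2" and ne: "val_ring K w1 \<noteq> val_ring K w2"
  proof -
    note n = nonruled_ring_if_extension[OF w(1)] nonruled_ring_if_extension[OF w(2)]
    obtain \<beta> s x' y' c' where B: "\<beta> \<in> k" "\<beta> \<noteq> \<zero>" "v \<beta> = Val s" "vdivby (v (b \<otimes> inv a)) (p - 1) = Val (divby s 1)"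
      "x = \<beta> \<otimes> x'" and all: "\<forall>U. nonruled_ring U \<longrightarrow> nonruled_curve K U k x' y' \<zeta> p c'"
      using main[OF n ne] by blast
    have c: "nonruled_curve K (val_ring K w1) k x' y' \<zeta> p c'" "nonruled_curve K (val_ring K w2) k x' y' \<zeta> p c'"
      using all n by blast+
    have cv: "curve_val K (val_ring K w1) k x' y' \<zeta> p" "curve_val K (val_ring K w2) k x' y' \<zeta> p"
      using c by (simp_all add: nonruled_curve_def normal_curve_def)
    have ext: "extends_valuation K k v w1" "extends_valuation K k v w2"
      using w by (simp_all add: nonruled_rt_extension_def residue_transcendental_extension_def)
    have "val_ring_field.res_transc K (val_ring K w1) k x' \<or> val_ring_field.res_transc K (val_ring K w2) k x'"
      using same[OF c n] ne by blast
    then have "gauss_extension K k v x (divby s 1) w1 \<or> gauss_extension K k v x (divby s 1) w2"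
      using curve_val.gauss_extension_if_transc[OF cv(1) v cut[OF n(1)] ext(1) refl B(1-3,5)]
        curve_val.gauss_extension_if_transc[OF cv(2) v cut[OF n(2)] ext(2) refl B(1-3,5)] by blast
    then show ?thesis using B(4) by blast
  qed
  show ?thesis
    using three[OF nonruled_ring_if_extension nonruled_ring_if_extension nonruled_ring_if_extension, of w1 w2 w3] two
    unfolding eqv by blast
qed

end
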